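(* Let $1<q_i<\infty$ $(i=1,\dots,N)$ and suppose the domain $\Omega\subset\mathbb{R}^n$ is $\nabla_{q_i}$-regular for every $i$. Let $\boldsymbol u_i^*\in W^{-1,q_i}(\Omega)^n$ $(i=1,\dots,N)$ satisfy $$\sum_{i=1}^N\langle\boldsymbol u_i^*,\boldsymbol\psi\rangle=0\qquad\forall\,\boldsymbol\psi\in\bigcap_{i=1}^N W^{1,q_i'}_{0,\mathrm{div}}(\Omega)^n.$$ Then for every subdomain $U\Subset\Omega$, $$\sum_{i=1}^N\langle\boldsymbol u_i^*,\boldsymbol\psi\rangle=-\sum_{i=1}^N\int_\Omega p_i\,\nabla\cdot\boldsymbol\psi\,dx\qquad\forall\,\boldsymbol\psi\in C^\infty_c(\Omega)^n,$$ where $p_i=\mathscr P^{(U)}(\boldsymbol E^*_{q_i}\boldsymbol u_i^* )\in L^{q_i}_{\mathrm{pot}}(\Omega)$.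
   Context: Let $n\ge 2$, $\Omega\subset\mathbb{R}^n$ a domain (open and connected). For $1<q<\infty$, $q'=q/(q-1)$; $W^{1,q}_0(\Omega)^n$ is the closure of $C^\infty_c(\Omega)^n$ in the Sobolev norm (normed by $\|\nabla\boldsymbol u\|_{L^q}$ if $\Omega$ is bounded, by the full $W^{1,q}$-norm otherwise); $W^{-1,q}(\Omega)^n$ is its dual with $q$ replaced by $q'$, i.e. the dual of $W^{1,q'}_0(\Omega)^n$, pairing $\langle\cdot,\cdot\rangle$. $W^{1,q}_{0,\mathrm{div}}(\Omega)^n$ is the closure in $W^{1,q}_0(\Omega)^n$ of the smooth compactly supported divergence-free fields. A function $p\in L^q_{\mathrm{loc}}(\Omega)$ is in $L^q_{\mathrm{pot}}(\Omega)$ if there is $\boldsymbol u^*\in W^{-1,q}(\Omega)^n$ with $\langle\boldsymbol u^*,\boldsymbol\psi\rangle=-\int_\Omega p\,\nabla\cdot\boldsymbol\psi\,dx$ for all $\boldsymbol\psi\in C^\infty_c(\Omega)^n$; this $\boldsymbol u^*$ is denoted $\nabla_q p$; $G^{-1,q}(\Omega)^n:=\{\nabla_q p: p\in L^q_{\mathrm{pot}}(\Omega)\}$. For $\boldsymbol u^*\in G^{-1,q}(\Omega)^n$ the potentials $p$ with $\nabla_q p=\boldsymbol u^*$ are unique up to constants; for a subdomain $U\Subset\Omega$, $\mathscr P^{(U)}(\boldsymbol u^* )$ is the unique one with $\int_U p\,dx=0$. $\boldsymbol J_2:W^{1,2}_0(\Omega)^n\to W^{-1,2}(\Omega)^n$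 is $\langle\boldsymbol J_2\boldsymbol u,\boldsymbol v\rangle=\int\nabla\boldsymbol u:\nabla\boldsymbol v$ ($\Omega$ bounded) resp. $\int\nabla\boldsymbol u:\nabla\boldsymbol v+\boldsymbol u\cdot\boldsymbol v$ ($\Omega$ unbounded); with the inner product $((\boldsymbol u^*,\boldsymbol v^* ))_*=\langle\boldsymbol u^*,\boldsymbol J_2^{-1}\boldsymbol v^*\rangle$ on $W^{-1,2}(\Omega)^n$, $\boldsymbol E_2^*$ is the orthogonal projection onto $G^{-1,2}(\Omega)^n$ and $\boldsymbol E_2$ its adjoint on $W^{1,2}_0(\Omega)^n$. $\Omega$ is $\nabla_q$-regular if there is a bounded linear projection $\boldsymbol E_{q'}$ on $W^{1,q'}_0(\Omega)^n$ with $\ker\boldsymbol E_{q'}=W^{1,q'}_{0,\mathrm{div}}(\Omega)^n$ and $\boldsymbol E_{q'}\boldsymbol\psi=\boldsymbol E_2\boldsymbol\psi$ for all $\boldsymbol\psi\in C^\infty_c(\Omega)^n$; $\boldsymbol E_q^*$ is its dual on $W^{-1,q}(\Omega)^n$, a projection onto $G^{-1,q}(\Omega)^n$. *)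

theory Defs
  imports "HOL-Analysis.Analysis"
begin

type_synonym 'n vfield = "real^'n \<Rightarrow> real^'n"

definition pd :: "'n::finite \<Rightarrow> (real^'n \<Rightarrow> real) \<Rightarrow> real^'n \<Rightarrow> real" where
  "pd j f x = frechet_derivative f (at x) (axis j 1)"

fun iter_pd :: "'n::finite list \<Rightarrow> (real^'n \<Rightarrow> real) \<Rightarrow> real^'n \<Rightarrow> real" where
  "iter_pd [] f = f"
| "iter_pd (j # js) f = pd j (iter_pd js f)"

definition smooth :: "(real^'n::finite \<Rightarrow> real) \<Rightarrow> bool" where
  "smooth f \<longleftrightarrow> (\<forall>js x. iter_pd js f differentiable (at x))"

definition test_fun :: "(real^'n::finite) set \<Rightarrow> (real^'n \<Rightarrow> real) \<Rightarrow> bool" where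
  "test_fun \<Omega> \<phi> \<longleftrightarrow> smooth \<phi> \<and> (\<exists>K. compact K \<and> K \<subseteq> \<Omega> \<and> (\<forall>x. x \<notin> K \<longrightarrow> \<phi> x = 0))"

definition test_field :: "(real^'n::finite) set \<Rightarrow> 'n vfield \<Rightarrow> bool" where
  "test_field \<Omega> \<psi> \<longleftrightarrow> (\<forall>i. test_fun \<Omega> (\<lambda>x. \<psi> x $ i))"

definition vdiv :: "'n::finite vfield \<Rightarrow> real^'n \<Rightarrow> real" where
  "vdiv \<psi> x = (\<Sum>i\<in>UNIV. pd i (\<lambda>y. \<psi> y $ i) x)"

definition cgrad :: "'n::finite vfield \<Rightarrow> real^'n \<Rightarrow> real^'n^'n" where
  "cgrad \<psi> x = (\<chi> i. \<chi> j. pd j (\<lambda>y. \<psi> y $ i) x)"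

definition in_Lq :: "(real^'n::finite) set \<Rightarrow> real \<Rightarrow> (real^'n \<Rightarrow> 'b::real_normed_vector) \<Rightarrow> bool" where
  "in_Lq \<Omega> q f \<longleftrightarrow> f \<in> borel_measurable (lebesgue_on \<Omega>) \<and>
     (\<integral>\<^sup>+x. ennreal (norm (f x) powr q) \<partial>lebesgue_on \<Omega>) < \<infinity>"

definition lq_norm :: "(real^'n::finite) set \<Rightarrow> real \<Rightarrow> (real^'n \<Rightarrow> 'b::real_normed_vector) \<Rightarrow> real" where
  "lq_norm \<Omega> q f = enn2real (\<integral>\<^sup>+x. ennreal (norm (f x) powr q) \<partial>lebesgue_on \<Omega>) powr (1 / q)"

definition Lq_loc :: "(real^'n::finite) set \<Rightarrow> real \<Rightarrow> (real^'n \<Rightarrow> real) \<Rightarrow> bool" where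
  "Lq_loc \<Omega> q p \<longleftrightarrow> p \<in> borel_measurable (lebesgue_on \<Omega>) \<and>
     (\<forall>K. compact K \<and> K \<subseteq> \<Omega> \<longrightarrow> (\<integral>\<^sup>+x. ennreal (\<bar>p x\<bar> powr q) \<partial>lebesgue_on K) < \<infinity>)"

definition conj_exp :: "real \<Rightarrow> real" where
  "conj_exp q = q / (q - 1)"

definition aeq :: "(real^'n::finite) set \<Rightarrow> 'n vfield \<Rightarrow> 'n vfield \<Rightarrow> bool" where
  "aeq \<Omega> u v \<longleftrightarrow> (AE x in lebesgue_on \<Omega>. u x = v x)"

definition weak_grad :: "(real^'n::finite) set \<Rightarrow> 'n vfield \<Rightarrow> (real^'n \<Rightarrow> real^'n^'n) \<Rightarrow> bool" where
  "weak_grad \<Omega> u G \<longleftrightarrow> u \<in> borel_measurable (lebesgue_on \<Omega>) \<and> G \<in> borel_measurable (lebesgue_on \<Omega>) \<and>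
     (\<forall>\<phi> i j. test_fun \<Omega> \<phi> \<longrightarrow>
        integrable (lebesgue_on \<Omega>) (\<lambda>x. u x $ i * pd j \<phi> x) \<and>
        integrable (lebesgue_on \<Omega>) (\<lambda>x. G x $ i $ j * \<phi> x) \<and>
        (\<integral>x. u x $ i * pd j \<phi> x \<partial>lebesgue_on \<Omega>) = - (\<integral>x. G x $ i $ j * \<phi> x \<partial>lebesgue_on \<Omega>))"

definition wgrad :: "(real^'n::finite) set \<Rightarrow> 'n vfield \<Rightarrow> real^'n \<Rightarrow> real^'n^'n" where
  "wgrad \<Omega> u = (SOME G. weak_grad \<Omega> u G)"

definition sob_norm :: "(real^'n::finite) set \<Rightarrow> real \<Rightarrow> 'n vfield \<Rightarrow> real" where
  "sob_norm \<Omega> q u = (if bounded \<Omega> then lq_norm \<Omega> q (wgrad \<Omega> u)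
                      else lq_norm \<Omega> q u + lq_norm \<Omega> q (wgrad \<Omega> u))"

definition W1q0 :: "(real^'n::finite) set \<Rightarrow> real \<Rightarrow> 'n vfield set" where
  "W1q0 \<Omega> q = {u. in_Lq \<Omega> q u \<and> (\<exists>G. weak_grad \<Omega> u G \<and> in_Lq \<Omega> q G \<and>
      (\<exists>\<phi>. (\<forall>k. test_field \<Omega> (\<phi> k)) \<and>
         (\<lambda>k. lq_norm \<Omega> q (\<lambda>x. \<phi> k x - u x) + lq_norm \<Omega> q (\<lambda>x. cgrad (\<phi> k) x - G x))
           \<longlonglongrightarrow> 0))}"

definition W1q0_div :: "(real^'n::finite) set \<Rightarrow> real \<Rightarrow> 'n vfield set" where
  "W1q0_div \<Omega> q = {u \<in> W1q0 \<Omega> q. \<exists>\<phi>.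
      (\<forall>k. test_field \<Omega> (\<phi> k) \<and> (\<forall>x. vdiv (\<phi> k) x = 0)) \<and>
      (\<lambda>k. sob_norm \<Omega> q (\<lambda>x. \<phi> k x - u x)) \<longlonglongrightarrow> 0}"

definition dualsp :: "(real^'n::finite) set \<Rightarrow> real \<Rightarrow> ('n vfield \<Rightarrow> real) set" where
  "dualsp \<Omega> q = {us.
     (\<forall>u\<in>W1q0 \<Omega> (conj_exp q). \<forall>v\<in>W1q0 \<Omega> (conj_exp q). \<forall>a b.
        us (\<lambda>x. a *\<^sub>R u x + b *\<^sub>R v x) = a * us u + b * us v) \<and>
     (\<exists>C. \<forall>v\<in>W1q0 \<Omega> (conj_exp q). \<bar>us v\<bar> \<le> C * sob_norm \<Omega> (conj_exp q) v)}"

definition is_grad_of :: "(real^'n::finite) set \<Rightarrow> real \<Rightarrow> (real^'n \<Rightarrow> real) \<Rightarrow> ('n vfield \<Rightarrow> real) \<Rightarrow> bool" where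
  "is_grad_of \<Omega> q p us \<longleftrightarrow> Lq_loc \<Omega> q p \<and> us \<in> dualsp \<Omega> q \<and>
     (\<forall>\<psi>. test_field \<Omega> \<psi> \<longrightarrow> us \<psi> = - (\<integral>x. p x * vdiv \<psi> x \<partial>lebesgue_on \<Omega>))"

definition Lpot :: "(real^'n::finite) set \<Rightarrow> real \<Rightarrow> (real^'n \<Rightarrow> real) set" where
  "Lpot \<Omega> q = {p. \<exists>us. is_grad_of \<Omega> q p us}"

definition Gsp :: "(real^'n::finite) set \<Rightarrow> real \<Rightarrow> ('n vfield \<Rightarrow> real) set" where
  "Gsp \<Omega> q = {us. \<exists>p. is_grad_of \<Omega> q p us}"

definition subdomain :: "(real^'n::finite) set \<Rightarrow> (real^'n) set \<Rightarrow> bool" where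
  "subdomain U \<Omega> \<longleftrightarrow> open U \<and> connected U \<and> U \<noteq> {} \<and> compact (closure U) \<and> closure U \<subseteq> \<Omega>"

definition scrP :: "(real^'n::finite) set \<Rightarrow> real \<Rightarrow> (real^'n) set \<Rightarrow> ('n vfield \<Rightarrow> real) \<Rightarrow> real^'n \<Rightarrow> real" where
  "scrP \<Omega> q U us = (SOME p. is_grad_of \<Omega> q p us \<and> (\<integral>x. p x \<partial>lebesgue_on U) = 0)"

definition inner2 :: "(real^'n::finite) set \<Rightarrow> 'n vfield \<Rightarrow> 'n vfield \<Rightarrow> real" where
  "inner2 \<Omega> u v = (\<integral>x. inner (wgrad \<Omega> u x) (wgrad \<Omega> v x)
                      + (if bounded \<Omega> then 0 else inner (u x) (v x)) \<partial>lebesgue_on \<Omega>)"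

definition J2 :: "(real^'n::finite) set \<Rightarrow> 'n vfield \<Rightarrow> ('n vfield \<Rightarrow> real)" where
  "J2 \<Omega> u = (\<lambda>v. inner2 \<Omega> u v)"

definition J2inv :: "(real^'n::finite) set \<Rightarrow> ('n vfield \<Rightarrow> real) \<Rightarrow> 'n vfield" where
  "J2inv \<Omega> us = (SOME u. u \<in> W1q0 \<Omega> 2 \<and> (\<forall>v\<in>W1q0 \<Omega> 2. J2 \<Omega> u v = us v))"

definition dual_inner :: "(real^'n::finite) set \<Rightarrow> ('n vfield \<Rightarrow> real) \<Rightarrow> ('n vfield \<Rightarrow> real) \<Rightarrow> real" where
  "dual_inner \<Omega> us vs = us (J2inv \<Omega> vs)"

definition E2star :: "(real^'n::finite) set \<Rightarrow> ('n vfield \<Rightarrow> real) \<Rightarrow> ('n vfield \<Rightarrow> real)" where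
  "E2star \<Omega> us = (SOME vs. vs \<in> Gsp \<Omega> 2 \<and>
      (\<forall>ws\<in>Gsp \<Omega> 2. dual_inner \<Omega> (\<lambda>v. us v - vs v) ws = 0))"

definition E2 :: "(real^'n::finite) set \<Rightarrow> 'n vfield \<Rightarrow> 'n vfield" where
  "E2 \<Omega> v = (SOME w. w \<in> W1q0 \<Omega> 2 \<and> (\<forall>us\<in>dualsp \<Omega> 2. E2star \<Omega> us v = us w))"

definition nabla_regular_with :: "(real^'n::finite) set \<Rightarrow> real \<Rightarrow> ('n vfield \<Rightarrow> 'n vfield) \<Rightarrow> bool" where
  "nabla_regular_with \<Omega> q E \<longleftrightarrow>
    (let W = W1q0 \<Omega> (conj_exp q) in
     (\<forall>v\<in>W. E v \<in> W) \<and>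
     (\<forall>v\<in>W. \<forall>w\<in>W. aeq \<Omega> v w \<longrightarrow> aeq \<Omega> (E v) (E w)) \<and>
     (\<forall>v\<in>W. \<forall>w\<in>W. \<forall>a b. aeq \<Omega> (E (\<lambda>x. a *\<^sub>R v x + b *\<^sub>R w x)) (\<lambda>x. a *\<^sub>R E v x + b *\<^sub>R E w x)) \<and>
     (\<exists>C. \<forall>v\<in>W. sob_norm \<Omega> (conj_exp q) (E v) \<le> C * sob_norm \<Omega> (conj_exp q) v) \<and>
     (\<forall>v\<in>W. aeq \<Omega> (E (E v)) (E v)) \<and>
     (\<forall>v\<in>W. aeq \<Omega> (E v) (\<lambda>x. 0) \<longleftrightarrow> v \<in> W1q0_div \<Omega> (conj_exp q)) \<and>
     (\<forall>\<psi>. test_field \<Omega> \<psi> \<longrightarrow> aeq \<Omega> (E \<psi>) (E2 \<Omega> \<psi>)))"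

definition nabla_regular :: "(real^'n::finite) set \<Rightarrow> real \<Rightarrow> bool" where
  "nabla_regular \<Omega> q \<longleftrightarrow> (\<exists>E. nabla_regular_with \<Omega> q E)"

definition Estar :: "('n::finite vfield \<Rightarrow> 'n vfield) \<Rightarrow> ('n vfield \<Rightarrow> real) \<Rightarrow> ('n vfield \<Rightarrow> real)" where
  "Estar E us = (\<lambda>\<psi>. us (E \<psi>))"

end

theory Submission
  imports Defs "HOL-Real_Asymp.Real_Asymp"
begin

text \<open>
  On a test field \<open>\<psi>\<close> all projections agree almost everywhere with one field \<open>E\<psi>\<close>, so
  \<open>\<psi> - E\<psi>\<close> lies in every divergence-free space and the hypothesis gives
  \<open>\<Sum>\<langle>u\<^sub>i, \<psi>\<rangle> = \<Sum>\<langle>u\<^sub>i, E\<psi>\<rangle>\<close>. What remains is de Rham's theorem: a functional on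
  \<open>W\<^sub>0\<close> with exponent \<open>r = q'\<close> that vanishes on divergence-free test fields has a potential in
  \<open>L\<^sup>q\<close> locally.

  In a ball, let \<open>\<eta>\<close> be a radial mollifier. A test function \<open>f\<close> is
  \<open>(\<integral>f)\<eta> + div(\<Psi> - \<nabla>w)\<close>, where \<open>\<Delta>w = \<eta> * f - f\<close> has a compactly supported solution that is an
  average of rescaled translates of \<open>f\<close>, and \<open>\<Psi>\<close> is smooth because it only moves copies of \<open>\<eta>\<close>.
  The \<open>L\<^sup>r\<close> bound of the second derivatives of \<open>w\<close> by \<open>\<Delta>w\<close> needs no singular integrals: for
  the random walk with steps \<open>h(e\<^sub>i \<plusminus> e\<^sub>j)\<close> a Bellman function obtained from Burkholder's
  zigzag-concave function bounds the dissipated bilinear energy, and one lets \<open>h\<close> tend to zero.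
  So the functional is \<open>L\<^sup>r\<close>-bounded as a functional of the divergence and is represented by an
  \<open>L\<^sup>q\<close> function on each ball; connectedness of the domain removes the dependence on the ball,
  and the local potentials are glued.
\<close>

section \<open>Smooth functions\<close>

text \<open>The boundary of the domain is arbitrary, but a potential only has to be locally
  integrable with exponent q, so each ball may have its own constant and nothing has to be uniform
  up to the boundary. What each ball must supply is a right inverse of the divergence that is
  bounded from \<open>L\<^sup>r\<close> into fields with first derivatives in
  \<open>L\<^sup>r\<close>; for r other than 2 this is a genuine second-order estimate. The walk
  yields it because its argument rests on convexity in a pair of functions, one in
  \<open>L\<^sup>r\<close> and one in the dual space, and convexity passes through averages. The
  walk sees second differences only along its own steps, which is why these are diagonal: two of
  them combine to a mixed derivative by polarisation, and all of them together to the Laplacian. A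
  second obstacle is formal. Elements of the Sobolev spaces are functions rather than classes, and
  the projections are tied to each other only almost everywhere, so every functional must first be
  shown to ignore null sets, which follows from its norm bound.\<close>

lemma pd_eqI: "(f has_derivative f') (at x) \<Longrightarrow> pd j f x = f' (axis j 1)"
  by (simp add: pd_def frechet_derivative_at[symmetric])

lemma has_derivative_pd:
  fixes f :: "real^'n::finite \<Rightarrow> real"
  assumes "f differentiable (at x)"
  shows "(f has_derivative (\<lambda>h. \<Sum>j\<in>UNIV. h $ j * pd j f x)) (at x)"
proof -
  have 1: "(f has_derivative frechet_derivative f (at x)) (at x)"
    using assms by (simp add: frechet_derivative_works)
  have "linear (frechet_derivative f (at x))"
    using 1 has_derivative_linear by blast
  then have "frechet_derivative f (at x) h = (\<Sum>j\<in>UNIV. h $ j * pd j f x)" for h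
    by (subst basis_expansion[symmetric]) (simp add: linear_sum linear_scale scalar_mult_eq_scaleR pd_def)
  then have "frechet_derivative f (at x) = (\<lambda>h. \<Sum>j\<in>UNIV. h $ j * pd j f x)" by auto
  then show ?thesis using 1 by simp
qed

text \<open>Here the derivative taken first is peeled off first, whereas \<open>iter_pd\<close>
  peels off the one taken last. With this order a product, an inverse or a composite differentiates
  into expressions of the same kind and lower order, so the closure properties are inductions over
  k.\<close>

fun Ck :: "nat \<Rightarrow> (real^'n::finite \<Rightarrow> real) \<Rightarrow> bool" where
  "Ck 0 f = True"
| "Ck (Suc k) f = ((\<forall>x. f differentiable (at x)) \<and> (\<forall>j. Ck k (pd j f)))"

lemma iter_pd_append: "iter_pd (js @ ks) f = iter_pd js (iter_pd ks f)"
  by (induction js) auto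

lemma smooth_pd: "smooth f \<Longrightarrow> smooth (pd j f)"
  unfolding smooth_def by (metis iter_pd_append iter_pd.simps)

lemma smooth_differentiable: "smooth f \<Longrightarrow> f differentiable (at x)"
  unfolding smooth_def by (metis iter_pd.simps(1))

lemma smooth_imp_Ck: "smooth f \<Longrightarrow> Ck k f"
  by (induction k arbitrary: f) (auto simp: smooth_pd smooth_differentiable)

lemma Ck_iter: "Ck (length js + k) f \<Longrightarrow> Ck k (iter_pd js f)"
proof (induction js arbitrary: k)
  case (Cons a js)
  have "Ck (length js + Suc k) f" using Cons.prems by (simp del: Ck.simps)
  from Cons.IH[OF this] show ?case by simp
qed simp

lemma smooth_iff_Ck: "smooth f \<longleftrightarrow> (\<forall>k. Ck k f)"
proof
  assume *: "\<forall>k. Ck k f"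
  show "smooth f" unfolding smooth_def
  proof (intro allI)
    fix js :: "'a list" and x
    have "Ck (length js + 1) f" using * by blast
    from Ck_iter[OF this] show "iter_pd js f differentiable (at x)" by simp
  qed
qed (simp add: smooth_imp_Ck)

lemma Ck_Suc_imp: "Ck (Suc k) f \<Longrightarrow> Ck k f"
  by (induction k arbitrary: f) auto

lemma Ck_const [simp]: "Ck k (\<lambda>x. c)"
proof (induction k arbitrary: c)
  case (Suc k)
  have "pd (j::'a) (\<lambda>x. c) = (\<lambda>x. 0)" for j by (rule ext, subst pd_eqI[OF has_derivative_const]) simp
  then show ?case using Suc by simp
qed simp

lemma pd_add: "f differentiable (at x) \<Longrightarrow> g differentiable (at x) \<Longrightarrow> pd j (\<lambda>x. f x + g x) x = pd j f x + pd j g x"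
  using pd_eqI[OF has_derivative_add[of f _ "at x" g]]
  by (simp add: frechet_derivative_works pd_def)

lemma pd_mult:
  fixes f g :: "real^'n::finite \<Rightarrow> real"
  assumes "f differentiable (at x)" "g differentiable (at x)"
  shows "pd j (\<lambda>x. f x * g x) x = pd j f x * g x + f x * pd j g x"
  using pd_eqI[OF has_derivative_mult[OF assms[unfolded frechet_derivative_works]]]
  by (simp add: pd_def)

lemma pd_const [simp]: "pd j (\<lambda>x. c) x = 0"
  by (subst pd_eqI[OF has_derivative_const]) simp

lemma pd_cmult: "f differentiable (at x) \<Longrightarrow> pd j (\<lambda>x. c * f x) x = c * pd j f x"
  by (simp add: pd_mult)

lemma pd_diff: "f differentiable (at x) \<Longrightarrow> g differentiable (at x) \<Longrightarrow> pd j (\<lambda>x. f x - g x) x = pd j f x - pd j g x"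
  using pd_eqI[OF has_derivative_diff[of f _ "at x" g]]
  by (simp add: frechet_derivative_works pd_def)

lemma Ck_add: "Ck k f \<Longrightarrow> Ck k g \<Longrightarrow> Ck k (\<lambda>x. f x + g x)"
proof (induction k arbitrary: f g)
  case (Suc k)
  then have "pd j (\<lambda>x. f x + g x) = (\<lambda>x. pd j f x + pd j g x)" for j by (intro ext pd_add) auto
  then show ?case using Suc by auto
qed simp

lemma Ck_mult: "Ck k f \<Longrightarrow> Ck k g \<Longrightarrow> Ck k (\<lambda>x. f x * g x)"
proof (induction k arbitrary: f g)
  case (Suc k)
  then have "pd j (\<lambda>x. f x * g x) = (\<lambda>x. pd j f x * g x + f x * pd j g x)" for j
    by (intro ext pd_mult) auto
  moreover have "Ck k f" "Ck k g" using Suc.prems Ck_Suc_imp by blast+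
  ultimately show ?case using Suc by (auto intro!: Ck_add)
qed simp

lemma Ck_inverse: "Ck k f \<Longrightarrow> (\<And>x. f x \<noteq> 0) \<Longrightarrow> Ck k (\<lambda>x. inverse (f x))"
proof (induction k arbitrary: f)
  case (Suc k)
  have "pd j (\<lambda>x. inverse (f x)) x = (-1 * pd j f x) * (inverse (f x) * inverse (f x))" for j x
  proof -
    have "(f has_derivative (\<lambda>h. \<Sum>j\<in>UNIV. h $ j * pd j f x)) (at x)"
      using Suc.prems by (intro has_derivative_pd) simp
    from pd_eqI[OF Deriv.has_derivative_inverse[OF Suc.prems(2)[of x] this], of j] pd_eqI[OF this, of j]
    show ?thesis by (simp add: algebra_simps)
  qed
  then have "pd j (\<lambda>x. inverse (f x)) = (\<lambda>x. (- 1 * pd j f x) * (inverse (f x) * inverse (f x)))" for j by auto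
  moreover have "Ck k f" using Suc.prems Ck_Suc_imp by blast
  moreover have "Ck k (\<lambda>x. (-1 * pd j f x) * (inverse (f x) * inverse (f x)))" for j
    using Suc.prems \<open>Ck k f\<close> by (intro Ck_mult Ck_const Suc.IH) auto
  moreover have "(\<lambda>x. inverse (f x)) differentiable (at x)" for x
    using Suc.prems by (intro differentiable_inverse) auto
  ultimately show ?case by (simp del: mult_minus1)
qed simp

lemma smooth_const [simp]: "smooth (\<lambda>x. c)" by (simp add: smooth_iff_Ck)
lemma smooth_add: "smooth f \<Longrightarrow> smooth g \<Longrightarrow> smooth (\<lambda>x. f x + g x)" by (simp add: smooth_iff_Ck Ck_add)
lemma smooth_mult: "smooth f \<Longrightarrow> smooth g \<Longrightarrow> smooth (\<lambda>x. f x * g x)" by (simp add: smooth_iff_Ck Ck_mult)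
lemma smooth_cmult: "smooth f \<Longrightarrow> smooth (\<lambda>x. c * f x)" by (simp add: smooth_mult)
lemma smooth_diff: "smooth f \<Longrightarrow> smooth g \<Longrightarrow> smooth (\<lambda>x. f x - g x)"
  using smooth_add[OF _ smooth_cmult[of g "-1"], of f] by simp
lemma smooth_inverse: "smooth f \<Longrightarrow> (\<And>x. f x \<noteq> 0) \<Longrightarrow> smooth (\<lambda>x. inverse (f x))"
  by (simp add: smooth_iff_Ck Ck_inverse)
lemma smooth_sum: "(\<And>i. i \<in> I \<Longrightarrow> smooth (f i)) \<Longrightarrow> smooth (\<lambda>x. \<Sum>i\<in>I. f i x)"
  by (induction I rule: infinite_finite_induct) (auto intro!: smooth_add)

lemma smooth_coord: "smooth (\<lambda>x::real^'n::finite. x $ i)"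
proof -
  have d: "((\<lambda>x::real^'n. x $ i) has_derivative (\<lambda>x. x $ i)) (at x)" for x
    using bounded_linear_vec_nth bounded_linear_imp_has_derivative by blast
  have "pd j (\<lambda>x::real^'n. x $ i) = (\<lambda>x. axis j 1 $ i)" for j
    using pd_eqI[OF d] by auto
  then have "Ck k (\<lambda>x::real^'n. x $ i)" for k
    using d by (cases k) (auto simp: differentiable_def)
  then show ?thesis by (simp add: smooth_iff_Ck)
qed

lemma smooth_continuous: "smooth f \<Longrightarrow> continuous_on S f"
  by (meson continuous_at_imp_continuous_on differentiable_imp_continuous_within smooth_differentiable)

section \<open>Flat exponentials, from which all cutoffs are built\<close>

definition flat_exp :: "nat \<Rightarrow> real \<Rightarrow> real" where
  "flat_exp k t = (if t > 0 then exp (- inverse t) / t ^ k else 0)"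

text \<open>The powers in the denominator make the family closed under differentiation, so one
  induction gives smoothness of all members. Away from 0 this is the quotient rule; at 0 the
  exponential beats every power on the right, and the function vanishes on the left. For
  \<open>k = 0\<close> the derivative is just \<open>flat_exp 2\<close>, on which the mollifier and
  its primitive depend.\<close>

lemma flat_exp_deriv:
  "(flat_exp k has_real_derivative (flat_exp (k + 2) t - real k * flat_exp (k + 1) t)) (at t)"
proof (cases "t = 0")
  case True
  have "((\<lambda>y. flat_exp k y / y) \<longlongrightarrow> 0) (at_right 0)"
  proof -
    have "((\<lambda>y::real. exp (- inverse y) / y ^ k / y) \<longlongrightarrow> 0) (at_right 0)" by real_asymp
    then show ?thesis
      by (rule Lim_transform_eventually)
        (auto simp: eventually_at_right_less flat_exp_def intro!: eventually_mono[OF eventually_at_right_less[of 0]])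
  qed
  moreover have "((\<lambda>y. flat_exp k y / y) \<longlongrightarrow> 0) (at_left 0)"
    by (rule Lim_transform_eventually[of "\<lambda>_. 0"])
       (auto simp: flat_exp_def eventually_at_left[of "-1" 0] intro!: exI[of _ "-1"])
  ultimately have "((\<lambda>y. flat_exp k y / y) \<longlongrightarrow> 0) (at 0)"
    by (simp add: filterlim_split_at)
  then show ?thesis using True by (simp add: has_field_derivative_iff flat_exp_def)
next
  case False
  show ?thesis
  proof (cases "t > 0")
    case True
    have "((\<lambda>t. exp (- inverse t) / t ^ k) has_real_derivative
        (exp (- inverse t) / t ^ (k+2) - real k * (exp (- inverse t) / t ^ (k+1)))) (at t)"
    proof -
      have D: "((\<lambda>t. t ^ k) has_real_derivative real k * t ^ (k - 1)) (at t)"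
        using DERIV_pow[of k t] by simp
      have E: "((\<lambda>t. exp (- inverse t)) has_real_derivative exp (- inverse t) / t ^ 2) (at t)"
        using True by (auto intro!: derivative_eq_intros simp: field_simps power2_eq_square)
      have "(exp (- inverse t) / t\<^sup>2 * t ^ k - exp (- inverse t) * (real k * t ^ (k - 1))) / (t ^ k * t ^ k) =
         exp (- inverse t) / t ^ (k+2) - real k * (exp (- inverse t) / t ^ (k+1))"
        using True by (cases k) (auto simp: field_simps power2_eq_square)
      then show ?thesis using DERIV_divide[OF E D] True by simp
    qed
    moreover have "eventually (\<lambda>y. exp (- inverse y) / y ^ k = flat_exp k y) (nhds t)"
      using True by (auto simp: flat_exp_def eventually_nhds intro!: exI[of _ "{0<..}"])
    ultimately show ?thesis using True
      by (subst DERIV_cong_ev[OF refl _ refl, symmetric]) (auto simp: flat_exp_def)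
  next
    case False
    with \<open>t \<noteq> 0\<close> have "t < 0" by simp
    then have ev: "eventually (\<lambda>y. 0 = flat_exp k y) (nhds t)"
      by (auto simp: flat_exp_def eventually_nhds intro!: exI[of _ "{..<0}"])
    have "((\<lambda>y. 0::real) has_real_derivative 0) (at t)" by simp
    then have "(flat_exp k has_real_derivative 0) (at t)"
      using DERIV_cong_ev[OF refl ev refl] by simp
    then show ?thesis using \<open>t < 0\<close> by (simp add: flat_exp_def)
  qed
qed

lemma flat_exp_nonneg: "0 \<le> flat_exp k t" by (simp add: flat_exp_def)
lemma flat_exp_pos_iff: "0 < flat_exp k t \<longleftrightarrow> 0 < t" by (simp add: flat_exp_def)

lemma flat_exp_comp_deriv:
  assumes "g differentiable (at x)"
  shows "((\<lambda>x. flat_exp m (g x)) has_derivative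
    (\<lambda>h. (\<Sum>j\<in>UNIV. h $ j * pd j g x) * (flat_exp (m+2) (g x) - real m * flat_exp (m+1) (g x)))) (at x)"
  using has_derivative_compose[OF has_derivative_pd[OF assms] flat_exp_deriv[of m "g x", unfolded has_field_derivative_def]]
  by (simp add: mult.commute)

lemma pd_flat_exp:
  fixes g :: "real^'n::finite \<Rightarrow> real"
  assumes "g differentiable (at x)"
  shows "pd j (\<lambda>x. flat_exp m (g x)) x = pd j g x * (flat_exp (m+2) (g x) - real m * flat_exp (m+1) (g x))"
proof -
  have "(\<Sum>i\<in>UNIV. (axis j 1 :: real^'n) $ i * pd i g x) = pd j g x"
    by (simp add: axis_def if_distrib [of "\<lambda>a. a * _"] cong: if_cong)
  then show ?thesis using pd_eqI[OF flat_exp_comp_deriv[OF assms], where j=j] by simp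
qed

lemma Ck_flat_exp: "smooth g \<Longrightarrow> Ck k (\<lambda>x. flat_exp m (g x))"
proof (induction k arbitrary: m)
  case (Suc k)
  have "pd j (\<lambda>x. flat_exp m (g x)) = (\<lambda>x. pd j g x * (flat_exp (m+2) (g x) + (- real m) * flat_exp (m+1) (g x)))" for j
    by (intro ext) (simp add: pd_flat_exp smooth_differentiable Suc.prems)
  moreover have "Ck k (pd j g)" for j using Suc.prems smooth_imp_Ck smooth_pd by blast
  moreover have "Ck k (\<lambda>x. pd j g x * (flat_exp (m+2) (g x) + (- real m) * flat_exp (m+1) (g x)))" for j
    using \<open>Ck k (pd j g)\<close> Suc by (intro Ck_mult Ck_add Ck_const Suc.IH)
  ultimately have "Ck k (pd j (\<lambda>x. flat_exp m (g x)))" for j by simp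
  then show ?case using flat_exp_comp_deriv[OF smooth_differentiable[OF Suc.prems]]
    by (auto simp: differentiable_def)
qed simp

lemma smooth_flat_exp: "smooth g \<Longrightarrow> smooth (\<lambda>x. flat_exp m (g x))"
  by (simp add: smooth_iff_Ck Ck_flat_exp)

section \<open>Powers and uniform convexity\<close>

text \<open>Strict monotonicity of the derivative turns the mean value theorem into the strict
  tangent inequality. The value 0 of m or x is treated by hand because \<open>powr\<close> is
  differentiated only at positive arguments.\<close>

lemma powr_above_tangent_strict:
  fixes x m r :: real
  assumes "1 < r" "0 \<le> x" "0 \<le> m" "x \<noteq> m"
  shows "m powr r + r * m powr (r - 1) * (x - m) < x powr r"
proof -
  have der: "((\<lambda>x. x powr r) has_real_derivative r * z powr (r - 1)) (at z)" if "z > 0" for z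
    using has_real_derivative_powr[OF that, of r] by simp
  consider "m = 0" | "m > 0" "x = 0" | "m > 0" "x > m" | "m > 0" "0 < x" "x < m"
    using assms by linarith
  then show ?thesis
  proof cases
    case 1
    then show ?thesis using assms by simp
  next
    case 2
    have "m powr (r - 1) * m = m powr r" using 2 by (simp add: powr_diff)
    then have "m powr r + r * m powr (r - 1) * (x - m) = (1 - r) * m powr r" using 2 by (simp add: algebra_simps)
    then show ?thesis using 2 assms by (simp add: mult_neg_pos)
  next
    case 3
    obtain z where z: "m < z" "z < x" "x powr r - m powr r = (x - m) * (r * z powr (r - 1))"
      using MVT2[of m x "\<lambda>x. x powr r" "\<lambda>z. r * z powr (r - 1)"] 3 der by force
    have "m powr (r - 1) < z powr (r - 1)" using z 3 assms by (intro powr_less_mono2) auto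
    then have "(x - m) * (r * m powr (r - 1)) < (x - m) * (r * z powr (r - 1))" using 3 assms by simp
    then show ?thesis using z by (simp add: algebra_simps)
  next
    case 4
    obtain z where z: "x < z" "z < m" "m powr r - x powr r = (m - x) * (r * z powr (r - 1))"
      using MVT2[of x m "\<lambda>x. x powr r" "\<lambda>z. r * z powr (r - 1)"] 4 der by force
    have "z powr (r - 1) < m powr (r - 1)" using z 4 assms by (intro powr_less_mono2) auto
    then have "(m - x) * (r * z powr (r - 1)) < (m - x) * (r * m powr (r - 1))" using 4 assms by simp
    then show ?thesis using z by (simp add: algebra_simps)
  qed
qed

lemma powr_above_tangent:
  fixes x m r :: real
  assumes "1 < r" "0 \<le> x" "0 \<le> m"
  shows "m powr r + r * m powr (r - 1) * (x - m) \<le> x powr r"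
  using powr_above_tangent_strict[OF assms] by (cases "x = m") auto

text \<open>Without the factors 1/r and 1/s Young's inequality is a comparison of b with
  \<open>a powr (r - 1)\<close>: the larger of the two decides which summand alone dominates the
  product.\<close>

lemma young_crude:
  fixes a b r s :: real
  assumes "1 < r" "s = r / (r - 1)" "0 \<le> a" "0 \<le> b"
  shows "a * b \<le> a powr r + b powr s"
proof (cases "a = 0 \<or> b = 0")
  case False
  then have ab: "a > 0" "b > 0" using assms by auto
  show ?thesis
  proof (cases "b \<le> a powr (r - 1)")
    case True
    then have "a * b \<le> a * a powr (r - 1)" using ab by simp
    also have "\<dots> = a powr r" using ab by (simp add: powr_diff)
    finally show ?thesis using powr_ge_zero[of b s] by linarith
  next
    case False
    have "a = (a powr (r - 1)) powr (1 / (r - 1))" using ab assms by (simp add: powr_powr)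
    also have "\<dots> \<le> b powr (1 / (r - 1))" using False ab assms by (intro powr_mono2) auto
    also have "1 / (r - 1) = s - 1" using assms by (simp add: field_simps)
    finally have "a * b \<le> b powr (s - 1) * b" using ab by simp
    also have "\<dots> = b powr s" using ab by (simp add: powr_diff)
    finally show ?thesis using powr_ge_zero[of a r] by linarith
  qed
qed (use assms in auto)

text \<open>The derivative of \<open>\<bar>a\<bar> powr r\<close>. Splitting into positive and
  negative parts reduces continuity at 0 to continuity of \<open>powr\<close> at nonnegative
  bases.\<close>

definition dpow :: "real \<Rightarrow> real \<Rightarrow> real" where
  "dpow r a = r * (max a 0 powr (r - 1) - max (- a) 0 powr (r - 1))"

lemma dpow_nonneg_arg: "0 \<le> a \<Longrightarrow> dpow r a = r * a powr (r - 1)"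
  by (simp add: dpow_def max_def)

lemma dpow_minus: "dpow r (- a) = - dpow r a"
  by (simp add: dpow_def algebra_simps)

lemma abs_dpow: "0 \<le> r \<Longrightarrow> \<bar>dpow r a\<bar> = r * \<bar>a\<bar> powr (r - 1)"
  by (cases "a \<ge> 0")
    (simp_all add: dpow_nonneg_arg abs_mult abs_minus_cancel[of "dpow r a", symmetric] dpow_minus[symmetric] del: abs_minus_cancel)

lemma dpow_mult_self: "1 < r \<Longrightarrow> dpow r a * a = r * \<bar>a\<bar> powr r"
  using dpow_nonneg_arg[of a r] dpow_nonneg_arg[of "-a" r] dpow_minus[of r a]
  by (cases "a = 0"; cases "a \<ge> 0") (auto simp: powr_diff)

lemma continuous_dpow: "1 < r \<Longrightarrow> continuous_on S f \<Longrightarrow> continuous_on S (\<lambda>x. dpow r (f x))"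
  unfolding dpow_def by (intro continuous_intros continuous_on_powr') auto

lemma continuous_abs_powr: "0 < r \<Longrightarrow> continuous_on S f \<Longrightarrow> continuous_on S (\<lambda>x. \<bar>f x\<bar> powr (r::real))"
  by (intro continuous_intros continuous_on_powr') auto

lemma abs_powr_above_tangent_strict:
  fixes b a r :: real
  assumes "1 < r" "b \<noteq> a"
  shows "\<bar>a\<bar> powr r + dpow r a * (b - a) < \<bar>b\<bar> powr r"
proof -
  have pos: "\<bar>a\<bar> powr r + dpow r a * (b - a) < \<bar>b\<bar> powr r" if "0 \<le> a" "b \<noteq> a" for a b :: real
  proof (cases "b \<ge> 0 \<or> a = 0")
    case True
    then show ?thesis
      using powr_above_tangent_strict[OF assms(1), of b a] that assms(1)
      by (auto simp: dpow_nonneg_arg)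
  next
    case False
    then have "dpow r a * (b - a) < dpow r a * (\<bar>b\<bar> - a)"
      using that assms by (auto simp: dpow_nonneg_arg)
    moreover have "a powr r + dpow r a * (\<bar>b\<bar> - a) \<le> \<bar>b\<bar> powr r"
      using powr_above_tangent[OF assms(1), of "\<bar>b\<bar>" a] that by (simp add: dpow_nonneg_arg)
    ultimately show ?thesis using that by simp
  qed
  show ?thesis
    using pos[of a b] pos[of "-a" "-b"] assms by (cases "a \<ge> 0") (auto simp: dpow_minus algebra_simps)
qed

lemma abs_powr_above_tangent:
  "1 < r \<Longrightarrow> \<bar>a\<bar> powr r + dpow r a * (b - a) \<le> \<bar>b\<bar> powr (r::real)"
  using abs_powr_above_tangent_strict[of r b a] by (cases "b = a") auto

lemma abs_powr_midpoint_strict: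
  fixes a b r :: real
  assumes "1 < r" "a \<noteq> b"
  shows "\<bar>(a + b) / 2\<bar> powr r < (\<bar>a\<bar> powr r + \<bar>b\<bar> powr r) / 2"
proof -
  let ?c = "(a + b) / 2"
  have "a \<noteq> ?c" "b \<noteq> ?c" using assms by auto
  then have "\<bar>?c\<bar> powr r + dpow r ?c * (a - ?c) < \<bar>a\<bar> powr r" "\<bar>?c\<bar> powr r + dpow r ?c * (b - ?c) < \<bar>b\<bar> powr r"
    using abs_powr_above_tangent_strict[OF assms(1)] by blast+
  moreover have "dpow r ?c * (a - ?c) + dpow r ?c * (b - ?c) = 0"
    by (simp add: distrib_left[symmetric] field_simps)
  ultimately show ?thesis by simp
qed

lemma abs_powr_midpoint:
  fixes a b r :: real
  assumes "1 < r"
  shows "\<bar>(a + b) / 2\<bar> powr r \<le> (\<bar>a\<bar> powr r + \<bar>b\<bar> powr r) / 2"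
  using abs_powr_midpoint_strict[OF assms, of a b] by (cases "a = b") auto

lemma abs_powr_add_le:
  fixes a b r :: real
  assumes "1 < r"
  shows "\<bar>a + b\<bar> powr r \<le> 2 powr r * (\<bar>a\<bar> powr r + \<bar>b\<bar> powr r)"
proof -
  have "\<bar>a + b\<bar> powr r \<le> (2 * max \<bar>a\<bar> \<bar>b\<bar>) powr r" using assms by (intro powr_mono2) auto
  also have "\<dots> = 2 powr r * max \<bar>a\<bar> \<bar>b\<bar> powr r" by (simp add: powr_mult)
  also have "\<dots> \<le> 2 powr r * (\<bar>a\<bar> powr r + \<bar>b\<bar> powr r)"
    by (intro mult_left_mono) (auto simp: max_def)
  finally show ?thesis .
qed

text \<open>Both sides are homogeneous of degree r, so it suffices to look at pairs of total power
  1. There the midpoint deficit is continuous and strictly positive off the diagonal, hence bounded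
  below by some c on the compact set where the distance term is at least e; elsewhere the first
  summand already suffices. Compactness treats all r > 1 alike.\<close>

lemma abs_powr_uniform_convexity:
  fixes r e :: real
  assumes "1 < r" "0 < e"
  obtains C where "C \<ge> 0" "\<And>a b. \<bar>a - b\<bar> powr r \<le> e * (\<bar>a\<bar> powr r + \<bar>b\<bar> powr r)
      + C * ((\<bar>a\<bar> powr r + \<bar>b\<bar> powr r) / 2 - \<bar>(a + b) / 2\<bar> powr r)"
proof -
  define ex where "ex z = (\<bar>fst z\<bar> powr r + \<bar>snd z\<bar> powr r) / 2 - \<bar>(fst z + snd z) / 2\<bar> powr r" for z :: "real \<times> real"
  define S where "S = {z::real\<times>real. \<bar>fst z\<bar> powr r + \<bar>snd z\<bar> powr r = 1 \<and> e \<le> \<bar>fst z - snd z\<bar> powr r}"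
  have contex: "continuous_on T ex" for T
    unfolding ex_def using assms by (intro continuous_intros continuous_abs_powr) auto
  have "closed S" unfolding S_def
    using assms by (intro closed_Collect_conj closed_Collect_eq closed_Collect_le continuous_intros continuous_abs_powr) auto
  moreover have "S \<subseteq> cbox (-1,-1) (1,1)"
  proof
    fix z assume "z \<in> S"
    then have "\<bar>fst z\<bar> powr r + \<bar>snd z\<bar> powr r = 1" by (simp add: S_def)
    then have *: "\<bar>fst z\<bar> powr r \<le> 1" "\<bar>snd z\<bar> powr r \<le> 1"
      using powr_ge_zero[of "\<bar>fst z\<bar>" r] powr_ge_zero[of "\<bar>snd z\<bar>" r] by linarith+
    have "\<bar>t\<bar> \<le> 1" if "\<bar>t\<bar> powr r \<le> 1" for t :: real
    proof (rule ccontr)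
      assume "\<not> \<bar>t\<bar> \<le> 1"
      then have "1 < \<bar>t\<bar> powr r" using assms by (intro gr_one_powr) auto
      with that show False by linarith
    qed
    from this[OF *(1)] this[OF *(2)] show "z \<in> cbox (-1,-1) (1,1)"
      by (cases z) (auto simp: cbox_Pair_eq)
  qed
  ultimately have "compact S"
    by (meson bounded_cbox bounded_subset compact_eq_bounded_closed)
  obtain c where c: "c > 0" "\<And>z. z \<in> S \<Longrightarrow> c \<le> ex z"
  proof (cases "S = {}")
    case True then show ?thesis using that[of 1] by auto
  next
    case False
    then obtain z where z: "z \<in> S" "\<forall>y\<in>S. ex z \<le> ex y"
      using continuous_attains_inf[OF \<open>compact S\<close> False contex] by blast
    have "fst z \<noteq> snd z" using z(1) assms unfolding S_def by auto
    then have "ex z > 0" unfolding ex_def using abs_powr_midpoint_strict[OF assms(1)] by simp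
    then show ?thesis using z that by blast
  qed
  \<comment> \<open>On normalised pairs the left side is at most \<open>2 powr r\<close>, and on S
    the deficit is at least c.\<close>
  define C where "C = 2 powr r / c"
  have main: "\<bar>a - b\<bar> powr r \<le> e * (\<bar>a\<bar> powr r + \<bar>b\<bar> powr r) + C * ex (a, b)"
    if n: "\<bar>a\<bar> powr r + \<bar>b\<bar> powr r = 1" for a b
  proof (cases "(a, b) \<in> S")
    case True
    have "\<bar>a - b\<bar> powr r \<le> 2 powr r * 1"
      using abs_powr_add_le[OF assms(1), of a "-b"] n by simp
    also have "\<dots> \<le> C * ex (a, b)" using c True unfolding C_def
      by (simp add: field_simps)
    finally show ?thesis using n assms by simp
  next
    case False
    have "0 \<le> C * ex (a, b)" unfolding C_def ex_def using c abs_powr_midpoint[OF assms(1), of a b] by simp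
    then show ?thesis using False n unfolding S_def by auto
  qed
  show thesis
  proof (rule that)
    show "0 \<le> C" unfolding C_def using c by simp
    fix a b :: real
    define N where "N = \<bar>a\<bar> powr r + \<bar>b\<bar> powr r"
    show "\<bar>a - b\<bar> powr r \<le> e * (\<bar>a\<bar> powr r + \<bar>b\<bar> powr r)
      + C * ((\<bar>a\<bar> powr r + \<bar>b\<bar> powr r) / 2 - \<bar>(a + b) / 2\<bar> powr r)"
    proof (cases "N = 0")
      case True
      then have "a = 0" "b = 0" unfolding N_def
        using powr_ge_zero[of "\<bar>a\<bar>" r] powr_ge_zero[of "\<bar>b\<bar>" r] by (simp_all add: add_nonneg_eq_0_iff)
      then show ?thesis by simp
    next
      case False
      then have "N > 0" unfolding N_def by (simp add: add_nonneg_eq_0_iff less_le)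
      define l where "l = N powr (1 / r)"
      have l: "l > 0" "l powr r = N" using \<open>N > 0\<close> assms by (simp_all add: l_def powr_powr)
      have sc: "\<bar>t / l\<bar> powr r = \<bar>t\<bar> powr r / N" for t
        using l by (simp add: powr_divide)
      have "\<bar>a / l\<bar> powr r + \<bar>b / l\<bar> powr r = 1"
        using \<open>N > 0\<close> unfolding sc by (simp add: N_def add_divide_distrib[symmetric])
      from main[OF this] have "\<bar>(a - b) / l\<bar> powr r \<le> e * (\<bar>a / l\<bar> powr r + \<bar>b / l\<bar> powr r)
         + C * ((\<bar>a / l\<bar> powr r + \<bar>b / l\<bar> powr r) / 2 - \<bar>((a + b) / 2) / l\<bar> powr r)"
        by (simp add: ex_def diff_divide_distrib add_divide_distrib mult.commute)
      also have "\<dots> = (e * (\<bar>a\<bar> powr r + \<bar>b\<bar> powr r)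
          + C * ((\<bar>a\<bar> powr r + \<bar>b\<bar> powr r) / 2 - \<bar>(a + b) / 2\<bar> powr r)) / N"
        unfolding sc using \<open>N > 0\<close> by (simp add: field_simps)
      finally show ?thesis unfolding sc using \<open>N > 0\<close> by (simp add: divide_le_cancel)
    qed
  qed
qed

section \<open>Burkholder's function and its partial Legendre transform\<close>

text \<open>A line supporting f at the joint c puts \<open>f c\<close> below every chord that
  crosses c. On each side of c the one-sided convexity then bounds f by an interpolation of values
  lying on or below the chord.\<close>

lemma convex_on_glue:
  fixes f :: "real \<Rightarrow> real"
  assumes S: "convex S" and c: "c \<in> S"
    and 1: "convex_on (S \<inter> {..c}) f" and 2: "convex_on (S \<inter> {c..}) f"
    and sup: "\<And>x. x \<in> S \<Longrightarrow> f c + s * (x - c) \<le> f x"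
  shows "convex_on S f"
proof (rule convex_on_linorderI)
  fix t x y :: real
  assume t: "0 < t" "t < 1" and xy: "x \<in> S" "y \<in> S" "x < y"
  define z where "z = (1 - t) * x + t * y"
  consider "y \<le> c" | "c \<le> x" | "x < c" "c < y" by linarith
  then have "f z \<le> (1 - t) * f x + t * f y"
  proof cases
    case 1
    then show ?thesis using convex_onD[OF assms(3), of t x y] xy t by (simp add: z_def)
  next
    case 2
    then show ?thesis using convex_onD[OF assms(4), of t x y] xy t by (simp add: z_def)
  next
    case 3
    define l where "l w = f x + (f y - f x) * ((w - x) / (y - x))" for w
    have lz: "l z = (1 - t) * f x + t * f y"
    proof -
      have "(z - x) / (y - x) = t" using xy by (simp add: z_def field_simps)
      then show ?thesis by (simp add: l_def algebra_simps)
    qed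
    have lx: "l x = f x" and ly: "l y = f y" using xy by (simp_all add: l_def)
    have lc: "f c \<le> l c"
    proof -
      have "f c * (y - x) = (f c + s * (x - c)) * (y - c) + (f c + s * (y - c)) * (c - x)"
        by (simp add: algebra_simps)
      also have "\<dots> \<le> f x * (y - c) + f y * (c - x)"
        using sup[OF xy(1)] sup[OF xy(2)] 3 by (intro add_mono mult_right_mono) auto
      also have "\<dots> = l c * (y - x)" using xy by (simp add: l_def field_simps)
      finally show ?thesis using xy by simp
    qed
    have aff: "l ((1 - u) * v + u * w) = (1 - u) * l v + u * l w" for u v w
      by (simp add: l_def algebra_simps add_divide_distrib diff_divide_distrib)
    have "f z \<le> l z"
    proof (cases "z \<le> c")
      case True
      define u where "u = (z - x) / (c - x)"
      have "x < z" using t xy by (simp add: z_def algebra_simps)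
      have "u * (c - x) = z - x" using 3 by (simp add: u_def)
      then have u3: "z = (1 - u) * x + u * c" by (simp add: algebra_simps)
      have u: "0 \<le> u" "u \<le> 1" using \<open>x < z\<close> 3 True by (simp_all add: u_def)
      have "f z \<le> (1 - u) * f x + u * f c"
        unfolding u3 using convex_onD[OF assms(3), of u x c] u xy c 3 by simp
      also have "\<dots> \<le> (1 - u) * l x + u * l c" using lx lc u by (simp add: mult_left_mono)
      also have "\<dots> = l z" by (simp add: aff[symmetric] u3[symmetric])
      finally show ?thesis .
    next
      case False
      define u where "u = (z - c) / (y - c)"
      have "z < y" using t xy mult_strict_left_mono[of x y "1 - t"] by (simp add: z_def algebra_simps)
      have "u * (y - c) = z - c" using 3 by (simp add: u_def)
      then have u3: "z = (1 - u) * c + u * y" by (simp add: algebra_simps)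
      have u: "0 \<le> u" "u \<le> 1" using \<open>z < y\<close> 3 False by (simp_all add: u_def)
      have "f z \<le> (1 - u) * f c + u * f y"
        unfolding u3 using convex_onD[OF assms(4), of u c y] u xy c 3 by simp
      also have "\<dots> \<le> (1 - u) * l c + u * l y" using ly lc u by (simp add: mult_left_mono)
      also have "\<dots> = l z" by (simp add: aff[symmetric] u3[symmetric])
      finally show ?thesis .
    qed
    then show ?thesis by (simp add: lz)
  qed
  then show "f ((1 - t) *\<^sub>R x + t *\<^sub>R y) \<le> (1 - t) * f x + t * f y" by (simp add: z_def)
qed (use S in auto)

locale burkholder =
  fixes p :: real
  assumes p: "1 < p"
begin

text \<open>Dominates Burkholder's constant \<open>max (p - 1) (1 / (p - 1))\<close>; taking the sum
  spares a distinction between p below and above 2 in the convexity estimates.\<close>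

definition k where "k = (p - 1) + 1 / (p - 1)"
text \<open>Burkholder's function up to a normalising factor: concave along both diagonal
  directions, and bounded below by a multiple of \<open>\<bar>y\<bar> powr p\<close> minus a
  multiple of \<open>\<bar>x\<bar> powr p\<close>.\<close>

definition U where "U x y = (\<bar>y\<bar> - k * \<bar>x\<bar>) * (\<bar>x\<bar> + \<bar>y\<bar>) powr (p - 1)"

lemma k: "p - 1 < k" "1 < k * (p - 1)" "1 < k"
proof -
  show "p - 1 < k" using p by (simp add: k_def)
  have "k * (p - 1) = (p - 1)^2 + 1" using p by (simp add: k_def field_simps power2_eq_square)
  then show "1 < k * (p - 1)" using p by simp
  show "1 < k"
  proof (cases "p < 2")
    case True
    then have "1 < 1 / (p - 1)" using p by (simp add: field_simps)
    then show ?thesis using p unfolding k_def by linarith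
  next
    case False
    then have "1 / (p - 1) > 0" "p - 1 \<ge> 1" using p by simp_all
    then show ?thesis unfolding k_def by linarith
  qed
qed

lemma U_uminus: "U x (- y) = U x y" "U (- x) (- y) = U x y" by (simp_all add: U_def)

text \<open>In the variable \<open>m = x + y\<close> with \<open>x - y = d\<close> fixed, \<open>-U\<close> is \<open>G 1 d m\<close> to the right of
  \<open>d\<close>, \<open>G (-1) d (-m)\<close> to the left of \<open>-d\<close>, and affine in between.\<close>

definition G where "G t d m = ((k - 1) * m powr p + t * (k + 1) * d * m powr (p - 1)) / 2"
definition G' where "G' t d m = ((k - 1) * p * m powr (p - 1) + t * (k + 1) * d * (p - 1) * m powr (p - 2)) / 2"
definition G'' where "G'' t d m = ((k - 1) * p * (p - 1) * m powr (p - 2) + t * (k + 1) * d * (p - 1) * (p - 2) * m powr (p - 3)) / 2"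

lemma G_deriv: "0 < m \<Longrightarrow> (G t d has_real_derivative G' t d m) (at m)"
  unfolding G_def[abs_def] G'_def
  by (auto intro!: derivative_eq_intros has_real_derivative_powr simp: field_simps)

lemma G'_deriv: "0 < m \<Longrightarrow> (G' t d has_real_derivative G'' t d m) (at m)"
  unfolding G'_def[abs_def] G''_def
  by (auto intro!: derivative_eq_intros has_real_derivative_powr simp: field_simps)

text \<open>For t = 1 the expression is \<open>2 * (k * (p - 1) - 1)\<close>, for t = -1 it is
  \<open>2 * (k - (p - 1))\<close>; both summands in the definition of \<open>k\<close> are spent
  here.\<close>

lemma k_ineq: "t = 1 \<or> t = -1 \<Longrightarrow> (k - 1) * p + t * ((k + 1) * (p - 2)) \<ge> 0"
  using k by (auto simp: algebra_simps)

text \<open>After factoring out \<open>m powr (p - 3)\<close> the bracket is affine and increasing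
  in m, so its least value for \<open>m \<ge> d\<close> is at m = d, where it is the expression of
  \<open>k_ineq\<close> times d.\<close>

lemma G''_nonneg:
  assumes t: "t = 1 \<or> t = -1" and d: "0 < d" "d \<le> m"
  shows "0 \<le> G'' t d m"
proof -
  have "m powr (p - 2) = m * m powr (p - 3)"
    using d powr_mult_base[of m "p - 3"] by simp
  then have *: "G'' t d m = (p - 1) / 2 * m powr (p - 3) * ((k - 1) * p * m + t * ((k + 1) * (p - 2)) * d)"
    unfolding G''_def by (simp add: field_simps)
  have "0 \<le> ((k - 1) * p + t * ((k + 1) * (p - 2))) * d" using k_ineq[OF t] d by simp
  also have "\<dots> \<le> (k - 1) * p * m + t * ((k + 1) * (p - 2)) * d"
  proof -
    have "(k - 1) * p * d \<le> (k - 1) * p * m" using d k p by (intro mult_left_mono) auto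
    then show ?thesis by (simp add: distrib_right)
  qed
  finally show ?thesis unfolding * using p by simp
qed

lemma convex_G: "t = 1 \<or> t = -1 \<Longrightarrow> 0 < d \<Longrightarrow> convex_on {d..} (G t d)"
  by (rule f''_ge0_imp_convex[of _ _ "G' t d" "G'' t d"])
     (auto intro: G_deriv G'_deriv G''_nonneg)

text \<open>The line has the slope of the affine middle piece of \<open>-U\<close>, seen through the
  reflection of m when t = -1. The slope of the outer branch at d exceeds it by a nonnegative
  multiple of the expression in \<open>k_ineq\<close>, so the kink bends upwards; convexity of the
  branch does the rest.\<close>

lemma G_above:
  assumes t: "t = 1 \<or> t = -1" and d: "0 < d" "d \<le> m"
  shows "G t d d + t * (k + 1) / 2 * d powr (p - 1) * (m - d) \<le> G t d m"
proof -
  have "G t d d + G' t d d * (m - d) \<le> G t d m"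
  proof (cases "m = d")
    case False
    then obtain z where z: "d < z" "z < m" "G t d m - G t d d = (m - d) * G' t d z"
      using MVT2[of d m "G t d" "G' t d"] d G_deriv by force
    have "G' t d d \<le> G' t d z"
      using DERIV_nonneg_imp_nondecreasing[of d z "G' t d"] z G'_deriv G''_nonneg[OF t] d
      by (meson less_eq_real_def order.strict_trans2)
    then have "G' t d d * (m - d) \<le> G' t d z * (m - d)" using d by (intro mult_right_mono) auto
    moreover have "G t d m = G t d d + G' t d z * (m - d)" using z(3) by (simp add: mult.commute)
    ultimately show ?thesis by linarith
  qed simp
  moreover have "t * (k + 1) / 2 * d powr (p - 1) \<le> G' t d d"
  proof -
    have dd: "d powr (p - 1) = d * d powr (p - 2)" using d powr_mult_base[of d "p - 2"] by simp
    have e: "t * (k + 1) * d * (p - 1) * d powr (p - 2) = t * (k + 1) * (p - 1) * d powr (p - 1)"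
      unfolding dd by (simp add: algebra_simps)
    have "G' t d d - t * (k + 1) / 2 * d powr (p - 1) = d powr (p - 1) / 2 * ((k - 1) * p + t * ((k + 1) * (p - 2)))"
      unfolding G'_def e by (simp add: field_simps)
    then show ?thesis using k_ineq[OF t] by (metis diff_ge_0_iff_ge divide_nonneg_nonneg mult_nonneg_nonneg powr_ge_zero zero_le_numeral)
  qed
  ultimately show ?thesis using d by (smt (verit) mult_right_mono)
qed

section \<open>Convexity of \<open>-U\<close> along diagonals\<close>

definition V where "V d m = - U ((m + d) / 2) ((m - d) / 2)"

lemma V_right: "0 < d \<Longrightarrow> d \<le> m \<Longrightarrow> V d m = G 1 d m"
proof -
  assume d: "0 < d" "d \<le> m"
  then have "\<bar>(m - d) / 2\<bar> = (m - d) / 2" "\<bar>(m + d) / 2\<bar> = (m + d) / 2" "(m + d) / 2 + (m - d) / 2 = m" by (simp_all add: field_simps)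
  moreover have "m powr p = m * m powr (p - 1)" using d powr_mult_base[of m "p - 1"] by simp
  ultimately show ?thesis unfolding V_def U_def G_def by (simp add: field_simps)
qed

lemma V_left: "0 < d \<Longrightarrow> m \<le> - d \<Longrightarrow> V d m = G (-1) d (- m)"
proof -
  assume d: "0 < d" "m \<le> - d"
  then have "\<bar>(m - d) / 2\<bar> = (d - m) / 2" "\<bar>(m + d) / 2\<bar> = - (m + d) / 2" "- (m + d) / 2 + (d - m) / 2 = - m" by (simp_all add: field_simps)
  moreover have "(- m) powr p = (- m) * (- m) powr (p - 1)" using d powr_mult_base[of "- m" "p - 1"] by simp
  ultimately show ?thesis unfolding V_def U_def G_def by (simp add: field_simps)
qed

lemma V_mid: "0 < d \<Longrightarrow> - d \<le> m \<Longrightarrow> m \<le> d \<Longrightarrow> V d m = ((k + 1) * m + (k - 1) * d) / 2 * d powr (p - 1)"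
proof -
  assume d: "0 < d" "- d \<le> m" "m \<le> d"
  then have "\<bar>(m - d) / 2\<bar> = (d - m) / 2" "\<bar>(m + d) / 2\<bar> = (m + d) / 2" "(m + d) / 2 + (d - m) / 2 = d" by (simp_all add: field_simps)
  then show ?thesis unfolding V_def U_def by (simp add: field_simps)
qed

text \<open>The affine middle piece extends to a line lying below \<open>V d\<close> on the whole
  axis. This single line supports the function at both joints -d and d, which is what glueing the
  three convex pieces requires.\<close>

lemma convex_V_pos:
  assumes d: "0 < d"
  shows "convex_on UNIV (V d)"
proof -
  let ?s = "(k + 1) / 2 * d powr (p - 1)"
  have line: "V d m = V d d + ?s * (m - d)" "V d m = V d (-d) + ?s * (m - (-d))" if "- d \<le> m" "m \<le> d" for m
    using d that by (simp_all add: V_mid field_simps)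
  have right: "V d d + ?s * (m - d) \<le> V d m" if "d \<le> m" for m
    using G_above[of 1 d m] d that by (simp add: V_right)
  have left: "V d (-d) + ?s * (m - (-d)) \<le> V d m" if "m \<le> - d" for m
    using G_above[of "-1" d "-m"] d that by (simp add: V_left algebra_simps)
  have dd: "V d (-d) + ?s * (m - (-d)) = V d d + ?s * (m - d)" for m
  proof -
    have *: "A + s * (- d - d) + s * (m - (- d)) = A + s * (m - d)" for A s :: real by (simp add: algebra_simps)
    have "V d (- d) = V d d + ?s * (- d - d)" using line(1)[of "-d"] d by simp
    then show ?thesis by (simp only: *)
  qed
  have all: "V d d + ?s * (m - d) \<le> V d m" for m
    using right[of m] left[of m] line(1)[of m] dd[of m] by linarith
  have c1: "convex_on {.. - d} (V d)"
  proof (rule convex_on_linorderI)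
    fix t x y :: real assume "0 < t" "t < 1" "x \<in> {..-d}" "y \<in> {..-d}"
    moreover from this have "(1 - t) * x + t * y \<le> - d"
      using convex_bound_le[of x "-d" y "1 - t" t] by simp
    ultimately show "V d ((1 - t) *\<^sub>R x + t *\<^sub>R y) \<le> (1 - t) * V d x + t * V d y"
      using convex_onD[OF convex_G[of "-1" d], of t "-x" "-y"] d by (simp add: V_left algebra_simps)
  qed simp
  have c2: "convex_on {-d..d} (V d)"
  proof (rule convex_on_linorderI)
    fix t x y :: real assume t: "0 < t" "t < 1" and xy: "x \<in> {-d..d}" "y \<in> {-d..d}"
    have z: "(1 - t) * x + t * y \<in> {-d..d}"
      using convex_bound_le[of x d y "1 - t" t] convex_bound_le[of "-x" d "-y" "1 - t" t] t xy by simp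
    have lin: "A + s * ((1 - t) * x + t * y - d) = (1 - t) * (A + s * (x - d)) + t * (A + s * (y - d))" for A s
      by (simp add: algebra_simps)
    have Vx: "V d x = V d d + ?s * (x - d)" by (rule line(1)) (use xy in auto)
    have Vy: "V d y = V d d + ?s * (y - d)" by (rule line(1)) (use xy in auto)
    have Vz: "V d ((1 - t) * x + t * y) = V d d + ?s * ((1 - t) * x + t * y - d)"
      by (rule line(1)) (use z in auto)
    have "V d ((1 - t) * x + t * y) = (1 - t) * V d x + t * V d y"
      unfolding Vx Vy Vz by (rule lin)
    then show "V d ((1 - t) *\<^sub>R x + t *\<^sub>R y) \<le> (1 - t) * V d x + t * V d y" by simp
  qed simp
  have c3: "convex_on {d..} (V d)"
  proof (rule convex_on_linorderI)
    fix t x y :: real assume "0 < t" "t < 1" "x \<in> {d..}" "y \<in> {d..}"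
    moreover from this have "d \<le> (1 - t) * x + t * y"
      using convex_bound_le[of "-x" "-d" "-y" "1 - t" t] by simp
    ultimately show "V d ((1 - t) *\<^sub>R x + t *\<^sub>R y) \<le> (1 - t) * V d x + t * V d y"
      using convex_onD[OF convex_G[of 1 d], of t x y] d by (simp add: V_right)
  qed simp
  have i1: "{..d} \<inter> {..-d} = {..-d}" "{..d} \<inter> {-d..} = {-d..d}" using d by auto
  have left': "V d (-d) + ?s * (m - (-d)) \<le> V d m" for m using all[of m] dd[of m] by linarith
  have "convex_on {..d} (V d)"
  proof (rule convex_on_glue[where c = "-d" and s = ?s])
    show "convex_on ({..d} \<inter> {..-d}) (V d)" unfolding i1 by (rule c1)
    show "convex_on ({..d} \<inter> {-d..}) (V d)" unfolding i1 by (rule c2)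
    show "V d (-d) + ?s * (x - - d) \<le> V d x" for x by (rule left')
  qed (simp, use d in simp)
  then have "convex_on (UNIV \<inter> {..d}) (V d)" by simp
  moreover have "convex_on (UNIV \<inter> {d..}) (V d)" using c3 by simp
  ultimately show ?thesis by (rule convex_on_glue[where c = d and s = ?s, OF convex_UNIV UNIV_I _ _ all])
qed

lemma continuous_U: "continuous_on S f \<Longrightarrow> continuous_on S g \<Longrightarrow> continuous_on S (\<lambda>x. U (f x) (g x))"
  unfolding U_def using p by (intro continuous_intros continuous_on_powr') auto

text \<open>Negative d is the point reflection of positive d, and d = 0 is a pointwise limit of
  convex functions.\<close>

lemma convex_V: "convex_on UNIV (V d)"
proof -
  consider "d > 0" | "d < 0" | "d = 0" by linarith
  then show ?thesis
  proof cases
    case 2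
    have *: "V d m = V (- d) (- m)" for m
      using U_uminus(2)[of "(m + d) / 2" "(m - d) / 2"] by (simp add: V_def diff_divide_distrib add_divide_distrib)
    show ?thesis
    proof (rule convex_on_linorderI)
      fix t x y :: real assume "0 < t" "t < 1"
      then show "V d ((1 - t) *\<^sub>R x + t *\<^sub>R y) \<le> (1 - t) * V d x + t * V d y"
        using convex_onD[OF convex_V_pos[of "-d"], of t "-x" "-y"] 2 unfolding * by (simp add: algebra_simps)
    qed simp
  next
    case 3
    have lim: "((\<lambda>d. V d m) \<longlongrightarrow> V 0 m) (at_right 0)" for m
    proof -
      have "continuous_on UNIV (\<lambda>d. V d m)" unfolding V_def by (intro continuous_intros continuous_U) auto
      then have "isCont (\<lambda>d. V d m) 0" by (simp add: continuous_on_eq_continuous_at)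
      then show ?thesis by (simp add: isCont_def filterlim_at_split)
    qed
    have "V 0 ((1 - t) *\<^sub>R x + t *\<^sub>R y) \<le> (1 - t) * V 0 x + t * V 0 y" if t: "0 < t" "t < 1" for t x y
    proof (rule tendsto_le[OF _ _ lim])
      show "((\<lambda>d. (1 - t) * V d x + t * V d y) \<longlongrightarrow> (1 - t) * V 0 x + t * V 0 y) (at_right 0)"
        by (intro tendsto_intros lim)
      show "\<forall>\<^sub>F d in at_right 0. V d ((1 - t) *\<^sub>R x + t *\<^sub>R y) \<le> (1 - t) * V d x + t * V d y"
        using t convex_onD[OF convex_V_pos]
        by (intro eventually_mono[OF eventually_at_right_less[of 0]]) auto
    qed simp
    then show ?thesis using 3 by (intro convex_on_linorderI) auto
  qed (rule convex_V_pos)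
qed

text \<open>Adding s to both arguments fixes the difference x - y and moves the sum by 2 s, so this
  is convexity of \<open>V (x - y)\<close> at the point x + y.\<close>

lemma U_diag_aux:
  assumes "0 \<le> u" "0 \<le> v" "u + v = 1" "u * s + v * t = 0"
  shows "u * U (x + s) (y + s) + v * U (x + t) (y + t) \<le> U x y"
proof -
  have *: "U (x + s) (y + s) = - V (x - y) (x + y + 2 * s)" for s
  proof -
    have "(x + y + 2 * s + (x - y)) / 2 = x + s" "(x + y + 2 * s - (x - y)) / 2 = y + s" by simp_all
    then show ?thesis by (simp only: V_def minus_minus)
  qed
  have u: "u = 1 - v" using assms by simp
  have "(1 - v) * (x + y + 2 * s) + v * (x + y + 2 * t) = x + y + 2 * (u * s + v * t)"
    unfolding u by (simp add: algebra_simps)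
  then have "(1 - v) * (x + y + 2 * s) + v * (x + y + 2 * t) = x + y" using assms by simp
  then have "V (x - y) (x + y) \<le> (1 - v) * V (x - y) (x + y + 2 * s) + v * V (x - y) (x + y + 2 * t)"
    using convex_onD[OF convex_V[of "x - y"], of v "x + y + 2 * s" "x + y + 2 * t"] assms by simp
  then show ?thesis using *[of 0] *[of s] *[of t] u by simp
qed

lemma U_diag:
  assumes "0 \<le> u" "0 \<le> v" "u + v = 1" "u * s + v * t = 0" "e = 1 \<or> e = -1"
  shows "u * U (x + s) (y + e * s) + v * U (x + t) (y + e * t) \<le> U x y"
proof (cases "e = 1")
  case False
  then have e: "e = -1" using assms by simp
  have "U x (- (- y + s)) = U x (- y + s)" for x s by (rule U_uminus)
  then have "U (x + s) (y - s) = U (x + s) (- y + s)" for s by (metis add.commute minus_add_distrib minus_minus uminus_add_conv_diff)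
  then show ?thesis using U_diag_aux[OF assms(1-4), of x "- y"] e by (simp add: U_uminus)
qed (use U_diag_aux[OF assms(1-4)] in simp)

definition K where "K = k * (1 + 2 * k) powr (p - 1) + (2 * k) powr p"

text \<open>If y dominates, the first factor of \<open>U\<close> is at least half of
  \<open>\<bar>y\<bar>\<close>; otherwise every term is controlled by a power of x. The two summands
  of \<open>K\<close> pay for the negative part of \<open>U\<close> and for
  \<open>\<bar>y\<bar> powr p\<close> in the second case.\<close>

lemma U_lower: "1/2 * \<bar>y\<bar> powr p - K * \<bar>x\<bar> powr p \<le> U x y"
proof (cases "2 * k * \<bar>x\<bar> \<le> \<bar>y\<bar>")
  case True
  have "1/2 * \<bar>y\<bar> powr p = 1/2 * \<bar>y\<bar> * \<bar>y\<bar> powr (p - 1)" using powr_mult_base[of "\<bar>y\<bar>" "p - 1"] by simp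
  also have "\<dots> \<le> (\<bar>y\<bar> - k * \<bar>x\<bar>) * (\<bar>x\<bar> + \<bar>y\<bar>) powr (p - 1)"
    using True p by (intro mult_mono powr_mono2) auto
  finally show ?thesis unfolding U_def K_def using k(3)
    by (smt (verit) mult_nonneg_nonneg powr_ge_zero)
next
  case False
  have "- (k * (1 + 2 * k) powr (p - 1) * \<bar>x\<bar> powr p) = - (k * \<bar>x\<bar> * ((1 + 2 * k) * \<bar>x\<bar>) powr (p - 1))"
    using powr_mult_base[of "\<bar>x\<bar>" "p - 1"] k by (simp add: powr_mult)
  also have "\<dots> \<le> - (k * \<bar>x\<bar> * (\<bar>x\<bar> + \<bar>y\<bar>) powr (p - 1))"
    using False p k by (auto intro!: mult_left_mono powr_mono2 simp: algebra_simps)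
  also have "\<dots> \<le> U x y" unfolding U_def by (simp add: algebra_simps)
  finally have a: "- (k * (1 + 2 * k) powr (p - 1) * \<bar>x\<bar> powr p) \<le> U x y" .
  have "1/2 * \<bar>y\<bar> powr p \<le> \<bar>y\<bar> powr p" by simp
  also have "\<dots> \<le> (2 * k * \<bar>x\<bar>) powr p" using False p by (intro powr_mono2) auto
  also have "\<dots> = (2 * k) powr p * \<bar>x\<bar> powr p" using k by (simp add: powr_mult)
  finally show ?thesis using a unfolding K_def by (simp add: algebra_simps)
qed

text \<open>Concavity of \<open>U\<close> along the diagonals makes \<open>Bell a b \<plusminus> 2ab\<close> convex.\<close>

definition Bell :: "real \<Rightarrow> real \<Rightarrow> real" where "Bell a b = (SUP t. b * t - U (2 * a) t)"

definition cB where "cB = K * 2 powr p + 2 powr (p / (p - 1))"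

lemma Bell_term_le: "b * t - U (2 * a) t \<le> cB * (\<bar>a\<bar> powr p + \<bar>b\<bar> powr (p / (p - 1)))"
proof -
  let ?s = "p / (p - 1)"
  \<comment> \<open>The weight \<open>2 powr (1/p)\<close> gives \<open>\<bar>t\<bar> powr p\<close>
    the coefficient 1/2, the same as in \<open>U_lower\<close>, so that the dependence on t
    cancels.\<close>
  have "b * t \<le> (\<bar>t\<bar> / 2 powr (1/p)) * (2 powr (1/p) * \<bar>b\<bar>)"
    by (simp add: abs_mult[symmetric] mult.commute)
  also have "\<dots> \<le> (\<bar>t\<bar> / 2 powr (1/p)) powr p + (2 powr (1/p) * \<bar>b\<bar>) powr ?s"
    using p by (intro young_crude) auto
  also have "\<dots> = 1/2 * \<bar>t\<bar> powr p + 2 powr (1 / (p - 1)) * \<bar>b\<bar> powr ?s"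
    using p by (simp add: powr_divide powr_mult powr_powr)
  also have "2 powr (1 / (p - 1)) * \<bar>b\<bar> powr ?s \<le> 2 powr ?s * \<bar>b\<bar> powr ?s"
    using p by (intro mult_right_mono powr_mono) (auto simp: divide_right_mono)
  finally have "b * t \<le> 1/2 * \<bar>t\<bar> powr p + 2 powr ?s * \<bar>b\<bar> powr ?s" by simp
  moreover have "1/2 * \<bar>t\<bar> powr p - K * (2 powr p * \<bar>a\<bar> powr p) \<le> U (2 * a) t"
    using U_lower[of t "2 * a"] by (simp add: abs_mult powr_mult)
  moreover have "0 \<le> 2 powr ?s * \<bar>a\<bar> powr p + K * 2 powr p * \<bar>b\<bar> powr ?s" using k by (auto simp: K_def)
  moreover have "cB * (\<bar>a\<bar> powr p + \<bar>b\<bar> powr ?s) = K * (2 powr p * \<bar>a\<bar> powr p) + 2 powr ?s * \<bar>b\<bar> powr ?s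
      + (2 powr ?s * \<bar>a\<bar> powr p + K * 2 powr p * \<bar>b\<bar> powr ?s)"
    unfolding cB_def by (simp add: algebra_simps)
  ultimately show ?thesis by linarith
qed

lemma Bell_bdd: "bdd_above (range (\<lambda>t. b * t - U (2 * a) t))"
  using Bell_term_le by (intro bdd_aboveI2)

lemma Bell_upper: "Bell a b \<le> cB * (\<bar>a\<bar> powr p + \<bar>b\<bar> powr (p / (p - 1)))"
  unfolding Bell_def by (rule cSUP_least) (use Bell_term_le in auto)

lemma Bell_ge: "b * t - U (2 * a) t \<le> Bell a b"
  unfolding Bell_def by (rule cSUP_upper[OF _ Bell_bdd]) simp

lemma Bell_nonneg: "0 \<le> Bell a b"
proof -
  have "0 \<le> b * 0 - U (2 * a) 0" using k by (simp add: U_def)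
  then show ?thesis using Bell_ge[of b 0 a] by linarith
qed

lemma Bell_zero: "Bell 0 0 = 0"
  using Bell_upper[of 0 0] Bell_nonneg[of 0 0] p by simp

text \<open>For given t, evaluate the two suprema at points shifted from t by 2 (a1 - a) and 2 (a2 -
  a), times the sign e. Both arguments of \<open>U\<close> then lie on one diagonal through
  \<open>(2 * a, t)\<close>, where \<open>U\<close> is concave, while the linear parts produce the
  cross term \<open>2 * u * v * (e * ((a1 - a2) * (b1 - b2)))\<close>. The sign e makes it an
  absolute value.\<close>

lemma Bell_strong_convex:
  assumes "0 \<le> u" "0 \<le> v" "u + v = 1"
  shows "Bell (u * a1 + v * a2) (u * b1 + v * b2) \<le> u * Bell a1 b1 + v * Bell a2 b2 - 2 * u * v * \<bar>a1 - a2\<bar> * \<bar>b1 - b2\<bar>"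
proof -
  define a b where "a = u * a1 + v * a2" and "b = u * b1 + v * b2"
  define e :: real where "e = (if (a1 - a2) * (b1 - b2) \<ge> 0 then 1 else -1)"
  have e: "e = 1 \<or> e = -1" by (simp add: e_def)
  have v: "v = 1 - u" using assms by simp
  have *: "b * t - U (2 * a) t \<le> u * Bell a1 b1 + v * Bell a2 b2 - 2 * u * v * \<bar>a1 - a2\<bar> * \<bar>b1 - b2\<bar>" for t
  proof -
    have z: "u * (2 * (a1 - a)) + v * (2 * (a2 - a)) = 0" unfolding a_def v by (simp add: algebra_simps)
    define X1 X2 P where "X1 = t + e * (2 * (a1 - a))" and "X2 = t + e * (2 * (a2 - a))"
      and "P = \<bar>a1 - a2\<bar> * \<bar>b1 - b2\<bar>"
    have 1: "u * U (2 * a1) X1 + v * U (2 * a2) X2 \<le> U (2 * a) t"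
      using U_diag[OF assms z e, of "2 * a" t] by (simp add: algebra_simps X1_def X2_def)
    have "u * (b1 * X1) + v * (b2 * X2) = b * t + 2 * u * v * (e * ((a1 - a2) * (b1 - b2)))"
      unfolding a_def b_def v X1_def X2_def by (simp add: algebra_simps)
    moreover have "e * ((a1 - a2) * (b1 - b2)) = P"
      by (simp add: e_def P_def abs_mult[symmetric])
    ultimately have 2: "u * (b1 * X1) + v * (b2 * X2) = b * t + 2 * u * v * P" by simp
    have "u * (b1 * X1 - U (2 * a1) X1) \<le> u * Bell a1 b1" "v * (b2 * X2 - U (2 * a2) X2) \<le> v * Bell a2 b2"
      using Bell_ge assms by (auto intro!: mult_left_mono)
    then have "u * (b1 * X1) - u * U (2 * a1) X1 \<le> u * Bell a1 b1" "v * (b2 * X2) - v * U (2 * a2) X2 \<le> v * Bell a2 b2"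
      by (simp_all only: right_diff_distrib)
    with 1 2 have "b * t - U (2 * a) t \<le> u * Bell a1 b1 + v * Bell a2 b2 - 2 * u * v * P" by linarith
    then show ?thesis by (simp add: P_def mult.assoc)
  qed
  show ?thesis unfolding a_def[symmetric] b_def[symmetric] Bell_def[of a b]
    by (rule cSUP_least) (use * in auto)
qed

lemma convex_Bell: "convex_on UNIV (\<lambda>z. Bell (fst z) (snd z))"
proof (rule convex_onI)
  fix t :: real and x y :: "real \<times> real"
  assume t: "0 < t" "t < 1"
  have "0 \<le> 2 * (1 - t) * t * \<bar>fst x - fst y\<bar> * \<bar>snd x - snd y\<bar>" using t by simp
  moreover have "Bell ((1 - t) * fst x + t * fst y) ((1 - t) * snd x + t * snd y)
     \<le> (1 - t) * Bell (fst x) (snd x) + t * Bell (fst y) (snd y)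
       - 2 * (1 - t) * t * \<bar>fst x - fst y\<bar> * \<bar>snd x - snd y\<bar>"
    using t by (intro Bell_strong_convex) auto
  ultimately have "Bell ((1 - t) * fst x + t * fst y) ((1 - t) * snd x + t * snd y)
     \<le> (1 - t) * Bell (fst x) (snd x) + t * Bell (fst y) (snd y)" by linarith
  then show "Bell (fst ((1 - t) *\<^sub>R x + t *\<^sub>R y)) (snd ((1 - t) *\<^sub>R x + t *\<^sub>R y))
        \<le> (1 - t) * Bell (fst x) (snd x) + t * Bell (fst y) (snd y)" by simp
qed simp

lemma continuous_Bell: "continuous_on S f \<Longrightarrow> continuous_on S g \<Longrightarrow> continuous_on S (\<lambda>x. Bell (f x) (g x))"
  using continuous_on_compose2[OF convex_on_continuous[OF open_UNIV convex_Bell], of S "\<lambda>x. (f x, g x)"]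
  by (simp add: continuous_on_Pair)

end

section \<open>Representation of bounded functionals on subspaces of \<open>L\<^sup>r\<close>\<close>

lemma borel_measurable_dpow [measurable]: "1 < r \<Longrightarrow> f \<in> borel_measurable M \<Longrightarrow> (\<lambda>x. dpow r (f x)) \<in> borel_measurable M"
  using measurable_compose[of f M borel "dpow r" borel] borel_measurable_continuous_onI[OF continuous_dpow[of r UNIV "\<lambda>x. x"]]
  by simp

lemma isCont_dpow: "1 < r \<Longrightarrow> isCont (dpow r) a"
  using continuous_dpow[of r UNIV "\<lambda>x. x"] by (simp add: continuous_on_eq_continuous_at)

lemma abs_dpow_mult_le:
  assumes "1 < r"
  shows "\<bar>dpow r b * a\<bar> \<le> r * (\<bar>a\<bar> powr r + \<bar>b\<bar> powr r)"
proof -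
  have "\<bar>a\<bar> * \<bar>b\<bar> powr (r - 1) \<le> \<bar>a\<bar> powr r + (\<bar>b\<bar> powr (r - 1)) powr (r / (r - 1))"
    using assms by (intro young_crude) auto
  also have "(\<bar>b\<bar> powr (r - 1)) powr (r / (r - 1)) = \<bar>b\<bar> powr r" using assms by (simp add: powr_powr)
  finally show ?thesis using assms by (simp add: abs_mult abs_dpow mult_left_mono mult.commute mult.assoc)
qed

text \<open>The representing function is the derivative of \<open>|f|\<^sup>r\<close> at the minimiser \<open>f\<close> of
  \<open>\<integral>|f|\<^sup>r - L f\<close> over the closure of \<open>D\<close>; uniform convexity makes minimising sequences Cauchy.\<close>

lemma riesz_Lr_subspace:
  fixes L :: "('a \<Rightarrow> real) \<Rightarrow> real" and D :: "('a \<Rightarrow> real) set"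
  assumes r: "1 < r"
    and ne: "D \<noteq> {}"
    and sub: "\<And>f g a b. f \<in> D \<Longrightarrow> g \<in> D \<Longrightarrow> (\<lambda>x. a * f x + b * g x) \<in> D"
    and lin: "\<And>f g a b. f \<in> D \<Longrightarrow> g \<in> D \<Longrightarrow> L (\<lambda>x. a * f x + b * g x) = a * L f + b * L g"
    and meas: "\<And>f. f \<in> D \<Longrightarrow> f \<in> borel_measurable M"
    and int: "\<And>f. f \<in> D \<Longrightarrow> integrable M (\<lambda>x. \<bar>f x\<bar> powr r)"
    and bnd: "\<And>f. f \<in> D \<Longrightarrow> \<bar>L f\<bar> \<le> C * (\<integral>x. \<bar>f x\<bar> powr r \<partial>M) powr (1 / r)"
  obtains p where "p \<in> borel_measurable M" "integrable M (\<lambda>x. \<bar>p x\<bar> powr (r / (r - 1)))"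
    "\<And>f. f \<in> D \<Longrightarrow> integrable M (\<lambda>x. p x * f x)" "\<And>f. f \<in> D \<Longrightarrow> L f = (\<integral>x. p x * f x \<partial>M)"
proof -
  define I where "I f = (\<integral>x. \<bar>f x\<bar> powr r \<partial>M)" for f
  define J where "J f = I f - L f" for f
  have I0: "0 \<le> I f" for f unfolding I_def by simp
  \<comment> \<open>What Young's inequality leaves over when half of \<open>I f\<close> absorbs the
    bound on \<open>L f\<close>; hence J is coercive and bounded below.\<close>
  define K where "K = (\<bar>C\<bar> * 2 powr (1/r)) powr (r / (r - 1))"
  have Lle: "\<bar>L f\<bar> \<le> I f / 2 + K" if "f \<in> D" for f
  proof -
    have "\<bar>L f\<bar> \<le> \<bar>C\<bar> * I f powr (1/r)"
      using bnd[OF that] unfolding I_def by (smt (verit) mult_right_mono powr_ge_zero)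
    also have "\<dots> = (I f / 2) powr (1/r) * (\<bar>C\<bar> * 2 powr (1/r))" using I0[of f] by (simp add: powr_divide)
    also have "\<dots> \<le> ((I f / 2) powr (1/r)) powr r + K"
      unfolding K_def using r by (intro young_crude) auto
    also have "((I f / 2) powr (1/r)) powr r = I f / 2" using r I0[of f] by (simp add: powr_powr)
    finally show ?thesis .
  qed
  have Jge: "I f / 2 - K \<le> J f" if "f \<in> D" for f using Lle[OF that] unfolding J_def by linarith
  define m where "m = Inf (J ` D)"
  have bdd: "bdd_below (J ` D)" by (rule bdd_belowI2[of _ "-K"]) (use Jge I0 in \<open>smt (verit) field_sum_of_halves\<close>)
  have mle: "m \<le> J f" if "f \<in> D" for f unfolding m_def using bdd that by (simp add: cINF_lower)
  have near: "\<exists>f\<in>D. J f < m + e" if "e > 0" for e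
  proof (rule ccontr)
    assume "\<not> (\<exists>f\<in>D. J f < m + e)"
    then have "m + e \<le> Inf (J ` D)" using ne by (intro cINF_greatest) auto
    then show False using that unfolding m_def by simp
  qed
  define Y where "Y = 2 * (m + 1 + K)"
  have IY: "I f \<le> Y" if "f \<in> D" "J f < m + 1" for f using Jge[OF that(1)] that(2) by (simp add: Y_def)
  \<comment> \<open>The midpoint of two almost-minimisers lies in D, so its J is at least m. As L is
    linear, the midpoint deficit of I is at most d, and uniform convexity converts this into
    closeness.\<close>
  have cauchy: "\<exists>d>0. \<forall>f\<in>D. \<forall>g\<in>D. J f < m + d \<longrightarrow> J g < m + d \<longrightarrow> I (\<lambda>x. f x - g x) < e" if e: "e > 0" for e
  proof -
    define e' where "e' = e / (4 * (\<bar>Y\<bar> + 1))"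
    have e': "e' > 0" using e by (simp add: e'_def)
    obtain C' where C': "C' \<ge> 0" "\<And>a b. \<bar>a - b\<bar> powr r \<le> e' * (\<bar>a\<bar> powr r + \<bar>b\<bar> powr r)
      + C' * ((\<bar>a\<bar> powr r + \<bar>b\<bar> powr r) / 2 - \<bar>(a + b) / 2\<bar> powr r)"
      using abs_powr_uniform_convexity[OF r e'] by blast
    define d where "d = min 1 (e / (4 * (C' + 1)))"
    have d: "d > 0" using e C' by (simp add: d_def)
    have gen: "(\<integral>x. e' * (F x + G x) + C' * ((F x + G x) / 2 - H x) \<partial>M)
       = e' * ((\<integral>x. F x \<partial>M) + (\<integral>x. G x \<partial>M)) + C' * (((\<integral>x. F x \<partial>M) + (\<integral>x. G x \<partial>M)) / 2 - (\<integral>x. H x \<partial>M))"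
      and geni: "integrable M (\<lambda>x. e' * (F x + G x) + C' * ((F x + G x) / 2 - H x))"
      if "integrable M F" "integrable M G" "integrable M H" for F G H
      using that by simp_all
    have "I (\<lambda>x. f x - g x) < e" if fg: "f \<in> D" "g \<in> D" "J f < m + d" "J g < m + d" for f g
    proof -
      have h: "(\<lambda>x. (f x + g x) / 2) \<in> D" using sub[OF fg(1,2), of "1/2" "1/2"] by (simp add: add_divide_distrib)
      have Lh: "L (\<lambda>x. (f x + g x) / 2) = (L f + L g) / 2"
        using lin[OF fg(1,2), of "1/2" "1/2"] by (simp add: add_divide_distrib)
      have fmg: "(\<lambda>x. f x - g x) \<in> D" using sub[OF fg(1,2), of 1 "-1"] by simp
      have "I (\<lambda>x. f x - g x) \<le> (\<integral>x. e' * (\<bar>f x\<bar> powr r + \<bar>g x\<bar> powr r)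
         + C' * ((\<bar>f x\<bar> powr r + \<bar>g x\<bar> powr r) / 2 - \<bar>(f x + g x) / 2\<bar> powr r) \<partial>M)"
        unfolding I_def
        by (rule integral_mono[OF int[OF fmg] geni[OF int[OF fg(1)] int[OF fg(2)] int[OF h]] C'(2)])
      also have "\<dots> = e' * (I f + I g) + C' * ((I f + I g) / 2 - I (\<lambda>x. (f x + g x) / 2))"
        unfolding I_def by (rule gen[OF int[OF fg(1)] int[OF fg(2)] int[OF h]])
      also have "(I f + I g) / 2 - I (\<lambda>x. (f x + g x) / 2) = (J f + J g) / 2 - J (\<lambda>x. (f x + g x) / 2)"
        unfolding J_def Lh by (simp add: field_simps)
      also have "\<dots> \<le> d" using fg(3,4) mle[OF h] by (simp add: field_simps)
      also have "e' * (I f + I g) \<le> e' * (2 * (\<bar>Y\<bar> + 1))"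
      proof -
        have "d \<le> 1" by (simp add: d_def)
        then have "I f \<le> Y" "I g \<le> Y" using IY fg by auto
        then have "I f + I g \<le> 2 * \<bar>Y\<bar> + 2" by linarith
        then have "I f + I g \<le> 2 * (\<bar>Y\<bar> + 1)" by simp
        then show ?thesis using e' by (intro mult_left_mono) auto
      qed
      also have "e' * (2 * (\<bar>Y\<bar> + 1)) = e / 2" unfolding e'_def by (simp add: field_simps)
      also have "C' * d \<le> C' * (e / (4 * (C' + 1)))" using C' by (intro mult_left_mono) (auto simp: d_def)
      also have "\<dots> \<le> e / 4" using C' e by (simp add: field_simps)
      finally show ?thesis using C' e by (simp add: mult_left_mono)
    qed
    then show ?thesis using d by blast
  qed
  \<comment> \<open>With the factor \<open>(2 powr r) ^ k\<close> in the denominator the weighted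
    sum \<open>H\<close> of the increments still has integral at most 2. Almost everywhere the k-th
    increment is then at most \<open>(1/2) ^ k\<close> times a fixed function, which gives pointwise
    convergence and a dominating function at once.\<close>
  define eta where "eta k = (1/2) ^ k / (2 powr r) ^ k" for k :: nat
  have eta: "eta k > 0" for k unfolding eta_def by simp
  obtain \<delta> where \<delta>: "\<And>k. \<delta> k > 0"
     "\<And>k f g. f \<in> D \<Longrightarrow> g \<in> D \<Longrightarrow> J f < m + \<delta> k \<Longrightarrow> J g < m + \<delta> k \<Longrightarrow> I (\<lambda>x. f x - g x) < eta k"
    using cauchy[OF eta] by metis
  \<comment> \<open>The minimum over all earlier thresholds puts consecutive members both within
    \<open>\<delta> k\<close> of the infimum. The bound 1/(k+1) is the square of the step size t of
    the variation below.\<close>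
  define \<rho> where "\<rho> k = min (Min (\<delta> ` {..k})) (1 / (real k + 1))" for k
  have \<rho>: "\<rho> k > 0" for k unfolding \<rho>_def using \<delta>(1) by simp
  have \<rho>1: "\<rho> k \<le> \<delta> j" if "j \<le> k" for j k
    unfolding \<rho>_def using that by (meson Min_le atMost_iff finite_atMost finite_imageI imageI min.coboundedI1)
  have \<rho>2: "\<rho> k \<le> 1 / (real k + 1)" for k unfolding \<rho>_def by simp
  obtain f where fD: "\<And>k. f k \<in> D" and fJ: "\<And>k. J (f k) < m + \<rho> k"
    using near[OF \<rho>] by metis
  note [measurable] = meas[OF fD]
  have step: "I (\<lambda>x. f (Suc k) x - f k x) < eta k" for k
    by (rule \<delta>(2)[OF fD fD]) (use fJ[of k] fJ[of "Suc k"] \<rho>1[of k k] \<rho>1[of k "Suc k"] in auto)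
  define d where "d k x = f (Suc k) x - f k x" for k x
  have dD: "d k \<in> D" for k unfolding d_def using sub[OF fD fD, of 1 "Suc k" "-1" k] by simp
  note [measurable] = meas[OF dD]
  define H where "H x = (\<Sum>k. ennreal ((2 powr r) ^ k * \<bar>d k x\<bar> powr r))" for x
  have Hm [measurable]: "H \<in> borel_measurable M" unfolding H_def[abs_def] by measurable
  have "(\<integral>\<^sup>+x. H x \<partial>M) = (\<Sum>k. \<integral>\<^sup>+x. ennreal ((2 powr r) ^ k * \<bar>d k x\<bar> powr r) \<partial>M)"
    unfolding H_def by (intro nn_integral_suminf) auto
  also have "\<dots> \<le> (\<Sum>k. ennreal ((1/2) ^ k))"
  proof (intro suminf_le allI)
    fix k
    have "(\<integral>\<^sup>+x. ennreal ((2 powr r) ^ k * \<bar>d k x\<bar> powr r) \<partial>M) = ennreal ((2 powr r) ^ k * I (d k))"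
      unfolding I_def using int[OF dD[of k]] by (subst nn_integral_eq_integral) auto
    also have "\<dots> \<le> ennreal ((1/2) ^ k)"
      using step[of k] unfolding eta_def d_def[abs_def] by (intro ennreal_leI) (simp add: field_simps)
    finally show "(\<integral>\<^sup>+x. ennreal ((2 powr r) ^ k * \<bar>d k x\<bar> powr r) \<partial>M) \<le> ennreal ((1/2) ^ k)" .
  qed auto
  also have "\<dots> = ennreal 2"
    using power_half_series sums_mult[OF power_half_series, of 2]
    by (intro suminf_ennreal_eq) auto
  finally have Hint: "(\<integral>\<^sup>+x. H x \<partial>M) < \<infinity>" by (simp add: order.strict_trans1)
  then have HAE: "AE x in M. H x < \<infinity>" using nn_integral_PInf_AE[of H M] by (auto simp: top.not_eq_extremum)
  define h where "h x = enn2real (H x)" for x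
  have hm [measurable]: "h \<in> borel_measurable M" unfolding h_def[abs_def] by measurable
  have hint: "integrable M h"
  proof (rule integrableI_nonneg)
    have "(\<integral>\<^sup>+x. ennreal (h x) \<partial>M) = (\<integral>\<^sup>+x. H x \<partial>M)"
      using HAE by (intro nn_integral_cong_AE) (auto simp: h_def ennreal_enn2real_if)
    then show "(\<integral>\<^sup>+x. ennreal (h x) \<partial>M) < \<infinity>" using Hint by simp
  qed (auto simp: h_def)
  have dle: "\<bar>d k x\<bar> \<le> (1/2) ^ k * h x powr (1/r)" if "H x < \<infinity>" for k x
  proof -
    have "ennreal ((2 powr r) ^ k * \<bar>d k x\<bar> powr r) \<le> H x"
    proof -
      define e where "e k = ennreal ((2 powr r) ^ k * \<bar>d k x\<bar> powr r)" for k
      have "sum e {k} \<le> suminf e" by (rule sum_le_suminf) auto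
      then have "e k \<le> suminf e" by simp
      then show ?thesis unfolding H_def e_def .
    qed
    then have "(2 powr r) ^ k * \<bar>d k x\<bar> powr r \<le> h x"
    proof -
      have "H x = ennreal (h x)" using that by (simp add: h_def)
      moreover have "0 \<le> h x" by (simp add: h_def)
      ultimately show ?thesis using \<open>ennreal _ \<le> H x\<close> by simp
    qed
    moreover have "(2 powr r) ^ k * \<bar>d k x\<bar> powr r = (2 ^ k * \<bar>d k x\<bar>) powr r"
    proof -
      have "(2 powr r) ^ k = (2 ^ k) powr r" by (induction k) (auto simp: powr_mult)
      then show ?thesis by (simp add: powr_mult)
    qed
    ultimately have "((2 ^ k * \<bar>d k x\<bar>) powr r) powr (1/r) \<le> h x powr (1/r)"
      using r by (intro powr_mono2) auto
    then have "2 ^ k * \<bar>d k x\<bar> \<le> h x powr (1/r)" using r by (simp add: powr_powr)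
    then show ?thesis by (simp add: field_simps power_one_over)
  qed
  have ffs: "f k x = f 0 x + (\<Sum>j<k. d j x)" for k x
    by (induction k) (auto simp: d_def)
  have fconv: "convergent (\<lambda>k. f k x)" and fbd: "\<bar>f k x\<bar> \<le> \<bar>f 0 x\<bar> + 2 * h x powr (1/r)"
    if x: "H x < \<infinity>" for k x
  proof -
    have s: "summable (\<lambda>k. (1/2) ^ k * h x powr (1/r))"
      by (intro summable_mult2 summable_geometric) simp
    have "summable (\<lambda>k. d k x)" by (rule summable_comparison_test'[OF s]) (use dle[OF x] in auto)
    then have "convergent (\<lambda>k. \<Sum>j<k. d j x)" by (simp add: summable_iff_convergent)
    then have "convergent (\<lambda>k. f 0 x + (\<Sum>j<k. d j x))" by (intro convergent_add convergent_const)
    then show "convergent (\<lambda>k. f k x)" by (simp add: ffs[symmetric])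
    have "\<bar>\<Sum>j<k. d j x\<bar> \<le> (\<Sum>j<k. (1/2) ^ j * h x powr (1/r))"
      using dle[OF x] by (intro order_trans[OF sum_abs] sum_mono) auto
    also have "\<dots> \<le> (\<Sum>j. (1/2) ^ j * h x powr (1/r))" by (intro sum_le_suminf s) auto
    also have "\<dots> = 2 * h x powr (1/r)" by (subst suminf_mult2[symmetric]) (auto simp: suminf_geometric)
    finally show "\<bar>f k x\<bar> \<le> \<bar>f 0 x\<bar> + 2 * h x powr (1/r)" unfolding ffs[of k] by linarith
  qed
  define F where "F x = lim (\<lambda>k. f k x)" for x
  have Fm [measurable]: "F \<in> borel_measurable M" unfolding F_def[abs_def] by measurable
  have Flim: "(\<lambda>k. f k x) \<longlonglongrightarrow> F x" if "H x < \<infinity>" for x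
    unfolding F_def using fconv[OF that] by (simp add: convergent_LIMSEQ_iff)
  define Q where "Q x = 2 powr r * (\<bar>f 0 x\<bar> powr r + 2 powr r * h x)" for x
  have Qm [measurable]: "Q \<in> borel_measurable M" unfolding Q_def[abs_def] by measurable
  have Qint: "integrable M Q" unfolding Q_def using int[OF fD[of 0]] hint by simp
  have fQ: "\<bar>f k x\<bar> powr r \<le> Q x" if "H x < \<infinity>" for k x
  proof -
    have "\<bar>f k x\<bar> powr r \<le> \<bar>\<bar>f 0 x\<bar> + 2 * h x powr (1/r)\<bar> powr r" using fbd[OF that, of k] r by (intro powr_mono2) auto
    also have "\<dots> \<le> 2 powr r * (\<bar>\<bar>f 0 x\<bar>\<bar> powr r + \<bar>2 * h x powr (1/r)\<bar> powr r)" by (rule abs_powr_add_le[OF r])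
    also have "\<bar>2 * h x powr (1/r)\<bar> powr r = 2 powr r * h x" using r by (simp add: powr_mult powr_powr h_def abs_mult)
    finally show ?thesis unfolding Q_def by simp
  qed
  have FQ: "\<bar>F x\<bar> powr r \<le> Q x" if "H x < \<infinity>" for x
  proof (rule LIMSEQ_le_const2)
    show "(\<lambda>k. \<bar>f k x\<bar> powr r) \<longlonglongrightarrow> \<bar>F x\<bar> powr r"
      using Flim[OF that] r by (intro tendsto_intros tendsto_powr') auto
  qed (use fQ[OF that] in auto)
  have Fint: "integrable M (\<lambda>x. \<bar>F x\<bar> powr r)"
    by (rule Bochner_Integration.integrable_bound[OF Qint])
       (use FQ HAE in \<open>auto elim!: eventually_mono intro: order_trans[OF _ abs_ge_self]\<close>)
  have pint: "integrable M (\<lambda>x. dpow r (F x) * \<phi> x)" if "\<phi> \<in> D" for \<phi>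
  proof (rule Bochner_Integration.integrable_bound)
    show "integrable M (\<lambda>x. r * (\<bar>\<phi> x\<bar> powr r + \<bar>F x\<bar> powr r))" using Fint int[OF that] by simp
    show "AE x in M. norm (dpow r (F x) * \<phi> x) \<le> norm (r * (\<bar>\<phi> x\<bar> powr r + \<bar>F x\<bar> powr r))"
      using abs_dpow_mult_le[OF r] r by (auto simp: abs_mult intro!: order_trans[OF _ abs_ge_self])
  qed (use r meas[OF that] in measurable)
  \<comment> \<open>The limit F may lie outside D, so the variation is carried out along the
    minimising sequence. The defect of \<open>f k\<close> is below \<open>t k * t k\<close>; after
    division by \<open>t k\<close> an error \<open>t k\<close> remains, which vanishes in the
    limit.\<close>
  have Lle2: "L \<phi> \<le> (\<integral>x. dpow r (F x) * \<phi> x \<partial>M)" if \<phi>: "\<phi> \<in> D" for \<phi>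
  proof -
    note [measurable] = meas[OF \<phi>]
    define t where "t k = 1 / sqrt (real k + 1)" for k
    have t: "0 < t k" "t k \<le> 1" for k unfolding t_def by (auto simp: field_simps)
    have tt: "1 / (real k + 1) = t k * t k" for k unfolding t_def by (simp add: real_sqrt_mult_self)
    have tlim: "t \<longlonglongrightarrow> 0" unfolding t_def by real_asymp
    define g where "g k x = f k x + t k * \<phi> x" for k x
    have gD: "g k \<in> D" for k unfolding g_def using sub[OF fD \<phi>, of 1 k "t k"] by simp
    note [measurable] = meas[OF gD]
    have Lg: "L (g k) = L (f k) + t k * L \<phi>" for k unfolding g_def using lin[OF fD \<phi>, of 1 k "t k"] by simp
    have gint: "integrable M (\<lambda>x. dpow r (g k x) * \<phi> x)" for k
    proof (rule Bochner_Integration.integrable_bound)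
      show "integrable M (\<lambda>x. r * (\<bar>\<phi> x\<bar> powr r + \<bar>g k x\<bar> powr r))" using int[OF gD] int[OF \<phi>] by simp
      show "AE x in M. norm (dpow r (g k x) * \<phi> x) \<le> norm (r * (\<bar>\<phi> x\<bar> powr r + \<bar>g k x\<bar> powr r))"
        using abs_dpow_mult_le[OF r] r by (auto simp: abs_mult intro!: order_trans[OF _ abs_ge_self])
    qed (use r in measurable)
    have le: "L \<phi> \<le> (\<integral>x. dpow r (g k x) * \<phi> x \<partial>M) + t k" for k
    proof -
      have "m \<le> J (g k)" by (rule mle[OF gD])
      moreover have "J (f k) < m + t k * t k" using fJ[of k] \<rho>2[of k] tt[of k] by linarith
      ultimately have a: "t k * L \<phi> \<le> I (g k) - I (f k) + t k * t k" unfolding J_def Lg by linarith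
      have "I (g k) - I (f k) = (\<integral>x. \<bar>g k x\<bar> powr r - \<bar>f k x\<bar> powr r \<partial>M)"
        unfolding I_def using int[OF gD] int[OF fD] by simp
      also have "\<dots> \<le> (\<integral>x. t k * (dpow r (g k x) * \<phi> x) \<partial>M)"
      proof (intro integral_mono)
        fix x
        show "\<bar>g k x\<bar> powr r - \<bar>f k x\<bar> powr r \<le> t k * (dpow r (g k x) * \<phi> x)"
          using abs_powr_above_tangent[OF r, of "g k x" "f k x"] by (simp add: g_def algebra_simps)
      qed (use gint int[OF gD] int[OF fD] in auto)
      also have "\<dots> = t k * (\<integral>x. dpow r (g k x) * \<phi> x \<partial>M)" by simp
      finally have "t k * L \<phi> \<le> t k * ((\<integral>x. dpow r (g k x) * \<phi> x \<partial>M) + t k)" using a by (simp add: algebra_simps)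
      then show ?thesis using t[of k] by simp
    qed
    have lim: "(\<lambda>k. \<integral>x. dpow r (g k x) * \<phi> x \<partial>M) \<longlonglongrightarrow> (\<integral>x. dpow r (F x) * \<phi> x \<partial>M)"
    proof (rule integral_dominated_convergence[where w = "\<lambda>x. r * (\<bar>\<phi> x\<bar> powr r + 2 powr r * (Q x + \<bar>\<phi> x\<bar> powr r))"])
      show "integrable M (\<lambda>x. r * (\<bar>\<phi> x\<bar> powr r + 2 powr r * (Q x + \<bar>\<phi> x\<bar> powr r)))" using Qint int[OF \<phi>] by simp
      show "AE x in M. (\<lambda>k. dpow r (g k x) * \<phi> x) \<longlonglongrightarrow> dpow r (F x) * \<phi> x"
        using HAE
      proof eventually_elim
        case (elim x)
        have "(\<lambda>k. g k x) \<longlonglongrightarrow> F x + 0 * \<phi> x"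
          unfolding g_def by (intro tendsto_intros Flim tlim) (use elim in auto)
        then have "(\<lambda>k. g k x) \<longlonglongrightarrow> F x" by simp
        then show ?case by (intro tendsto_mult tendsto_const isCont_tendsto_compose[OF isCont_dpow[OF r]])
      qed
      show "AE x in M. norm (dpow r (g k x) * \<phi> x) \<le> r * (\<bar>\<phi> x\<bar> powr r + 2 powr r * (Q x + \<bar>\<phi> x\<bar> powr r))" for k
        using HAE
      proof eventually_elim
        case (elim x)
        have "\<bar>t k * \<phi> x\<bar> powr r \<le> \<bar>\<phi> x\<bar> powr r"
          using t[of k] r by (intro powr_mono2) (auto simp: abs_mult mult_left_le_one_le)
        then have "\<bar>g k x\<bar> powr r \<le> 2 powr r * (Q x + \<bar>\<phi> x\<bar> powr r)"
          unfolding g_def using fQ[of x k] elim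
          by (intro order_trans[OF abs_powr_add_le[OF r]] mult_left_mono add_mono) auto
        then show ?case using r
          by (simp only: real_norm_def) (rule order_trans[OF abs_dpow_mult_le[OF r]], auto intro!: mult_left_mono add_left_mono)
      qed
    qed (use r in measurable)
    have "(\<lambda>k. (\<integral>x. dpow r (g k x) * \<phi> x \<partial>M) + t k) \<longlonglongrightarrow> (\<integral>x. dpow r (F x) * \<phi> x \<partial>M) + 0"
      by (intro tendsto_add lim tlim)
    then show ?thesis using LIMSEQ_le_const[of _ _ "L \<phi>"] le by auto
  qed
  show thesis
  proof (rule that)
    show "(\<lambda>x. dpow r (F x)) \<in> borel_measurable M" using r by measurable
    have "\<bar>dpow r a\<bar> powr (r / (r - 1)) = r powr (r / (r - 1)) * \<bar>a\<bar> powr r" for a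
      using r by (simp add: abs_dpow powr_mult powr_powr)
    then show "integrable M (\<lambda>x. \<bar>dpow r (F x)\<bar> powr (r / (r - 1)))" using Fint by simp
    fix \<phi> assume \<phi>: "\<phi> \<in> D"
    show "integrable M (\<lambda>x. dpow r (F x) * \<phi> x)" by (rule pint[OF \<phi>])
    have "(\<lambda>x. - \<phi> x) \<in> D" "L (\<lambda>x. - \<phi> x) = - L \<phi>" using sub[OF \<phi> \<phi>, of "-1" 0] lin[OF \<phi> \<phi>, of "-1" 0] by simp_all
    then show "L \<phi> = (\<integral>x. dpow r (F x) * \<phi> x \<partial>M)" using Lle2[OF \<phi>] Lle2[of "\<lambda>x. - \<phi> x"] by simp
  qed
qed

section \<open>Test functions and averages of translates\<close>

text \<open>A working class for integrals over the whole space: unlike test functions it is stable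
  under absolute values, powers and the Bellman function, and still every member is bounded,
  integrable and uniformly continuous.\<close>

definition cc_fun :: "(real^'n::finite \<Rightarrow> real) \<Rightarrow> bool" where
  "cc_fun f \<longleftrightarrow> continuous_on UNIV f \<and> (\<exists>R. \<forall>x. R < norm x \<longrightarrow> f x = 0)"

lemma cc_fun_measurable [measurable_dest]: "cc_fun f \<Longrightarrow> f \<in> borel_measurable borel"
  by (simp add: cc_fun_def borel_measurable_continuous_onI)

lemma cc_fun_bounded:
  assumes "cc_fun f"
  obtains B where "0 \<le> B" "\<And>x. \<bar>f x\<bar> \<le> B"
proof -
  obtain R where R: "\<And>x. R < norm x \<Longrightarrow> f x = 0" using assms by (auto simp: cc_fun_def)
  have "compact (f ` cball 0 R)"
    using assms by (intro compact_continuous_image) (auto simp: cc_fun_def intro: continuous_on_subset)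
  then obtain B where "\<forall>y \<in> f ` cball 0 R. norm y \<le> B"
    using compact_imp_bounded[of "f ` cball 0 R"] unfolding bounded_iff by blast
  then have B: "\<And>x. norm x \<le> R \<Longrightarrow> \<bar>f x\<bar> \<le> B" by auto
  show thesis
  proof (rule that[of "\<bar>B\<bar>"])
    show "\<bar>f x\<bar> \<le> \<bar>B\<bar>" for x using B[of x] R[of x] by (cases "norm x \<le> R") auto
  qed simp
qed

lemma cc_fun_integrable:
  assumes "cc_fun f" shows "integrable lborel f"
proof -
  obtain R where R: "\<And>x. R < norm x \<Longrightarrow> f x = 0" using assms by (auto simp: cc_fun_def)
  have "integrable lborel (\<lambda>x. indicator (cball 0 R) x *\<^sub>R f x)"
    using assms by (intro borel_integrable_compact) (auto simp: cc_fun_def intro: continuous_on_subset)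
  also have "(\<lambda>x. indicator (cball 0 R) x *\<^sub>R f x) = f"
  proof (rule ext)
    show "indicator (cball 0 R) x *\<^sub>R f x = f x" for x using R[of x] by (cases "norm x \<le> R") auto
  qed
  finally show ?thesis .
qed

lemma cc_fun_uniformly_continuous:
  assumes "cc_fun f" "0 < e"
  obtains d where "0 < d" "\<And>x y. dist x y < d \<Longrightarrow> \<bar>f x - f y\<bar> < e"
proof -
  obtain R where R: "\<And>x. R < norm x \<Longrightarrow> f x = 0" using assms by (auto simp: cc_fun_def)
  have "uniformly_continuous_on (cball 0 (R + 1)) f"
    using assms by (intro compact_uniformly_continuous) (auto simp: cc_fun_def intro: continuous_on_subset)
  then obtain d where d: "d > 0" "\<And>x y. x \<in> cball 0 (R+1) \<Longrightarrow> y \<in> cball 0 (R+1) \<Longrightarrow> dist x y < d \<Longrightarrow> \<bar>f x - f y\<bar> < e"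
    using assms(2) unfolding uniformly_continuous_on_def by (metis dist_commute dist_real_def)
  show thesis
  proof (rule that[of "min d 1"])
    fix x y :: "real^'a" assume xy: "dist x y < min d 1"
    show "\<bar>f x - f y\<bar> < e"
    proof (cases "norm x \<le> R + 1 \<and> norm y \<le> R + 1")
      case True then show ?thesis using d(2)[of x y] xy by simp
    next
      case False
      have "\<bar>norm x - norm y\<bar> < 1" using xy norm_triangle_ineq3[of x y] by (simp add: dist_norm)
      then have "R < norm x" "R < norm y" using False by linarith+
      then show ?thesis using R assms(2) by simp
    qed
  qed (use d in simp)
qed

lemma cc_fun_comp2:
  assumes f: "cc_fun f" and g: "cc_fun g" and F: "F 0 0 = (0::real)"
    and cont: "continuous_on UNIV (\<lambda>x. F (f x) (g x))"
  shows "cc_fun (\<lambda>x. F (f x) (g x))"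
proof -
  obtain R S where "\<And>x. R < norm x \<Longrightarrow> f x = 0" "\<And>x. S < norm x \<Longrightarrow> g x = 0" using f g by (auto simp: cc_fun_def)
  then show ?thesis unfolding cc_fun_def using cont F by (auto intro!: exI[of _ "max R S"])
qed

lemma cc_fun_comp:
  "cc_fun f \<Longrightarrow> F 0 = (0::real) \<Longrightarrow> continuous_on UNIV (\<lambda>x. F (f x)) \<Longrightarrow> cc_fun (\<lambda>x. F (f x))"
  using cc_fun_comp2[of f f "\<lambda>a b. F a"] by simp

lemma cc_fun_mult_left:
  assumes f: "cc_fun f" and g: "continuous_on UNIV g"
  shows "cc_fun (\<lambda>x. g x * f x)"
  using assms by (auto simp: cc_fun_def intro!: continuous_intros)

lemma cc_fun_cont: "cc_fun f \<Longrightarrow> continuous_on S f"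
  by (auto simp: cc_fun_def intro: continuous_on_subset)

lemma cc_fun_0 [simp]: "cc_fun (\<lambda>x. 0)" by (simp add: cc_fun_def)
lemma cc_fun_add: "cc_fun f \<Longrightarrow> cc_fun g \<Longrightarrow> cc_fun (\<lambda>x. f x + g x)"
  by (rule cc_fun_comp2[where F = "\<lambda>a b. a + b"]) (use cc_fun_cont[of f UNIV] cc_fun_cont[of g UNIV] in \<open>auto intro!: continuous_intros\<close>)
lemma cc_fun_diff: "cc_fun f \<Longrightarrow> cc_fun g \<Longrightarrow> cc_fun (\<lambda>x. f x - g x)"
  by (rule cc_fun_comp2[where F = "\<lambda>a b. a - b"]) (use cc_fun_cont[of f UNIV] cc_fun_cont[of g UNIV] in \<open>auto intro!: continuous_intros\<close>)
lemma cc_fun_mult: "cc_fun f \<Longrightarrow> cc_fun g \<Longrightarrow> cc_fun (\<lambda>x. f x * g x)"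
  by (rule cc_fun_comp2[where F = "\<lambda>a b. a * b"]) (use cc_fun_cont[of f UNIV] cc_fun_cont[of g UNIV] in \<open>auto intro!: continuous_intros\<close>)
lemma cc_fun_cmult: "cc_fun f \<Longrightarrow> cc_fun (\<lambda>x. c * f x)"
  by (rule cc_fun_mult_left) auto
lemma cc_fun_abs: "cc_fun f \<Longrightarrow> cc_fun (\<lambda>x. \<bar>f x\<bar>)"
  by (rule cc_fun_comp[where F = "\<lambda>a. \<bar>a\<bar>"]) (use cc_fun_cont[of f UNIV] in \<open>auto intro!: continuous_intros\<close>)
lemma cc_fun_powr: "cc_fun f \<Longrightarrow> 0 < r \<Longrightarrow> cc_fun (\<lambda>x. \<bar>f x\<bar> powr r)"
  by (rule cc_fun_comp[where F = "\<lambda>a. \<bar>a\<bar> powr r"]) (use cc_fun_cont[of f UNIV] in \<open>auto intro!: continuous_abs_powr\<close>)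
lemma cc_fun_sum: "(\<And>i. i \<in> I \<Longrightarrow> cc_fun (f i)) \<Longrightarrow> cc_fun (\<lambda>x. \<Sum>i\<in>I. f i x)"
  by (induction I rule: infinite_finite_induct) (auto intro!: cc_fun_add)

lemma cc_fun_translate:
  assumes "cc_fun f" shows "cc_fun (\<lambda>x. f (x + a))"
proof -
  obtain R where R: "\<And>x. R < norm x \<Longrightarrow> f x = 0" using assms by (auto simp: cc_fun_def)
  have "f (x + a) = 0" if "R + norm a < norm x" for x
    using R[of "x + a"] that norm_diff_ineq[of x a] by linarith
  moreover have "continuous_on UNIV (\<lambda>x. f (x + a))"
    by (rule continuous_on_compose2[OF cc_fun_cont[OF assms, of UNIV]]) (auto intro!: continuous_intros)
  ultimately show ?thesis unfolding cc_fun_def by blast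
qed

lemma integral_translate:
  fixes f :: "real^'n::finite \<Rightarrow> real"
  assumes [measurable]: "f \<in> borel_measurable borel"
  shows "(\<integral>x. f (x + a) \<partial>lborel) = (\<integral>x. f x \<partial>lborel)"
proof -
  have "(\<integral>x. f x \<partial>lborel) = (\<integral>x. f x \<partial>distr lborel borel ((+) a))" by (simp add: lborel_distr_plus)
  also have "\<dots> = (\<integral>x. f (a + x) \<partial>lborel)" by (rule integral_distr) auto
  finally show ?thesis by (simp add: add.commute)
qed

lemma nn_integral_translate:
  fixes f :: "real^'n::finite \<Rightarrow> ennreal"
  assumes [measurable]: "f \<in> borel_measurable borel"
  shows "(\<integral>\<^sup>+x. f (x + a) \<partial>lborel) = (\<integral>\<^sup>+x. f x \<partial>lborel)"
proof -
  have "(\<integral>\<^sup>+x. f x \<partial>lborel) = (\<integral>\<^sup>+x. f x \<partial>distr lborel borel ((+) a))" by (simp add: lborel_distr_plus)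
  also have "\<dots> = (\<integral>\<^sup>+x. f (a + x) \<partial>lborel)" by (rule nn_integral_distr) auto
  finally show ?thesis by (simp add: add.commute)
qed

section \<open>Test functions and bumps\<close>

lemma test_fun_smooth: "test_fun S f \<Longrightarrow> smooth f" by (simp add: test_fun_def)

lemma test_fun_differentiable: "test_fun S f \<Longrightarrow> f differentiable (at x)"
  by (simp add: test_fun_def smooth_differentiable)

lemma test_fun_mono: "test_fun S f \<Longrightarrow> S \<subseteq> T \<Longrightarrow> test_fun T f"
  unfolding test_fun_def by blast

lemma test_fun_cc: "test_fun S f \<Longrightarrow> cc_fun f"
proof -
  assume f: "test_fun S f"
  then obtain K where K: "compact K" "\<And>x. x \<notin> K \<Longrightarrow> f x = 0" by (auto simp: test_fun_def)
  obtain R where "\<And>x. x \<in> K \<Longrightarrow> norm x \<le> R" using compact_imp_bounded[OF K(1)] by (auto simp: bounded_iff)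
  then have "\<forall>x. R < norm x \<longrightarrow> f x = 0" using K(2) by (meson not_le)
  then show ?thesis using smooth_continuous test_fun_smooth f unfolding cc_fun_def by blast
qed

lemma test_fun_outside: "test_fun S f \<Longrightarrow> x \<notin> S \<Longrightarrow> f x = 0" by (auto simp: test_fun_def)

lemma pd_eq_0:
  assumes "open U" "x \<in> U" "\<And>y. y \<in> U \<Longrightarrow> f y = 0"
  shows "pd j f x = 0"
proof -
  have "(f has_derivative (\<lambda>h. 0)) (at x)"
    by (rule has_derivative_transform_within_open[of "\<lambda>_. 0" _ _ UNIV U]) (use assms in auto)
  from pd_eqI[OF this] show ?thesis .
qed

lemma test_fun_pd: "test_fun S f \<Longrightarrow> test_fun S (pd j f)"
proof -
  assume f: "test_fun S f"
  then obtain K where K: "compact K" "K \<subseteq> S" "\<And>x. x \<notin> K \<Longrightarrow> f x = 0" by (auto simp: test_fun_def)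
  have "pd j f x = 0" if "x \<notin> K" for x
    using K that by (intro pd_eq_0[of "- K"]) (auto simp: compact_imp_closed open_Compl)
  then show ?thesis using f K smooth_pd unfolding test_fun_def by blast
qed

lemma test_fun_lincomb:
  assumes f: "test_fun S f" and g: "test_fun S g"
  shows "test_fun S (\<lambda>x. a * f x + b * g x)"
proof -
  obtain K1 K2 where "compact K1" "K1 \<subseteq> S" "\<And>x. x \<notin> K1 \<Longrightarrow> f x = 0" "compact K2" "K2 \<subseteq> S" "\<And>x. x \<notin> K2 \<Longrightarrow> g x = 0"
    using f g by (auto simp: test_fun_def)
  then have "\<exists>K. compact K \<and> K \<subseteq> S \<and> (\<forall>x. x \<notin> K \<longrightarrow> a * f x + b * g x = 0)"
    by (intro exI[of _ "K1 \<union> K2"]) auto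
  then show ?thesis using f g unfolding test_fun_def by (auto intro!: smooth_add smooth_cmult)
qed

lemma test_fun_add: "test_fun S f \<Longrightarrow> test_fun S g \<Longrightarrow> test_fun S (\<lambda>x. f x + g x)"
  using test_fun_lincomb[of S f g 1 1] by simp
lemma test_fun_0 [simp]: "test_fun S (\<lambda>x. 0)"
  by (auto simp: test_fun_def intro!: exI[of _ "{}"])
lemma test_fun_cmult: "test_fun S f \<Longrightarrow> test_fun S (\<lambda>x. c * f x)"
  using test_fun_lincomb[of S f f c 0] by simp
lemma test_fun_sum: "(\<And>i. i \<in> I \<Longrightarrow> test_fun S (f i)) \<Longrightarrow> test_fun S (\<lambda>x. \<Sum>i\<in>I. f i x)"
  by (induction I rule: infinite_finite_induct) (auto intro!: test_fun_add)

lemma test_fun_mult_left: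
  assumes "smooth g" "test_fun S f" shows "test_fun S (\<lambda>x. g x * f x)"
  using assms unfolding test_fun_def by (auto intro!: smooth_mult)

definition bump :: "nat \<Rightarrow> real^'n::finite \<Rightarrow> real \<Rightarrow> real^'n \<Rightarrow> real" where
  "bump m c \<rho> x = flat_exp m (\<rho>\<^sup>2 - (norm (x - c))\<^sup>2)"

lemma norm_sq_vec: "(norm (x::real^'n::finite))\<^sup>2 = (\<Sum>i\<in>UNIV. x $ i * x $ i)"
  by (simp add: power2_norm_eq_inner inner_vec_def)

lemma smooth_norm_sq: "smooth (\<lambda>x::real^'n::finite. (norm (x - c))\<^sup>2)"
  unfolding norm_sq_vec by (intro smooth_sum smooth_mult) (auto intro!: smooth_diff smooth_coord)

lemma smooth_bump: "smooth (bump m c \<rho>)"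
  unfolding bump_def[abs_def] by (intro smooth_flat_exp smooth_diff smooth_const smooth_norm_sq)

lemma bump_nonneg: "0 \<le> bump m c \<rho> x" by (simp add: bump_def flat_exp_nonneg)

lemma bump_pos_iff: "0 < \<rho> \<Longrightarrow> 0 < bump m c \<rho> x \<longleftrightarrow> x \<in> ball c \<rho>"
proof -
  assume "0 < \<rho>"
  then have "(norm (x - c))\<^sup>2 < \<rho>\<^sup>2 \<longleftrightarrow> norm (x - c) < \<rho>"
    using power2_less_imp_less[of "norm (x - c)" \<rho>] power_strict_mono[of "norm (x - c)" \<rho> 2] by auto
  then show ?thesis by (simp add: bump_def flat_exp_pos_iff dist_norm norm_minus_commute)
qed

lemma bump_eq_0: "0 < \<rho> \<Longrightarrow> x \<notin> ball c \<rho> \<Longrightarrow> bump m c \<rho> x = 0"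
  using bump_pos_iff[of \<rho> m c x] bump_nonneg[of m c \<rho> x] by linarith

lemma test_fun_bump: "0 < \<rho> \<Longrightarrow> cball c \<rho> \<subseteq> S \<Longrightarrow> test_fun S (bump m c \<rho>)"
  unfolding test_fun_def by (intro conjI smooth_bump exI[of _ "cball c \<rho>"]) (auto intro!: bump_eq_0)

lemma smooth_line_deriv:
  assumes "smooth f"
  shows "((\<lambda>t. f (x + t *\<^sub>R h)) has_real_derivative (\<Sum>j\<in>UNIV. h $ j * pd j f (x + t *\<^sub>R h))) (at t)"
proof -
  have 1: "((\<lambda>t. x + t *\<^sub>R h) has_derivative (\<lambda>s. s *\<^sub>R h)) (at t)"
    by (auto intro!: derivative_eq_intros)
  have 2: "((\<lambda>t. f (x + t *\<^sub>R h)) has_derivative (\<lambda>s. \<Sum>j\<in>UNIV. (s *\<^sub>R h) $ j * pd j f (x + t *\<^sub>R h))) (at t)"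
    by (rule has_derivative_compose[OF 1 has_derivative_pd[OF smooth_differentiable[OF assms]]])
  have "(\<lambda>s. \<Sum>j\<in>UNIV. (s *\<^sub>R h) $ j * pd j f (x + t *\<^sub>R h)) = (*) (\<Sum>j\<in>UNIV. h $ j * pd j f (x + t *\<^sub>R h))"
    by (rule ext) (simp add: sum_distrib_left sum_distrib_right mult.assoc mult.commute)
  then show ?thesis unfolding has_field_derivative_def using 2 by simp
qed

text \<open>Uniform continuity of the partial derivatives makes the remainder uniform in x, which is
  what lets a derivative pass under an average over arbitrary shifts.\<close>

lemma test_fun_uniform_C1:
  assumes f: "test_fun S f" and e: "0 < e"
  obtains d where "0 < d" "\<And>x h. norm h < d \<Longrightarrow> \<bar>f (x + h) - f x - (\<Sum>j\<in>UNIV. h $ j * pd j f x)\<bar> \<le> e * norm h"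
proof -
  define e' where "e' = e / real CARD('a)"
  have e': "e' > 0" using e by (simp add: e'_def)
  have "\<exists>d>0. \<forall>x y. dist x y < d \<longrightarrow> \<bar>pd j f x - pd j f y\<bar> < e'" for j
    using cc_fun_uniformly_continuous[OF test_fun_cc[OF test_fun_pd[OF f]] e', of j] by metis
  then obtain \<delta> where \<delta>: "\<And>j. \<delta> j > 0" "\<And>j x y. dist x y < \<delta> j \<Longrightarrow> \<bar>pd j f x - pd j f y\<bar> < e'" by metis
  define d where "d = Min (range \<delta>)"
  have d: "d > 0" "\<And>j. d \<le> \<delta> j" unfolding d_def using \<delta>(1) by auto
  show thesis
  proof (rule that[OF d(1)])
    fix x h :: "real^'a" assume h: "norm h < d"
    obtain z where z: "0 < z" "z < 1" "f (x + 1 *\<^sub>R h) - f (x + 0 *\<^sub>R h) = (1 - 0) * (\<Sum>j\<in>UNIV. h $ j * pd j f (x + z *\<^sub>R h))"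
      using MVT2[of 0 1 "\<lambda>t. f (x + t *\<^sub>R h)" "\<lambda>t. \<Sum>j\<in>UNIV. h $ j * pd j f (x + t *\<^sub>R h)"]
        smooth_line_deriv[OF test_fun_smooth[OF f]] by auto
    have "f (x + h) - f x - (\<Sum>j\<in>UNIV. h $ j * pd j f x) = (\<Sum>j\<in>UNIV. h $ j * (pd j f (x + z *\<^sub>R h) - pd j f x))"
      using z(3) by (simp add: sum_subtractf right_diff_distrib)
    also have "\<bar>\<dots>\<bar> \<le> (\<Sum>j\<in>(UNIV::'a set). norm h * e')"
    proof (intro order_trans[OF sum_abs] sum_mono)
      fix j
      have "dist (x + z *\<^sub>R h) x \<le> norm h" using z by (simp add: dist_norm mult_left_le_one_le)
      then have "\<bar>pd j f (x + z *\<^sub>R h) - pd j f x\<bar> \<le> e'" using \<delta>(2)[of "x + z *\<^sub>R h" x j] d(2)[of j] h by simp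
      then show "\<bar>h $ j * (pd j f (x + z *\<^sub>R h) - pd j f x)\<bar> \<le> norm h * e'"
        unfolding abs_mult using component_le_norm_cart[of h j] by (intro mult_mono) auto
    qed
    also have "\<dots> = e * norm h" by (simp add: e'_def)
    finally show "\<bar>f (x + h) - f x - (\<Sum>j\<in>UNIV. h $ j * pd j f x)\<bar> \<le> e * norm h" .
  qed
qed

text \<open>A weighted average of translates over an arbitrary measure space. Line integrals,
  convolution with a mollifier, the solution of the Poisson equation and the transport field are all
  instances, so smoothness, supports and \<open>L\<^sup>r\<close> bounds are proved once.\<close>

definition avg :: "'s measure \<Rightarrow> ('s \<Rightarrow> real) \<Rightarrow> ('s \<Rightarrow> real^'n::finite) \<Rightarrow> (real^'n \<Rightarrow> real) \<Rightarrow> real^'n \<Rightarrow> real" where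
  "avg M c \<phi> f x = (\<integral>s. c s * f (x + \<phi> s) \<partial>M)"

lemma avg_integrable:
  assumes c: "integrable M c" and [measurable]: "\<phi> \<in> borel_measurable M" and f: "cc_fun f"
  shows "integrable M (\<lambda>s. c s * f (x + \<phi> s))"
proof -
  obtain B where B: "0 \<le> B" "\<And>x. \<bar>f x\<bar> \<le> B" using cc_fun_bounded[OF f] by blast
  note [measurable] = cc_fun_measurable[OF f] borel_measurable_integrable[OF c]
  show ?thesis
  proof (rule Bochner_Integration.integrable_bound)
    show "integrable M (\<lambda>s. B * c s)" using c by simp
    show "AE s in M. norm (c s * f (x + \<phi> s)) \<le> norm (B * c s)"
      using B by (auto simp: abs_mult mult.commute[of B] intro!: mult_left_mono)
  qed measurable
qed

lemma avg_has_derivative: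
  assumes c: "integrable M c" and \<phi>: "\<phi> \<in> borel_measurable M" and f: "test_fun S f"
  shows "(avg M c \<phi> f has_derivative (\<lambda>h. \<Sum>j\<in>UNIV. h $ j * avg M c \<phi> (pd j f) x)) (at x)"
  unfolding has_derivative_at_alt
proof (intro conjI allI impI)
  show "bounded_linear (\<lambda>h. \<Sum>j\<in>UNIV. h $ j * avg M c \<phi> (pd j f) x)"
    by (intro linear_conv_bounded_linear[THEN iffD1] linearI)
       (auto simp: algebra_simps sum.distrib sum_distrib_left)
next
  fix e :: real assume e: "0 < e"
  define A where "A = (\<integral>s. \<bar>c s\<bar> \<partial>M)"
  have A: "0 \<le> A" by (simp add: A_def)
  define e' where "e' = e / (A + 1)"
  have e': "e' > 0" using e A by (simp add: e'_def)
  obtain d where d: "0 < d" "\<And>x h. norm h < d \<Longrightarrow> \<bar>f (x + h) - f x - (\<Sum>j\<in>UNIV. h $ j * pd j f x)\<bar> \<le> e' * norm h"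
    using test_fun_uniform_C1[OF f e'] by blast
  note If = avg_integrable[OF c \<phi> test_fun_cc[OF f]]
  note Ij = avg_integrable[OF c \<phi> test_fun_cc[OF test_fun_pd[OF f]]]
  have "norm (avg M c \<phi> f y - avg M c \<phi> f x - (\<Sum>j\<in>UNIV. (y - x) $ j * avg M c \<phi> (pd j f) x)) \<le> e * norm (y - x)"
    if y: "norm (y - x) < d" for y
  proof -
    define h where "h = y - x"
    have "avg M c \<phi> f y - avg M c \<phi> f x - (\<Sum>j\<in>UNIV. h $ j * avg M c \<phi> (pd j f) x)
       = (\<integral>s. c s * f (y + \<phi> s) - c s * f (x + \<phi> s) - (\<Sum>j\<in>UNIV. h $ j * (c s * pd j f (x + \<phi> s))) \<partial>M)"
      unfolding avg_def using If Ij by (simp add: Bochner_Integration.integral_sum)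
    also have "\<bar>\<dots>\<bar> \<le> (\<integral>s. \<bar>c s * f (y + \<phi> s) - c s * f (x + \<phi> s) - (\<Sum>j\<in>UNIV. h $ j * (c s * pd j f (x + \<phi> s)))\<bar> \<partial>M)"
      by (rule integral_abs_bound)
    also have "\<dots> \<le> (\<integral>s. (e' * norm h) * \<bar>c s\<bar> \<partial>M)"
    proof (rule integral_mono)
      show "integrable M (\<lambda>s. \<bar>c s * f (y + \<phi> s) - c s * f (x + \<phi> s) - (\<Sum>j\<in>UNIV. h $ j * (c s * pd j f (x + \<phi> s)))\<bar>)"
        using If Ij by (intro integrable_abs Bochner_Integration.integrable_diff Bochner_Integration.integrable_sum) auto
      show "integrable M (\<lambda>s. (e' * norm h) * \<bar>c s\<bar>)" using c by simp
      fix s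
      have "c s * f (y + \<phi> s) - c s * f (x + \<phi> s) - (\<Sum>j\<in>UNIV. h $ j * (c s * pd j f (x + \<phi> s)))
        = c s * (f ((x + \<phi> s) + h) - f (x + \<phi> s) - (\<Sum>j\<in>UNIV. h $ j * pd j f (x + \<phi> s)))"
        by (simp add: h_def algebra_simps sum_distrib_left)
      then show "\<bar>c s * f (y + \<phi> s) - c s * f (x + \<phi> s) - (\<Sum>j\<in>UNIV. h $ j * (c s * pd j f (x + \<phi> s)))\<bar> \<le> (e' * norm h) * \<bar>c s\<bar>"
        using d(2)[of h "x + \<phi> s"] y by (simp add: abs_mult h_def mult.commute mult_left_mono)
    qed
    also have "\<dots> = e' * A * norm h" unfolding A_def by simp
    also have "\<dots> \<le> e * norm h"
      using A e by (intro mult_right_mono) (auto simp: e'_def field_simps)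
    finally show ?thesis by (simp add: h_def)
  qed
  then show "\<exists>d>0. \<forall>y. norm (y - x) < d \<longrightarrow>
      norm (avg M c \<phi> f y - avg M c \<phi> f x - (\<Sum>j\<in>UNIV. (y - x) $ j * avg M c \<phi> (pd j f) x)) \<le> e * norm (y - x)"
    using d(1) by blast
qed

lemma sum_axis_mult: "(\<Sum>i\<in>UNIV. (axis j 1 :: real^'n::finite) $ i * a i) = a j"
  by (simp add: axis_def if_distrib [of "\<lambda>a. a * _"] cong: if_cong)

lemma pd_avg:
  assumes "integrable M c" "\<phi> \<in> borel_measurable M" "test_fun S f"
  shows "pd j (avg M c \<phi> f) = avg M c \<phi> (pd j f)"
  using pd_eqI[OF avg_has_derivative[OF assms], of j] by (auto simp: sum_axis_mult)

lemma smooth_avg: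
  assumes c: "integrable M c" "\<phi> \<in> borel_measurable M" and f: "test_fun S f"
  shows "smooth (avg M c \<phi> f)"
proof -
  have "Ck k (avg M c \<phi> f)" for k
    using f
  proof (induction k arbitrary: f)
    case (Suc k)
    have "avg M c \<phi> f differentiable (at x)" for x
      using avg_has_derivative[OF c Suc.prems] by (auto simp: differentiable_def)
    then show ?case using pd_avg[OF c Suc.prems] Suc.IH[OF test_fun_pd[OF Suc.prems]] by simp
  qed simp
  then show ?thesis by (simp add: smooth_iff_Ck)
qed

lemma test_fun_avg:
  assumes c: "integrable M c" "\<phi> \<in> borel_measurable M" and f: "test_fun S f"
    and K: "compact K" "K \<subseteq> S'" and supp: "\<And>x s. x \<notin> K \<Longrightarrow> s \<in> space M \<Longrightarrow> c s \<noteq> 0 \<Longrightarrow> f (x + \<phi> s) = 0"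
  shows "test_fun S' (avg M c \<phi> f)"
proof -
  have "avg M c \<phi> f x = 0" if "x \<notin> K" for x
  proof -
    have "avg M c \<phi> f x = (\<integral>s. 0 \<partial>M)" unfolding avg_def
      by (rule Bochner_Integration.integral_cong[OF refl]) (use supp[OF that] in auto)
    then show ?thesis by simp
  qed
  then show ?thesis unfolding test_fun_def using smooth_avg[OF c f] K by blast
qed

text \<open>Integrate the tangent inequality at the weighted mean m = N / A of
  \<open>\<bar>g\<bar>\<close>, where its linear term integrates to zero. Weights of either sign are
  allowed, since only \<open>\<bar>c\<bar>\<close> enters.\<close>

lemma jensen_powr:
  fixes c g :: "'s \<Rightarrow> real"
  assumes r: "1 < r" and c: "integrable M c" and cg: "integrable M (\<lambda>s. c s * g s)"
    and cgr: "integrable M (\<lambda>s. \<bar>c s\<bar> * \<bar>g s\<bar> powr r)"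
  shows "\<bar>\<integral>s. c s * g s \<partial>M\<bar> powr r \<le> (\<integral>s. \<bar>c s\<bar> \<partial>M) powr (r - 1) * (\<integral>s. \<bar>c s\<bar> * \<bar>g s\<bar> powr r \<partial>M)"
proof -
  define A where "A = (\<integral>s. \<bar>c s\<bar> \<partial>M)"
  define N where "N = (\<integral>s. \<bar>c s\<bar> * \<bar>g s\<bar> \<partial>M)"
  have A0: "0 \<le> A" and N0: "0 \<le> N" by (simp_all add: A_def N_def)
  have icg: "integrable M (\<lambda>s. \<bar>c s\<bar> * \<bar>g s\<bar>)" using integrable_abs[OF cg] by (simp add: abs_mult)
  have le: "\<bar>\<integral>s. c s * g s \<partial>M\<bar> \<le> N" unfolding N_def using integral_abs_bound[of M "\<lambda>s. c s * g s"] by (simp add: abs_mult)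
  show ?thesis
  proof (cases "A = 0")
    case True
    then have "AE s in M. \<bar>c s\<bar> = 0" unfolding A_def using c by (subst (asm) integral_nonneg_eq_0_iff_AE) auto
    then have "N = 0" unfolding N_def by (intro integral_eq_zero_AE) auto
    then show ?thesis using le by simp
  next
    case False
    then have A: "A > 0" using A0 by simp
    define m where "m = N / A"
    have m: "0 \<le> m" using A N0 by (simp add: m_def)
    have "(\<integral>s. m powr r * \<bar>c s\<bar> + r * m powr (r - 1) * (\<bar>c s\<bar> * \<bar>g s\<bar> - m * \<bar>c s\<bar>) \<partial>M) \<le> (\<integral>s. \<bar>c s\<bar> * \<bar>g s\<bar> powr r \<partial>M)"
    proof (rule integral_mono)
      fix s
      have "\<bar>c s\<bar> * (m powr r + r * m powr (r - 1) * (\<bar>g s\<bar> - m)) \<le> \<bar>c s\<bar> * \<bar>g s\<bar> powr r"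
        using powr_above_tangent[OF r _ m, of "\<bar>g s\<bar>"] by (intro mult_left_mono) auto
      then show "m powr r * \<bar>c s\<bar> + r * m powr (r - 1) * (\<bar>c s\<bar> * \<bar>g s\<bar> - m * \<bar>c s\<bar>) \<le> \<bar>c s\<bar> * \<bar>g s\<bar> powr r"
        by (simp add: algebra_simps)
    qed (use c icg cgr in auto)
    also have "(\<integral>s. m powr r * \<bar>c s\<bar> + r * m powr (r - 1) * (\<bar>c s\<bar> * \<bar>g s\<bar> - m * \<bar>c s\<bar>) \<partial>M)
        = m powr r * A + r * m powr (r - 1) * (N - m * A)"
      unfolding A_def N_def using c icg by simp
    also have "N - m * A = 0" using A by (simp add: m_def)
    finally have 1: "m powr r * A \<le> (\<integral>s. \<bar>c s\<bar> * \<bar>g s\<bar> powr r \<partial>M)" by simp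
    have "\<bar>\<integral>s. c s * g s \<partial>M\<bar> powr r \<le> N powr r" using le r by (intro powr_mono2) auto
    also have "N = A * m" using A by (simp add: m_def)
    also have "(A * m) powr r = A powr (r - 1) * (m powr r * A)"
      using A m by (simp add: powr_mult powr_diff)
    also have "\<dots> \<le> A powr (r - 1) * (\<integral>s. \<bar>c s\<bar> * \<bar>g s\<bar> powr r \<partial>M)" using 1 by (intro mult_left_mono) auto
    finally show ?thesis unfolding A_def .
  qed
qed

text \<open>Young's convolution inequality for general averages: Jensen's inequality in s costs the
  factor \<open>A powr (r - 1)\<close>, and Tonelli with translation invariance costs the remaining
  factor A.\<close>

lemma avg_Lr:
  assumes r: "1 < r" and M: "sigma_finite_measure M" and c: "integrable M c" and \<phi>: "\<phi> \<in> borel_measurable M"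
    and f: "cc_fun f" and af: "cc_fun (avg M c \<phi> f)"
  shows "(\<integral>x. \<bar>avg M c \<phi> f x\<bar> powr r \<partial>lborel) \<le> (\<integral>s. \<bar>c s\<bar> \<partial>M) powr r * (\<integral>x. \<bar>f x\<bar> powr r \<partial>lborel)"
proof -
  interpret sigma_finite_measure M by fact
  interpret P: pair_sigma_finite M "lborel :: (real^'b) measure" ..
  note [measurable] = cc_fun_measurable[OF f] borel_measurable_integrable[OF c] \<phi>
  define A where "A = (\<integral>s. \<bar>c s\<bar> \<partial>M)"
  have A0: "0 \<le> A" by (simp add: A_def)
  have fr: "cc_fun (\<lambda>x. \<bar>f x\<bar> powr r)" using f r by (intro cc_fun_powr) auto
  have cr: "integrable M (\<lambda>s. \<bar>c s\<bar> * \<bar>f (x + \<phi> s)\<bar> powr r)" for x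
    using avg_integrable[OF integrable_abs[OF c] \<phi> fr] .
  have pw: "\<bar>avg M c \<phi> f x\<bar> powr r \<le> A powr (r - 1) * (\<integral>s. \<bar>c s\<bar> * \<bar>f (x + \<phi> s)\<bar> powr r \<partial>M)" for x
    unfolding avg_def A_def by (rule jensen_powr[OF r c avg_integrable[OF c \<phi> f] cr])
  have "ennreal (\<integral>x. \<bar>avg M c \<phi> f x\<bar> powr r \<partial>lborel) = (\<integral>\<^sup>+x. ennreal (\<bar>avg M c \<phi> f x\<bar> powr r) \<partial>lborel)"
    using cc_fun_integrable[OF cc_fun_powr[OF af, of r]] r by (subst nn_integral_eq_integral) auto
  also have "\<dots> \<le> (\<integral>\<^sup>+x. ennreal (A powr (r - 1)) * (\<integral>\<^sup>+s. ennreal (\<bar>c s\<bar> * \<bar>f (x + \<phi> s)\<bar> powr r) \<partial>M) \<partial>lborel)"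
  proof (rule nn_integral_mono)
    fix x
    have "ennreal (\<bar>avg M c \<phi> f x\<bar> powr r) \<le> ennreal (A powr (r - 1) * (\<integral>s. \<bar>c s\<bar> * \<bar>f (x + \<phi> s)\<bar> powr r \<partial>M))"
      by (rule ennreal_leI[OF pw])
    also have "\<dots> = ennreal (A powr (r - 1)) * (\<integral>\<^sup>+s. ennreal (\<bar>c s\<bar> * \<bar>f (x + \<phi> s)\<bar> powr r) \<partial>M)"
      using cr[of x] by (subst nn_integral_eq_integral) (auto simp: ennreal_mult')
    finally show "ennreal (\<bar>avg M c \<phi> f x\<bar> powr r) \<le> \<dots>" .
  qed
  also have "\<dots> = ennreal (A powr (r - 1)) * (\<integral>\<^sup>+x. \<integral>\<^sup>+s. ennreal (\<bar>c s\<bar> * \<bar>f (x + \<phi> s)\<bar> powr r) \<partial>M \<partial>lborel)"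
    by (rule nn_integral_cmult) measurable
  also have "(\<integral>\<^sup>+x. \<integral>\<^sup>+s. ennreal (\<bar>c s\<bar> * \<bar>f (x + \<phi> s)\<bar> powr r) \<partial>M \<partial>lborel)
     = (\<integral>\<^sup>+s. \<integral>\<^sup>+x. ennreal (\<bar>c s\<bar> * \<bar>f (x + \<phi> s)\<bar> powr r) \<partial>lborel \<partial>M)"
    by (rule P.Fubini') measurable
  also have "\<dots> = (\<integral>\<^sup>+s. ennreal \<bar>c s\<bar> * ennreal (\<integral>x. \<bar>f x\<bar> powr r \<partial>lborel) \<partial>M)"
  proof (rule nn_integral_cong)
    fix s
    have "(\<integral>\<^sup>+x. ennreal (\<bar>c s\<bar> * \<bar>f (x + \<phi> s)\<bar> powr r) \<partial>lborel) = ennreal \<bar>c s\<bar> * (\<integral>\<^sup>+x. ennreal (\<bar>f (x + \<phi> s)\<bar> powr r) \<partial>lborel)"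
      by (subst nn_integral_cmult[symmetric]) (auto simp: ennreal_mult')
    also have "(\<integral>\<^sup>+x. ennreal (\<bar>f (x + \<phi> s)\<bar> powr r) \<partial>lborel) = (\<integral>\<^sup>+x. ennreal (\<bar>f x\<bar> powr r) \<partial>lborel)"
      by (rule nn_integral_translate) measurable
    also have "\<dots> = ennreal (\<integral>x. \<bar>f x\<bar> powr r \<partial>lborel)"
      using cc_fun_integrable[OF fr] by (intro nn_integral_eq_integral) auto
    finally show "(\<integral>\<^sup>+x. ennreal (\<bar>c s\<bar> * \<bar>f (x + \<phi> s)\<bar> powr r) \<partial>lborel) = ennreal \<bar>c s\<bar> * ennreal (\<integral>x. \<bar>f x\<bar> powr r \<partial>lborel)" .
  qed
  also have "\<dots> = ennreal A * ennreal (\<integral>x. \<bar>f x\<bar> powr r \<partial>lborel)"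
    unfolding A_def using c by (subst nn_integral_multc) (auto simp: nn_integral_eq_integral)
  also have "ennreal (A powr (r - 1)) * (ennreal A * ennreal (\<integral>x. \<bar>f x\<bar> powr r \<partial>lborel))
     = ennreal (A powr (r - 1) * A * (\<integral>x. \<bar>f x\<bar> powr r \<partial>lborel))"
    using A0 by (simp add: ennreal_mult' mult.assoc)
  also have "A powr (r - 1) * A = A powr r" using A0 powr_mult_base[of A "r - 1"] by (simp add: mult.commute)
  finally show ?thesis unfolding A_def by (subst (asm) ennreal_le_iff) auto
qed

text \<open>The average of f over translates by a large ball does not depend on x near 0, since f is
  supported well inside. Differentiating under the average gives the integral of the partial
  derivative, which is therefore 0.\<close>

lemma integral_pd_eq_0:
  assumes f: "test_fun S f"
  shows "(\<integral>x. pd j f x \<partial>lborel) = 0"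
proof -
  obtain R where R: "\<And>x. R < norm x \<Longrightarrow> f x = 0" "\<And>x. R < norm x \<Longrightarrow> pd j f x = 0"
  proof -
    obtain R1 where 1: "\<And>x. R1 < norm x \<Longrightarrow> f x = 0" using test_fun_cc[OF f] by (auto simp: cc_fun_def)
    obtain R2 where 2: "\<And>x. R2 < norm x \<Longrightarrow> pd j f x = 0" using test_fun_cc[OF test_fun_pd[OF f], of j] by (auto simp: cc_fun_def)
    show thesis using that[of "max R1 R2"] 1 2 by simp
  qed
  \<comment> \<open>The margin 1 beyond the support leaves room for every x in the unit
    ball.\<close>
  define c :: "real^'a \<Rightarrow> real" where "c = indicator (cball 0 (\<bar>R\<bar> + 1))"
  have c: "integrable lborel c" unfolding c_def
    by (intro integrable_real_indicator) (use emeasure_bounded_finite[of "cball (0::real^'a) (\<bar>R\<bar> + 1)"] in auto)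
  have id: "(\<lambda>s. s) \<in> borel_measurable lborel" by simp
  have const: "avg lborel c (\<lambda>s. s) g x = (\<integral>x. g x \<partial>lborel)" if g: "\<And>x. R < norm x \<Longrightarrow> g x = 0" "cc_fun g" and x: "norm x < 1" for g x
  proof -
    have "c s * g (x + s) = g (s + x)" for s
    proof (cases "norm s \<le> \<bar>R\<bar> + 1")
      case False
      have "norm s - norm x \<le> norm (x + s)" using norm_diff_ineq[of s x] by (simp add: add.commute)
      then have "R < norm (x + s)" using x False by linarith
      then show ?thesis using g by (simp add: add.commute)
    qed (simp add: c_def add.commute)
    then have "avg lborel c (\<lambda>s. s) g x = (\<integral>s. g (s + x) \<partial>lborel)" unfolding avg_def by simp
    also have "\<dots> = (\<integral>x. g x \<partial>lborel)" by (rule integral_translate) (rule cc_fun_measurable[OF g(2)])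
    finally show ?thesis .
  qed
  have "((\<lambda>x. \<integral>x. f x \<partial>lborel) has_derivative (\<lambda>h. \<Sum>j\<in>UNIV. h $ j * avg lborel c (\<lambda>s. s) (pd j f) 0)) (at 0)"
    by (rule has_derivative_transform_within_open[OF avg_has_derivative[OF c id f], of "ball 0 1"])
       (use const[OF R(1) test_fun_cc[OF f]] in auto)
  from has_derivative_unique[OF this has_derivative_const] have "(\<Sum>i\<in>UNIV. (axis j 1 :: real^'a) $ i * avg lborel c (\<lambda>s. s) (pd i f) 0) = 0"
    by metis
  then have "avg lborel c (\<lambda>s. s) (pd j f) 0 = 0" by (simp add: sum_axis_mult)
  then show ?thesis using const[OF R(2) test_fun_cc[OF test_fun_pd[OF f]], of 0] by simp
qed

lemma integral_by_parts:
  assumes f: "smooth f" and g: "test_fun S g"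
  shows "(\<integral>x. f x * pd j g x \<partial>lborel) = - (\<integral>x. pd j f x * g x \<partial>lborel)"
proof -
  have fg: "test_fun S (\<lambda>x. f x * g x)" by (rule test_fun_mult_left[OF f g])
  have "pd j (\<lambda>x. f x * g x) = (\<lambda>x. pd j f x * g x + f x * pd j g x)"
    using pd_mult[OF smooth_differentiable[OF f] test_fun_differentiable[OF g]] by blast
  then have "0 = (\<integral>x. pd j f x * g x + f x * pd j g x \<partial>lborel)" using integral_pd_eq_0[OF fg, of j] by simp
  also have "\<dots> = (\<integral>x. pd j f x * g x \<partial>lborel) + (\<integral>x. f x * pd j g x \<partial>lborel)"
    using f g smooth_pd[OF f] test_fun_pd[OF g]
    by (intro Bochner_Integration.integral_add cc_fun_integrable test_fun_cc[OF test_fun_mult_left]) auto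
  finally show ?thesis by simp
qed

section \<open>The second-order estimate\<close>

lemma convex_abs_powr:
  assumes "1 < r" shows "convex_on UNIV (\<lambda>x::real. \<bar>x\<bar> powr r)"
proof (rule convex_onI)
  fix t x y :: real assume t: "0 < t" "t < 1"
  define z where "z = (1 - t) * x + t * y"
  have "(1 - t) * (\<bar>z\<bar> powr r + dpow r z * (x - z)) + t * (\<bar>z\<bar> powr r + dpow r z * (y - z)) \<le> (1 - t) * \<bar>x\<bar> powr r + t * \<bar>y\<bar> powr r"
    using t by (intro add_mono mult_left_mono abs_powr_above_tangent[OF assms]) auto
  moreover have "(1 - t) * (a + b * (x - z)) + t * (a + b * (y - z)) = a" for a b
    by (simp add: z_def algebra_simps)
  ultimately show "\<bar>(1 - t) *\<^sub>R x + t *\<^sub>R y\<bar> powr r \<le> (1 - t) * \<bar>x\<bar> powr r + t * \<bar>y\<bar> powr r"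
    by (simp add: z_def)
qed simp

section \<open>Symmetric random walks and their difference operators\<close>

locale walk =
  fixes v :: "'i::finite \<Rightarrow> real^'n::finite"
begin

definition N :: real where "N = real CARD('i)"
text \<open>The transition operator of the walk with the \<open>2 * N\<close> equally likely
  increments \<open>v i\<close> and \<open>- v i\<close>. It is self-adjoint, preserves integrals
  and commutes with the antisymmetric differences \<open>dl i\<close>; nothing else about the walk
  enters.\<close>

definition P :: "(real^'n \<Rightarrow> real) \<Rightarrow> real^'n \<Rightarrow> real" where
  "P u x = (\<Sum>i\<in>UNIV. u (x + v i) + u (x - v i)) / (2 * N)"
definition dl :: "'i \<Rightarrow> (real^'n \<Rightarrow> real) \<Rightarrow> real^'n \<Rightarrow> real" where
  "dl i u x = u (x + v i) - u (x - v i)"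

lemma N: "0 < N" by (simp add: N_def)

lemma cc_translate_minus: "cc_fun u \<Longrightarrow> cc_fun (\<lambda>x. u (x - a))"
  using cc_fun_translate[of u "- a"] by simp

lemma P_cc: "cc_fun u \<Longrightarrow> cc_fun (P u)"
  unfolding P_def[abs_def] divide_inverse mult.commute[of _ "inverse (2 * N)"]
  by (intro cc_fun_cmult cc_fun_sum cc_fun_add cc_fun_translate cc_translate_minus)

lemma Pk_cc: "cc_fun u \<Longrightarrow> cc_fun ((P ^^ k) u)"
  by (induction k) (auto intro: P_cc)

lemma dl_cc: "cc_fun u \<Longrightarrow> cc_fun (dl i u)"
  unfolding dl_def[abs_def] by (intro cc_fun_diff cc_fun_translate cc_translate_minus)

lemma shift_adj:
  assumes u: "cc_fun u" and g: "cc_fun g"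
  shows "(\<integral>x. u (x + a) * g x \<partial>lborel) = (\<integral>x. u x * g (x - a) \<partial>lborel)"
proof -
  note [measurable] = cc_fun_measurable[OF u] cc_fun_measurable[OF g]
  have "(\<integral>x. (\<lambda>x. u x * g (x - a)) (x + a) \<partial>lborel) = (\<integral>x. u x * g (x - a) \<partial>lborel)"
    by (rule integral_translate) measurable
  then show ?thesis by simp
qed

lemma shift_adj':
  "cc_fun u \<Longrightarrow> cc_fun g \<Longrightarrow> (\<integral>x. u (x - a) * g x \<partial>lborel) = (\<integral>x. u x * g (x + a) \<partial>lborel)"
  using shift_adj[of u g "- a"] by simp

lemma int_mult: "cc_fun u \<Longrightarrow> cc_fun g \<Longrightarrow> integrable lborel (\<lambda>x. u x * g x)"
  by (intro cc_fun_integrable cc_fun_mult)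

lemma dl_adj:
  assumes u: "cc_fun u" and g: "cc_fun g"
  shows "(\<integral>x. dl i u x * g x \<partial>lborel) = - (\<integral>x. u x * dl i g x \<partial>lborel)"
proof -
  have "(\<integral>x. dl i u x * g x \<partial>lborel) = (\<integral>x. u (x + v i) * g x \<partial>lborel) - (\<integral>x. u (x - v i) * g x \<partial>lborel)"
    unfolding dl_def left_diff_distrib
    by (intro Bochner_Integration.integral_diff int_mult cc_fun_translate cc_translate_minus u g)
  also have "\<dots> = (\<integral>x. u x * g (x - v i) \<partial>lborel) - (\<integral>x. u x * g (x + v i) \<partial>lborel)"
    by (simp add: shift_adj[OF u g] shift_adj'[OF u g])
  also have "\<dots> = - ((\<integral>x. u x * g (x + v i) \<partial>lborel) - (\<integral>x. u x * g (x - v i) \<partial>lborel))" by simp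
  also have "(\<integral>x. u x * g (x + v i) \<partial>lborel) - (\<integral>x. u x * g (x - v i) \<partial>lborel) = (\<integral>x. u x * dl i g x \<partial>lborel)"
    unfolding dl_def right_diff_distrib
    by (intro Bochner_Integration.integral_diff[symmetric] int_mult cc_fun_translate cc_translate_minus u g)
  finally show ?thesis .
qed

lemma P_expand:
  assumes u: "cc_fun u" and g: "cc_fun g"
  shows "(\<integral>x. P u x * g x \<partial>lborel) = (\<Sum>i\<in>UNIV. (\<integral>x. u (x + v i) * g x \<partial>lborel) + (\<integral>x. u (x - v i) * g x \<partial>lborel)) / (2 * N)"
proof -
  have *: "integrable lborel (\<lambda>x. u (x + v i) * g x)" "integrable lborel (\<lambda>x. u (x - v i) * g x)" for i
    by (intro int_mult cc_fun_translate cc_translate_minus u g)+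
  have "(\<lambda>x. P u x * g x) = (\<lambda>x. (\<Sum>i\<in>UNIV. u (x + v i) * g x + u (x - v i) * g x) / (2 * N))"
    by (auto simp: P_def sum_distrib_right distrib_right)
  then show ?thesis using * by (simp add: Bochner_Integration.integral_sum)
qed

lemma P_adj:
  assumes u: "cc_fun u" and g: "cc_fun g"
  shows "(\<integral>x. P u x * g x \<partial>lborel) = (\<integral>x. u x * P g x \<partial>lborel)"
proof -
  have "(\<integral>x. u x * P g x \<partial>lborel) = (\<integral>x. P g x * u x \<partial>lborel)" by (simp add: mult.commute)
  also have "\<dots> = (\<integral>x. P u x * g x \<partial>lborel)"
    unfolding P_expand[OF u g] P_expand[OF g u] shift_adj[OF u g] shift_adj'[OF u g]
    by (simp add: mult.commute add.commute)
  finally show ?thesis by simp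
qed

lemma Pk_adj:
  "cc_fun u \<Longrightarrow> cc_fun g \<Longrightarrow> (\<integral>x. (P ^^ k) u x * g x \<partial>lborel) = (\<integral>x. u x * (P ^^ k) g x \<partial>lborel)"
proof (induction k arbitrary: u)
  case (Suc k)
  have "(\<integral>x. (P ^^ Suc k) u x * g x \<partial>lborel) = (\<integral>x. (P ^^ k) (P u) x * g x \<partial>lborel)"
    by (simp add: funpow_swap1)
  also have "\<dots> = (\<integral>x. P u x * (P ^^ k) g x \<partial>lborel)" using Suc P_cc by blast
  also have "\<dots> = (\<integral>x. u x * P ((P ^^ k) g) x \<partial>lborel)" using Suc Pk_cc P_adj by blast
  finally show ?case by simp
qed simp

lemma P_diff: "P (\<lambda>x. a x - b x) = (\<lambda>x. P a x - P b x)"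
  by (rule ext) (simp add: P_def sum_subtractf[symmetric] diff_divide_distrib[symmetric] algebra_simps)

lemma dl_P: "dl i (P u) = P (dl i u)"
  by (rule ext) (simp add: dl_def P_def diff_divide_distrib[symmetric] sum_subtractf[symmetric] algebra_simps)

lemma dl_Pk: "dl i ((P ^^ k) u) = (P ^^ k) (dl i u)"
  by (induction k) (simp_all add: dl_P)

lemma integral_P:
  assumes u: "cc_fun u"
  shows "(\<integral>x. P u x \<partial>lborel) = (\<integral>x. u x \<partial>lborel)"
proof -
  note [measurable] = cc_fun_measurable[OF u]
  have *: "integrable lborel (\<lambda>x. u (x + v i))" "integrable lborel (\<lambda>x. u (x - v i))" for i
    by (intro cc_fun_integrable cc_fun_translate cc_translate_minus u)+
  have t: "(\<integral>x. u (x + v i) \<partial>lborel) = (\<integral>x. u x \<partial>lborel)" "(\<integral>x. u (x - v i) \<partial>lborel) = (\<integral>x. u x \<partial>lborel)" for i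
    using integral_translate[of u "v i"] integral_translate[of u "- v i"] by simp_all
  have "(\<integral>x. P u x \<partial>lborel) = (\<Sum>i\<in>UNIV. (\<integral>x. u (x + v i) \<partial>lborel) + (\<integral>x. u (x - v i) \<partial>lborel)) / (2 * N)"
    unfolding P_def using * by (simp add: Bochner_Integration.integral_sum)
  then show ?thesis using N by (simp add: t N_def)
qed

lemma P_jensen:
  assumes "convex_on UNIV F"
  shows "F (P u x) \<le> P (\<lambda>x. F (u x)) x"
proof -
  have "F (\<Sum>i\<in>(UNIV::'i set). (1 / N) *\<^sub>R ((u (x + v i) + u (x - v i)) / 2)) \<le> (\<Sum>i\<in>(UNIV::'i set). 1 / N * F ((u (x + v i) + u (x - v i)) / 2))"
    using N by (intro convex_on_sum[OF _ _ assms]) (auto simp: N_def)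
  also have "\<dots> \<le> (\<Sum>i\<in>(UNIV::'i set). 1 / N * ((F (u (x + v i)) + F (u (x - v i))) / 2))"
    using convex_onD[OF assms, of "1/2"] N by (intro sum_mono mult_left_mono) (auto simp: add_divide_distrib)
  also have "\<dots> = P (\<lambda>x. F (u x)) x" by (simp add: P_def sum_divide_distrib mult.commute)
  also have "(\<Sum>i\<in>(UNIV::'i set). (1 / N) *\<^sub>R ((u (x + v i) + u (x - v i)) / 2)) = P u x" by (simp add: P_def sum_divide_distrib mult.commute)
  finally show ?thesis .
qed

end

section \<open>Dissipation of the Bellman function along the walk\<close>

locale walk_bellman = walk v + burkholder p for v :: "'i::finite \<Rightarrow> real^'n::finite" and p
begin

lemma Bell_cc: "cc_fun u \<Longrightarrow> cc_fun g \<Longrightarrow> cc_fun (\<lambda>x. Bell (u x) (g x))"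
  by (rule cc_fun_comp2) (auto simp: Bell_zero intro: continuous_Bell cc_fun_cont)

text \<open>Plain convexity handles the average over directions. Within a pair
  \<open>x + v j\<close>, \<open>x - v j\<close>, strong convexity with weights 1/2 gains half the
  product of differences, and averaging over N directions leaves 1/(2 N) of it. Only the gain of the
  direction i is kept.\<close>

lemma Bell_step_pointwise:
  "Bell (P u x) (P g x) + \<bar>dl i u x\<bar> * \<bar>dl i g x\<bar> / (2 * N) \<le> P (\<lambda>x. Bell (u x) (g x)) x"
proof -
  define a b where "a j = (u (x + v j) + u (x - v j)) / 2" and "b j = (g (x + v j) + g (x - v j)) / 2" for j
  define E where "E j = \<bar>dl j u x\<bar> * \<bar>dl j g x\<bar>" for j
  have E0: "0 \<le> E j" for j by (simp add: E_def)
  have "(\<Sum>j\<in>UNIV. (1 / N) *\<^sub>R (a j, b j)) = (P u x, P g x)"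
    by (simp add: prod_eq_iff fst_sum snd_sum a_def b_def P_def sum_divide_distrib mult.commute)
  then have "Bell (P u x) (P g x) = (\<lambda>z. Bell (fst z) (snd z)) (\<Sum>j\<in>UNIV. (1 / N) *\<^sub>R (a j, b j))" by simp
  also have "\<dots> \<le> (\<Sum>j\<in>(UNIV::'i set). 1 / N * Bell (fst (a j, b j)) (snd (a j, b j)))"
    using N by (intro convex_on_sum[OF _ _ convex_Bell]) (auto simp: N_def)
  also have "\<dots> \<le> (\<Sum>j\<in>(UNIV::'i set). 1 / N * ((Bell (u (x + v j)) (g (x + v j)) + Bell (u (x - v j)) (g (x - v j))) / 2 - E j / 2))"
  proof (intro sum_mono mult_left_mono)
    fix j
    have "1/2 * u (x + v j) + 1/2 * u (x - v j) = a j" "1/2 * g (x + v j) + 1/2 * g (x - v j) = b j"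
      by (simp_all add: a_def b_def)
    then show "Bell (fst (a j, b j)) (snd (a j, b j)) \<le> (Bell (u (x + v j)) (g (x + v j)) + Bell (u (x - v j)) (g (x - v j))) / 2 - E j / 2"
      using Bell_strong_convex[of "1/2" "1/2" "u (x + v j)" "u (x - v j)" "g (x + v j)" "g (x - v j)"]
      by (simp add: E_def dl_def add_divide_distrib)
  qed (use N in simp)
  also have "\<dots> = P (\<lambda>x. Bell (u x) (g x)) x - (\<Sum>j\<in>UNIV. E j) / (2 * N)"
    by (simp add: P_def sum_divide_distrib right_diff_distrib sum_subtractf mult.commute)
  also have "\<dots> \<le> P (\<lambda>x. Bell (u x) (g x)) x - E i / (2 * N)"
    using member_le_sum[of i UNIV E] E0 N by (simp add: divide_right_mono)
  finally show ?thesis by (simp add: E_def)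
qed

definition en :: "'i \<Rightarrow> (real^'n \<Rightarrow> real) \<Rightarrow> (real^'n \<Rightarrow> real) \<Rightarrow> real" where
  "en i u g = (\<integral>x. \<bar>dl i u x\<bar> * \<bar>dl i g x\<bar> \<partial>lborel)"

definition bl :: "(real^'n \<Rightarrow> real) \<Rightarrow> (real^'n \<Rightarrow> real) \<Rightarrow> real" where
  "bl u g = (\<integral>x. Bell (u x) (g x) \<partial>lborel)"

lemma bl_nonneg: "0 \<le> bl u g" by (simp add: bl_def Bell_nonneg)
lemma en_nonneg: "0 \<le> en i u g" by (simp add: en_def)

lemma Bell_step:
  assumes u: "cc_fun u" and g: "cc_fun g"
  shows "bl (P u) (P g) + en i u g / (2 * N) \<le> bl u g"
proof -
  have i1: "integrable lborel (\<lambda>x. Bell (P u x) (P g x))" by (intro cc_fun_integrable Bell_cc P_cc u g)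
  have i2: "integrable lborel (\<lambda>x. \<bar>dl i u x\<bar> * \<bar>dl i g x\<bar>)" by (intro int_mult cc_fun_abs dl_cc u g)
  have "bl (P u) (P g) + en i u g / (2 * N) = (\<integral>x. Bell (P u x) (P g x) + \<bar>dl i u x\<bar> * \<bar>dl i g x\<bar> / (2 * N) \<partial>lborel)"
    unfolding bl_def en_def using i1 i2 by simp
  also have "\<dots> \<le> (\<integral>x. P (\<lambda>x. Bell (u x) (g x)) x \<partial>lborel)"
    using i1 i2 by (intro integral_mono Bell_step_pointwise cc_fun_integrable[OF P_cc[OF Bell_cc]] u g) auto
  also have "\<dots> = bl u g" unfolding bl_def by (rule integral_P[OF Bell_cc[OF u g]])
  finally show ?thesis .
qed

text \<open>The Bellman integral is nonnegative and drops at every step by at least the dissipated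
  energy, so the total energy is bounded by its initial value, uniformly in the number of
  steps.\<close>

lemma energy_sum:
  assumes u: "cc_fun u" and g: "cc_fun g"
  shows "(\<Sum>j<mm. en i ((P ^^ j) u) ((P ^^ j) g)) \<le> 2 * N * bl u g"
proof -
  have "bl ((P ^^ mm) u) ((P ^^ mm) g) + (\<Sum>j<mm. en i ((P ^^ j) u) ((P ^^ j) g)) / (2 * N) \<le> bl u g"
  proof (induction mm)
    case (Suc mm)
    have "bl ((P ^^ Suc mm) u) ((P ^^ Suc mm) g) + en i ((P ^^ mm) u) ((P ^^ mm) g) / (2 * N) \<le> bl ((P ^^ mm) u) ((P ^^ mm) g)"
      using Bell_step[OF Pk_cc[OF u] Pk_cc[OF g], of mm mm i] by simp
    then show ?case using Suc by (simp add: add_divide_distrib)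
  qed simp
  then have "(\<Sum>j<mm. en i ((P ^^ j) u) ((P ^^ j) g)) / (2 * N) \<le> bl u g" using bl_nonneg[of "(P ^^ mm) u" "(P ^^ mm) g"] by linarith
  then show ?thesis using N by (simp add: field_simps)
qed

text \<open>Of the 2 j steps acting on u, self-adjointness moves j to the other factor, together
  with one of the two differences. Both factors have then evolved equally long, which is the form in
  which energy is dissipated.\<close>

lemma double_dl:
  assumes u: "cc_fun u" and g: "cc_fun g"
  shows "\<bar>\<integral>x. dl i (dl i ((P ^^ (2 * j)) u)) x * g x \<partial>lborel\<bar> \<le> en i ((P ^^ j) u) ((P ^^ j) g)"
proof -
  have e: "dl i ((P ^^ (2 * j)) u) = (P ^^ j) (dl i ((P ^^ j) u))"
    unfolding mult_2 funpow_add by (simp add: dl_Pk)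
  have 1: "(\<integral>x. dl i (dl i ((P ^^ (2 * j)) u)) x * g x \<partial>lborel) = - (\<integral>x. dl i ((P ^^ (2 * j)) u) x * dl i g x \<partial>lborel)"
    by (intro dl_adj dl_cc Pk_cc u g)
  have 2: "(\<integral>x. (P ^^ j) (dl i ((P ^^ j) u)) x * dl i g x \<partial>lborel) = (\<integral>x. dl i ((P ^^ j) u) x * dl i ((P ^^ j) g) x \<partial>lborel)"
    unfolding dl_Pk[of i j g] by (intro Pk_adj dl_cc Pk_cc u g)
  have "\<bar>- (\<integral>x. dl i ((P ^^ j) u) x * dl i ((P ^^ j) g) x \<partial>lborel)\<bar> \<le> en i ((P ^^ j) u) ((P ^^ j) g)"
    unfolding en_def
    using integral_abs_bound[of lborel "\<lambda>x. dl i ((P ^^ j) u) x * dl i ((P ^^ j) g) x"] by (simp add: abs_mult)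
  then show ?thesis unfolding 1 unfolding e 2 .
qed

text \<open>Increments are taken over two steps at a time so that only even powers of the walk
  occur, as \<open>double_dl\<close> requires.\<close>

lemma telescope: "w x - (P ^^ (2 * mm)) w x = (\<Sum>j<mm. (P ^^ (2 * j)) (\<lambda>x. w x - P (P w) x) x)"
proof (induction mm)
  case (Suc mm)
  have Pkd: "(P ^^ m) (\<lambda>x. a x - b x) = (\<lambda>x. (P ^^ m) a x - (P ^^ m) b x)" for a b m
    by (induction m) (simp_all add: P_diff)
  have "(P ^^ (2 * mm)) (P (P w)) = (P ^^ (2 * Suc mm)) w" by (simp add: funpow_swap1)
  then show ?case using Suc by (simp add: Pkd)
qed simp

text \<open>Expanding w into even powers of the walk applied to \<open>w - P (P w)\<close> bounds
  each term by the energy of one step, and \<open>energy_sum\<close> bounds all of them by a single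
  Bellman integral.\<close>

lemma bilinear_estimate:
  assumes w: "cc_fun w" and g: "cc_fun g"
  shows "\<bar>\<integral>x. dl i (dl i w) x * g x \<partial>lborel\<bar> \<le> 2 * N * bl (\<lambda>x. w x - P (P w) x) g"
proof -
  define f where "f x = w x - P (P w) x" for x
  have f: "cc_fun f" unfolding f_def by (intro cc_fun_diff P_cc w)
  define e where "e j = en i ((P ^^ j) w) ((P ^^ j) g)" for j
  have e0: "0 \<le> e j" for j by (simp add: e_def en_nonneg)
  have "\<bar>\<integral>x. dl i (dl i w) x * g x \<partial>lborel\<bar> \<le> e mm + 2 * N * bl f g" for mm
  proof -
    have fw: "w = (\<lambda>x. (P ^^ (2 * mm)) w x + (\<Sum>j<mm. (P ^^ (2 * j)) f x))"
    proof (rule ext)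
      fix x
      have "w x - (P ^^ (2 * mm)) w x = (\<Sum>j<mm. (P ^^ (2 * j)) f x)"
        using telescope[of w x mm] by (simp only: f_def[abs_def])
      then show "w x = (P ^^ (2 * mm)) w x + (\<Sum>j<mm. (P ^^ (2 * j)) f x)" by linarith
    qed
    have dls: "dl i (\<lambda>x. a x + (\<Sum>j<mm. b j x)) = (\<lambda>x. dl i a x + (\<Sum>j<mm. dl i (b j) x))" for a b
      by (rule ext) (simp add: dl_def sum_subtractf)
    have "dl i (dl i w) = (\<lambda>x. dl i (dl i ((P ^^ (2 * mm)) w)) x + (\<Sum>j<mm. dl i (dl i ((P ^^ (2 * j)) f)) x))"
      using arg_cong[OF fw, of "\<lambda>w. dl i (dl i w)"] by (simp only: dls)
    then have "(\<integral>x. dl i (dl i w) x * g x \<partial>lborel) = (\<integral>x. dl i (dl i ((P ^^ (2 * mm)) w)) x * g x + (\<Sum>j<mm. dl i (dl i ((P ^^ (2 * j)) f)) x * g x) \<partial>lborel)"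
      by (simp only: distrib_right sum_distrib_right)
    also have "\<dots> = (\<integral>x. dl i (dl i ((P ^^ (2 * mm)) w)) x * g x \<partial>lborel) + (\<Sum>j<mm. \<integral>x. dl i (dl i ((P ^^ (2 * j)) f)) x * g x \<partial>lborel)"
    proof -
      have sum_int: "(\<integral>x. a x + (\<Sum>j<mm. b j x) \<partial>lborel) = (\<integral>x. a x \<partial>lborel) + (\<Sum>j<mm. \<integral>x. b j x \<partial>lborel)"
        if "integrable lborel a" "\<And>j. integrable lborel (b j)" for a :: "real^'n \<Rightarrow> real" and b
        using that by (simp add: Bochner_Integration.integral_sum)
      show ?thesis by (intro sum_int int_mult dl_cc Pk_cc w f g)
    qed
    finally have eq: "(\<integral>x. dl i (dl i w) x * g x \<partial>lborel) = (\<integral>x. dl i (dl i ((P ^^ (2 * mm)) w)) x * g x \<partial>lborel) + (\<Sum>j<mm. \<integral>x. dl i (dl i ((P ^^ (2 * j)) f)) x * g x \<partial>lborel)" .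
    have "\<bar>\<integral>x. dl i (dl i w) x * g x \<partial>lborel\<bar> \<le> e mm + (\<Sum>j<mm. en i ((P ^^ j) f) ((P ^^ j) g))"
    proof -
      have "\<bar>\<Sum>j<mm. \<integral>x. dl i (dl i ((P ^^ (2 * j)) f)) x * g x \<partial>lborel\<bar> \<le> (\<Sum>j<mm. en i ((P ^^ j) f) ((P ^^ j) g))"
        by (rule order_trans[OF sum_abs]) (rule sum_mono, rule double_dl[OF f g])
      then show ?thesis unfolding e_def eq
        by (rule order_trans[OF abs_triangle_ineq add_mono[OF double_dl[OF w g]]])
    qed
    also have "\<dots> \<le> e mm + 2 * N * bl f g" by (rule add_left_mono[OF energy_sum[OF f g]])
    finally show ?thesis .
  qed
  \<comment> \<open>The remainder is bounded by the energy of the pair w, g at time mm. These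
    energies are themselves summable by \<open>energy_sum\<close>, hence tend to 0.\<close>
  moreover have "e \<longlonglongrightarrow> 0"
  proof (rule summable_LIMSEQ_zero)
    show "summable e"
    proof (rule bounded_imp_summable)
      show "(\<Sum>j\<le>m. e j) \<le> 2 * N * bl w g" for m
        unfolding e_def lessThan_Suc_atMost[symmetric] by (rule energy_sum[OF w g])
    qed (rule e0)
  qed
  then have "(\<lambda>mm. e mm + 2 * N * bl f g) \<longlonglongrightarrow> 0 + 2 * N * bl f g" by (intro tendsto_intros)
  ultimately show ?thesis unfolding f_def[abs_def, symmetric]
    using LIMSEQ_le_const[of "\<lambda>mm. e mm + 2 * N * bl f g" "0 + 2 * N * bl f g" "\<bar>\<integral>x. dl i (dl i w) x * g x \<partial>lborel\<bar>"] by auto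
qed

lemma bl_upper:
  assumes u: "cc_fun u" and g: "cc_fun g"
  shows "bl u g \<le> cB * ((\<integral>x. \<bar>u x\<bar> powr p \<partial>lborel) + (\<integral>x. \<bar>g x\<bar> powr (p / (p - 1)) \<partial>lborel))"
proof -
  have i: "integrable lborel (\<lambda>x. \<bar>u x\<bar> powr p)" "integrable lborel (\<lambda>x. \<bar>g x\<bar> powr (p / (p - 1)))"
    using p u g by (auto intro!: cc_fun_integrable cc_fun_powr)
  have "bl u g \<le> (\<integral>x. cB * (\<bar>u x\<bar> powr p + \<bar>g x\<bar> powr (p / (p - 1))) \<partial>lborel)"
    unfolding bl_def
  proof (rule integral_mono)
    show "integrable lborel (\<lambda>x. Bell (u x) (g x))" by (intro cc_fun_integrable Bell_cc u g)
  qed (use i Bell_upper in auto)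
  then show ?thesis using i by simp
qed

text \<open>The first factor is the scaling l of \<open>walk_estimate\<close> raised to p; the
  second is the price of replacing \<open>w - P (P w)\<close> by \<open>w - P w\<close>. Neither
  depends on the step vectors.\<close>

definition cW where "cW = (4 * N * cB) powr p * (2 powr p * 2)"

lemma cB_pos: "0 < cB"
  unfolding cB_def K_def using k by (intro add_nonneg_pos) auto

text \<open>A duality argument: the second difference D is paired with g, the derivative of its p-th
  power divided by p. The pairing is the integral X of \<open>\<bar>D\<bar> powr p\<close>, and the
  dual integral in \<open>bl_upper\<close> is X again. Multiplying w by a large l makes the latter
  absorbable.\<close>

lemma walk_estimate:
  assumes w: "cc_fun w"
  shows "(\<integral>x. \<bar>dl i (dl i w) x\<bar> powr p \<partial>lborel) \<le> cW * (\<integral>x. \<bar>w x - P w x\<bar> powr p \<partial>lborel)"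
proof -
  define D where "D = dl i (dl i w)"
  define f where "f x = w x - P (P w) x" for x
  define g where "g x = dpow p (D x) / p" for x
  have D: "cc_fun D" unfolding D_def by (intro dl_cc w)
  have f: "cc_fun f" unfolding f_def by (intro cc_fun_diff P_cc w)
  have g: "cc_fun g" unfolding g_def
    by (rule cc_fun_comp[OF D, where F = "\<lambda>t. dpow p t / p"])
       (use p continuous_on_divide[OF continuous_dpow[OF p cc_fun_cont[OF D]] continuous_on_const, of UNIV p] in
         \<open>auto simp: dpow_nonneg_arg\<close>)
  define X where "X = (\<integral>x. \<bar>D x\<bar> powr p \<partial>lborel)"
  define Y where "Y = (\<integral>x. \<bar>f x\<bar> powr p \<partial>lborel)"
  \<comment> \<open>Chosen so that \<open>2 * N * cB\<close> is half of l: the term in X on the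
    right then carries half the coefficient that it has on the left.\<close>
  define l where "l = 4 * N * cB"
  have l: "0 < l" using N cB_pos by (simp add: l_def)
  have gX: "(\<integral>x. \<bar>g x\<bar> powr (p / (p - 1)) \<partial>lborel) = X"
    unfolding X_def g_def using p by (simp add: abs_dpow powr_powr)
  have DX: "(\<integral>x. D x * g x \<partial>lborel) = X"
    unfolding X_def g_def using p dpow_mult_self[OF p] by (simp add: mult.commute)
  have "\<bar>\<integral>x. dl i (dl i (\<lambda>x. l * w x)) x * g x \<partial>lborel\<bar> \<le> 2 * N * bl (\<lambda>x. l * w x - P (P (\<lambda>x. l * w x)) x) g"
    by (intro bilinear_estimate cc_fun_cmult w g)
  also have "dl i (dl i (\<lambda>x. l * w x)) = (\<lambda>x. l * D x)"
    by (rule ext) (simp add: dl_def D_def algebra_simps)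
  also have "(\<lambda>x. l * w x - P (P (\<lambda>x. l * w x)) x) = (\<lambda>x. l * f x)"
  proof -
    have "P (\<lambda>x. l * u x) = (\<lambda>x. l * P u x)" for u
      by (rule ext) (simp add: P_def sum_distrib_left distrib_left)
    then show ?thesis by (simp add: f_def right_diff_distrib)
  qed
  also have "bl (\<lambda>x. l * f x) g \<le> cB * ((\<integral>x. \<bar>l * f x\<bar> powr p \<partial>lborel) + X)"
    unfolding gX[symmetric] by (intro bl_upper cc_fun_cmult f g)
  also have "(\<integral>x. \<bar>l * f x\<bar> powr p \<partial>lborel) = l powr p * Y"
    unfolding Y_def using l by (simp add: abs_mult powr_mult)
  finally have "\<bar>\<integral>x. l * (D x * g x) \<partial>lborel\<bar> \<le> 2 * N * (cB * (l powr p * Y + X))" using N by (simp add: mult.assoc)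
  then have "l * X \<le> l / 2 * (l powr p * Y + X)" using DX by (simp add: l_def abs_le_iff)
  then have "X \<le> (l powr p * Y + X) / 2" using l by (simp add: field_simps)
  then have 1: "X \<le> l powr p * Y" by simp
  define h where "h x = w x - P w x" for x
  have h: "cc_fun h" unfolding h_def by (intro cc_fun_diff P_cc w)
  have fh: "f x = h x + P h x" for x
  proof -
    have "P h = (\<lambda>x. P w x - P (P w) x)" unfolding h_def[abs_def] by (rule P_diff)
    then show ?thesis by (simp add: f_def h_def)
  qed
  have hp: "cc_fun (\<lambda>x. \<bar>h x\<bar> powr p)" using p h by (intro cc_fun_powr) auto
  have Php: "cc_fun (\<lambda>x. \<bar>P h x\<bar> powr p)" using p h by (intro cc_fun_powr P_cc) auto
  have "Y \<le> (\<integral>x. 2 powr p * (\<bar>h x\<bar> powr p + \<bar>P h x\<bar> powr p) \<partial>lborel)"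
    unfolding Y_def fh
    using cc_fun_integrable[OF hp] cc_fun_integrable[OF Php] cc_fun_integrable[OF cc_fun_powr[OF f, of p]] p fh
    by (intro integral_mono abs_powr_add_le[OF p]) auto
  also have "\<dots> = 2 powr p * ((\<integral>x. \<bar>h x\<bar> powr p \<partial>lborel) + (\<integral>x. \<bar>P h x\<bar> powr p \<partial>lborel))"
    using cc_fun_integrable[OF hp] cc_fun_integrable[OF Php] by simp
  also have "(\<integral>x. \<bar>P h x\<bar> powr p \<partial>lborel) \<le> (\<integral>x. P (\<lambda>x. \<bar>h x\<bar> powr p) x \<partial>lborel)"
    by (intro integral_mono cc_fun_integrable Php P_cc hp P_jensen[OF convex_abs_powr[OF p]])
  also have "\<dots> = (\<integral>x. \<bar>h x\<bar> powr p \<partial>lborel)" by (rule integral_P[OF hp])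
  finally have "Y \<le> 2 powr p * 2 * (\<integral>x. \<bar>h x\<bar> powr p \<partial>lborel)" by simp
  then have "l powr p * Y \<le> l powr p * (2 powr p * 2 * (\<integral>x. \<bar>h x\<bar> powr p \<partial>lborel))" by (intro mult_left_mono) auto
  then show ?thesis using 1 unfolding X_def D_def h_def cW_def l_def by (simp add: mult.assoc)
qed

end

text \<open>Two mean value theorems, one per direction. The intermediate point stays within 2 a of
  x, so the quotient converges even along moving base points.\<close>

lemma mixed_difference:
  fixes w :: "real^'n::finite \<Rightarrow> real"
  assumes w: "smooth w" and a: "0 < a"
  obtains y where "dist y x \<le> 2 * a"
    "w (x + a *\<^sub>R axis i 1 + a *\<^sub>R axis j 1) - w (x - a *\<^sub>R axis i 1 + a *\<^sub>R axis j 1)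
     - w (x + a *\<^sub>R axis i 1 - a *\<^sub>R axis j 1) + w (x - a *\<^sub>R axis i 1 - a *\<^sub>R axis j 1) = 4 * a\<^sup>2 * pd j (pd i w) y"
proof -
  let ?e = "axis i 1 :: real^'n" and ?d = "axis j 1 :: real^'n"
  have der: "((\<lambda>t. u (z + t *\<^sub>R axis k 1)) has_real_derivative pd k u (z + t *\<^sub>R axis k 1)) (at t)" if "smooth u" for u z k and t :: real
    using smooth_line_deriv[OF that, of z "axis k 1" t] by (simp add: sum_axis_mult)
  have "\<exists>s>- a. s < a \<and>
    (w (x + a *\<^sub>R ?d + a *\<^sub>R ?e) - w (x - a *\<^sub>R ?d + a *\<^sub>R ?e)) - (w (x + a *\<^sub>R ?d + (-a) *\<^sub>R ?e) - w (x - a *\<^sub>R ?d + (-a) *\<^sub>R ?e))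
      = (a - (- a)) * (pd i w (x + a *\<^sub>R ?d + s *\<^sub>R ?e) - pd i w (x - a *\<^sub>R ?d + s *\<^sub>R ?e))"
    by (rule MVT2) (use a in simp, intro DERIV_diff der[OF w])
  then obtain s where s: "- a < s" "s < a"
    "(w (x + a *\<^sub>R ?d + a *\<^sub>R ?e) - w (x - a *\<^sub>R ?d + a *\<^sub>R ?e)) - (w (x + a *\<^sub>R ?d + (-a) *\<^sub>R ?e) - w (x - a *\<^sub>R ?d + (-a) *\<^sub>R ?e))
      = (a - (- a)) * (pd i w (x + a *\<^sub>R ?d + s *\<^sub>R ?e) - pd i w (x - a *\<^sub>R ?d + s *\<^sub>R ?e))"
    by blast
  have "\<exists>t>- a. t < a \<and>
    pd i w ((x + s *\<^sub>R ?e) + a *\<^sub>R ?d) - pd i w ((x + s *\<^sub>R ?e) + (-a) *\<^sub>R ?d) = (a - (- a)) * pd j (pd i w) ((x + s *\<^sub>R ?e) + t *\<^sub>R ?d)"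
    by (rule MVT2) (use a in simp, intro der[OF smooth_pd[OF w]])
  then obtain t where t: "- a < t" "t < a"
    "pd i w ((x + s *\<^sub>R ?e) + a *\<^sub>R ?d) - pd i w ((x + s *\<^sub>R ?e) + (-a) *\<^sub>R ?d) = (a - (- a)) * pd j (pd i w) ((x + s *\<^sub>R ?e) + t *\<^sub>R ?d)"
    by blast
  show thesis
  proof (rule that[of "x + s *\<^sub>R ?e + t *\<^sub>R ?d"])
    have "norm (s *\<^sub>R ?e + t *\<^sub>R ?d) \<le> \<bar>s\<bar> + \<bar>t\<bar>"
      by (rule order_trans[OF norm_triangle_ineq]) (simp add: norm_axis_1)
    then show "dist (x + s *\<^sub>R ?e + t *\<^sub>R ?d) x \<le> 2 * a" using s t by (simp add: dist_norm add.assoc)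
    have "pd i w (x + a *\<^sub>R ?d + s *\<^sub>R ?e) - pd i w (x - a *\<^sub>R ?d + s *\<^sub>R ?e) = 2 * a * pd j (pd i w) (x + s *\<^sub>R ?e + t *\<^sub>R ?d)"
      using t(3) by (simp add: algebra_simps)
    then show "w (x + a *\<^sub>R ?e + a *\<^sub>R ?d) - w (x - a *\<^sub>R ?e + a *\<^sub>R ?d)
     - w (x + a *\<^sub>R ?e - a *\<^sub>R ?d) + w (x - a *\<^sub>R ?e - a *\<^sub>R ?d) = 4 * a\<^sup>2 * pd j (pd i w) (x + s *\<^sub>R ?e + t *\<^sub>R ?d)"
      using s(3) by (simp add: algebra_simps power2_eq_square)
  qed
qed

section \<open>Vanishing step size\<close>

lemma dct_powr:
  fixes g :: "nat \<Rightarrow> real^'n::finite \<Rightarrow> real"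
  assumes r: "0 < r" and meas: "\<And>n. g n \<in> borel_measurable borel"
    and B: "\<And>n x. \<bar>g n x\<bar> \<le> B" and R: "\<And>n x. R < norm x \<Longrightarrow> g n x = 0"
    and lim: "\<And>x. (\<lambda>n. g n x) \<longlonglongrightarrow> G x"
  shows "(\<lambda>n. \<integral>x. \<bar>g n x\<bar> powr r \<partial>lborel) \<longlonglongrightarrow> (\<integral>x. \<bar>G x\<bar> powr r \<partial>lborel)"
proof (rule integral_dominated_convergence[where w = "\<lambda>x. B powr r * indicator (cball 0 R) x"])
  note [measurable] = meas
  have "G \<in> borel_measurable borel" by (rule borel_measurable_LIMSEQ_real[OF lim]) measurable
  then show "(\<lambda>x. \<bar>G x\<bar> powr r) \<in> borel_measurable lborel" by measurable
  show "(\<lambda>x. \<bar>g n x\<bar> powr r) \<in> borel_measurable lborel" for n by measurable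
  show "integrable lborel (\<lambda>x::real^'n. B powr r * indicator (cball 0 R) x)"
    using emeasure_bounded_finite[of "cball (0::real^'n) R"] by (intro integrable_mult_right integrable_real_indicator) auto
  show "AE x in lborel. (\<lambda>n. \<bar>g n x\<bar> powr r) \<longlonglongrightarrow> \<bar>G x\<bar> powr r"
    using r lim by (intro AE_I2 tendsto_powr' tendsto_intros) auto
  show "AE x in lborel. norm (\<bar>g n x\<bar> powr r) \<le> B powr r * indicator (cball 0 R) x" for n
  proof (intro AE_I2)
    fix x show "norm (\<bar>g n x\<bar> powr r) \<le> B powr r * indicator (cball 0 R) x"
      using R[of x n] B[of n x] r by (cases "norm x \<le> R") (auto intro!: powr_mono2)
  qed
qed

text \<open>Summing the second differences along \<open>e\<^sub>i \<plusminus> e\<^sub>j\<close> over all \<open>i, j\<close> gives a multiple of the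
  Laplacian, while the difference of the two signs is the mixed derivative.\<close>

definition steps :: "real \<Rightarrow> 'n \<times> 'n \<times> bool \<Rightarrow> real^'n::finite" where
  "steps h = (\<lambda>(i, j, s). h *\<^sub>R axis i 1 + (if s then h else - h) *\<^sub>R axis j 1)"

definition lap :: "(real^'n::finite \<Rightarrow> real) \<Rightarrow> real^'n \<Rightarrow> real" where
  "lap w x = (\<Sum>k\<in>UNIV. pd k (pd k w) x)"

text \<open>The estimate for the walk is homogeneous: dividing by the square of the step length h
  turns both sides into difference quotients, bounded uniformly by second derivatives and supported
  in a fixed ball. Dominated convergence as h tends to 0 then gives the differential
  statement.\<close>

theorem calderon_zygmund:
  assumes r: "1 < r"
  obtains C where "0 \<le> C" "\<And>(w :: real^'n::finite \<Rightarrow> real) i j. test_fun UNIV w \<Longrightarrow>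
    (\<integral>x. \<bar>pd j (pd i w) x\<bar> powr r \<partial>lborel) \<le> C * (\<integral>x. \<bar>lap w x\<bar> powr r \<partial>lborel)"
proof -
  define n where "n = real CARD('n)"
  have n: "n > 0" by (simp add: n_def)
  \<comment> \<open>\<open>cW\<close> involves only the number of steps and the exponent, so one
    constant serves all step lengths.\<close>
  define c0 where "c0 = walk_bellman.cW TYPE('n \<times> 'n \<times> bool) r"
  have c0: "0 \<le> c0"
  proof -
    interpret walk_bellman "steps 1 :: 'n \<times> 'n \<times> bool \<Rightarrow> real^'n" r by standard (use r in auto)
    show ?thesis unfolding c0_def cW_def by simp
  qed
  \<comment> \<open>The factors in the numerator come from separating the two signs of the diagonal.
    The 16 normalises the mixed difference with step 2 h, and n appears because the rescaled walk
    increment tends to the Laplacian divided by n.\<close>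
  define C where "C = 2 powr r * (2 * c0) / (16 * n) powr r"
  have main: "(\<integral>x. \<bar>pd j (pd i w) x\<bar> powr r \<partial>lborel) \<le> C * (\<integral>x. \<bar>lap w x\<bar> powr r \<partial>lborel)"
    if w: "test_fun UNIV w" for w :: "real^'n \<Rightarrow> real" and i j
  proof -
    have ws: "smooth w" using w test_fun_smooth by blast
    have wc: "cc_fun w" using w test_fun_cc by blast
    note [measurable] = cc_fun_measurable[OF wc]
    obtain R where R: "\<And>x. R < norm x \<Longrightarrow> w x = 0" using wc by (auto simp: cc_fun_def)
    have "\<exists>B. \<forall>x. \<bar>pd l (pd k w) x\<bar> \<le> B" for l k
      using cc_fun_bounded[OF test_fun_cc[OF test_fun_pd[OF test_fun_pd[OF w]]]] by metis
    then obtain B0 where B0: "\<And>l k x. \<bar>pd l (pd k w) x\<bar> \<le> B0 l k" by metis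
    define B where "B = (\<Sum>l\<in>UNIV. \<Sum>k\<in>UNIV. \<bar>B0 l k\<bar>)"
    have B: "\<bar>pd l (pd k w) x\<bar> \<le> B" for l k x
    proof -
      have "\<bar>B0 l k\<bar> \<le> (\<Sum>k\<in>UNIV. \<bar>B0 l k\<bar>)" by (rule member_le_sum) auto
      also have "\<dots> \<le> B" unfolding B_def by (rule member_le_sum) (auto intro: sum_nonneg)
      finally show ?thesis using B0[of l k x] by linarith
    qed
    define h where "h m = 1 / (real m + 1)" for m :: nat
    have h: "0 < h m" "h m \<le> 1" for m by (auto simp: h_def)
    have hlim: "h \<longlonglongrightarrow> 0" unfolding h_def by real_asymp
    define md where "md i j a x = w (x + a *\<^sub>R axis i 1 + a *\<^sub>R axis j 1) - w (x - a *\<^sub>R axis i 1 + a *\<^sub>R axis j 1)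
     - w (x + a *\<^sub>R axis i 1 - a *\<^sub>R axis j 1) + w (x - a *\<^sub>R axis i 1 - a *\<^sub>R axis j 1)" for i j a x
    have md: "\<exists>y. dist y x \<le> 2 * a \<and> md i j a x = 4 * a\<^sup>2 * pd j (pd i w) y" if "0 < a" for i j a x
      unfolding md_def using mixed_difference[OF ws that] by metis
    have mdB: "\<bar>md i j a x\<bar> \<le> 4 * a\<^sup>2 * B" if "0 < a" for i j a x
      using md[OF that, of x i j] B by (auto simp: abs_mult mult_left_mono)
    have mdlim: "(\<lambda>m. md i j (a m) (x m) / (4 * (a m)\<^sup>2)) \<longlonglongrightarrow> pd j (pd i w) z"
      if a: "\<And>m. 0 < a m" "a \<longlonglongrightarrow> 0" and x: "x \<longlonglongrightarrow> z" for i j a x z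
    proof -
      obtain y where y: "\<And>m. dist (y m) (x m) \<le> 2 * a m" "\<And>m. md i j (a m) (x m) = 4 * (a m)\<^sup>2 * pd j (pd i w) (y m)"
        using choice[of "\<lambda>m y. dist y (x m) \<le> 2 * a m \<and> md i j (a m) (x m) = 4 * (a m)\<^sup>2 * pd j (pd i w) y"] md[OF a(1)] by blast
      have "(\<lambda>m. dist (y m) z) \<longlonglongrightarrow> 0"
      proof (rule tendsto_sandwich[OF _ _ tendsto_const])
        show "(\<lambda>m. 2 * a m + dist (x m) z) \<longlonglongrightarrow> 0"
          using tendsto_add[OF tendsto_mult[OF tendsto_const[of 2] a(2)] tendsto_dist[OF x tendsto_const[of z]]] by simp
        have "dist (y m) z \<le> 2 * a m + dist (x m) z" for m using y(1)[of m] dist_triangle[of "y m" z "x m"] by linarith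
        then show "\<forall>\<^sub>F m in sequentially. dist (y m) z \<le> 2 * a m + dist (x m) z" by simp
      qed simp
      then have "y \<longlonglongrightarrow> z" by (subst tendsto_dist_iff)
      moreover have "isCont (pd j (pd i w)) z"
        using smooth_continuous[OF smooth_pd[OF smooth_pd[OF ws]], of UNIV] by (simp add: continuous_on_eq_continuous_at)
      ultimately have "(\<lambda>m. pd j (pd i w) (y m)) \<longlonglongrightarrow> pd j (pd i w) z" using isCont_tendsto_compose by blast
      moreover have "md i j (a m) (x m) / (4 * (a m)\<^sup>2) = pd j (pd i w) (y m)" for m
        using a(1)[of m] y(2)[of m] by simp
      ultimately show ?thesis by simp
    qed
    define Q where "Q m x = md i j (2 * h m) x / (16 * (h m)\<^sup>2)" for m x
    define pw where "pw m = walk.P (steps (h m)) w" for m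
    define F where "F m x = (pw m x - w x) / (h m)\<^sup>2" for m x
    \<comment> \<open>\<open>md j j (h m / 2)\<close> is the ordinary second difference with step
      \<open>h m\<close>. Taken along j at both points x +- h e_i, and twice along i at x, these add
      up to the four diagonal corners minus four times the centre.\<close>
    have pwe: "pw m x - w x = (\<Sum>i\<in>UNIV. \<Sum>j\<in>UNIV. md j j (h m / 2) (x + h m *\<^sub>R axis i 1) + md j j (h m / 2) (x - h m *\<^sub>R axis i 1) + 2 * md i i (h m / 2) x) / (4 * n\<^sup>2)" for m x
    proof -
      have four: "md j j (a / 2) (x + a *\<^sub>R axis i 1) + md j j (a / 2) (x - a *\<^sub>R axis i 1) + 2 * md i i (a / 2) x
         = (\<Sum>s\<in>UNIV. w (x + steps a (i, j, s)) + w (x - steps a (i, j, s))) - 4 * w x" for a i j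
        by (simp add: md_def steps_def UNIV_bool scaleR_half_double[symmetric] algebra_simps scaleR_2[symmetric] flip: scaleR_left_distrib)
      have "(\<Sum>i\<in>UNIV. \<Sum>j\<in>UNIV. \<Sum>s\<in>UNIV. w (x + steps (h m) (i, j, s)) + w (x - steps (h m) (i, j, s)))
        = (\<Sum>t\<in>(UNIV::('n \<times> 'n \<times> bool) set). w (x + steps (h m) t) + w (x - steps (h m) t))"
        by (simp add: sum.cartesian_product UNIV_Times_UNIV[symmetric] del: UNIV_Times_UNIV)
      moreover have "walk.N TYPE('n \<times> 'n \<times> bool) = 2 * n\<^sup>2" by (simp add: walk.N_def n_def power2_eq_square)
      ultimately show ?thesis
        unfolding four using n by (simp add: pw_def walk.P_def sum_subtractf n_def[symmetric] field_simps power2_eq_square)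
    qed
    have Flim: "(\<lambda>m. F m x) \<longlonglongrightarrow> lap w x / n" for x
    proof -
      have a: "(\<lambda>m. h m / 2) \<longlonglongrightarrow> 0" "0 < h m / 2" for m using tendsto_divide[OF hlim tendsto_const[of 2]] h by auto
      have xi: "(\<lambda>m. x + h m *\<^sub>R e) \<longlonglongrightarrow> x" "(\<lambda>m. x - h m *\<^sub>R e) \<longlonglongrightarrow> x" for e
        using tendsto_add[OF tendsto_const[of x] tendsto_scaleR[OF hlim tendsto_const[of e]]]
              tendsto_diff[OF tendsto_const[of x] tendsto_scaleR[OF hlim tendsto_const[of e]]] by simp_all
      have e: "F m x = (\<Sum>i\<in>UNIV. \<Sum>j\<in>UNIV. md j j (h m / 2) (x + h m *\<^sub>R axis i 1) / (4 * (h m / 2)\<^sup>2) + md j j (h m / 2) (x - h m *\<^sub>R axis i 1) / (4 * (h m / 2)\<^sup>2) + 2 * (md i i (h m / 2) x / (4 * (h m / 2)\<^sup>2))) / (4 * n\<^sup>2)" for m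
        unfolding F_def pwe by (simp add: power_divide sum_divide_distrib add_divide_distrib mult_ac)
      have "(\<lambda>m. F m x) \<longlonglongrightarrow> (\<Sum>i\<in>UNIV. \<Sum>j\<in>UNIV. pd j (pd j w) x + pd j (pd j w) x + 2 * pd i (pd i w) x) / (4 * n\<^sup>2)"
        unfolding e by (intro tendsto_intros mdlim a xi) (use n in auto)
      also have "(\<Sum>i\<in>(UNIV::'n set). \<Sum>j\<in>(UNIV::'n set). pd j (pd j w) x + pd j (pd j w) x + 2 * pd i (pd i w) x) = 4 * n * lap w x"
        by (simp add: lap_def sum.distrib n_def sum_distrib_left[symmetric])
      also have "4 * n * lap w x / (4 * n\<^sup>2) = lap w x / n" using n by (simp add: power2_eq_square)
      finally show ?thesis .
    qed
    have Qlim: "(\<lambda>m. Q m x) \<longlonglongrightarrow> pd j (pd i w) x" for x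
    proof -
      have "(\<lambda>m. md i j (2 * h m) x / (4 * (2 * h m)\<^sup>2)) \<longlonglongrightarrow> pd j (pd i w) x"
        using h tendsto_mult[OF tendsto_const[of 2] hlim] by (intro mdlim) auto
      then show ?thesis by (simp add: Q_def power_mult_distrib)
    qed
    have far: "w (x + y) = 0" if "\<bar>R\<bar> + 4 < norm x" "norm y \<le> 4" for x y
    proof -
      have "norm x - norm y \<le> norm (x + y)" using norm_diff_ineq[of x y] by simp
      then show ?thesis using that by (intro R) linarith
    qed
    have st: "norm (a *\<^sub>R axis i (1::real) + b *\<^sub>R axis j 1 :: real^'n) \<le> \<bar>a\<bar> + \<bar>b\<bar>" for a b i j
      by (rule order_trans[OF norm_triangle_ineq]) (simp add: norm_axis_1)
    have Qfar: "Q m x = 0" if x: "\<bar>R\<bar> + 4 < norm x" for m x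
    proof -
      have "w (x + (a *\<^sub>R axis i 1 + b *\<^sub>R axis j 1)) = 0" if "\<bar>a\<bar> \<le> 2" "\<bar>b\<bar> \<le> 2" for a b :: real
        using st[of a i b j] that by (intro far[OF x]) linarith
      from this[of "2 * h m" "2 * h m"] this[of "- 2 * h m" "2 * h m"] this[of "2 * h m" "- 2 * h m"] this[of "- 2 * h m" "- 2 * h m"]
      show ?thesis using h[of m] by (simp add: Q_def md_def algebra_simps)
    qed
    have Ffar: "F m x = 0" if x: "\<bar>R\<bar> + 4 < norm x" for m x
    proof -
      have "w (x + steps (h m) t) = 0" "w (x - steps (h m) t) = 0" for t :: "'n \<times> 'n \<times> bool"
      proof -
        have "norm (steps (h m) t) \<le> 4"
          using st[of "h m" "fst t" "if snd (snd t) then h m else - h m" "fst (snd t)"] h[of m]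
          by (auto simp: steps_def split: prod.splits if_splits)
        then show "w (x + steps (h m) t) = 0" "w (x - steps (h m) t) = 0"
          using far[OF x, of "steps (h m) t"] far[OF x, of "- steps (h m) t"] by simp_all
      qed
      moreover have "w x = 0" using far[OF x, of 0] by simp
      ultimately show ?thesis by (simp add: F_def pw_def walk.P_def)
    qed
    have QB: "\<bar>Q m x\<bar> \<le> B" for m x
      using mdB[of "2 * h m" i j x] h[of m] by (simp add: Q_def abs_mult power_mult_distrib field_simps)
    have FB: "\<bar>F m x\<bar> \<le> B" for m x
    proof -
      have "\<bar>md j j (h m / 2) (x + h m *\<^sub>R axis i 1) + md j j (h m / 2) (x - h m *\<^sub>R axis i 1) + 2 * md i i (h m / 2) x\<bar> \<le> 4 * ((h m)\<^sup>2 * B)" for i j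
      proof -
        have "\<bar>md k k (h m / 2) y\<bar> \<le> (h m)\<^sup>2 * B" for k y
          using mdB[of "h m / 2" k k y] h[of m] by (simp add: power_divide)
        from this[of j "x + h m *\<^sub>R axis i 1"] this[of j "x - h m *\<^sub>R axis i 1"] this[of i x] show ?thesis by linarith
      qed
      then have "\<bar>\<Sum>i\<in>UNIV. \<Sum>j\<in>UNIV. md j j (h m / 2) (x + h m *\<^sub>R axis i 1) + md j j (h m / 2) (x - h m *\<^sub>R axis i 1) + 2 * md i i (h m / 2) x\<bar> \<le> (\<Sum>i\<in>(UNIV::'n set). \<Sum>j\<in>(UNIV::'n set). 4 * ((h m)\<^sup>2 * B))"
        by (intro order_trans[OF sum_abs] sum_mono) auto
      also have "\<dots> = 4 * n\<^sup>2 * ((h m)\<^sup>2 * B)" by (simp add: n_def power2_eq_square)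
      finally show ?thesis unfolding F_def pwe using n h[of m] by (simp add: abs_divide field_simps)
    qed
    have le: "(\<integral>x. \<bar>Q m x\<bar> powr r \<partial>lborel) \<le> C * n powr r * (\<integral>x. \<bar>F m x\<bar> powr r \<partial>lborel)" for m
    proof -
      interpret W: walk_bellman "steps (h m) :: 'n \<times> 'n \<times> bool \<Rightarrow> real^'n" r by standard (use r in auto)
      define D where "D s = W.dl (i, j, s) (W.dl (i, j, s) w)" for s
      have D: "cc_fun (D s)" for s unfolding D_def by (intro W.dl_cc wc)
      \<comment> \<open>Applying a centred difference twice gives the second difference over twice
        the step. The centres cancel between the two signs, and the corners x +- 2 h e_i +- 2 h e_j
        of the mixed difference remain.\<close>
      have Deq: "md i j (2 * h m) x = D True x - D False x" for x
      proof -
        have dd: "D s x = w (x + 2 *\<^sub>R steps (h m) (i, j, s)) - 2 * w x + w (x - 2 *\<^sub>R steps (h m) (i, j, s))" for s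
          by (simp add: D_def W.dl_def scaleR_2 algebra_simps)
        have st: "2 *\<^sub>R steps (h m) (i, j, True) = (2 * h m) *\<^sub>R axis i 1 + (2 * h m) *\<^sub>R axis j 1"
          "2 *\<^sub>R steps (h m) (i, j, False) = (2 * h m) *\<^sub>R axis i 1 - (2 * h m) *\<^sub>R axis j 1"
          by (simp_all add: steps_def scaleR_add_right scaleR_diff_right)
        show ?thesis unfolding dd st md_def by (simp add: algebra_simps)
      qed
      have Q: "Q m x = (1 / (16 * (h m)\<^sup>2)) * (D True x - D False x)" for x by (simp add: Q_def Deq)
      have est: "(\<integral>x. \<bar>D s x\<bar> powr r \<partial>lborel) \<le> c0 * (\<integral>x. \<bar>w x - W.P w x\<bar> powr r \<partial>lborel)" for s
        unfolding D_def c0_def by (rule W.walk_estimate[OF wc])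
      have "(\<integral>x. \<bar>D True x - D False x\<bar> powr r \<partial>lborel) \<le> (\<integral>x. 2 powr r * (\<bar>D True x\<bar> powr r + \<bar>- D False x\<bar> powr r) \<partial>lborel)"
      proof (rule integral_mono)
        show "\<bar>D True x - D False x\<bar> powr r \<le> 2 powr r * (\<bar>D True x\<bar> powr r + \<bar>- D False x\<bar> powr r)" for x
          using abs_powr_add_le[OF r, of "D True x" "- D False x"] by simp
      next
        show "integrable lborel (\<lambda>x. \<bar>D True x - D False x\<bar> powr r)"
          using r D by (intro cc_fun_integrable cc_fun_powr cc_fun_diff) auto
        have "integrable lborel (\<lambda>x. \<bar>D s x\<bar> powr r)" for s
          using r D by (intro cc_fun_integrable cc_fun_powr) auto
        then show "integrable lborel (\<lambda>x. 2 powr r * (\<bar>D True x\<bar> powr r + \<bar>- D False x\<bar> powr r))" by simp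
      qed
      also have "\<dots> = 2 powr r * ((\<integral>x. \<bar>D True x\<bar> powr r \<partial>lborel) + (\<integral>x. \<bar>D False x\<bar> powr r \<partial>lborel))"
        using r D by (simp add: cc_fun_integrable cc_fun_powr)
      also have "\<dots> \<le> 2 powr r * (2 * (c0 * (\<integral>x. \<bar>w x - W.P w x\<bar> powr r \<partial>lborel)))"
        using est[of True] est[of False] by (intro mult_left_mono) auto
      also have "(\<integral>x. \<bar>w x - W.P w x\<bar> powr r \<partial>lborel) = (h m)\<^sup>2 powr r * (\<integral>x. \<bar>F m x\<bar> powr r \<partial>lborel)"
      proof -
        have "\<bar>w x - W.P w x\<bar> powr r = (h m)\<^sup>2 powr r * \<bar>F m x\<bar> powr r" for x
        proof -
          have "\<bar>w x - W.P w x\<bar> = (h m)\<^sup>2 * \<bar>F m x\<bar>" using h[of m] by (simp add: F_def pw_def abs_minus_commute)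
          then show ?thesis by (simp add: powr_mult)
        qed
        then show ?thesis by simp
      qed
      finally have 1: "(\<integral>x. \<bar>D True x - D False x\<bar> powr r \<partial>lborel) \<le> 2 powr r * (2 * (c0 * ((h m)\<^sup>2 powr r * (\<integral>x. \<bar>F m x\<bar> powr r \<partial>lborel))))" .
      have "(\<integral>x. \<bar>Q m x\<bar> powr r \<partial>lborel) = (\<integral>x. \<bar>D True x - D False x\<bar> powr r \<partial>lborel) / ((16 powr r) * (h m)\<^sup>2 powr r)"
        unfolding Q by (simp add: abs_mult powr_mult powr_divide)
      also have "\<dots> \<le> 2 powr r * (2 * (c0 * ((h m)\<^sup>2 powr r * (\<integral>x. \<bar>F m x\<bar> powr r \<partial>lborel)))) / ((16 powr r) * (h m)\<^sup>2 powr r)"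
        by (intro divide_right_mono 1) auto
      also have "\<dots> = C * n powr r * (\<integral>x. \<bar>F m x\<bar> powr r \<partial>lborel)"
        unfolding C_def using h[of m] n by (simp add: powr_mult)
      finally show ?thesis .
    qed
    have Qm: "Q m \<in> borel_measurable borel" for m unfolding Q_def[abs_def] md_def by measurable
    have Fm: "F m \<in> borel_measurable borel" for m unfolding F_def[abs_def] pw_def walk.P_def by measurable
    have r0: "0 < r" using r by simp
    have "(\<integral>x. \<bar>pd j (pd i w) x\<bar> powr r \<partial>lborel) \<le> C * n powr r * (\<integral>x. \<bar>lap w x / n\<bar> powr r \<partial>lborel)"
      by (rule tendsto_le[OF _ tendsto_mult[OF tendsto_const dct_powr[OF r0 Fm FB Ffar Flim]] dct_powr[OF r0 Qm QB Qfar Qlim]])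
         (use le in auto)
    also have "(\<integral>x. \<bar>lap w x / n\<bar> powr r \<partial>lborel) = (\<integral>x. \<bar>lap w x\<bar> powr r \<partial>lborel) / n powr r"
      using n by (simp add: powr_divide)
    finally show ?thesis using n by simp
  qed
  show thesis
    by (rule that[of C]) (use main c0 in \<open>auto simp: C_def\<close>)
qed

section \<open>The divergence equation in a ball\<close>

lemma integrable_bounded_support:
  fixes g :: "'a::euclidean_space \<Rightarrow> real"
  assumes [measurable]: "g \<in> borel_measurable borel" and B: "\<And>x. \<bar>g x\<bar> \<le> B" and R: "\<And>x. R < norm x \<Longrightarrow> g x = 0"
  shows "integrable lborel g"
proof (rule Bochner_Integration.integrable_bound)
  show "integrable lborel (\<lambda>x::'a. B * indicator (cball 0 R) x)"
    using emeasure_bounded_finite[of "cball (0::'a) R"] by (intro integrable_mult_right integrable_real_indicator) auto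
  show "AE x in lborel. norm (g x) \<le> norm (B * indicator (cball 0 R) x)"
  proof (intro AE_I2)
    fix x show "norm (g x) \<le> norm (B * indicator (cball 0 R) x)"
      using B[of x] R[of x] by (cases "norm x \<le> R") auto
  qed
qed simp

lemma Fubini_lborel:
  fixes g :: "'a::euclidean_space \<times> 'b::euclidean_space \<Rightarrow> real"
  assumes "integrable lborel g"
  shows "(\<integral>x. \<integral>y. g (x, y) \<partial>lborel \<partial>lborel) = (\<integral>z. g z \<partial>lborel)"
    and "(\<integral>y. \<integral>x. g (x, y) \<partial>lborel \<partial>lborel) = (\<integral>z. g z \<partial>lborel)"
proof -
  have i: "integrable (lborel \<Otimes>\<^sub>M lborel) g" using assms by (simp add: lborel_prod)
  show "(\<integral>x. \<integral>y. g (x, y) \<partial>lborel \<partial>lborel) = (\<integral>z. g z \<partial>lborel)"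
    using lborel_pair.integral_fst'[OF i] by (simp add: lborel_prod)
  show "(\<integral>y. \<integral>x. g (x, y) \<partial>lborel \<partial>lborel) = (\<integral>z. g z \<partial>lborel)"
    using lborel_pair.integral_snd[of "\<lambda>x y. g (x, y)"] i by (simp add: lborel_prod)
qed

lemma affine_has_derivative:
  fixes g :: "real^'n::finite \<Rightarrow> real"
  assumes "\<And>y. g differentiable (at y)"
  shows "((\<lambda>z. g (x + t *\<^sub>R z)) has_derivative (\<lambda>h. \<Sum>j\<in>UNIV. h $ j * (t * pd j g (x + t *\<^sub>R z)))) (at z)"
proof -
  have 1: "((\<lambda>z. x + t *\<^sub>R z) has_derivative (\<lambda>h. t *\<^sub>R h)) (at z)" by (auto intro!: derivative_eq_intros)
  have "(\<lambda>h. \<Sum>j\<in>UNIV. (t *\<^sub>R h) $ j * pd j g (x + t *\<^sub>R z)) = (\<lambda>h. \<Sum>j\<in>UNIV. h $ j * (t * pd j g (x + t *\<^sub>R z)))"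
    by (simp add: mult_ac)
  then show ?thesis using has_derivative_compose[OF 1 has_derivative_pd[OF assms]] by simp
qed

lemma pd_affine:
  assumes "\<And>y. g differentiable (at y)"
  shows "pd j (\<lambda>z. g (x + t *\<^sub>R z)) z = t * pd j g (x + t *\<^sub>R z)"
  using pd_eqI[OF affine_has_derivative[OF assms], of j] by (simp add: sum_axis_mult)

lemma smooth_affine:
  assumes "smooth g" shows "smooth (\<lambda>z. g (x + t *\<^sub>R z))"
proof -
  have "Ck k (\<lambda>z. g (x + t *\<^sub>R z))" for k
    using assms
  proof (induction k arbitrary: g)
    case (Suc k)
    have "pd j (\<lambda>z. g (x + t *\<^sub>R z)) = (\<lambda>z. t * pd j g (x + t *\<^sub>R z))" for j
      using pd_affine[OF smooth_differentiable[OF Suc.prems]] by blast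
    then show ?case using affine_has_derivative[OF smooth_differentiable[OF Suc.prems], of x t] Suc.IH[OF smooth_pd[OF Suc.prems]]
      by (auto simp: differentiable_def intro!: Ck_mult)
  qed simp
  then show ?thesis by (simp add: smooth_iff_Ck)
qed

lemma smooth_isCont: "smooth f \<Longrightarrow> isCont f x"
  using smooth_continuous[of f UNIV] by (simp add: continuous_on_eq_continuous_at)

lemma line_FTC:
  fixes f :: "real^'n::finite \<Rightarrow> real"
  assumes f: "smooth f" and L: "0 \<le> L"
  shows "(\<integral>s. indicator {0..L} s * (\<Sum>j\<in>UNIV. h $ j * pd j f (x + s *\<^sub>R h)) \<partial>lborel) = f (x + L *\<^sub>R h) - f x"
proof -
  have "(\<integral>s. (\<Sum>j\<in>UNIV. h $ j * pd j f (x + s *\<^sub>R h)) * indicator {0..L} s \<partial>lborel) = f (x + L *\<^sub>R h) - f (x + 0 *\<^sub>R h)"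
  proof (rule integral_FTC_Icc_real[OF L])
    show "((\<lambda>t. f (x + t *\<^sub>R h)) has_real_derivative (\<Sum>j\<in>UNIV. h $ j * pd j f (x + s *\<^sub>R h))) (at s)" for s
      by (rule smooth_line_deriv[OF f])
    show "isCont (\<lambda>s. \<Sum>j\<in>UNIV. h $ j * pd j f (x + s *\<^sub>R h)) s" for s
    proof (intro continuous_intros)
      fix j
      show "isCont (\<lambda>s. pd j f (x + s *\<^sub>R h)) s"
        by (rule isCont_o2[OF _ smooth_isCont[OF smooth_pd[OF f]]]) (auto intro!: continuous_intros)
    qed
  qed
  then show ?thesis by (simp add: mult.commute)
qed

text \<open>A shift by L, longer than the diameter of the support, makes g and its translate
  disjointly supported, so the r-th power of their difference splits. That difference is an average
  of the derivative along a segment, with total weight L.\<close>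

lemma poincare:
  fixes g :: "real^'n::finite \<Rightarrow> real"
  assumes r: "1 < r" and g: "test_fun S g" and \<rho>: "0 \<le> \<rho>" and supp: "\<And>x. x \<notin> cball y0 \<rho> \<Longrightarrow> g x = 0"
  shows "(\<integral>x. \<bar>g x\<bar> powr r \<partial>lborel) \<le> (2 * \<rho> + 1) powr r * (\<integral>x. \<bar>pd k g x\<bar> powr r \<partial>lborel)"
proof -
  define L where "L = 2 * \<rho> + 1"
  have L: "0 \<le> L" "2 * \<rho> < L" using \<rho> by (auto simp: L_def)
  define e where "e = (axis k 1 :: real^'n)"
  define c :: "real \<Rightarrow> real" where "c = indicator {0..L}"
  have c: "integrable lborel c" unfolding c_def by (intro integrable_real_indicator) (use L in auto)
  have \<phi>: "(\<lambda>s. s *\<^sub>R e) \<in> borel_measurable lborel" by simp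
  have gc: "cc_fun g" and pgc: "cc_fun (pd k g)" using g test_fun_cc test_fun_pd by blast+
  have T: "avg lborel c (\<lambda>s. s *\<^sub>R e) (pd k g) x = g (x + L *\<^sub>R e) - g x" for x
    using line_FTC[OF test_fun_smooth[OF g] L(1), of e x] by (simp add: avg_def c_def e_def sum_axis_mult)
  have T': "avg lborel c (\<lambda>s. s *\<^sub>R e) (pd k g) = (\<lambda>x. g (x + L *\<^sub>R e) - g x)" using T by blast
  have gt: "cc_fun (\<lambda>x. g (x + L *\<^sub>R e))" by (rule cc_fun_translate[OF gc])
  have gr: "cc_fun (\<lambda>x. \<bar>g x\<bar> powr r)" "cc_fun (\<lambda>x. \<bar>g (x + L *\<^sub>R e)\<bar> powr r)" using r gc gt by (auto intro: cc_fun_powr)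
  have disj: "g (x + L *\<^sub>R e) = 0 \<or> g x = 0" for x
  proof (rule ccontr)
    assume "\<not> (g (x + L *\<^sub>R e) = 0 \<or> g x = 0)"
    then have "dist y0 (x + L *\<^sub>R e) \<le> \<rho>" "dist y0 x \<le> \<rho>" using supp[of x] supp[of "x + L *\<^sub>R e"] by auto
    then have "dist x (x + L *\<^sub>R e) \<le> 2 * \<rho>" using dist_triangle3[of x "x + L *\<^sub>R e" y0] by linarith
    then show False using L by (simp add: dist_norm e_def norm_axis_1)
  qed
  have "(\<integral>x. \<bar>g x\<bar> powr r \<partial>lborel) \<le> (\<integral>x. \<bar>g (x + L *\<^sub>R e)\<bar> powr r + \<bar>g x\<bar> powr r \<partial>lborel)"
    using cc_fun_integrable[OF gr(1)] cc_fun_integrable[OF gr(2)] by (intro integral_mono) auto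
  also have "\<dots> = (\<integral>x. \<bar>avg lborel c (\<lambda>s. s *\<^sub>R e) (pd k g) x\<bar> powr r \<partial>lborel)"
  proof (intro Bochner_Integration.integral_cong refl)
    fix x show "\<bar>g (x + L *\<^sub>R e)\<bar> powr r + \<bar>g x\<bar> powr r = \<bar>avg lborel c (\<lambda>s. s *\<^sub>R e) (pd k g) x\<bar> powr r"
      unfolding T using disj[of x] by auto
  qed
  also have "\<dots> \<le> (\<integral>s. \<bar>c s\<bar> \<partial>lborel) powr r * (\<integral>x. \<bar>pd k g x\<bar> powr r \<partial>lborel)"
    by (rule avg_Lr[OF r _ c \<phi> pgc]) (auto simp: T' intro!: cc_fun_diff gc gt lborel.sigma_finite_measure_axioms)
  also have "(\<integral>s. \<bar>c s\<bar> \<partial>lborel) = L" using L by (simp add: c_def)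
  finally show ?thesis by (simp add: L_def)
qed

lemma jensen_ball:
  fixes f :: "real^'n::finite \<Rightarrow> real"
  assumes r: "1 < r" and f: "cc_fun f" and supp: "\<And>x. x \<notin> cball y0 \<rho> \<Longrightarrow> f x = 0"
  shows "(\<integral>x. \<bar>f x\<bar> \<partial>lborel) powr r \<le> measure lborel (cball y0 \<rho>) powr (r - 1) * (\<integral>x. \<bar>f x\<bar> powr r \<partial>lborel)"
proof -
  define c :: "real^'n \<Rightarrow> real" where "c = indicator (cball y0 \<rho>)"
  have c: "integrable lborel c" unfolding c_def
    using emeasure_bounded_finite[of "cball y0 \<rho>"] by (intro integrable_real_indicator) auto
  have e: "(\<lambda>x. c x * \<bar>f x\<bar>) = (\<lambda>x. \<bar>f x\<bar>)" "(\<lambda>x. \<bar>c x\<bar> * \<bar>\<bar>f x\<bar>\<bar> powr r) = (\<lambda>x. \<bar>f x\<bar> powr r)"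
    "(\<lambda>x. \<bar>c x\<bar> * \<bar>f x\<bar> powr r) = (\<lambda>x. \<bar>f x\<bar> powr r)"
    using supp by (auto simp: c_def fun_eq_iff indicator_def split: if_splits)
  have "\<bar>\<integral>x. c x * \<bar>f x\<bar> \<partial>lborel\<bar> powr r \<le> (\<integral>x. \<bar>c x\<bar> \<partial>lborel) powr (r - 1) * (\<integral>x. \<bar>c x\<bar> * \<bar>\<bar>f x\<bar>\<bar> powr r \<partial>lborel)"
    by (rule jensen_powr[OF r c]) (use r f in \<open>auto simp: e intro!: cc_fun_integrable cc_fun_abs cc_fun_powr\<close>)
  moreover have "(\<integral>x. \<bar>c x\<bar> \<partial>lborel) = measure lborel (cball y0 \<rho>)" by (simp add: c_def)
  moreover have "\<bar>\<integral>x. \<bar>f x\<bar> \<partial>lborel\<bar> = (\<integral>x. \<bar>f x\<bar> \<partial>lborel)" by simp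
  ultimately show ?thesis unfolding e by metis
qed

section \<open>Mollifiers and their primitives\<close>

lemma bump_integral_pos:
  assumes "0 < \<rho>"
  shows "0 < (\<integral>x. bump m c \<rho> x \<partial>lborel)"
proof -
  have i: "integrable lborel (bump m c \<rho>)"
    using test_fun_bump[OF assms, of c UNIV m] by (auto intro!: cc_fun_integrable test_fun_cc)
  have "(\<integral>x. bump m c \<rho> x \<partial>lborel) \<noteq> 0"
  proof
    assume "(\<integral>x. bump m c \<rho> x \<partial>lborel) = 0"
    then have "AE x in lborel. bump m c \<rho> x = 0"
      using i by (subst (asm) integral_nonneg_eq_0_iff_AE) (auto simp: bump_nonneg)
    then have "AE x in lborel. x \<notin> ball c \<rho>"
    proof eventually_elim
      case (elim x)
      then show ?case using bump_pos_iff[OF assms, of m c x] by simp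
    qed
    then have "emeasure lborel (ball c \<rho>) = 0"
      by (subst (asm) AE_iff_measurable[of "ball c \<rho>"]) auto
    then have "measure lborel (ball c \<rho>) = 0" by (simp add: measure_def)
    then show False using content_ball_pos[OF assms, of c] by simp
  qed
  moreover have "0 \<le> (\<integral>x. bump m c \<rho> x \<partial>lborel)" by (intro Bochner_Integration.integral_nonneg) (simp add: bump_nonneg)
  ultimately show ?thesis by simp
qed

text \<open>Built on index 2, the derivative of index 0, so that z times the centred mollifier is an
  exact gradient. Normalising by the bump at the origin makes mollifiers of equal radius translates
  of each other by definition.\<close>

definition mollifier :: "real^'n::finite \<Rightarrow> real \<Rightarrow> real^'n \<Rightarrow> real" where
  "mollifier c \<rho> x = inverse (\<integral>z. bump 2 (0::real^'n) \<rho> z \<partial>lborel) * bump 2 c \<rho> x"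

lemma test_fun_mollifier: "0 < \<rho> \<Longrightarrow> cball c \<rho> \<subseteq> S \<Longrightarrow> test_fun S (mollifier c \<rho>)"
  unfolding mollifier_def[abs_def] by (intro test_fun_cmult test_fun_bump)

lemma mollifier_shift: "mollifier c \<rho> x = mollifier 0 \<rho> (x - c)"
  by (simp add: mollifier_def bump_def)

lemma mollifier_nonneg: "0 < \<rho> \<Longrightarrow> 0 \<le> mollifier c \<rho> x"
  unfolding mollifier_def by (intro mult_nonneg_nonneg) (auto simp: bump_nonneg)

lemma mollifier_eq_0: "0 < \<rho> \<Longrightarrow> x \<notin> ball c \<rho> \<Longrightarrow> mollifier c \<rho> x = 0"
  unfolding mollifier_def using bump_eq_0[of \<rho> x c 2] by simp

lemma integral_mollifier:
  assumes "0 < \<rho>" shows "(\<integral>x. mollifier c \<rho> x \<partial>lborel) = 1"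
proof -
  have "cc_fun (mollifier (0::real^'a) \<rho>)" using test_fun_mollifier[OF assms, of 0 UNIV] test_fun_cc by auto
  then have "(\<integral>x. mollifier (0::real^'a) \<rho> (x + (- c)) \<partial>lborel) = (\<integral>x. mollifier (0::real^'a) \<rho> x \<partial>lborel)"
    by (intro integral_translate cc_fun_measurable)
  also have "\<dots> = 1" using bump_integral_pos[OF assms, of 2 "0::real^'a"] by (simp add: mollifier_def)
  finally show ?thesis by (simp add: mollifier_shift[of c])
qed

lemma pd_norm_sq: "pd i (\<lambda>x::real^'n::finite. \<rho>2 - (norm x)\<^sup>2) z = - 2 * z $ i"
proof -
  have "((\<lambda>x::real^'n. \<rho>2 - x \<bullet> x) has_derivative (\<lambda>h. - (2 * (z \<bullet> h)))) (at z)"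
    by (auto intro!: derivative_eq_intros simp: inner_commute)
  from pd_eqI[OF this, of i] show ?thesis by (simp add: power2_norm_eq_inner inner_axis)
qed

text \<open>The primitive of the mollifier: \<open>\<nabla>\<gamma>(z) = - z \<eta>(z)\<close>, so that \<open>d/dt \<eta>\<^sub>t = t \<Delta>\<gamma>\<^sub>t\<close>.\<close>

definition moll_prim :: "real \<Rightarrow> real^'n::finite \<Rightarrow> real" where
  "moll_prim \<rho> x = inverse (2 * (\<integral>z. bump 2 (0::real^'n) \<rho> z \<partial>lborel)) * bump 0 0 \<rho> x"

lemma test_fun_moll_prim: "0 < \<rho> \<Longrightarrow> cball 0 \<rho> \<subseteq> S \<Longrightarrow> test_fun S (moll_prim \<rho>)"
  unfolding moll_prim_def[abs_def] by (intro test_fun_cmult test_fun_bump)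

text \<open>The gradient of the squared norm supplies a factor 2, which the normalisation of
  \<open>moll_prim\<close> removes.\<close>

lemma pd_moll_prim: "pd i (moll_prim \<rho>) z = - (z $ i) * mollifier 0 \<rho> z"
proof -
  have e2: "flat_exp (Suc (Suc 0)) t = flat_exp 2 t" for t by (simp add: numeral_2_eq_2)
  have "pd i (bump 0 0 \<rho>) z = (- 2 * z $ i) * flat_exp 2 (\<rho>\<^sup>2 - (norm z)\<^sup>2)"
    unfolding bump_def[abs_def]
    using pd_flat_exp[OF smooth_differentiable[OF smooth_diff[OF smooth_const smooth_norm_sq]], of i 0 "\<rho>\<^sup>2" 0 z]
    by (simp add: pd_norm_sq e2)
  then show ?thesis unfolding moll_prim_def[abs_def] mollifier_def
    by (subst pd_cmult) (auto simp: smooth_differentiable smooth_bump bump_def)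
qed

section \<open>Solution operators in a ball\<close>

locale local_div =
  fixes y0 :: "real^'n::finite" and \<rho> :: real
  assumes \<rho>: "0 < \<rho>"
begin

abbreviation \<eta> :: "real^'n \<Rightarrow> real" where "\<eta> \<equiv> mollifier 0 \<rho>"
abbreviation \<gamma> :: "real^'n \<Rightarrow> real" where "\<gamma> \<equiv> moll_prim \<rho>"

lemma \<eta>: "test_fun UNIV \<eta>" by (intro test_fun_mollifier \<rho>) auto
lemma \<gamma>: "test_fun UNIV \<gamma>" by (intro test_fun_moll_prim \<rho>) auto

definition cw :: "real \<times> (real^'n) \<Rightarrow> real" where "cw = (\<lambda>(t, z). indicator {0..1} t * t * \<gamma> z)"
definition pw :: "real \<times> (real^'n) \<Rightarrow> real^'n" where "pw = (\<lambda>(t, z). t *\<^sub>R z)"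
definition W :: "(real^'n \<Rightarrow> real) \<Rightarrow> real^'n \<Rightarrow> real" where "W f = avg lborel cw pw f"
definition conv :: "(real^'n \<Rightarrow> real) \<Rightarrow> real^'n \<Rightarrow> real" where "conv f = avg lborel \<eta> (\<lambda>z. z) f"
text \<open>\<open>W f\<close> is \<open>\<integral>\<^sub>0\<^sup>1 t (\<gamma>\<^sub>t * f) dt\<close>; \<open>Psi f\<close> transports \<open>f(y)\<close> copies of \<open>\<eta>\<close> from \<open>y\<^sub>0\<close> to
  \<open>y\<close> along the segment.\<close>

definition cP :: "(real^'n \<Rightarrow> real) \<Rightarrow> 'n \<Rightarrow> real \<times> (real^'n) \<Rightarrow> real" where
  "cP f i = (\<lambda>(s, y). - (indicator {0..1} s * (f y * (y - y0) $ i)))"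
definition pP :: "real \<times> (real^'n) \<Rightarrow> real^'n" where "pP = (\<lambda>(s, y). - y0 - s *\<^sub>R (y - y0))"
definition Psi :: "(real^'n \<Rightarrow> real) \<Rightarrow> 'n \<Rightarrow> real^'n \<Rightarrow> real" where "Psi f i = avg lborel (cP f i) pP \<eta>"

text \<open>The double integrals below share this shape: the indicator of the unit time interval, a
  compactly supported weight, and a factor that is bounded where the weight lives.\<close>

lemma strip_integrable:
  fixes g :: "real^'n \<Rightarrow> real" and F :: "real \<times> (real^'n) \<Rightarrow> real"
  assumes g: "cc_fun g" and [measurable]: "F \<in> borel_measurable borel"
    and B: "\<And>t z. 0 \<le> t \<Longrightarrow> t \<le> 1 \<Longrightarrow> g z \<noteq> 0 \<Longrightarrow> \<bar>F (t, z)\<bar> \<le> B"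
  shows "integrable lborel (\<lambda>(t, z). indicator {0..1} t * (g z * F (t, z)))"
proof -
  note [measurable] = cc_fun_measurable[OF g]
  obtain R where R: "\<And>x. R < norm x \<Longrightarrow> g x = 0" using g by (auto simp: cc_fun_def)
  obtain A where A: "0 \<le> A" "\<And>x. \<bar>g x\<bar> \<le> A" using cc_fun_bounded[OF g] by blast
  have meas: "(\<lambda>(t, z). indicator {0..1} t * (g z * F (t, z))) \<in> borel_measurable (borel \<Otimes>\<^sub>M borel)"
    unfolding case_prod_beta by measurable
  show ?thesis
  proof (rule integrable_bounded_support[where B = "A * \<bar>B\<bar>" and R = "\<bar>R\<bar> + 1"])
    show "(\<lambda>(t, z). indicator {0..1} t * (g z * F (t, z))) \<in> borel_measurable borel"
      using meas by (simp add: borel_prod)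
    fix x :: "real \<times> (real^'n)"
    obtain t z where x: "x = (t, z)" by (cases x)
    show "\<bar>case x of (t, z) \<Rightarrow> indicator {0..1} t * (g z * F (t, z))\<bar> \<le> A * \<bar>B\<bar>"
    proof (cases "0 \<le> t \<and> t \<le> 1 \<and> g z \<noteq> 0")
      case True
      then have "\<bar>g z\<bar> * \<bar>F (t, z)\<bar> \<le> A * \<bar>B\<bar>" using A B[of t z] by (intro mult_mono) auto
      then show ?thesis using True by (simp add: x abs_mult)
    qed (use A in \<open>auto simp: x\<close>)
    assume "\<bar>R\<bar> + 1 < norm x"
    then have "\<bar>R\<bar> + 1 < \<bar>t\<bar> + norm z" using norm_Pair_le[of t z] by (simp add: x)
    then have "\<not> (0 \<le> t \<and> t \<le> 1) \<or> R < norm z" by linarith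
    then show "(case x of (t, z) \<Rightarrow> indicator {0..1} t * (g z * F (t, z))) = 0"
      using R[of z] by (auto simp: x)
  qed
qed

lemma cw: "integrable lborel cw"
proof -
  have "integrable lborel (\<lambda>(t::real, z::real^'n). indicator {0..1} t * (\<gamma> z * fst (t, z)))"
  proof (rule strip_integrable[OF test_fun_cc[OF \<gamma>], of fst 1])
    show "fst \<in> borel_measurable (borel :: (real \<times> (real^'n)) measure)"
      by (intro borel_measurable_continuous_onI continuous_intros)
  qed auto
  also have "(\<lambda>(t, z). indicator {0..1} t * (\<gamma> z * fst (t, z))) = cw" by (auto simp: cw_def)
  finally show ?thesis .
qed

lemma pw: "pw \<in> borel_measurable lborel"
proof -
  have "continuous_on UNIV pw" unfolding pw_def case_prod_beta by (intro continuous_intros)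
  then show ?thesis by (simp add: borel_measurable_continuous_onI)
qed

lemma pP: "pP \<in> borel_measurable lborel"
proof -
  have "continuous_on UNIV pP" unfolding pP_def case_prod_beta by (intro continuous_intros)
  then show ?thesis by (simp add: borel_measurable_continuous_onI)
qed

lemma cP_int: assumes f: "test_fun (ball y0 \<rho>) f" shows "integrable lborel (cP f i)"
proof -
  have "integrable lborel (\<lambda>(t, z). indicator {0..1} t * (f z * (\<lambda>(s::real, y). - ((y - y0) $ i)) (t, z)))"
  proof (rule strip_integrable[OF test_fun_cc[OF f], of _ \<rho>])
    have "continuous_on UNIV (\<lambda>(s::real, y). - ((y - y0) $ i))"
      unfolding case_prod_beta by (intro continuous_intros)
    then show "(\<lambda>(s::real, y). - ((y - y0) $ i)) \<in> borel_measurable borel"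
      by (rule borel_measurable_continuous_onI)
    fix t :: real and z assume "f z \<noteq> 0"
    then have "z \<in> ball y0 \<rho>" using test_fun_outside[OF f] by blast
    then show "\<bar>case (t, z) of (s, y) \<Rightarrow> - ((y - y0) $ i)\<bar> \<le> \<rho>"
      using component_le_norm_cart[of "z - y0" i] by (simp add: dist_norm norm_minus_commute)
  qed
  also have "(\<lambda>(t, z). indicator {0..1} t * (f z * (\<lambda>(s::real, y). - ((y - y0) $ i)) (t, z))) = cP f i"
    by (auto simp: cP_def fun_eq_iff algebra_simps)
  finally show ?thesis .
qed

text \<open>On the support of f the distance to \<open>y0\<close> is below \<rho>, and the time
  interval has length 1.\<close>

lemma cP_bound:
  assumes f: "test_fun (ball y0 \<rho>) f"
  shows "(\<integral>s. \<bar>cP f i s\<bar> \<partial>lborel) \<le> \<rho> * (\<integral>x. \<bar>f x\<bar> \<partial>lborel)"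
proof -
  have i: "integrable lborel (\<lambda>(t::real, z). indicator {0..1} t * (\<bar>f z\<bar> * (\<lambda>_. \<rho>) (t, z)))"
    by (rule strip_integrable[OF cc_fun_abs[OF test_fun_cc[OF f]], of "\<lambda>_. \<rho>" \<rho>]) (use \<rho> in auto)
  have "(\<integral>s. \<bar>cP f i s\<bar> \<partial>lborel) \<le> (\<integral>s. (case s of (t::real, z) \<Rightarrow> indicator {0..1} t * (\<bar>f z\<bar> * (\<lambda>_. \<rho>) (t, z))) \<partial>lborel)"
  proof (rule Bochner_Integration.integral_mono)
    show "integrable lborel (\<lambda>s. \<bar>cP f i s\<bar>)" by (rule integrable_abs[OF cP_int[OF f]])
    show "integrable lborel (\<lambda>s. case s of (t::real, z) \<Rightarrow> indicator {0..1} t * (\<bar>f z\<bar> * (\<lambda>_. \<rho>) (t, z)))" using i by simp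
    fix x :: "real \<times> (real^'n)"
    obtain t z where x: "x = (t, z)" by (cases x)
    have "\<bar>f z\<bar> * \<bar>(z - y0) $ i\<bar> \<le> \<bar>f z\<bar> * \<rho>"
    proof (cases "f z = 0")
      case False
      then have "z \<in> ball y0 \<rho>" using test_fun_outside[OF f] by blast
      then show ?thesis
        using component_le_norm_cart[of "z - y0" i] by (intro mult_left_mono) (auto simp: dist_norm norm_minus_commute)
    qed simp
    then show "\<bar>cP f i x\<bar> \<le> (case x of (t, z) \<Rightarrow> indicator {0..1} t * (\<bar>f z\<bar> * (\<lambda>_. \<rho>) (t, z)))"
      by (auto simp: x cP_def abs_mult indicator_def)
  qed
  also have "\<dots> = (\<integral>t. \<integral>z. indicator {0..1} (t::real) * (\<bar>f z\<bar> * \<rho>) \<partial>lborel \<partial>lborel)"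
    using Fubini_lborel(1)[OF i] by simp
  also have "\<dots> = \<rho> * (\<integral>x. \<bar>f x\<bar> \<partial>lborel)" by simp
  finally show ?thesis .
qed

text \<open>The shifts t z are shorter than \<rho> wherever the weight is nonzero, so supports
  spread by at most \<rho>; hence the radius \<open>2 * \<rho>\<close>.\<close>

lemma W_test:
  assumes f: "test_fun (ball y0 \<rho>) f" and S: "cball y0 (2 * \<rho>) \<subseteq> S"
  shows "test_fun S (W f)"
  unfolding W_def
proof (rule test_fun_avg[OF cw pw f compact_cball S])
  fix x :: "real^'n" and s assume x: "x \<notin> cball y0 (2 * \<rho>)" and c: "cw s \<noteq> 0"
  obtain t z where s: "s = (t, z)" by (cases s)
  have t: "0 \<le> t" "t \<le> 1" and "\<gamma> z \<noteq> 0" using c by (auto simp: s cw_def indicator_def split: if_splits)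
  then have z: "norm z < \<rho>" using bump_eq_0[OF \<rho>, of z 0 0] by (force simp: moll_prim_def)
  have "norm (t *\<^sub>R z) \<le> norm z" using t by (simp add: mult_left_le_one_le)
  then have "x + t *\<^sub>R z \<notin> ball y0 \<rho>"
    using x z norm_triangle_ineq4[of "x + t *\<^sub>R z - y0" "t *\<^sub>R z"]
    by (simp add: dist_norm norm_minus_commute algebra_simps)
  then show "f (x + pw s) = 0" using test_fun_outside[OF f] by (simp add: s pw_def)
qed

lemma Psi_test:
  assumes f: "test_fun (ball y0 \<rho>) f" and S: "cball y0 (2 * \<rho>) \<subseteq> S"
  shows "test_fun S (Psi f i)"
  unfolding Psi_def
proof (rule test_fun_avg[OF cP_int[OF f] pP \<eta> compact_cball S])
  fix x :: "real^'n" and s assume x: "x \<notin> cball y0 (2 * \<rho>)" and c: "cP f i s \<noteq> 0"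
  obtain t y where s: "s = (t, y)" by (cases s)
  have t: "0 \<le> t" "t \<le> 1" and "f y \<noteq> 0" using c by (auto simp: s cP_def indicator_def split: if_splits)
  then have y: "norm (y - y0) < \<rho>" using test_fun_outside[OF f, of y] by (auto simp: dist_norm norm_minus_commute)
  have "norm (t *\<^sub>R (y - y0)) \<le> norm (y - y0)" using t by (simp add: mult_left_le_one_le)
  then have "x - y0 - t *\<^sub>R (y - y0) \<notin> ball 0 \<rho>"
    using x y norm_triangle_ineq2[of "x - y0" "t *\<^sub>R (y - y0)"]
    by (simp add: dist_norm norm_minus_commute)
  then show "\<eta> (x + pP s) = 0" using mollifier_eq_0[OF \<rho>, of "x - y0 - t *\<^sub>R (y - y0)" 0] by (simp add: s pP_def algebra_simps)
qed

lemma conv_eq_convolution: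
  assumes f: "cc_fun f"
  shows "(\<integral>y. f y * \<eta> (x - y) \<partial>lborel) = conv f x"
proof -
  note [measurable] = cc_fun_measurable[OF f] cc_fun_measurable[OF test_fun_cc[OF \<eta>]]
  have even: "\<eta> (- z) = \<eta> z" for z by (simp add: mollifier_def bump_def)
  have "(\<integral>y. f y * \<eta> (x - y) \<partial>lborel) = (\<integral>y. (\<lambda>y. f y * \<eta> (x - y)) (y + x) \<partial>lborel)"
    by (rule integral_translate[symmetric]) measurable
  also have "\<dots> = conv f x" by (simp add: conv_def avg_def even add.commute mult.commute)
  finally show ?thesis .
qed

text \<open>For fixed y the divergence in x of the moving copy of \<eta>, weighted with its
  velocity, is up to sign its derivative in the time s. The s-integral therefore telescopes to the
  copy at y minus the copy at \<open>y0\<close>, multiplied by \<open>f y\<close>.\<close>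

lemma div_Psi:
  assumes f: "test_fun (ball y0 \<rho>) f"
  shows "(\<Sum>i\<in>UNIV. pd i (Psi f i) x) = conv f x - (\<integral>y. f y \<partial>lborel) * mollifier y0 \<rho> x"
proof -
  have fc: "cc_fun f" using f test_fun_cc by blast
  have c1: "integrable lborel (\<lambda>s. cP f i s * pd i \<eta> (x + pP s))" for i
    by (rule avg_integrable[OF cP_int[OF f] pP test_fun_cc[OF test_fun_pd[OF \<eta>]]])
  define G where "G s = (\<Sum>i\<in>UNIV. cP f i s * pd i \<eta> (x + pP s))" for s
  have Gi: "integrable lborel G" unfolding G_def using c1 by auto
  have "(\<Sum>i\<in>UNIV. pd i (Psi f i) x) = (\<Sum>i\<in>UNIV. \<integral>s. cP f i s * pd i \<eta> (x + pP s) \<partial>lborel)"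
    unfolding Psi_def pd_avg[OF cP_int[OF f] pP \<eta>] avg_def ..
  also have "\<dots> = (\<integral>s. G s \<partial>lborel)" unfolding G_def using c1 by (simp add: Bochner_Integration.integral_sum)
  also have "\<dots> = (\<integral>y. \<integral>s. G (s, y) \<partial>lborel \<partial>lborel)" by (rule Fubini_lborel(2)[OF Gi, symmetric])
  also have "\<dots> = (\<integral>y. f y * \<eta> (x - y) - f y * \<eta> (x - y0) \<partial>lborel)"
  proof (intro Bochner_Integration.integral_cong refl)
    fix y
    have "(\<integral>s. indicator {0..1} s * (\<Sum>j\<in>UNIV. (y0 - y) $ j * pd j \<eta> (x - y0 + s *\<^sub>R (y0 - y))) \<partial>lborel)
       = \<eta> (x - y0 + 1 *\<^sub>R (y0 - y)) - \<eta> (x - y0)"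
      by (rule line_FTC[OF test_fun_smooth[OF \<eta>]]) simp
    moreover have "G (s, y) = f y * (indicator {0..1} s * (\<Sum>j\<in>UNIV. (y0 - y) $ j * pd j \<eta> (x - y0 + s *\<^sub>R (y0 - y))))" for s
    proof -
      have "x + pP (s, y) = x - y0 + s *\<^sub>R (y0 - y)" by (simp add: pP_def algebra_simps)
      note e = this
      show ?thesis unfolding G_def sum_distrib_left e
        by (intro sum.cong refl) (simp add: cP_def algebra_simps)
    qed
    ultimately show "(\<integral>s. G (s, y) \<partial>lborel) = f y * \<eta> (x - y) - f y * \<eta> (x - y0)"
      by (simp add: right_diff_distrib)
  qed
  also have "\<dots> = (\<integral>y. f y * \<eta> (x - y) \<partial>lborel) - (\<integral>y. f y * \<eta> (x - y0) \<partial>lborel)"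
  proof (intro Bochner_Integration.integral_diff)
    show "integrable lborel (\<lambda>y. f y * \<eta> (x - y0))" using cc_fun_integrable[OF fc] by simp
    have "continuous_on UNIV (\<lambda>y. \<eta> (x - y))"
      by (rule continuous_on_compose2[OF cc_fun_cont[OF test_fun_cc[OF \<eta>], of UNIV]]) (auto intro!: continuous_intros)
    then have "cc_fun (\<lambda>y. \<eta> (x - y) * f y)" by (rule cc_fun_mult_left[OF fc])
    then show "integrable lborel (\<lambda>y. f y * \<eta> (x - y))" using cc_fun_integrable by (simp add: mult.commute)
  qed
  also have "\<dots> = conv f x - (\<integral>y. f y \<partial>lborel) * mollifier y0 \<rho> x"
    by (simp add: conv_eq_convolution[OF fc] mollifier_shift[of y0])
  finally show ?thesis .
qed

text \<open>The inner derivative of z \<mapsto> x + t z supplies the factor t, and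
  \<open>pd_moll_prim\<close> turns the derivative of \<gamma> into -z \<eta>.\<close>

lemma ibp_affine:
  assumes f: "smooth f"
  shows "t * (\<integral>z. \<gamma> z * pd i f (x + t *\<^sub>R z) \<partial>lborel) = (\<integral>z. \<eta> z * (z $ i * f (x + t *\<^sub>R z)) \<partial>lborel)"
proof -
  have fs: "smooth (\<lambda>z. f (x + t *\<^sub>R z))" by (rule smooth_affine[OF f])
  have "(\<integral>z. f (x + t *\<^sub>R z) * pd i \<gamma> z \<partial>lborel) = - (\<integral>z. pd i (\<lambda>z. f (x + t *\<^sub>R z)) z * \<gamma> z \<partial>lborel)"
    by (rule integral_by_parts[OF fs \<gamma>])
  also have "\<dots> = - (\<integral>z. t * (\<gamma> z * pd i f (x + t *\<^sub>R z)) \<partial>lborel)"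
    by (simp add: pd_affine[OF smooth_differentiable[OF f]] mult_ac)
  also have "\<dots> = - (t * (\<integral>z. \<gamma> z * pd i f (x + t *\<^sub>R z) \<partial>lborel))" by simp
  finally have "t * (\<integral>z. \<gamma> z * pd i f (x + t *\<^sub>R z) \<partial>lborel) = (\<integral>z. - (f (x + t *\<^sub>R z) * pd i \<gamma> z) \<partial>lborel)" by simp
  then show ?thesis by (simp add: pd_moll_prim mult_ac)
qed

text \<open>Integration by parts in z trades \<open>t * \<gamma>\<close> and one derivative for z
  times \<eta>, which turns the Laplacian into the t-derivative of f (x + t z); the fundamental
  theorem of calculus finishes. Behind this stands that \<eta> is radial with mass 1, so that \<eta>
  minus a point mass is the Laplacian of something compactly supported.\<close>

lemma lap_W:
  assumes f: "test_fun S f"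
  shows "lap (W f) x = conv f x - f x"
proof -
  have fc: "cc_fun f" using f test_fun_cc by blast
  have pf: "test_fun S (pd k f)" for k by (rule test_fun_pd[OF f])
  have ppf: "test_fun S (pd k (pd k f))" for k by (rule test_fun_pd[OF pf])
  have ci: "integrable lborel (\<lambda>s. cw s * pd k (pd k f) (x + pw s))" for k
    by (rule avg_integrable[OF cw pw test_fun_cc[OF ppf]])
  define H where "H s = (\<Sum>k\<in>UNIV. cw s * pd k (pd k f) (x + pw s))" for s
  have Hi: "integrable lborel H" unfolding H_def using ci by auto
  have "lap (W f) x = (\<Sum>k\<in>UNIV. \<integral>s. cw s * pd k (pd k f) (x + pw s) \<partial>lborel)"
    unfolding lap_def W_def pd_avg[OF cw pw f] pd_avg[OF cw pw pf] avg_def ..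
  also have "\<dots> = (\<integral>s. H s \<partial>lborel)" unfolding H_def using ci by (simp add: Bochner_Integration.integral_sum)
  also have "\<dots> = (\<integral>t. \<integral>z. H (t, z) \<partial>lborel \<partial>lborel)" by (rule Fubini_lborel(1)[OF Hi, symmetric])
  finally have 1: "lap (W f) x = (\<integral>t. \<integral>z. H (t, z) \<partial>lborel \<partial>lborel)" .
  define A where "A t z = indicator {0..1} (t::real) * (\<eta> z * (\<Sum>i\<in>UNIV. z $ i * pd i f (x + t *\<^sub>R z)))" for t z
  have HA: "(\<integral>z. H (t, z) \<partial>lborel) = (\<integral>z. A t z \<partial>lborel)" for t
  proof -
    have g: "continuous_on UNIV (\<lambda>z. u (x + t *\<^sub>R z))" if "smooth u" for u
      by (rule smooth_continuous[OF smooth_affine[OF that]])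
    have i1: "integrable lborel (\<lambda>z. \<gamma> z * pd k (pd k f) (x + t *\<^sub>R z))" for k
      using cc_fun_integrable[OF cc_fun_mult_left[OF test_fun_cc[OF \<gamma>] g[OF smooth_pd[OF smooth_pd[OF test_fun_smooth[OF f]]]]]]
      by (simp add: mult.commute)
    have i2: "integrable lborel (\<lambda>z. \<eta> z * (z $ k * pd k f (x + t *\<^sub>R z)))" for k
    proof -
      have "continuous_on UNIV (\<lambda>z. z $ k * pd k f (x + t *\<^sub>R z))"
        by (intro continuous_intros g smooth_pd test_fun_smooth[OF f])
      from cc_fun_integrable[OF cc_fun_mult_left[OF test_fun_cc[OF \<eta>] this]] show ?thesis by (simp add: mult.commute)
    qed
    have "(\<integral>z. H (t, z) \<partial>lborel) = (\<integral>z. indicator {0..1} t * (t * (\<Sum>k\<in>UNIV. \<gamma> z * pd k (pd k f) (x + t *\<^sub>R z))) \<partial>lborel)"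
      by (intro Bochner_Integration.integral_cong refl) (simp add: H_def cw_def pw_def sum_distrib_left mult_ac)
    also have "\<dots> = indicator {0..1} t * (\<Sum>k\<in>UNIV. t * (\<integral>z. \<gamma> z * pd k (pd k f) (x + t *\<^sub>R z) \<partial>lborel))"
      using i1 by (simp add: Bochner_Integration.integral_sum sum_distrib_left)
    also have "\<dots> = indicator {0..1} t * (\<Sum>k\<in>UNIV. \<integral>z. \<eta> z * (z $ k * pd k f (x + t *\<^sub>R z)) \<partial>lborel)"
      by (simp only: ibp_affine[OF smooth_pd[OF test_fun_smooth[OF f]]])
    also have "\<dots> = (\<integral>z. indicator {0..1} t * (\<Sum>k\<in>UNIV. \<eta> z * (z $ k * pd k f (x + t *\<^sub>R z))) \<partial>lborel)"
      using i2 by (simp add: Bochner_Integration.integral_sum)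
    also have "\<dots> = (\<integral>z. A t z \<partial>lborel)" by (simp add: A_def sum_distrib_left)
    finally show ?thesis .
  qed
  have Ai: "integrable lborel (\<lambda>(t, z). A t z)"
  proof -
    define F where "F = (\<lambda>(t, z). \<Sum>i\<in>UNIV. z $ i * pd i f (x + t *\<^sub>R z))"
    have "\<exists>b. \<forall>y. \<bar>pd i f y\<bar> \<le> b" for i
      using cc_fun_bounded[OF test_fun_cc[OF pf[of i]]] by blast
    then obtain B where B: "\<And>i y. \<bar>pd i f y\<bar> \<le> B i" by metis
    have "integrable lborel (\<lambda>(t, z). indicator {0..1} t * (\<eta> z * F (t, z)))"
    proof (rule strip_integrable[OF test_fun_cc[OF \<eta>], of F "\<Sum>i\<in>UNIV. \<rho> * B i"])
      have "continuous_on UNIV (\<lambda>p. pd i f (x + fst p *\<^sub>R snd p))" for i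
        by (rule continuous_on_compose2[OF smooth_continuous[OF test_fun_smooth[OF pf], of UNIV]]) (auto intro!: continuous_intros)
      then have "continuous_on UNIV F" unfolding F_def case_prod_beta by (intro continuous_intros)
      then show "F \<in> borel_measurable borel" by (rule borel_measurable_continuous_onI)
      fix t :: real and z assume "\<eta> z \<noteq> 0"
      then have "norm z < \<rho>" using mollifier_eq_0[OF \<rho>, of z 0] by force
      then have z: "\<bar>z $ i\<bar> \<le> \<rho>" for i using component_le_norm_cart[of z i] by linarith
      have "\<bar>\<Sum>i\<in>UNIV. z $ i * pd i f (x + t *\<^sub>R z)\<bar> \<le> (\<Sum>i\<in>UNIV. \<rho> * B i)"
        using z B \<rho> by (intro order_trans[OF sum_abs] sum_mono) (auto simp: abs_mult intro!: mult_mono)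
      then show "\<bar>F (t, z)\<bar> \<le> (\<Sum>i\<in>UNIV. \<rho> * B i)" by (simp add: F_def)
    qed
    then show ?thesis by (simp add: A_def F_def)
  qed
  have "lap (W f) x = (\<integral>t. \<integral>z. A t z \<partial>lborel \<partial>lborel)" unfolding 1 HA ..
  also have "\<dots> = (\<integral>z. \<integral>t. A t z \<partial>lborel \<partial>lborel)"
    using Fubini_lborel[OF Ai] by simp
  also have "\<dots> = (\<integral>z. \<eta> z * f (x + z) - \<eta> z * f x \<partial>lborel)"
  proof (intro Bochner_Integration.integral_cong refl)
    fix z
    have "(\<integral>s. indicator {0..1} s * (\<Sum>j\<in>UNIV. z $ j * pd j f (x + s *\<^sub>R z)) \<partial>lborel) = f (x + 1 *\<^sub>R z) - f x"
      by (rule line_FTC[OF test_fun_smooth[OF f]]) simp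
    then have "\<eta> z * (\<integral>s. indicator {0..1} s * (\<Sum>j\<in>UNIV. z $ j * pd j f (x + s *\<^sub>R z)) \<partial>lborel) = \<eta> z * f (x + z) - \<eta> z * f x"
      by (simp add: right_diff_distrib)
    then show "(\<integral>t. A t z \<partial>lborel) = \<eta> z * f (x + z) - \<eta> z * f x"
      unfolding A_def by (simp add: mult.left_commute)
  qed
  also have "\<dots> = (\<integral>z. \<eta> z * f (x + z) \<partial>lborel) - (\<integral>z. \<eta> z * f x \<partial>lborel)"
    using avg_integrable[OF cc_fun_integrable[OF test_fun_cc[OF \<eta>]] _ fc, of "\<lambda>z. z" x] cc_fun_integrable[OF test_fun_cc[OF \<eta>]]
    by (intro Bochner_Integration.integral_diff) auto
  also have "\<dots> = conv f x - f x"
    using integral_mollifier[OF \<rho>, of "0::real^'n"] by (simp add: conv_def avg_def)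
  finally show ?thesis .
qed

end

text \<open>The field is the transport field minus the gradient of \<open>W f\<close>; the
  convolution terms cancel in its divergence. Second derivatives of \<open>W f\<close> come from
  \<open>calderon_zygmund\<close>, first ones from \<open>poincare\<close>, and the transport part
  from \<open>avg_Lr\<close>, since its weights have mass at most \<rho> times the integral of
  \<open>\<bar>f\<bar>\<close>.\<close>

theorem local_divergence:
  fixes y0 :: "real^'n::finite"
  assumes r: "1 < r" and \<rho>: "0 < \<rho>" and S: "cball y0 (2 * \<rho>) \<subseteq> S"
  obtains C where "0 \<le> C" "\<And>f. test_fun (ball y0 \<rho>) f \<Longrightarrow>
    \<exists>\<psi>. (\<forall>i. test_fun S (\<psi> i)) \<and> (\<forall>x. (\<Sum>i\<in>UNIV. pd i (\<psi> i) x) = f x - (\<integral>y. f y \<partial>lborel) * mollifier y0 \<rho> x)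
      \<and> (\<forall>i. (\<integral>x. \<bar>\<psi> i x\<bar> powr r \<partial>lborel) \<le> C * (\<integral>x. \<bar>f x\<bar> powr r \<partial>lborel))
      \<and> (\<forall>i j. (\<integral>x. \<bar>pd j (\<psi> i) x\<bar> powr r \<partial>lborel) \<le> C * (\<integral>x. \<bar>f x\<bar> powr r \<partial>lborel))"
proof -
  interpret local_div y0 \<rho> by standard (rule \<rho>)
  obtain C0 where C0: "0 \<le> C0" "\<And>(w :: real^'n \<Rightarrow> real) i j. test_fun UNIV w \<Longrightarrow>
    (\<integral>x. \<bar>pd j (pd i w) x\<bar> powr r \<partial>lborel) \<le> C0 * (\<integral>x. \<bar>lap w x\<bar> powr r \<partial>lborel)"
    using calderon_zygmund[OF r] by metis
  \<comment> \<open>C1 serves the second derivatives of \<open>W f\<close>, C2 the first ones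
    through the Poincare constant of a ball of radius \<open>2 * \<rho>\<close>. V converts the r-th
    power of the mass of the transport weights into the integral of
    \<open>\<bar>f\<bar> powr r\<close>, and E collects the norms of \<eta> and its
    derivatives.\<close>
  define C1 where "C1 = C0 * (2 powr r * 2)"
  define C2 where "C2 = (4 * \<rho> + 1) powr r * C1"
  define V where "V = \<rho> powr r * measure lborel (cball y0 \<rho>) powr (r - 1)"
  define E where "E = (\<integral>x. \<bar>\<eta> x\<bar> powr r \<partial>lborel) + (\<Sum>j\<in>UNIV. \<integral>x. \<bar>pd j \<eta> x\<bar> powr r \<partial>lborel)"
  define C where "C = 2 powr r * (C1 + C2 + V * E)"
  have E: "(\<integral>x. \<bar>\<eta> x\<bar> powr r \<partial>lborel) \<le> E" "(\<integral>x. \<bar>pd j \<eta> x\<bar> powr r \<partial>lborel) \<le> E" for j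
  proof -
    have "(\<integral>x. \<bar>pd j \<eta> x\<bar> powr r \<partial>lborel) \<le> (\<Sum>j\<in>UNIV. \<integral>x. \<bar>pd j \<eta> x\<bar> powr r \<partial>lborel)"
      by (rule member_le_sum) auto
    moreover have "0 \<le> (\<Sum>j\<in>UNIV. \<integral>x. \<bar>pd j \<eta> x\<bar> powr r \<partial>lborel)" "0 \<le> (\<integral>x. \<bar>\<eta> x\<bar> powr r \<partial>lborel)"
      by (auto intro!: sum_nonneg)
    ultimately show "(\<integral>x. \<bar>\<eta> x\<bar> powr r \<partial>lborel) \<le> E" "(\<integral>x. \<bar>pd j \<eta> x\<bar> powr r \<partial>lborel) \<le> E" unfolding E_def by linarith+
  qed
  have E0: "0 \<le> E" by (rule order_trans[OF _ E(1)]) simp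
  have nn: "0 \<le> C1" "0 \<le> C2" "0 \<le> V" using C0(1) by (auto simp: C1_def C2_def V_def)
  have sumr: "(\<integral>x. \<bar>a x + b x\<bar> powr r \<partial>lborel) \<le> 2 powr r * ((\<integral>x. \<bar>a x\<bar> powr r \<partial>lborel) + (\<integral>x. \<bar>b x\<bar> powr r \<partial>lborel))"
    if "cc_fun a" "cc_fun b" for a b :: "real^'n \<Rightarrow> real"
  proof -
    have i: "integrable lborel (\<lambda>x. \<bar>a x\<bar> powr r)" "integrable lborel (\<lambda>x. \<bar>b x\<bar> powr r)" "integrable lborel (\<lambda>x. \<bar>a x + b x\<bar> powr r)"
      using that r by (auto intro!: cc_fun_integrable cc_fun_powr cc_fun_add)
    have "(\<integral>x. \<bar>a x + b x\<bar> powr r \<partial>lborel) \<le> (\<integral>x. 2 powr r * (\<bar>a x\<bar> powr r + \<bar>b x\<bar> powr r) \<partial>lborel)"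
      using i by (intro integral_mono abs_powr_add_le[OF r]) auto
    then show ?thesis using i by simp
  qed
  have main: "\<exists>\<psi>. (\<forall>i. test_fun S (\<psi> i)) \<and> (\<forall>x. (\<Sum>i\<in>UNIV. pd i (\<psi> i) x) = f x - (\<integral>y. f y \<partial>lborel) * mollifier y0 \<rho> x)
      \<and> (\<forall>i. (\<integral>x. \<bar>\<psi> i x\<bar> powr r \<partial>lborel) \<le> C * (\<integral>x. \<bar>f x\<bar> powr r \<partial>lborel))
      \<and> (\<forall>i j. (\<integral>x. \<bar>pd j (\<psi> i) x\<bar> powr r \<partial>lborel) \<le> C * (\<integral>x. \<bar>f x\<bar> powr r \<partial>lborel))"
    if f: "test_fun (ball y0 \<rho>) f" for f
  proof -
    define I where "I = (\<integral>x. \<bar>f x\<bar> powr r \<partial>lborel)"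
    have I0: "0 \<le> I" by (simp add: I_def)
    have fc: "cc_fun f" using f test_fun_cc by blast
    have w: "test_fun (cball y0 (2 * \<rho>)) (W f)" by (rule W_test[OF f order_refl])
    have p: "test_fun (cball y0 (2 * \<rho>)) (Psi f i)" for i by (rule Psi_test[OF f order_refl])
    have \<eta>i: "integrable lborel \<eta>" by (intro cc_fun_integrable test_fun_cc[OF \<eta>])
    have "conv f = (\<lambda>x. lap (W f) x + f x)" using lap_W[OF f] by auto
    moreover have "cc_fun (\<lambda>x. lap (W f) x + f x)"
      unfolding lap_def by (intro cc_fun_add cc_fun_sum test_fun_cc[OF test_fun_pd[OF test_fun_pd[OF w]]] fc)
    ultimately have cc: "cc_fun (conv f)" by simp
    have "(\<integral>x. \<bar>conv f x\<bar> powr r \<partial>lborel) \<le> (\<integral>z. \<bar>\<eta> z\<bar> \<partial>lborel) powr r * I"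
      unfolding conv_def I_def
      by (rule avg_Lr[OF r lborel.sigma_finite_measure_axioms \<eta>i _ fc cc[unfolded conv_def]]) simp
    also have "(\<integral>z. \<bar>\<eta> z\<bar> \<partial>lborel) = 1"
      using integral_mollifier[OF \<rho>, of "0::real^'n"] by (simp add: mollifier_nonneg[OF \<rho>])
    finally have cI: "(\<integral>x. \<bar>conv f x\<bar> powr r \<partial>lborel) \<le> I" by simp
    have "(\<integral>x. \<bar>lap (W f) x\<bar> powr r \<partial>lborel) = (\<integral>x. \<bar>conv f x + (- 1) * f x\<bar> powr r \<partial>lborel)"
      by (simp add: lap_W[OF f])
    also have "\<dots> \<le> 2 powr r * ((\<integral>x. \<bar>conv f x\<bar> powr r \<partial>lborel) + (\<integral>x. \<bar>(- 1) * f x\<bar> powr r \<partial>lborel))"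
      by (intro sumr cc cc_fun_cmult fc)
    also have "\<dots> \<le> 2 powr r * (I + I)" using cI by (intro mult_left_mono) (auto simp: I_def)
    finally have lI: "(\<integral>x. \<bar>lap (W f) x\<bar> powr r \<partial>lborel) \<le> 2 powr r * 2 * I" by simp
    have D2: "(\<integral>x. \<bar>pd j (pd i (W f)) x\<bar> powr r \<partial>lborel) \<le> C1 * I" for i j
    proof -
      have "(\<integral>x. \<bar>pd j (pd i (W f)) x\<bar> powr r \<partial>lborel) \<le> C0 * (\<integral>x. \<bar>lap (W f) x\<bar> powr r \<partial>lborel)"
        by (rule C0(2)) (rule test_fun_mono[OF w], simp)
      also have "\<dots> \<le> C0 * (2 powr r * 2 * I)" by (rule mult_left_mono[OF lI C0(1)])
      finally show ?thesis by (simp add: C1_def mult.assoc)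
    qed
    have D1: "(\<integral>x. \<bar>pd i (W f) x\<bar> powr r \<partial>lborel) \<le> C2 * I" for i
    proof -
      have "(\<integral>x. \<bar>pd i (W f) x\<bar> powr r \<partial>lborel) \<le> (2 * (2 * \<rho>) + 1) powr r * (\<integral>x. \<bar>pd i (pd i (W f)) x\<bar> powr r \<partial>lborel)"
        by (rule poincare[OF r test_fun_pd[OF w]]) (use \<rho> test_fun_outside[OF test_fun_pd[OF w]] in auto)
      also have "\<dots> \<le> (2 * (2 * \<rho>) + 1) powr r * (C1 * I)" by (intro mult_left_mono D2) auto
      finally show ?thesis by (simp add: C2_def mult.assoc)
    qed
    have P: "(\<integral>x. \<bar>avg lborel (cP f i) pP u x\<bar> powr r \<partial>lborel) \<le> V * E * I"
      if u: "cc_fun u" "cc_fun (avg lborel (cP f i) pP u)" "(\<integral>x. \<bar>u x\<bar> powr r \<partial>lborel) \<le> E" for u i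
    proof -
      have "(\<integral>x. \<bar>avg lborel (cP f i) pP u x\<bar> powr r \<partial>lborel) \<le> (\<integral>s. \<bar>cP f i s\<bar> \<partial>lborel) powr r * (\<integral>x. \<bar>u x\<bar> powr r \<partial>lborel)"
        by (rule avg_Lr[OF r lborel.sigma_finite_measure_axioms cP_int[OF f] pP u(1,2)])
      also have "\<dots> \<le> (V * I) * E"
      proof (intro mult_mono u(3))
        have "(\<integral>s. \<bar>cP f i s\<bar> \<partial>lborel) powr r \<le> (\<rho> * (\<integral>x. \<bar>f x\<bar> \<partial>lborel)) powr r"
          using r by (intro powr_mono2 cP_bound[OF f]) auto
        also have "\<dots> = \<rho> powr r * (\<integral>x. \<bar>f x\<bar> \<partial>lborel) powr r" using \<rho> by (simp add: powr_mult)
        also have "\<dots> \<le> \<rho> powr r * (measure lborel (cball y0 \<rho>) powr (r - 1) * I)"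
          unfolding I_def using test_fun_outside[OF f] by (intro mult_left_mono jensen_ball[OF r fc]) auto
        finally show "(\<integral>s. \<bar>cP f i s\<bar> \<partial>lborel) powr r \<le> V * I" by (simp add: V_def mult.assoc)
      qed (use nn I0 in auto)
      finally show ?thesis by (simp add: mult_ac)
    qed
    have P0: "(\<integral>x. \<bar>Psi f i x\<bar> powr r \<partial>lborel) \<le> V * E * I" for i
      unfolding Psi_def by (rule P) (use test_fun_cc[OF \<eta>] test_fun_cc[OF p[of i]] E in \<open>auto simp: Psi_def\<close>)
    have P1: "(\<integral>x. \<bar>pd j (Psi f i) x\<bar> powr r \<partial>lborel) \<le> V * E * I" for i j
      using P[of "pd j \<eta>" i] test_fun_cc[OF test_fun_pd[OF \<eta>], of j] test_fun_cc[OF test_fun_pd[OF p[of i]], of j] E(2)[of j]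
      unfolding Psi_def pd_avg[OF cP_int[OF f] pP \<eta>] by simp
    define \<psi> where "\<psi> i x = (- 1) * pd i (W f) x + 1 * Psi f i x" for i x
    have \<psi>: "test_fun S (\<psi> i)" for i unfolding \<psi>_def
      using test_fun_mono[OF test_fun_pd[OF w] S] test_fun_mono[OF p S] by (rule test_fun_lincomb)
    have pd\<psi>: "pd j (\<psi> i) x = (- 1) * pd j (pd i (W f)) x + pd j (Psi f i) x" for i j x
      unfolding \<psi>_def[abs_def]
      using test_fun_differentiable[OF test_fun_pd[OF w]] test_fun_differentiable[OF p]
      by (simp add: pd_diff)
    have bd: "2 powr r * (a + V * E * I) \<le> C * I" if "a \<le> C1 * I \<or> a \<le> C2 * I" for a
    proof -
      have "a \<le> C1 * I + C2 * I" using that nn I0 by (smt (verit) mult_nonneg_nonneg)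
      then have "a + V * E * I \<le> (C1 + C2 + V * E) * I" by (simp add: distrib_right)
      then show ?thesis unfolding C_def mult.assoc by (intro mult_left_mono) (auto simp: mult.assoc)
    qed
    have "(\<integral>x. \<bar>\<psi> i x\<bar> powr r \<partial>lborel) \<le> C * I" for i
    proof -
      have "(\<integral>x. \<bar>\<psi> i x\<bar> powr r \<partial>lborel) \<le> 2 powr r * ((\<integral>x. \<bar>(- 1) * pd i (W f) x\<bar> powr r \<partial>lborel) + (\<integral>x. \<bar>1 * Psi f i x\<bar> powr r \<partial>lborel))"
        unfolding \<psi>_def by (intro sumr cc_fun_cmult test_fun_cc[OF test_fun_pd[OF w]] test_fun_cc[OF p])
      also have "\<dots> \<le> 2 powr r * ((\<integral>x. \<bar>pd i (W f) x\<bar> powr r \<partial>lborel) + V * E * I)"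
        using P0[of i] by (intro mult_left_mono) auto
      also have "\<dots> \<le> C * I" by (rule bd) (use D1 in blast)
      finally show ?thesis .
    qed
    moreover have "(\<integral>x. \<bar>pd j (\<psi> i) x\<bar> powr r \<partial>lborel) \<le> C * I" for i j
    proof -
      have "(\<integral>x. \<bar>pd j (\<psi> i) x\<bar> powr r \<partial>lborel) \<le> 2 powr r * ((\<integral>x. \<bar>(- 1) * pd j (pd i (W f)) x\<bar> powr r \<partial>lborel) + (\<integral>x. \<bar>pd j (Psi f i) x\<bar> powr r \<partial>lborel))"
        unfolding pd\<psi> by (intro sumr cc_fun_cmult test_fun_cc[OF test_fun_pd[OF test_fun_pd[OF w]]] test_fun_cc[OF test_fun_pd[OF p]])
      also have "\<dots> \<le> 2 powr r * ((\<integral>x. \<bar>pd j (pd i (W f)) x\<bar> powr r \<partial>lborel) + V * E * I)"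
        using P1[of j i] by (intro mult_left_mono) auto
      also have "\<dots> \<le> C * I" by (rule bd) (use D2 in blast)
      finally show ?thesis .
    qed
    moreover have "(\<Sum>i\<in>UNIV. pd i (\<psi> i) x) = f x - (\<integral>y. f y \<partial>lborel) * mollifier y0 \<rho> x" for x
    proof -
      have "(\<Sum>i\<in>UNIV. pd i (\<psi> i) x) = - lap (W f) x + (\<Sum>i\<in>UNIV. pd i (Psi f i) x)"
        by (simp add: pd\<psi> lap_def sum.distrib sum_negf sum_subtractf)
      then show ?thesis by (simp add: lap_W[OF f] div_Psi[OF f])
    qed
    ultimately show ?thesis using \<psi> unfolding I_def by blast
  qed
  have "0 \<le> C" using nn E0 by (simp add: C_def)
  then show thesis using main that by blast
qed

section \<open>Partitions of unity and the fundamental lemma\<close>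

text \<open>Bumps of half the radius have compact support inside the given balls. The bound by 1 off
  K lets the sum double as a cutoff function.\<close>

lemma smooth_partition:
  fixes K :: "(real^'n::finite) set"
  assumes K: "compact K" and \<rho>: "\<And>x. x \<in> K \<Longrightarrow> 0 < \<rho> x"
  obtains F g where "finite F" "F \<subseteq> K" "\<And>x. x \<in> F \<Longrightarrow> test_fun (ball x (\<rho> x)) (g x)"
    "\<And>x y. 0 \<le> g x y" "\<And>y. y \<in> K \<Longrightarrow> (\<Sum>x\<in>F. g x y) = 1" "\<And>y. (\<Sum>x\<in>F. g x y) \<le> 1"
proof -
  obtain F where F: "finite F" "F \<subseteq> K" "K \<subseteq> (\<Union>x\<in>F. ball x (\<rho> x / 2))"
  proof -
    have "K \<subseteq> (\<Union>x\<in>K. ball x (\<rho> x / 2))" using \<rho> by force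
    then show thesis using that compactE_image[OF K, of K "\<lambda>x. ball x (\<rho> x / 2)"] by (metis open_ball)
  qed
  have \<rho>F: "0 < \<rho> x / 2" if "x \<in> F" for x using \<rho> F that by auto
  define b where "b x = bump 0 x (\<rho> x / 2)" for x
  define S where "S y = (\<Sum>x\<in>F. b x y)" for y
  have b0: "0 \<le> b x y" for x y by (simp add: b_def bump_nonneg)
  have S0: "0 \<le> S y" for y unfolding S_def by (intro sum_nonneg b0)
  have bS: "smooth (b x)" for x unfolding b_def by (rule smooth_bump)
  have SS: "smooth S" unfolding S_def[abs_def] by (intro smooth_sum bS)
  have Spos: "0 < S y" if y: "y \<in> K" for y
  proof -
    obtain x where x: "x \<in> F" "y \<in> ball x (\<rho> x / 2)" using F y by blast
    then have "0 < b x y" unfolding b_def using bump_pos_iff[OF \<rho>F] by blast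
    also have "b x y \<le> S y" unfolding S_def using x F b0 by (intro member_le_sum) auto
    finally show ?thesis .
  qed
  obtain m where m: "0 < m" "\<And>y. y \<in> K \<Longrightarrow> m \<le> S y"
  proof (cases "K = {}")
    case True then show thesis using that[of 1] by auto
  next
    case False
    obtain z where "z \<in> K" "\<forall>y\<in>K. S z \<le> S y"
      using continuous_attains_inf[OF K False smooth_continuous[OF SS]] by blast
    then show thesis using that[of "S z"] Spos by blast
  qed
  \<comment> \<open>S may vanish off K, so it cannot serve as denominator. The added term is zero
    exactly where \<open>S y \<ge> m\<close>, in particular on K, and positive elsewhere; hence D is
    smooth and positive everywhere and equals S on K.\<close>
  define D where "D y = S y + flat_exp 0 (m - S y)" for y
  have Dpos: "0 < D y" for y
  proof (cases "S y < m")
    case True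
    then show ?thesis unfolding D_def using S0[of y] flat_exp_pos_iff[of 0 "m - S y"] by linarith
  next
    case False
    then show ?thesis unfolding D_def using m flat_exp_nonneg[of 0 "m - S y"] by linarith
  qed
  have DS: "smooth D" unfolding D_def[abs_def] by (intro smooth_add SS smooth_flat_exp smooth_diff smooth_const)
  have Dne: "D y \<noteq> 0" for y using Dpos[of y] by simp
  define g where "g x y = inverse (D y) * b x y" for x y
  have gsum: "(\<Sum>x\<in>F. g x y) = S y / D y" for y by (simp add: g_def S_def sum_distrib_left[symmetric] divide_inverse mult.commute)
  show thesis
  proof (rule that[OF F(1,2), of g])
    fix x assume x: "x \<in> F"
    have "test_fun (ball x (\<rho> x)) (b x)" unfolding b_def using \<rho>F[OF x] by (intro test_fun_bump) auto
    then show "test_fun (ball x (\<rho> x)) (g x)" unfolding g_def[abs_def]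
      by (intro test_fun_mult_left smooth_inverse DS Dne)
  next
    show "0 \<le> g x y" for x y using b0[of x y] Dpos[of y] by (simp add: g_def)
    show "(\<Sum>x\<in>F. g x y) = 1" if "y \<in> K" for y
    proof -
      have "flat_exp 0 (m - S y) = 0" using m(2)[OF that] by (simp add: flat_exp_def)
      then have "D y = S y" by (simp add: D_def)
      then show ?thesis unfolding gsum using Dne[of y] by simp
    qed
    show "(\<Sum>x\<in>F. g x y) \<le> 1" for y
      unfolding gsum using Dpos[of y] flat_exp_nonneg[of 0 "m - S y"] by (simp add: D_def)
  qed
qed

lemma test_partition:
  fixes f :: "real^'n::finite \<Rightarrow> real"
  assumes f: "test_fun \<Omega> f" and \<rho>: "\<And>x. x \<in> \<Omega> \<Longrightarrow> 0 < \<rho> x"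
  obtains F g where "finite F" "F \<subseteq> \<Omega>" "\<And>x. x \<in> F \<Longrightarrow> test_fun (ball x (\<rho> x)) (g x)" "f = (\<lambda>y. \<Sum>x\<in>F. g x y)"
proof -
  obtain K where K: "compact K" "K \<subseteq> \<Omega>" "\<And>x. x \<notin> K \<Longrightarrow> f x = 0" using f by (auto simp: test_fun_def)
  have \<rho>K: "\<And>x. x \<in> K \<Longrightarrow> 0 < \<rho> x" using \<rho> K(2) by blast
  obtain F g where Fg: "finite F" "F \<subseteq> K" "\<And>x. x \<in> F \<Longrightarrow> test_fun (ball x (\<rho> x)) (g x)"
    "\<And>x y. 0 \<le> g x y" "\<And>y. y \<in> K \<Longrightarrow> (\<Sum>x\<in>F. g x y) = 1" "\<And>y. (\<Sum>x\<in>F. g x y) \<le> 1"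
    by (rule smooth_partition[where \<rho> = \<rho>, OF K(1) \<rho>K], assumption) (rule that; assumption)
  show thesis
  proof (rule that[of F "\<lambda>x y. f y * g x y"])
    show "test_fun (ball x (\<rho> x)) (\<lambda>y. f y * g x y)" if "x \<in> F" for x
      by (rule test_fun_mult_left[OF test_fun_smooth[OF f] Fg(3)[OF that]])
    show "f = (\<lambda>y. \<Sum>x\<in>F. f y * g x y)"
    proof
      fix y show "f y = (\<Sum>x\<in>F. f y * g x y)"
        unfolding sum_distrib_left[symmetric] using Fg(5)[of y] K(3)[of y] by (cases "y \<in> K") auto
    qed
  qed (use Fg K in auto)
qed

lemma smooth_urysohn:
  fixes K :: "(real^'n::finite) set"
  assumes K: "compact K" and U: "open U" "K \<subseteq> U"
  obtains \<phi> where "test_fun U \<phi>" "\<And>x. 0 \<le> \<phi> x" "\<And>x. \<phi> x \<le> 1" "\<And>x. x \<in> K \<Longrightarrow> \<phi> x = 1"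
proof -
  have "\<forall>x\<in>K. \<exists>e>0. ball x e \<subseteq> U" using U by (meson openE subsetD)
  then obtain \<rho> where \<rho>: "\<And>x. x \<in> K \<Longrightarrow> 0 < \<rho> x" "\<And>x. x \<in> K \<Longrightarrow> ball x (\<rho> x) \<subseteq> U" by metis
  obtain F g where Fg: "finite F" "F \<subseteq> K" "\<And>x. x \<in> F \<Longrightarrow> test_fun (ball x (\<rho> x)) (g x)"
    "\<And>x y. 0 \<le> g x y" "\<And>y. y \<in> K \<Longrightarrow> (\<Sum>x\<in>F. g x y) = 1" "\<And>y. (\<Sum>x\<in>F. g x y) \<le> 1"
    by (rule smooth_partition[where \<rho> = \<rho>, OF K \<rho>(1)], assumption) (rule that; assumption)
  show thesis
  proof (rule that[of "\<lambda>y. \<Sum>x\<in>F. g x y"])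
    show "test_fun U (\<lambda>y. \<Sum>x\<in>F. g x y)"
      using Fg(2,3) \<rho>(2) by (intro test_fun_sum test_fun_mono[OF Fg(3)]) auto
  qed (use Fg in \<open>auto intro: sum_nonneg\<close>)
qed

text \<open>Finite products of cutoffs for shrinking neighbourhoods decrease to the indicator of K
  and are dominated by the first cutoff, whose product with g is integrable by hypothesis.
  Integrability of g on compact sets is thus a consequence of the test condition.\<close>

lemma integral_compact_eq_0:
  fixes g :: "real^'n::finite \<Rightarrow> real"
  assumes \<Omega>: "open \<Omega>"
    and test: "\<And>\<phi>. test_fun \<Omega> \<phi> \<Longrightarrow> integrable (lebesgue_on \<Omega>) (\<lambda>x. g x * \<phi> x) \<and> (\<integral>x. g x * \<phi> x \<partial>lebesgue_on \<Omega>) = 0"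
    and gm: "g \<in> borel_measurable (lebesgue_on \<Omega>)" and K: "compact K" "K \<subseteq> \<Omega>"
  shows "integrable (lebesgue_on \<Omega>) (\<lambda>x. g x * indicator K x) \<and> (\<integral>x. g x * indicator K x \<partial>lebesgue_on \<Omega>) = 0"
proof (cases "K = {}")
  case False
  define U where "U k = \<Omega> \<inter> {x. infdist x K < 1 / (real k + 1)}" for k :: nat
  have U: "open (U k)" "K \<subseteq> U k" for k
    using \<Omega> K False by (auto simp: U_def intro!: open_Int open_Collect_less continuous_intros)
  have "\<exists>\<phi>. test_fun (U k) \<phi> \<and> (\<forall>x. 0 \<le> \<phi> x \<and> \<phi> x \<le> 1) \<and> (\<forall>x\<in>K. \<phi> x = 1)" for k
    by (rule smooth_urysohn[OF K(1) U[of k]]) blast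
  then obtain \<psi> where \<psi>: "\<And>k. test_fun (U k) (\<psi> k)" "\<And>k x. 0 \<le> \<psi> k x" "\<And>k x. \<psi> k x \<le> 1" "\<And>k x. x \<in> K \<Longrightarrow> \<psi> k x = 1"
    by metis
  define \<phi> where "\<phi> k x = (\<Prod>j\<le>k. \<psi> j x)" for k x
  have \<phi>0: "0 \<le> \<phi> k x" for k x unfolding \<phi>_def by (intro prod_nonneg) (use \<psi> in auto)
  have \<phi>le: "\<phi> k x \<le> \<psi> 0 x" for k x
  proof (induction k)
    case (Suc k)
    have "\<phi> (Suc k) x = \<phi> k x * \<psi> (Suc k) x" by (simp add: \<phi>_def)
    also have "\<dots> \<le> \<phi> k x" using \<phi>0 \<psi> by (simp add: mult_left_le)
    finally show ?case using Suc by simp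
  qed (simp add: \<phi>_def)
  have \<psi>\<Omega>: "test_fun \<Omega> (\<psi> k)" for k using \<psi>(1) by (rule test_fun_mono) (simp add: U_def)
  have \<phi>t: "test_fun \<Omega> (\<phi> k)" for k
  proof (induction k)
    case (Suc k)
    have "\<phi> (Suc k) = (\<lambda>x. \<phi> k x * \<psi> (Suc k) x)" by (auto simp: \<phi>_def)
    then show ?case using test_fun_mult_left[OF test_fun_smooth[OF Suc] \<psi>\<Omega>] by simp
  qed (use \<psi>\<Omega> in \<open>simp add: \<phi>_def[abs_def]\<close>)
  have \<phi>lim: "(\<lambda>k. \<phi> k x) \<longlonglongrightarrow> indicator K x" for x
  proof (cases "x \<in> K")
    case True then show ?thesis using \<psi>(4) by (simp add: \<phi>_def)
  next
    case False
    have "0 < infdist x K" using infdist_pos_not_in_closed[of K x] K False \<open>K \<noteq> {}\<close> compact_imp_closed by blast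
    then obtain N where N: "1 / (real N + 1) < infdist x K" using reals_Archimedean[of "infdist x K"] by (auto simp: inverse_eq_divide add.commute)
    have "\<phi> k x = 0" if "N \<le> k" for k
    proof -
      have "\<psi> N x = 0" using test_fun_outside[OF \<psi>(1), of x N] N by (simp add: U_def)
      then show ?thesis unfolding \<phi>_def using that by (auto intro!: prod_zero)
    qed
    then have "(\<lambda>k. \<phi> k x) \<longlonglongrightarrow> 0" by (intro tendsto_eventually) (auto simp: eventually_sequentially)
    then show ?thesis using False by simp
  qed
  have Km: "K \<in> sets (lebesgue_on \<Omega>)"
    using K \<Omega> by (auto simp: sets_restrict_space_iff compact_imp_closed lmeasurable_compact fmeasurableD)
  have d1: "(\<lambda>x. g x * indicator K x) \<in> borel_measurable (lebesgue_on \<Omega>)" using gm Km by measurable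
  have d2: "(\<lambda>x. g x * \<phi> k x) \<in> borel_measurable (lebesgue_on \<Omega>)" for k
    using test[OF \<phi>t[of k]] borel_measurable_integrable by blast
  have d3: "AE x in lebesgue_on \<Omega>. (\<lambda>k. g x * \<phi> k x) \<longlonglongrightarrow> g x * indicator K x"
    by (intro AE_I2 tendsto_mult tendsto_const \<phi>lim)
  have d4: "integrable (lebesgue_on \<Omega>) (\<lambda>x. \<bar>g x * \<psi> 0 x\<bar>)" using test[OF \<psi>\<Omega>[of 0]] by simp
  have d5: "AE x in lebesgue_on \<Omega>. norm (g x * \<phi> k x) \<le> \<bar>g x * \<psi> 0 x\<bar>" for k
    using \<phi>le \<phi>0 \<psi>(2) by (intro AE_I2) (auto simp: abs_mult intro!: mult_left_mono)
  show ?thesis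
  proof
    show "integrable (lebesgue_on \<Omega>) (\<lambda>x. g x * indicator K x)"
      by (rule integrable_dominated_convergence[OF d1 d2 d4 d3 d5])
    have "(\<lambda>k. \<integral>x. g x * \<phi> k x \<partial>lebesgue_on \<Omega>) \<longlonglongrightarrow> (\<integral>x. g x * indicator K x \<partial>lebesgue_on \<Omega>)"
      by (rule integral_dominated_convergence[OF d1 d2 d4 d3 d5])
    then show "(\<integral>x. g x * indicator K x \<partial>lebesgue_on \<Omega>) = 0"
      using test[OF \<phi>t] by (simp add: LIMSEQ_const_iff)
  qed
qed simp

text \<open>Testing with indicators of compact sets shows that a level set on which g exceeds some e
  > 0 has only compact subsets of measure zero; inner regularity makes it null.\<close>

theorem fundamental_lemma:
  fixes g :: "real^'n::finite \<Rightarrow> real"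
  assumes \<Omega>: "open \<Omega>" and gm: "g \<in> borel_measurable (lebesgue_on \<Omega>)"
    and test: "\<And>\<phi>. test_fun \<Omega> \<phi> \<Longrightarrow> integrable (lebesgue_on \<Omega>) (\<lambda>x. g x * \<phi> x) \<and> (\<integral>x. g x * \<phi> x \<partial>lebesgue_on \<Omega>) = 0"
  shows "AE x in lebesgue_on \<Omega>. g x = 0"
proof -
  have \<Omega>m: "\<Omega> \<in> sets lebesgue" using \<Omega> by (simp add: borel_open)
  have pos: "AE x in lebesgue_on \<Omega>. g x \<le> 0"
    if gm: "g \<in> borel_measurable (lebesgue_on \<Omega>)"
     and test: "\<And>\<phi>. test_fun \<Omega> \<phi> \<Longrightarrow> integrable (lebesgue_on \<Omega>) (\<lambda>x. g x * \<phi> x) \<and> (\<integral>x. g x * \<phi> x \<partial>lebesgue_on \<Omega>) = 0"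
    for g :: "real^'n \<Rightarrow> real"
  proof -
    have null: "{x \<in> \<Omega>. e < g x} \<in> null_sets lebesgue" if e: "0 < e" for e
    proof -
      define S where "S = {x \<in> \<Omega>. e < g x}"
      have "{x \<in> space (lebesgue_on \<Omega>). e < g x} \<in> sets (lebesgue_on \<Omega>)" using gm by measurable
      then have Sm: "S \<in> sets lebesgue" using \<Omega>m by (auto simp: S_def sets_restrict_space_iff space_restrict_space)
      have K0: "emeasure lebesgue K = 0" if K: "compact K" "K \<subseteq> S" for K
      proof -
        have K\<Omega>: "K \<subseteq> \<Omega>" using K by (auto simp: S_def)
        have Km: "K \<in> lmeasurable" using K(1) by (rule lmeasurable_compact)
        have KmO: "K \<in> sets (lebesgue_on \<Omega>)" using Km K\<Omega> \<Omega>m by (auto simp: sets_restrict_space_iff fmeasurableD)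
        have eK: "emeasure (lebesgue_on \<Omega>) K = emeasure lebesgue K"
          using \<Omega>m K\<Omega> by (intro emeasure_restrict_space) auto
        have fin: "emeasure (lebesgue_on \<Omega>) K < \<infinity>" using Km unfolding eK fmeasurable_def by blast
        have "(\<integral>x. e * indicator K x \<partial>lebesgue_on \<Omega>) \<le> (\<integral>x. g x * indicator K x \<partial>lebesgue_on \<Omega>)"
        proof (rule integral_mono)
          show "integrable (lebesgue_on \<Omega>) (\<lambda>x. e * indicator K x)"
            using KmO fin by (intro integrable_mult_right integrable_real_indicator) auto
          show "integrable (lebesgue_on \<Omega>) (\<lambda>x. g x * indicator K x)"
            using integral_compact_eq_0[OF \<Omega> test gm K(1) K\<Omega>] by blast
          show "e * indicator K x \<le> g x * indicator K x" for x
            using K(2) by (cases "x \<in> K") (auto simp: S_def intro: less_imp_le)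
        qed
        also have "\<dots> = 0" using integral_compact_eq_0[OF \<Omega> test gm K(1) K\<Omega>] by blast
        also have "(\<integral>x. e * indicator K x \<partial>lebesgue_on \<Omega>) = e * measure (lebesgue_on \<Omega>) K"
          using K\<Omega> by (simp add: space_restrict_space Int_absorb1 Int_absorb2)
        finally have "measure (lebesgue_on \<Omega>) K \<le> 0" using e by (simp add: mult_le_0_iff)
        then have "measure (lebesgue_on \<Omega>) K = 0" by (simp add: antisym)
        then show ?thesis using fin by (simp add: eK[symmetric] emeasure_eq_ennreal_measure)
      qed
      \<comment> \<open>Inner regularity provides closed subsets, and these are exhausted by compact
        ones.\<close>
      have T0: "emeasure lebesgue T = 0" if T: "closed T" "T \<subseteq> S" for T
      proof -
        have Tk: "T \<inter> cball 0 (real k) \<in> null_sets lebesgue" for k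
          using K0[of "T \<inter> cball 0 (real k)"] T
          by (intro null_setsI) (auto simp: closed_Int_compact lmeasurable_compact fmeasurableD)
        have "T = (\<Union>k. T \<inter> cball 0 (real k))" using real_arch_simple by (auto simp: dist_norm)
        also have "\<dots> \<in> null_sets lebesgue" by (intro null_sets_UN Tk)
        finally show ?thesis by auto
      qed
      have "emeasure lebesgue S \<le> 0"
      proof (rule ennreal_le_epsilon)
        fix d :: real assume d: "0 < d"
        obtain T where T: "closed T" "T \<subseteq> S" "S - T \<in> lmeasurable" "emeasure lebesgue (S - T) < ennreal d"
          using sets_lebesgue_inner_closed[OF Sm d] by metis
        have "emeasure lebesgue S = emeasure lebesgue (T \<union> (S - T))" using T by (simp add: Un_absorb1)
        also have "\<dots> \<le> emeasure lebesgue T + emeasure lebesgue (S - T)"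
          using T by (intro emeasure_subadditive) (auto simp: fmeasurableD borel_closed)
        finally show "emeasure lebesgue S \<le> 0 + ennreal d" using T T0[OF T(1,2)] by simp
      qed
      then show ?thesis using Sm by (intro null_setsI) (auto simp: S_def)
    qed
    have "AE x in lebesgue. \<forall>k::nat. x \<notin> {x \<in> \<Omega>. 1 / (real k + 1) < g x}"
      unfolding AE_all_countable by (intro allI AE_not_in null) simp
    then have "AE x in lebesgue. x \<in> \<Omega> \<longrightarrow> g x \<le> 0"
    proof eventually_elim
      case (elim x)
      show ?case
      proof (intro impI, rule ccontr)
        assume x: "x \<in> \<Omega>" "\<not> g x \<le> 0"
        then obtain N where "inverse (real (Suc N)) < g x" using reals_Archimedean[of "g x"] by auto
        then show False using elim x by (auto simp: inverse_eq_divide add.commute)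
      qed
    qed
    then show ?thesis using \<Omega>m by (simp add: AE_restrict_space_iff)
  qed
  have "AE x in lebesgue_on \<Omega>. g x \<le> 0" by (rule pos[OF gm test])
  moreover have "AE x in lebesgue_on \<Omega>. - g x \<le> 0" by (rule pos) (use gm test in auto)
  ultimately show ?thesis by eventually_elim auto
qed

section \<open>The global potential\<close>

text \<open>The function spaces integrate over \<open>lebesgue_on \<Omega>\<close>, the analysis
  over \<open>lborel\<close>; for Borel functions vanishing off \<Omega> this is the passage between
  them.\<close>

lemma lebesgue_on_extend:
  fixes h :: "real^'n::finite \<Rightarrow> real"
  assumes \<Omega>: "\<Omega> \<in> sets lebesgue" and h: "h \<in> borel_measurable borel" and out: "\<And>x. x \<notin> \<Omega> \<Longrightarrow> h x = 0"
  shows "integrable (lebesgue_on \<Omega>) h \<longleftrightarrow> integrable lborel h"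
    and "(\<integral>x. h x \<partial>lebesgue_on \<Omega>) = (\<integral>x. h x \<partial>lborel)"
proof -
  have e: "(\<lambda>x. indicator \<Omega> x * h x) = h" using out by (auto simp: fun_eq_iff indicator_def)
  have h': "h \<in> borel_measurable lborel" using h by simp
  show "integrable (lebesgue_on \<Omega>) h \<longleftrightarrow> integrable lborel h"
    using \<Omega> integrable_restrict_space[of \<Omega> lebesgue h] integrable_completion[OF h'] by (simp add: e)
  show "(\<integral>x. h x \<partial>lebesgue_on \<Omega>) = (\<integral>x. h x \<partial>lborel)"
    using \<Omega> integral_restrict_space[of \<Omega> lebesgue h] integral_completion[OF h'] by (simp add: e)
qed

lemma test_field_comp: "test_field \<Omega> \<psi> \<Longrightarrow> test_fun \<Omega> (\<lambda>x. \<psi> x $ i)"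
  by (simp add: test_field_def)

lemma test_field_lincomb:
  "test_field \<Omega> \<psi> \<Longrightarrow> test_field \<Omega> \<xi> \<Longrightarrow> test_field \<Omega> (\<lambda>x. a *\<^sub>R \<psi> x + b *\<^sub>R \<xi> x)"
  unfolding test_field_def by (simp add: test_fun_lincomb)

lemma pd_lincomb:
  assumes "f differentiable (at x)" "g differentiable (at x)"
  shows "pd i (\<lambda>x. a * f x + b * g x) x = a * pd i f x + b * pd i g x"
  using assms by (subst pd_add) (auto intro!: derivative_intros simp: pd_cmult)

lemma vdiv_lincomb:
  assumes "test_field \<Omega> \<psi>" "test_field \<Omega> \<xi>"
  shows "vdiv (\<lambda>x. a *\<^sub>R \<psi> x + b *\<^sub>R \<xi> x) x = a * vdiv \<psi> x + b * vdiv \<xi> x"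
proof -
  have "pd i (\<lambda>x. a * \<psi> x $ i + b * \<xi> x $ i) x = a * pd i (\<lambda>x. \<psi> x $ i) x + b * pd i (\<lambda>x. \<xi> x $ i) x" for i
    using assms by (intro pd_lincomb test_fun_differentiable[OF test_field_comp])
  then show ?thesis unfolding vdiv_def by (simp add: sum.distrib sum_distrib_left)
qed

lemma test_field_0: "test_field \<Omega> (\<lambda>x. 0)" by (simp add: test_field_def)
lemma vdiv_0: "vdiv (\<lambda>x. 0) x = 0" by (simp add: vdiv_def)

lemma test_fun_vdiv: "test_field \<Omega> \<psi> \<Longrightarrow> test_fun \<Omega> (vdiv \<psi>)"
  unfolding vdiv_def[abs_def] by (intro test_fun_sum test_fun_pd test_field_comp)

lemma integral_vdiv:
  assumes "test_field \<Omega> \<psi>" shows "(\<integral>x. vdiv \<psi> x \<partial>lborel) = 0"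
proof -
  have "test_fun \<Omega> (\<lambda>x. \<psi> x $ i)" for i by (rule test_field_comp[OF assms])
  then have "(\<integral>x. pd i (\<lambda>x. \<psi> x $ i) x \<partial>lborel) = 0" "integrable lborel (pd i (\<lambda>x. \<psi> x $ i))" for i
    by (auto intro: integral_pd_eq_0 cc_fun_integrable test_fun_cc test_fun_pd)
  then show ?thesis unfolding vdiv_def by (simp add: Bochner_Integration.integral_sum)
qed

lemma test_fun_integrable: "test_fun S f \<Longrightarrow> integrable lborel f"
  by (rule cc_fun_integrable[OF test_fun_cc])

text \<open>F depends only on the divergence of its argument. Every test function becomes a
  divergence after subtracting a multiple of one fixed mollifier, so F induces a linear functional L
  on all test functions; in each ball L is bounded in \<open>L\<^sup>r\<close> and hence given by a
  function. The local functions agree on overlaps with no constants to adjust, because the mollifier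
  is the same for all balls.\<close>

theorem bounded_functional_has_pressure:
  fixes \<Omega> :: "(real^'n::finite) set" and F :: "'n vfield \<Rightarrow> real"
  assumes r: "1 < r" and \<Omega>: "open \<Omega>" "connected \<Omega>" "\<Omega> \<noteq> {}"
    and lin: "\<And>\<psi> \<xi> a b. test_field \<Omega> \<psi> \<Longrightarrow> test_field \<Omega> \<xi> \<Longrightarrow> F (\<lambda>x. a *\<^sub>R \<psi> x + b *\<^sub>R \<xi> x) = a * F \<psi> + b * F \<xi>"
    and div0: "\<And>\<psi>. test_field \<Omega> \<psi> \<Longrightarrow> (\<forall>x. vdiv \<psi> x = 0) \<Longrightarrow> F \<psi> = 0"
    and bnd: "\<And>\<psi>. test_field \<Omega> \<psi> \<Longrightarrow> \<bar>F \<psi>\<bar> \<le> C * (\<Sum>i\<in>UNIV. (\<integral>x. \<bar>\<psi> x $ i\<bar> powr r \<partial>lborel) powr (1/r)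
        + (\<Sum>j\<in>UNIV. (\<integral>x. \<bar>pd j (\<lambda>y. \<psi> y $ i) x\<bar> powr r \<partial>lborel) powr (1/r)))"
  obtains p where "p \<in> borel_measurable borel"
    "\<And>K. compact K \<Longrightarrow> K \<subseteq> \<Omega> \<Longrightarrow> (\<integral>\<^sup>+x. ennreal (\<bar>p x\<bar> powr (r / (r - 1))) * indicator K x \<partial>lborel) < \<infinity>"
    "\<And>\<psi>. test_field \<Omega> \<psi> \<Longrightarrow> F \<psi> = (\<integral>x. p x * vdiv \<psi> x \<partial>lborel)"
proof -
  define q where "q = r / (r - 1)"
  define dv where "dv f \<longleftrightarrow> (\<exists>\<psi>. test_field \<Omega> \<psi> \<and> (\<forall>x. vdiv \<psi> x = f x))" for f
  have dv_lincomb: "dv (\<lambda>x. a * f x + b * g x)" if fg: "dv f" "dv g" for f g a b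
  proof -
    obtain \<psi> \<xi> where \<psi>: "test_field \<Omega> \<psi>" "\<forall>x. vdiv \<psi> x = f x" and \<xi>: "test_field \<Omega> \<xi>" "\<forall>x. vdiv \<xi> x = g x"
      using fg unfolding dv_def by blast
    have "\<forall>x. vdiv (\<lambda>x. a *\<^sub>R \<psi> x + b *\<^sub>R \<xi> x) x = a * f x + b * g x"
      unfolding vdiv_lincomb[OF \<psi>(1) \<xi>(1)] using \<psi>(2) \<xi>(2) by simp
    then show ?thesis unfolding dv_def using test_field_lincomb[OF \<psi>(1) \<xi>(1)] by blast
  qed
  have dv_0: "dv (\<lambda>x. 0)" unfolding dv_def using test_field_0 vdiv_0 by blast
  have dv_sum: "dv (\<lambda>y. \<Sum>x\<in>A. g x y)" if "finite A" "\<And>x. x \<in> A \<Longrightarrow> dv (g x)" for A and g :: "real^'n \<Rightarrow> real^'n \<Rightarrow> real"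
    using that
  proof (induction A rule: finite_induct)
    case (insert x A)
    have "dv (\<lambda>y. 1 * g x y + 1 * (\<Sum>x\<in>A. g x y))" using insert by (intro dv_lincomb) auto
    then show ?case using insert by simp
  qed (simp add: dv_0)
  have "\<forall>x\<in>\<Omega>. \<exists>e>0. cball x (2 * e) \<subseteq> \<Omega>"
  proof
    fix x assume "x \<in> \<Omega>"
    then obtain e where "0 < e" "cball x e \<subseteq> \<Omega>" using \<Omega>(1) by (meson open_contains_cball)
    then show "\<exists>e>0. cball x (2 * e) \<subseteq> \<Omega>" by (intro exI[of _ "e / 2"]) auto
  qed
  then obtain \<rho> where \<rho>: "\<And>x. x \<in> \<Omega> \<Longrightarrow> 0 < \<rho> x" "\<And>x. x \<in> \<Omega> \<Longrightarrow> cball x (2 * \<rho> x) \<subseteq> \<Omega>" by metis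
  define B where "B x = ball x (\<rho> x)" for x
  define m where "m x = mollifier x (\<rho> x)" for x
  have cb: "cball x (\<rho> x) \<subseteq> \<Omega>" if "x \<in> \<Omega>" for x
    using \<rho>(1)[OF that] by (intro order_trans[OF _ \<rho>(2)[OF that]]) (auto intro!: subset_cball)
  have BO: "B x \<subseteq> \<Omega>" if "x \<in> \<Omega>" for x unfolding B_def using cb[OF that] ball_subset_cball by blast
  have Bx: "x \<in> B x" if "x \<in> \<Omega>" for x using \<rho>(1)[OF that] by (simp add: B_def)
  have openB: "open (B x)" for x by (simp add: B_def)
  have LD: "\<exists>Cx\<ge>0. \<forall>f. test_fun (B x) f \<longrightarrow> (\<exists>\<psi>. test_field \<Omega> \<psi> \<and> (\<forall>y. vdiv \<psi> y = f y - (\<integral>y. f y \<partial>lborel) * m x y)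
      \<and> (\<forall>i. (\<integral>y. \<bar>\<psi> y $ i\<bar> powr r \<partial>lborel) \<le> Cx * (\<integral>x. \<bar>f x\<bar> powr r \<partial>lborel))
      \<and> (\<forall>i j. (\<integral>y. \<bar>pd j (\<lambda>z. \<psi> z $ i) y\<bar> powr r \<partial>lborel) \<le> Cx * (\<integral>x. \<bar>f x\<bar> powr r \<partial>lborel)))"
    if x: "x \<in> \<Omega>" for x
  proof -
    obtain Cx where Cx: "0 \<le> Cx" "\<And>f. test_fun (ball x (\<rho> x)) f \<Longrightarrow>
    \<exists>\<psi>. (\<forall>i. test_fun \<Omega> (\<psi> i)) \<and> (\<forall>y. (\<Sum>i\<in>UNIV. pd i (\<psi> i) y) = f y - (\<integral>y. f y \<partial>lborel) * mollifier x (\<rho> x) y)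
      \<and> (\<forall>i. (\<integral>x. \<bar>\<psi> i x\<bar> powr r \<partial>lborel) \<le> Cx * (\<integral>x. \<bar>f x\<bar> powr r \<partial>lborel))
      \<and> (\<forall>i j. (\<integral>x. \<bar>pd j (\<psi> i) x\<bar> powr r \<partial>lborel) \<le> Cx * (\<integral>x. \<bar>f x\<bar> powr r \<partial>lborel))"
      by (rule local_divergence[OF r \<rho>(1)[OF x] \<rho>(2)[OF x]]) blast
    show ?thesis
    proof (intro exI[of _ Cx] conjI Cx(1) allI impI)
      fix f assume "test_fun (B x) f"
      then obtain \<psi> where \<psi>: "\<forall>i. test_fun \<Omega> (\<psi> i)" "\<forall>y. (\<Sum>i\<in>UNIV. pd i (\<psi> i) y) = f y - (\<integral>y. f y \<partial>lborel) * mollifier x (\<rho> x) y"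
        "\<forall>i. (\<integral>x. \<bar>\<psi> i x\<bar> powr r \<partial>lborel) \<le> Cx * (\<integral>x. \<bar>f x\<bar> powr r \<partial>lborel)"
        "\<forall>i j. (\<integral>x. \<bar>pd j (\<psi> i) x\<bar> powr r \<partial>lborel) \<le> Cx * (\<integral>x. \<bar>f x\<bar> powr r \<partial>lborel)"
        using Cx(2)[of f] unfolding B_def by blast
      have e: "(\<lambda>z. (\<lambda>y. \<chi> i. \<psi> i y) z $ i) = \<psi> i" for i by (simp add: fun_eq_iff)
      show "\<exists>\<psi>. test_field \<Omega> \<psi> \<and> (\<forall>y. vdiv \<psi> y = f y - (\<integral>y. f y \<partial>lborel) * m x y)
      \<and> (\<forall>i. (\<integral>y. \<bar>\<psi> y $ i\<bar> powr r \<partial>lborel) \<le> Cx * (\<integral>x. \<bar>f x\<bar> powr r \<partial>lborel))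
      \<and> (\<forall>i j. (\<integral>y. \<bar>pd j (\<lambda>z. \<psi> z $ i) y\<bar> powr r \<partial>lborel) \<le> Cx * (\<integral>x. \<bar>f x\<bar> powr r \<partial>lborel))"
        by (rule exI[of _ "\<lambda>y. \<chi> i. \<psi> i y"])
           (use \<psi> in \<open>simp add: test_field_def vdiv_def m_def\<close>)
    qed
  qed
  have dv1: "dv (\<lambda>y. f y - (\<integral>y. f y \<partial>lborel) * m x y)" if "x \<in> \<Omega>" "test_fun (B x) f" for x f
    using LD[OF that(1)] that(2) unfolding dv_def by blast
  \<comment> \<open>A mollifier of a small ball inside the overlap has mass 1, so it differs from
    each of the two by a divergence.\<close>
  have overlap: "dv (\<lambda>t. m x t - m y t)" if xy: "x \<in> \<Omega>" "y \<in> \<Omega>" and z: "z \<in> B x" "z \<in> B y" for x y z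
  proof -
    have "open (B x \<inter> B y)" using openB by blast
    then obtain e where e: "0 < e" "cball z e \<subseteq> B x \<inter> B y" using z by (meson IntI open_contains_cball)
    have 1: "test_fun (B x) (mollifier z e)" "test_fun (B y) (mollifier z e)" using e by (auto intro!: test_fun_mollifier)
    have "dv (\<lambda>t. (- 1) * (mollifier z e t - 1 * m x t) + 1 * (mollifier z e t - 1 * m y t))"
      using dv1[OF xy(1) 1(1)] dv1[OF xy(2) 1(2)] unfolding integral_mollifier[OF e(1)] by (rule dv_lincomb)
    then show ?thesis by simp
  qed
  obtain x0 where x0: "x0 \<in> \<Omega>" using \<Omega>(3) by blast
  have conn: "dv (\<lambda>t. m x t - m x0 t)" if "x \<in> \<Omega>" for x
  proof -
    \<comment> \<open>The points whose mollifier is linked to that of \<open>x0\<close>. By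
      \<open>overlap\<close>, balls around linked points and balls around unlinked ones are
      disjoint, so connectedness excludes unlinked points.\<close>
    define A where "A = {x \<in> \<Omega>. dv (\<lambda>t. m x t - m x0 t)}"
    define UA where "UA = (\<Union>x\<in>A. B x)"
    define UB where "UB = (\<Union>x\<in>\<Omega> - A. B x)"
    have disj: False if x: "x \<in> A" and y: "y \<in> \<Omega> - A" and z: "z \<in> B x" "z \<in> B y" for x y z
    proof -
      have "dv (\<lambda>t. 1 * (m y t - m x t) + 1 * (m x t - m x0 t))"
        using x y z by (intro dv_lincomb overlap[of y x z]) (auto simp: A_def)
      then show False using y by (simp add: A_def)
    qed
    have "UA \<inter> UB \<inter> \<Omega> = {}" using disj unfolding UA_def UB_def by blast
    moreover have "\<Omega> \<subseteq> UA \<union> UB" using Bx unfolding UA_def UB_def by blast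
    moreover have "open UA" "open UB" using openB by (auto simp: UA_def UB_def)
    ultimately have "UA \<inter> \<Omega> = {} \<or> UB \<inter> \<Omega> = {}" using connectedD[OF \<Omega>(2)] by blast
    moreover have "x0 \<in> UA"
    proof -
      have "x0 \<in> A" using x0 dv_0 by (simp add: A_def)
      then show ?thesis using Bx[OF x0] by (auto simp: UA_def)
    qed
    ultimately have "UB \<inter> \<Omega> = {}" using x0 by blast
    then have "x \<in> A" using that Bx[OF that] unfolding UB_def by blast
    then show ?thesis by (simp add: A_def)
  qed
  \<comment> \<open>A partition subordinate to the balls reduces each piece first to the mollifier
    of its own ball, then to that of \<open>x0\<close>.\<close>
  have dvall: "dv (\<lambda>y. f y - (\<integral>y. f y \<partial>lborel) * m x0 y)" if f: "test_fun \<Omega> f" for f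
  proof -
    obtain A g where Ag: "finite A" "A \<subseteq> \<Omega>" "\<And>x. x \<in> A \<Longrightarrow> test_fun (ball x (\<rho> x)) (g x)" "f = (\<lambda>y. \<Sum>x\<in>A. g x y)"
      by (rule test_partition[where \<rho> = \<rho>, OF f \<rho>(1)], assumption) (rule that; assumption)
    have "dv (\<lambda>y. 1 * (g x y - (\<integral>y. g x y \<partial>lborel) * m x y) + (\<integral>y. g x y \<partial>lborel) * (m x y - m x0 y))" if "x \<in> A" for x
      using that Ag(2) Ag(3)[OF that] by (intro dv_lincomb dv1 conn) (auto simp: B_def)
    then have "dv (\<lambda>y. g x y - (\<integral>y. g x y \<partial>lborel) * m x0 y)" if "x \<in> A" for x
      using that by (simp add: right_diff_distrib)
    then have "dv (\<lambda>y. \<Sum>x\<in>A. g x y - (\<integral>y. g x y \<partial>lborel) * m x0 y)" by (intro dv_sum Ag(1))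
    moreover have "(\<integral>y. f y \<partial>lborel) = (\<Sum>x\<in>A. \<integral>y. g x y \<partial>lborel)"
      unfolding Ag(4) by (rule Bochner_Integration.integral_sum) (rule test_fun_integrable[OF Ag(3)])
    ultimately show ?thesis unfolding Ag(4) by (simp add: sum_subtractf sum_distrib_right Ag(4)[symmetric])
  qed
  \<comment> \<open>The choice is immaterial: two candidates differ by a divergence-free test field,
    on which F vanishes.\<close>
  define L where "L f = F (SOME \<psi>. test_field \<Omega> \<psi> \<and> (\<forall>x. vdiv \<psi> x = f x - (\<integral>y. f y \<partial>lborel) * m x0 x))" for f
  have Lval: "L f = F \<psi>" if "test_field \<Omega> \<psi>" "\<forall>x. vdiv \<psi> x = f x - (\<integral>y. f y \<partial>lborel) * m x0 x" for f \<psi>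
  proof -
    define \<xi> where "\<xi> = (SOME \<psi>. test_field \<Omega> \<psi> \<and> (\<forall>x. vdiv \<psi> x = f x - (\<integral>y. f y \<partial>lborel) * m x0 x))"
    have \<xi>: "test_field \<Omega> \<xi>" "\<forall>x. vdiv \<xi> x = f x - (\<integral>y. f y \<partial>lborel) * m x0 x"
      using someI[of "\<lambda>\<psi>. test_field \<Omega> \<psi> \<and> (\<forall>x. vdiv \<psi> x = f x - (\<integral>y. f y \<partial>lborel) * m x0 x)" \<psi>] that
      unfolding \<xi>_def by blast+
    have "F (\<lambda>x. 1 *\<^sub>R \<xi> x + (- 1) *\<^sub>R \<psi> x) = 0"
    proof (rule div0[OF test_field_lincomb[OF \<xi>(1) that(1)]], rule allI)
      show "vdiv (\<lambda>x. 1 *\<^sub>R \<xi> x + (- 1) *\<^sub>R \<psi> x) x = 0" for x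
        unfolding vdiv_lincomb[OF \<xi>(1) that(1)] using \<xi>(2) that(2) by simp
    qed
    then show ?thesis unfolding lin[OF \<xi>(1) that(1)] by (simp add: L_def \<xi>_def)
  qed
  have Llin: "L (\<lambda>x. a * f x + b * g x) = a * L f + b * L g" if f: "test_fun \<Omega> f" and g: "test_fun \<Omega> g" for f g a b
  proof -
    obtain \<psi> where \<psi>: "test_field \<Omega> \<psi>" "\<forall>x. vdiv \<psi> x = f x - (\<integral>y. f y \<partial>lborel) * m x0 x" using dvall[OF f] unfolding dv_def by blast
    obtain \<xi> where \<xi>: "test_field \<Omega> \<xi>" "\<forall>x. vdiv \<xi> x = g x - (\<integral>y. g y \<partial>lborel) * m x0 x" using dvall[OF g] unfolding dv_def by blast
    have i: "(\<integral>x. a * f x + b * g x \<partial>lborel) = a * (\<integral>x. f x \<partial>lborel) + b * (\<integral>x. g x \<partial>lborel)"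
      using test_fun_integrable[OF f] test_fun_integrable[OF g] by simp
    have "L (\<lambda>x. a * f x + b * g x) = F (\<lambda>x. a *\<^sub>R \<psi> x + b *\<^sub>R \<xi> x)"
    proof (rule Lval[OF test_field_lincomb[OF \<psi>(1) \<xi>(1)]], rule allI)
      show "vdiv (\<lambda>x. a *\<^sub>R \<psi> x + b *\<^sub>R \<xi> x) x = a * f x + b * g x - (\<integral>x. a * f x + b * g x \<partial>lborel) * m x0 x" for x
        unfolding i vdiv_lincomb[OF \<psi>(1) \<xi>(1)] \<psi>(2)[rule_format] \<xi>(2)[rule_format] by (simp add: algebra_simps)
    qed
    then show ?thesis unfolding lin[OF \<psi>(1) \<xi>(1)] using Lval[OF \<psi>] Lval[OF \<xi>] by simp
  qed
  have L0: "L (\<lambda>x. 0) = 0" using Llin[of "\<lambda>x. 0" "\<lambda>x. 0" 0 0] by simp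
  have Lsum: "L (\<lambda>y. \<Sum>x\<in>A. g x y) = (\<Sum>x\<in>A. L (g x))" if "finite A" "\<And>x. x \<in> A \<Longrightarrow> test_fun \<Omega> (g x)" for A and g :: "real^'n \<Rightarrow> real^'n \<Rightarrow> real"
    using that
  proof (induction A rule: finite_induct)
    case (insert x A)
    have "L (\<lambda>y. 1 * g x y + 1 * (\<Sum>x\<in>A. g x y)) = 1 * L (g x) + 1 * L (\<lambda>y. \<Sum>x\<in>A. g x y)"
      using insert by (intro Llin test_fun_sum) auto
    then show ?case using insert by simp
  qed (simp add: L0)
  have Ldiv: "F \<psi> = L (vdiv \<psi>)" if "test_field \<Omega> \<psi>" for \<psi>
    using Lval[OF that, of "vdiv \<psi>"] integral_vdiv[OF that] by simp
  have Lbnd: "\<exists>c. \<forall>f. test_fun (B x) f \<longrightarrow> \<bar>L f\<bar> \<le> c * (\<integral>y. \<bar>f y\<bar> powr r \<partial>lborel) powr (1/r)" if x: "x \<in> \<Omega>" for x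
  proof -
    obtain Cx where Cx: "0 \<le> Cx" "\<And>f. test_fun (B x) f \<Longrightarrow> \<exists>\<psi>. test_field \<Omega> \<psi> \<and> (\<forall>y. vdiv \<psi> y = f y - (\<integral>y. f y \<partial>lborel) * m x y)
      \<and> (\<forall>i. (\<integral>y. \<bar>\<psi> y $ i\<bar> powr r \<partial>lborel) \<le> Cx * (\<integral>x. \<bar>f x\<bar> powr r \<partial>lborel))
      \<and> (\<forall>i j. (\<integral>y. \<bar>pd j (\<lambda>z. \<psi> z $ i) y\<bar> powr r \<partial>lborel) \<le> Cx * (\<integral>x. \<bar>f x\<bar> powr r \<partial>lborel))"
      using LD[OF x] by blast
    obtain \<xi> where \<xi>: "test_field \<Omega> \<xi>" "\<forall>t. vdiv \<xi> t = m x t - m x0 t" using conn[OF x] unfolding dv_def by blast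
    define V where "V = measure lborel (cball x (\<rho> x)) powr (r - 1)"
    define n where "n = real CARD('n)"
    \<comment> \<open>The first summand pays for the field whose divergence is f minus its mass
      times \<open>m x\<close>. The second pays for the passage from \<open>m x\<close> to
      \<open>m x0\<close>: one fixed field \<xi>, with a coefficient bounded by the
      \<open>L\<^sup>r\<close> norm of f on the ball.\<close>
    define c where "c = \<bar>C\<bar> * (n * (Cx powr (1/r) + n * Cx powr (1/r))) + V powr (1/r) * \<bar>F \<xi>\<bar>"
    have "\<bar>L f\<bar> \<le> c * (\<integral>y. \<bar>f y\<bar> powr r \<partial>lborel) powr (1/r)" if f: "test_fun (B x) f" for f
    proof -
      define I where "I = (\<integral>y. \<bar>f y\<bar> powr r \<partial>lborel)"
      have I0: "0 \<le> I" by (simp add: I_def)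
      obtain \<psi> where \<psi>: "test_field \<Omega> \<psi>" "\<forall>y. vdiv \<psi> y = f y - (\<integral>y. f y \<partial>lborel) * m x y"
        "\<And>i. (\<integral>y. \<bar>\<psi> y $ i\<bar> powr r \<partial>lborel) \<le> Cx * I"
        "\<And>i j. (\<integral>y. \<bar>pd j (\<lambda>z. \<psi> z $ i) y\<bar> powr r \<partial>lborel) \<le> Cx * I"
        using Cx(2)[OF f] unfolding I_def by blast
      have "L f = F (\<lambda>y. 1 *\<^sub>R \<psi> y + (\<integral>y. f y \<partial>lborel) *\<^sub>R \<xi> y)"
      proof (rule Lval[OF test_field_lincomb[OF \<psi>(1) \<xi>(1)]], rule allI)
        show "vdiv (\<lambda>y. 1 *\<^sub>R \<psi> y + (\<integral>y. f y \<partial>lborel) *\<^sub>R \<xi> y) t = f t - (\<integral>y. f y \<partial>lborel) * m x0 t" for t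
          unfolding vdiv_lincomb[OF \<psi>(1) \<xi>(1)] \<psi>(2)[rule_format] \<xi>(2)[rule_format] by (simp add: algebra_simps)
      qed
      then have Lf: "L f = F \<psi> + (\<integral>y. f y \<partial>lborel) * F \<xi>" unfolding lin[OF \<psi>(1) \<xi>(1)] by simp
      have pw: "a powr (1/r) \<le> Cx powr (1/r) * I powr (1/r)" if "0 \<le> a" "a \<le> Cx * I" for a
        using powr_mono2[of "1/r" a "Cx * I"] that r Cx(1) I0 by (simp add: powr_mult)
      have "\<bar>F \<psi>\<bar> \<le> \<bar>C\<bar> * (\<Sum>i\<in>UNIV. (\<integral>x. \<bar>\<psi> x $ i\<bar> powr r \<partial>lborel) powr (1/r)
        + (\<Sum>j\<in>UNIV. (\<integral>x. \<bar>pd j (\<lambda>y. \<psi> y $ i) x\<bar> powr r \<partial>lborel) powr (1/r)))"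
        by (rule order_trans[OF bnd[OF \<psi>(1)]]) (intro mult_right_mono sum_nonneg add_nonneg_nonneg, auto intro: sum_nonneg)
      also have "\<dots> \<le> \<bar>C\<bar> * (\<Sum>i\<in>(UNIV::'n set). Cx powr (1/r) * I powr (1/r) + (\<Sum>j\<in>(UNIV::'n set). Cx powr (1/r) * I powr (1/r)))"
        by (intro mult_left_mono sum_mono add_mono pw \<psi>) auto
      also have "\<dots> = \<bar>C\<bar> * (n * (Cx powr (1/r) + n * Cx powr (1/r))) * I powr (1/r)" by (simp add: n_def algebra_simps)
      finally have 1: "\<bar>F \<psi>\<bar> \<le> \<bar>C\<bar> * (n * (Cx powr (1/r) + n * Cx powr (1/r))) * I powr (1/r)" .
      have "(\<integral>y. \<bar>f y\<bar> \<partial>lborel) powr r \<le> V * I"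
        unfolding V_def I_def using test_fun_outside[OF f]
        by (intro jensen_ball[OF r test_fun_cc[OF f]]) (auto simp: B_def)
      then have "((\<integral>y. \<bar>f y\<bar> \<partial>lborel) powr r) powr (1/r) \<le> (V * I) powr (1/r)" using r by (intro powr_mono2) auto
      then have "(\<integral>y. \<bar>f y\<bar> \<partial>lborel) \<le> V powr (1/r) * I powr (1/r)"
        using r I0 by (simp add: powr_powr powr_mult V_def)
      then have "\<bar>\<integral>y. f y \<partial>lborel\<bar> \<le> V powr (1/r) * I powr (1/r)" using integral_abs_bound[of lborel f] by linarith
      then have "\<bar>(\<integral>y. f y \<partial>lborel) * F \<xi>\<bar> \<le> V powr (1/r) * I powr (1/r) * \<bar>F \<xi>\<bar>" unfolding abs_mult by (rule mult_right_mono) simp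
      then have "\<bar>L f\<bar> \<le> c * I powr (1/r)" using 1 unfolding Lf c_def distrib_right
        by (intro order_trans[OF abs_triangle_ineq] add_mono) (auto simp: mult_ac)
      then show ?thesis by (simp add: I_def)
    qed
    then show ?thesis by blast
  qed
  have "\<exists>p. p \<in> borel_measurable borel \<and> integrable lborel (\<lambda>x. \<bar>p x\<bar> powr q)
     \<and> (\<forall>f. test_fun (B x) f \<longrightarrow> integrable lborel (\<lambda>t. p t * f t) \<and> L f = (\<integral>t. p t * f t \<partial>lborel))" if x: "x \<in> \<Omega>" for x
  proof -
    obtain c where c: "\<And>f. test_fun (B x) f \<Longrightarrow> \<bar>L f\<bar> \<le> c * (\<integral>y. \<bar>f y\<bar> powr r \<partial>lborel) powr (1/r)" using Lbnd[OF x] by blast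
    define D where "D = {f. test_fun (B x) f}"
    have DO: "test_fun \<Omega> f" if "f \<in> D" for f using that BO[OF x] by (auto simp: D_def intro: test_fun_mono)
    have ne: "D \<noteq> {}" using test_fun_0[of "B x"] unfolding D_def by blast
    obtain p where p: "p \<in> borel_measurable lborel" "integrable lborel (\<lambda>x. \<bar>p x\<bar> powr (r / (r - 1)))"
      "\<And>f. f \<in> D \<Longrightarrow> integrable lborel (\<lambda>x. p x * f x)" "\<And>f. f \<in> D \<Longrightarrow> L f = (\<integral>x. p x * f x \<partial>lborel)"
    proof (rule riesz_Lr_subspace[OF r ne, where L = L and M = lborel and C = c])
      show "(\<lambda>x. a * f x + b * g x) \<in> D" if "f \<in> D" "g \<in> D" for f g a b
        using that by (simp add: D_def test_fun_lincomb)
      show "L (\<lambda>x. a * f x + b * g x) = a * L f + b * L g" if "f \<in> D" "g \<in> D" for f g a b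
        by (rule Llin[OF DO[OF that(1)] DO[OF that(2)]])
      show "f \<in> borel_measurable lborel" if "f \<in> D" for f
        using cc_fun_measurable[OF test_fun_cc[OF DO[OF that]]] by simp
      show "integrable lborel (\<lambda>x. \<bar>f x\<bar> powr r)" if "f \<in> D" for f
        using cc_fun_integrable[OF cc_fun_powr[OF test_fun_cc[OF DO[OF that]]]] r by simp
      show "\<bar>L f\<bar> \<le> c * (\<integral>x. \<bar>f x\<bar> powr r \<partial>lborel) powr (1 / r)" if "f \<in> D" for f
        using that c by (simp add: D_def)
    qed (rule that; assumption)
    then show ?thesis unfolding q_def D_def by auto
  qed
  then obtain P where P: "\<And>x. x \<in> \<Omega> \<Longrightarrow> P x \<in> borel_measurable borel" "\<And>x. x \<in> \<Omega> \<Longrightarrow> integrable lborel (\<lambda>t. \<bar>P x t\<bar> powr q)"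
    "\<And>x f. x \<in> \<Omega> \<Longrightarrow> test_fun (B x) f \<Longrightarrow> integrable lborel (\<lambda>t. P x t * f t)"
    "\<And>x f. x \<in> \<Omega> \<Longrightarrow> test_fun (B x) f \<Longrightarrow> L f = (\<integral>t. P x t * f t \<partial>lborel)"
  proof -
    assume ex: "\<And>x. x \<in> \<Omega> \<Longrightarrow> \<exists>p. p \<in> borel_measurable borel \<and> integrable lborel (\<lambda>x. \<bar>p x\<bar> powr q)
     \<and> (\<forall>f. test_fun (B x) f \<longrightarrow> integrable lborel (\<lambda>t. p t * f t) \<and> L f = (\<integral>t. p t * f t \<partial>lborel))"
    show thesis
      by (rule that[of "\<lambda>x. SOME p. p \<in> borel_measurable borel \<and> integrable lborel (\<lambda>x. \<bar>p x\<bar> powr q)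
     \<and> (\<forall>f. test_fun (B x) f \<longrightarrow> integrable lborel (\<lambda>t. p t * f t) \<and> L f = (\<integral>t. p t * f t \<partial>lborel))"])
        (use someI_ex[OF ex] in blast)+
  qed
  \<comment> \<open>Both functions represent the same L on test functions supported in the overlap,
    so \<open>fundamental_lemma\<close> applies to their difference.\<close>
  have agree: "AE t in lborel. t \<in> B x \<inter> B y \<longrightarrow> P x t = P y t" if xy: "x \<in> \<Omega>" "y \<in> \<Omega>" for x y
  proof -
    note [measurable] = P(1)[OF xy(1)] P(1)[OF xy(2)]
    have o: "open (B x \<inter> B y)" using openB by blast
    then have om: "B x \<inter> B y \<in> sets lebesgue" by (simp add: borel_open)
    have "AE t in lebesgue_on (B x \<inter> B y). P x t - P y t = 0"
    proof (rule fundamental_lemma[OF o])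
      have "(\<lambda>t. P x t - P y t) \<in> borel_measurable borel" by measurable
      then show "(\<lambda>t. P x t - P y t) \<in> borel_measurable (lebesgue_on (B x \<inter> B y))"
        by (intro measurable_restrict_space1 measurable_completion) simp
      fix \<phi> assume \<phi>: "test_fun (B x \<inter> B y) \<phi>"
      note [measurable] = cc_fun_measurable[OF test_fun_cc[OF \<phi>]]
      have \<phi>': "test_fun (B x) \<phi>" "test_fun (B y) \<phi>" using \<phi> by (auto intro: test_fun_mono)
      have m: "(\<lambda>t. (P x t - P y t) * \<phi> t) \<in> borel_measurable borel" by measurable
      have out: "(P x t - P y t) * \<phi> t = 0" if "t \<notin> B x \<inter> B y" for t using test_fun_outside[OF \<phi> that] by simp
      have i: "integrable lborel (\<lambda>t. (P x t - P y t) * \<phi> t)" "(\<integral>t. (P x t - P y t) * \<phi> t \<partial>lborel) = 0"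
        unfolding left_diff_distrib using P(3)[OF xy(1) \<phi>'(1)] P(3)[OF xy(2) \<phi>'(2)] P(4)[OF xy(1) \<phi>'(1)] P(4)[OF xy(2) \<phi>'(2)] by simp_all
      show "integrable (lebesgue_on (B x \<inter> B y)) (\<lambda>t. (P x t - P y t) * \<phi> t)
          \<and> (\<integral>t. (P x t - P y t) * \<phi> t \<partial>lebesgue_on (B x \<inter> B y)) = 0"
        using lebesgue_on_extend[OF om m out] i by simp
    qed
    then have "AE t in lebesgue. t \<in> B x \<inter> B y \<longrightarrow> P x t - P y t = 0" using om by (simp add: AE_restrict_space_iff)
    then have "AE t in lborel. t \<in> B x \<inter> B y \<longrightarrow> P x t - P y t = 0" by (simp add: AE_completion_iff)
    then show ?thesis by eventually_elim auto
  qed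
  \<comment> \<open>A countable subcover keeps the union of the exceptional sets null and the glued
    function measurable.\<close>
  obtain X where X: "countable X" "X \<subseteq> \<Omega>" "\<Omega> \<subseteq> (\<Union>x\<in>X. B x)"
  proof -
    obtain \<F> where \<F>: "\<F> \<subseteq> B ` \<Omega>" "countable \<F>" "\<Union>\<F> = \<Union>(B ` \<Omega>)"
      using Lindelof[of "B ` \<Omega>"] openB by blast
    then obtain X where "countable X" "X \<subseteq> \<Omega>" "\<F> = B ` X" by (metis countable_subset_image)
    then show thesis using that[of X] \<F>(3) Bx by blast
  qed
  have "X \<noteq> {}" using X(3) x0 by blast
  define c where "c = from_nat_into X"
  have cX: "range c = X" unfolding c_def using X(1) \<open>X \<noteq> {}\<close> by (rule range_from_nat_into[rotated])
  have cO: "c k \<in> \<Omega>" for k using cX X(2) by blast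
  \<comment> \<open>Each t belongs only to the piece of the first ball that contains it, so the
    series for p has at most one nonzero term.\<close>
  define D where "D k = B (c k) - (\<Union>j<k. B (c j))" for k
  have Dm: "D k \<in> sets borel" for k unfolding D_def using openB by (intro sets.Diff sets.finite_UN) (auto simp: borel_open)
  define p where "p t = (\<Sum>k. indicator (D k) t * P (c k) t)" for t
  have pm: "p \<in> borel_measurable borel"
  proof -
    note [measurable] = P(1)[OF cO] Dm
    show ?thesis unfolding p_def[abs_def] by measurable
  qed
  have pD: "p t = P (c k) t" if t: "t \<in> D k" for t k
  proof -
    have "t \<notin> D j" if "j \<noteq> k" for j using t that unfolding D_def by (cases j k rule: linorder_cases) auto
    then have "p t = (\<Sum>j\<in>{k}. indicator (D j) t * P (c j) t)" unfolding p_def by (intro suminf_finite) auto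
    then show ?thesis using t by simp
  qed
  have pP: "AE t in lborel. t \<in> B x \<longrightarrow> p t = P x t" if x: "x \<in> \<Omega>" for x
  proof -
    have "AE t in lborel. \<forall>k. t \<in> B x \<inter> B (c k) \<longrightarrow> P x t = P (c k) t"
      unfolding AE_all_countable by (intro allI agree x cO)
    then show ?thesis
    proof eventually_elim
      case (elim t)
      show ?case
      proof
        assume t: "t \<in> B x"
        then have "t \<in> \<Omega>" using BO[OF x] by blast
        then have ex: "\<exists>k. t \<in> B (c k)" using X(3) cX by blast
        define k where "k = (LEAST k. t \<in> B (c k))"
        have "t \<in> B (c k)" unfolding k_def using ex by (rule LeastI_ex)
        moreover have "t \<notin> B (c j)" if "j < k" for j using not_less_Least[OF that[unfolded k_def]] .
        ultimately have "t \<in> D k" unfolding D_def by blast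
        then show "p t = P x t" using pD elim t \<open>t \<in> B (c k)\<close> by auto
      qed
    qed
  qed
  have Lp: "L f = (\<integral>t. p t * f t \<partial>lborel)" if f: "test_fun \<Omega> f" for f
  proof -
    obtain A g where Ag: "finite A" "A \<subseteq> \<Omega>" "\<And>x. x \<in> A \<Longrightarrow> test_fun (ball x (\<rho> x)) (g x)" "f = (\<lambda>y. \<Sum>x\<in>A. g x y)"
      by (rule test_partition[where \<rho> = \<rho>, OF f \<rho>(1)], assumption) (rule that; assumption)
    have gB: "test_fun (B x) (g x)" if "x \<in> A" for x using Ag(3)[OF that] by (simp add: B_def)
    have ae: "AE t in lborel. P x t * g x t = p t * g x t" if x: "x \<in> A" for x
      using pP[of x] x Ag(2)
    proof -
      have "AE t in lborel. t \<in> B x \<longrightarrow> p t = P x t" using pP x Ag(2) by blast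
      then show ?thesis
      proof eventually_elim
        case (elim t)
        then show ?case using test_fun_outside[OF gB[OF x], of t] by (cases "t \<in> B x") auto
      qed
    qed
    have gi: "integrable lborel (\<lambda>t. p t * g x t)" "L (g x) = (\<integral>t. p t * g x t \<partial>lborel)" if x: "x \<in> A" for x
    proof -
      have xO: "x \<in> \<Omega>" using x Ag(2) by blast
      note [measurable] = pm P(1)[OF xO] cc_fun_measurable[OF test_fun_cc[OF gB[OF x]]]
      have 1: "(\<lambda>t. P x t * g x t) \<in> borel_measurable lborel" "(\<lambda>t. p t * g x t) \<in> borel_measurable lborel" by measurable
      show "integrable lborel (\<lambda>t. p t * g x t)"
        using integrable_cong_AE[OF 1 ae[OF x]] P(3)[OF xO gB[OF x]] by simp
      show "L (g x) = (\<integral>t. p t * g x t \<partial>lborel)"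
        unfolding P(4)[OF xO gB[OF x]] by (rule integral_cong_AE[OF 1 ae[OF x]])
    qed
    have "L f = (\<Sum>x\<in>A. L (g x))"
      unfolding Ag(4) by (rule Lsum[OF Ag(1)]) (use gB BO Ag(2) in \<open>blast intro: test_fun_mono\<close>)
    also have "\<dots> = (\<Sum>x\<in>A. \<integral>t. p t * g x t \<partial>lborel)" using gi(2) by simp
    also have "\<dots> = (\<integral>t. (\<Sum>x\<in>A. p t * g x t) \<partial>lborel)" using gi(1) by (simp add: Bochner_Integration.integral_sum)
    also have "\<dots> = (\<integral>t. p t * f t \<partial>lborel)" unfolding Ag(4) by (simp add: sum_distrib_left)
    finally show ?thesis .
  qed
  show thesis
  proof (rule that[OF pm])
    fix K assume K: "compact K" "K \<subseteq> \<Omega>"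
    have "K \<subseteq> (\<Union>x\<in>K. B x)" using Bx K by blast
    then obtain A where A: "A \<subseteq> K" "finite A" "K \<subseteq> (\<Union>x\<in>A. B x)"
      using compactE_image[OF K(1), of K B] openB by metis
    have AO: "x \<in> \<Omega>" if "x \<in> A" for x using that A K by blast
    have "AE t in lborel. \<forall>x\<in>A. t \<in> B x \<longrightarrow> p t = P x t"
      using A(2) pP AO by (intro AE_finite_allI) auto
    then have "AE t in lborel. ennreal (\<bar>p t\<bar> powr q) * indicator K t \<le> (\<Sum>x\<in>A. ennreal (\<bar>P x t\<bar> powr q))"
    proof eventually_elim
      case (elim t)
      show ?case
      proof (cases "t \<in> K")
        case True
        then obtain x where x: "x \<in> A" "t \<in> B x" using A by blast
        then have "ennreal (\<bar>p t\<bar> powr q) = ennreal (\<bar>P x t\<bar> powr q)" using elim by simp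
        also have "\<dots> \<le> (\<Sum>x\<in>A. ennreal (\<bar>P x t\<bar> powr q))" using x A(2) by (intro member_le_sum) auto
        finally show ?thesis using True by simp
      qed simp
    qed
    then have "(\<integral>\<^sup>+t. ennreal (\<bar>p t\<bar> powr q) * indicator K t \<partial>lborel) \<le> (\<integral>\<^sup>+t. (\<Sum>x\<in>A. ennreal (\<bar>P x t\<bar> powr q)) \<partial>lborel)"
      by (rule nn_integral_mono_AE)
    also have "\<dots> = (\<Sum>x\<in>A. \<integral>\<^sup>+t. ennreal (\<bar>P x t\<bar> powr q) \<partial>lborel)"
      using P(1) AO by (intro nn_integral_sum) auto
    also have "\<dots> < \<infinity>"
      using P(2)[OF AO] A(2) by (simp add: ennreal_sum_less_top nn_integral_eq_integral)
    finally show "(\<integral>\<^sup>+x. ennreal (\<bar>p x\<bar> powr (r / (r - 1))) * indicator K x \<partial>lborel) < \<infinity>" by (simp add: q_def)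
  next
    show "F \<psi> = (\<integral>x. p x * vdiv \<psi> x \<partial>lborel)" if "test_field \<Omega> \<psi>" for \<psi>
      using Ldiv[OF that] Lp[OF test_fun_vdiv[OF that]] by simp
  qed
qed

section \<open>Sobolev spaces and projections\<close>

lemma borel_measurable_lebesgue_on:
  "f \<in> borel_measurable borel \<Longrightarrow> f \<in> borel_measurable (lebesgue_on \<Omega>)"
  by (intro measurable_restrict_space1 measurable_completion) simp

text \<open>Comparison with the largest summand works for exponents above and below 1 alike; both r
  and 1/r occur.\<close>

lemma powr_sum_le:
  fixes a :: "'i \<Rightarrow> real"
  assumes I: "finite I" and a: "\<And>i. i \<in> I \<Longrightarrow> 0 \<le> a i" and s: "0 < s"
  shows "(\<Sum>i\<in>I. a i) powr s \<le> real (card I) powr s * (\<Sum>i\<in>I. a i powr s)"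
proof (cases "I = {}")
  case False
  define M where "M = Max (a ` I)"
  have "M \<in> a ` I" unfolding M_def using I False by (intro Max_in) auto
  then obtain k where k: "k \<in> I" "M = a k" by blast
  have aM: "a i \<le> M" if "i \<in> I" for i unfolding M_def using I that by auto
  have "(\<Sum>i\<in>I. a i) \<le> (\<Sum>i\<in>I. M)" by (intro sum_mono aM)
  then have "(\<Sum>i\<in>I. a i) powr s \<le> (real (card I) * M) powr s" using s a by (intro powr_mono2 sum_nonneg) auto
  also have "\<dots> = real (card I) powr s * a k powr s" using k a by (simp add: powr_mult)
  also have "\<dots> \<le> real (card I) powr s * (\<Sum>i\<in>I. a i powr s)"
    using k I by (intro mult_left_mono member_le_sum) auto
  finally show ?thesis .
qed simp

lemma nn_integral_lebesgue_on_le: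
  fixes f :: "real^'n::finite \<Rightarrow> ennreal"
  assumes "\<Omega> \<in> sets lebesgue"
  shows "(\<integral>\<^sup>+x. f x \<partial>lebesgue_on \<Omega>) \<le> (\<integral>\<^sup>+x. f x \<partial>lborel)"
proof -
  have "(\<integral>\<^sup>+x. f x \<partial>lebesgue_on \<Omega>) = (\<integral>\<^sup>+x. f x * indicator \<Omega> x \<partial>lebesgue)"
    using assms by (intro nn_integral_restrict_space) simp
  also have "\<dots> \<le> (\<integral>\<^sup>+x. f x \<partial>lebesgue)" by (intro nn_integral_mono) (auto simp: indicator_def)
  finally show ?thesis by (simp add: nn_integral_completion)
qed

text \<open>Stated for a finite dominating family so that it covers vector fields and their gradient
  matrices alike.\<close>

lemma component_powr_le:
  fixes f :: "real^'n::finite \<Rightarrow> 'b::real_normed_vector"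
  assumes r: "1 < r" and I: "finite I" and h: "\<And>k. k \<in> I \<Longrightarrow> cc_fun (h k)" and le: "\<And>x. norm (f x) \<le> (\<Sum>k\<in>I. \<bar>h k x\<bar>)"
    and \<Omega>: "\<Omega> \<in> sets lebesgue"
  shows "(\<integral>\<^sup>+x. ennreal (norm (f x) powr r) \<partial>lebesgue_on \<Omega>) \<le> ennreal (real (card I) powr r * (\<Sum>k\<in>I. \<integral>x. \<bar>h k x\<bar> powr r \<partial>lborel))"
proof -
  have hr: "integrable lborel (\<lambda>x. \<bar>h k x\<bar> powr r)" if "k \<in> I" for k
    using r h[OF that] by (intro cc_fun_integrable cc_fun_powr) auto
  have "(\<integral>\<^sup>+x. ennreal (norm (f x) powr r) \<partial>lebesgue_on \<Omega>) \<le> (\<integral>\<^sup>+x. ennreal (norm (f x) powr r) \<partial>lborel)"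
    by (rule nn_integral_lebesgue_on_le[OF \<Omega>])
  also have "\<dots> \<le> (\<integral>\<^sup>+x. ennreal (real (card I) powr r * (\<Sum>k\<in>I. \<bar>h k x\<bar> powr r)) \<partial>lborel)"
  proof (intro nn_integral_mono ennreal_leI)
    fix x
    have "norm (f x) powr r \<le> (\<Sum>k\<in>I. \<bar>h k x\<bar>) powr r" using le r by (intro powr_mono2) auto
    also have "\<dots> \<le> real (card I) powr r * (\<Sum>k\<in>I. \<bar>h k x\<bar> powr r)" using r by (intro powr_sum_le I) auto
    finally show "norm (f x) powr r \<le> real (card I) powr r * (\<Sum>k\<in>I. \<bar>h k x\<bar> powr r)" .
  qed
  also have "\<dots> = ennreal (\<integral>x. real (card I) powr r * (\<Sum>k\<in>I. \<bar>h k x\<bar> powr r) \<partial>lborel)"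
    using hr by (intro nn_integral_eq_integral integrable_mult_right Bochner_Integration.integrable_sum) (auto intro!: AE_I2 mult_nonneg_nonneg sum_nonneg)
  also have "(\<integral>x. real (card I) powr r * (\<Sum>k\<in>I. \<bar>h k x\<bar> powr r) \<partial>lborel) = real (card I) powr r * (\<Sum>k\<in>I. \<integral>x. \<bar>h k x\<bar> powr r \<partial>lborel)"
    using hr by (simp add: Bochner_Integration.integral_sum)
  finally show ?thesis .
qed

lemma lq_norm_le_components:
  fixes f :: "real^'n::finite \<Rightarrow> 'b::real_normed_vector"
  assumes r: "1 < r" and I: "finite I" and h: "\<And>k. k \<in> I \<Longrightarrow> cc_fun (h k)" and le: "\<And>x. norm (f x) \<le> (\<Sum>k\<in>I. \<bar>h k x\<bar>)"
    and \<Omega>: "\<Omega> \<in> sets lebesgue"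
  shows "lq_norm \<Omega> r f \<le> real (card I) * real (card I) powr (1/r) * (\<Sum>k\<in>I. (\<integral>x. \<bar>h k x\<bar> powr r \<partial>lborel) powr (1/r))"
proof -
  define a where "a k = (\<integral>x. \<bar>h k x\<bar> powr r \<partial>lborel)" for k
  have a0: "0 \<le> a k" for k by (simp add: a_def)
  have "enn2real (\<integral>\<^sup>+x. ennreal (norm (f x) powr r) \<partial>lebesgue_on \<Omega>) \<le> real (card I) powr r * (\<Sum>k\<in>I. a k)"
    unfolding a_def by (intro enn2real_leI component_powr_le[OF r I h le \<Omega>] mult_nonneg_nonneg sum_nonneg) auto
  then have "lq_norm \<Omega> r f \<le> (real (card I) powr r * (\<Sum>k\<in>I. a k)) powr (1/r)"
    unfolding lq_norm_def using r by (intro powr_mono2) auto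
  also have "\<dots> = real (card I) * (\<Sum>k\<in>I. a k) powr (1/r)"
    using r a0 by (simp add: powr_mult powr_powr sum_nonneg)
  also have "\<dots> \<le> real (card I) * (real (card I) powr (1/r) * (\<Sum>k\<in>I. a k powr (1/r)))"
    using r a0 by (intro mult_left_mono powr_sum_le I) auto
  finally show ?thesis by (simp add: a_def mult.assoc)
qed

lemma norm_cgrad_le: "norm (cgrad \<psi> x) \<le> (\<Sum>(i, j)\<in>UNIV. \<bar>pd j (\<lambda>y. \<psi> y $ i) x\<bar>)"
proof -
  have "norm (cgrad \<psi> x) \<le> (\<Sum>i\<in>UNIV. norm (cgrad \<psi> x $ i))"
    unfolding norm_vec_def[of "cgrad \<psi> x"] by (rule L2_set_le_sum) simp
  also have "\<dots> \<le> (\<Sum>i\<in>UNIV. \<Sum>j\<in>UNIV. \<bar>cgrad \<psi> x $ i $ j\<bar>)" by (intro sum_mono norm_le_l1_cart)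
  also have "\<dots> = (\<Sum>(i, j)\<in>UNIV. \<bar>pd j (\<lambda>y. \<psi> y $ i) x\<bar>)"
    by (simp add: cgrad_def sum.cartesian_product)
  finally show ?thesis .
qed

section \<open>Sobolev spaces on a fixed open set\<close>

context
  fixes \<Omega> :: "(real^'n::finite) set"
  assumes \<Omega>: "open \<Omega>"
begin

lemma \<Omega>_sets: "\<Omega> \<in> sets lebesgue"
  using \<Omega> by (simp add: borel_open)

lemma test_field_continuous:
  assumes \<psi>: "test_field \<Omega> \<psi>"
  shows "continuous_on UNIV \<psi>" "continuous_on UNIV (cgrad \<psi>)"
proof -
  have "continuous_on UNIV (\<lambda>x. \<chi> i. \<psi> x $ i)"
    by (intro continuous_on_vec_lambda cc_fun_cont test_fun_cc[OF test_field_comp[OF \<psi>]])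
  then show "continuous_on UNIV \<psi>" by simp
  show "continuous_on UNIV (cgrad \<psi>)" unfolding cgrad_def[abs_def]
    by (intro continuous_on_vec_lambda cc_fun_cont test_fun_cc[OF test_fun_pd[OF test_field_comp[OF \<psi>]]])
qed

lemma in_Lq_test:
  assumes \<psi>: "test_field \<Omega> \<psi>" and r: "1 < r"
  shows "in_Lq \<Omega> r \<psi>" "in_Lq \<Omega> r (cgrad \<psi>)"
proof -
  have m: "\<psi> \<in> borel_measurable (lebesgue_on \<Omega>)" "cgrad \<psi> \<in> borel_measurable (lebesgue_on \<Omega>)"
    using test_field_continuous[OF \<psi>] by (auto intro!: borel_measurable_lebesgue_on borel_measurable_continuous_onI)
  have "(\<integral>\<^sup>+x. ennreal (norm (\<psi> x) powr r) \<partial>lebesgue_on \<Omega>) \<le> ennreal (real CARD('n) powr r * (\<Sum>k\<in>UNIV. \<integral>x. \<bar>\<psi> x $ k\<bar> powr r \<partial>lborel))"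
    by (rule component_powr_le[OF r _ _ _ \<Omega>_sets]) (auto intro: norm_le_l1_cart test_fun_cc test_field_comp[OF \<psi>])
  then show "in_Lq \<Omega> r \<psi>" unfolding in_Lq_def using m by (auto intro: order.strict_trans1)
  define h where "h k = pd (snd k) (\<lambda>y. \<psi> y $ fst k)" for k
  have "(\<integral>\<^sup>+x. ennreal (norm (cgrad \<psi> x) powr r) \<partial>lebesgue_on \<Omega>) \<le> ennreal (real CARD('n \<times> 'n) powr r * (\<Sum>k\<in>UNIV. \<integral>x. \<bar>h k x\<bar> powr r \<partial>lborel))"
  proof (rule component_powr_le[OF r _ _ _ \<Omega>_sets])
    show "cc_fun (h k)" for k unfolding h_def by (rule test_fun_cc[OF test_fun_pd[OF test_field_comp[OF \<psi>]]])
    show "norm (cgrad \<psi> x) \<le> (\<Sum>k\<in>UNIV. \<bar>h k x\<bar>)" for x using norm_cgrad_le[of \<psi> x] by (simp add: h_def case_prod_beta)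
  qed simp
  then show "in_Lq \<Omega> r (cgrad \<psi>)" unfolding in_Lq_def using m by (auto intro: order.strict_trans1)
qed

lemma weak_grad_test:
  assumes \<psi>: "test_field \<Omega> \<psi>"
  shows "weak_grad \<Omega> \<psi> (cgrad \<psi>)"
  unfolding weak_grad_def
proof (intro conjI allI impI)
  show "\<psi> \<in> borel_measurable (lebesgue_on \<Omega>)" "cgrad \<psi> \<in> borel_measurable (lebesgue_on \<Omega>)"
    using test_field_continuous[OF \<psi>] by (auto intro!: borel_measurable_lebesgue_on borel_measurable_continuous_onI)
next
  fix \<phi> :: "real^'n \<Rightarrow> real" and i j assume \<phi>: "test_fun \<Omega> \<phi>"
  have i: "test_fun \<Omega> (\<lambda>x. \<psi> x $ i)" by (rule test_field_comp[OF \<psi>])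
  have c1: "cc_fun (\<lambda>x. \<psi> x $ i * pd j \<phi> x)" using i \<phi> by (intro cc_fun_mult test_fun_cc test_fun_pd)
  have c2: "cc_fun (\<lambda>x. cgrad \<psi> x $ i $ j * \<phi> x)"
    unfolding cgrad_def using test_fun_cc[OF test_fun_pd[OF i]] test_fun_cc[OF \<phi>] by (simp add: cc_fun_mult)
  have e1: "integrable (lebesgue_on \<Omega>) (\<lambda>x. \<psi> x $ i * pd j \<phi> x) \<longleftrightarrow> integrable lborel (\<lambda>x. \<psi> x $ i * pd j \<phi> x)"
      "(\<integral>x. \<psi> x $ i * pd j \<phi> x \<partial>lebesgue_on \<Omega>) = (\<integral>x. \<psi> x $ i * pd j \<phi> x \<partial>lborel)"
    using test_fun_outside[OF i] by (auto intro!: lebesgue_on_extend[OF \<Omega>_sets cc_fun_measurable[OF c1]])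
  have e2: "integrable (lebesgue_on \<Omega>) (\<lambda>x. cgrad \<psi> x $ i $ j * \<phi> x) \<longleftrightarrow> integrable lborel (\<lambda>x. cgrad \<psi> x $ i $ j * \<phi> x)"
      "(\<integral>x. cgrad \<psi> x $ i $ j * \<phi> x \<partial>lebesgue_on \<Omega>) = (\<integral>x. cgrad \<psi> x $ i $ j * \<phi> x \<partial>lborel)"
    using test_fun_outside[OF \<phi>] by (auto intro!: lebesgue_on_extend[OF \<Omega>_sets cc_fun_measurable[OF c2]])
  show "integrable (lebesgue_on \<Omega>) (\<lambda>x. \<psi> x $ i * pd j \<phi> x)" unfolding e1 by (rule cc_fun_integrable[OF c1])
  show "integrable (lebesgue_on \<Omega>) (\<lambda>x. cgrad \<psi> x $ i $ j * \<phi> x)" unfolding e2 by (rule cc_fun_integrable[OF c2])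
  show "(\<integral>x. \<psi> x $ i * pd j \<phi> x \<partial>lebesgue_on \<Omega>) = - (\<integral>x. cgrad \<psi> x $ i $ j * \<phi> x \<partial>lebesgue_on \<Omega>)"
    unfolding e1 e2 using integral_by_parts[OF test_fun_smooth[OF i] \<phi>, of j] by (simp add: cgrad_def)
qed

lemma borel_measurable_entry:
  "G \<in> borel_measurable M \<Longrightarrow> (\<lambda>x. (G x :: real^'n^'n) $ i $ j) \<in> borel_measurable M"
  by (rule measurable_compose[of G M borel "\<lambda>A. A $ i $ j"]) (auto intro!: borel_measurable_continuous_onI continuous_intros)

lemma borel_measurable_component:
  "u \<in> borel_measurable M \<Longrightarrow> (\<lambda>x. (u x :: real^'n) $ i) \<in> borel_measurable M"
  by (rule measurable_compose[of u M borel "\<lambda>A. A $ i"]) (auto intro!: borel_measurable_continuous_onI continuous_intros)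

text \<open>This is \<open>fundamental_lemma\<close> entry by entry. Since \<open>wgrad\<close> is a
  choice of some weak gradient, uniqueness is what makes \<open>sob_norm\<close> computable and
  insensitive to null sets.\<close>

lemma weak_grad_unique:
  assumes G: "weak_grad \<Omega> u G" and H: "weak_grad \<Omega> v H" and uv: "aeq \<Omega> u v"
  shows "AE x in lebesgue_on \<Omega>. G x = H x"
proof -
  have "AE x in lebesgue_on \<Omega>. G x $ i $ j - H x $ i $ j = 0" for i j
  proof (rule fundamental_lemma[OF \<Omega>])
    show "(\<lambda>x. G x $ i $ j - H x $ i $ j) \<in> borel_measurable (lebesgue_on \<Omega>)"
      using G H by (intro borel_measurable_diff borel_measurable_entry) (auto simp: weak_grad_def)
    fix \<phi> assume \<phi>: "test_fun \<Omega> \<phi>"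
    have g: "integrable (lebesgue_on \<Omega>) (\<lambda>x. u x $ i * pd j \<phi> x)" "integrable (lebesgue_on \<Omega>) (\<lambda>x. G x $ i $ j * \<phi> x)"
      "(\<integral>x. u x $ i * pd j \<phi> x \<partial>lebesgue_on \<Omega>) = - (\<integral>x. G x $ i $ j * \<phi> x \<partial>lebesgue_on \<Omega>)"
      using G \<phi> unfolding weak_grad_def by blast+
    have h: "integrable (lebesgue_on \<Omega>) (\<lambda>x. v x $ i * pd j \<phi> x)" "integrable (lebesgue_on \<Omega>) (\<lambda>x. H x $ i $ j * \<phi> x)"
      "(\<integral>x. v x $ i * pd j \<phi> x \<partial>lebesgue_on \<Omega>) = - (\<integral>x. H x $ i $ j * \<phi> x \<partial>lebesgue_on \<Omega>)"
      using H \<phi> unfolding weak_grad_def by blast+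
    have "(\<integral>x. u x $ i * pd j \<phi> x \<partial>lebesgue_on \<Omega>) = (\<integral>x. v x $ i * pd j \<phi> x \<partial>lebesgue_on \<Omega>)"
      using uv g(1) h(1) unfolding aeq_def by (intro integral_cong_AE) (auto elim!: eventually_mono)
    then show "integrable (lebesgue_on \<Omega>) (\<lambda>x. (G x $ i $ j - H x $ i $ j) * \<phi> x) \<and> (\<integral>x. (G x $ i $ j - H x $ i $ j) * \<phi> x \<partial>lebesgue_on \<Omega>) = 0"
      unfolding left_diff_distrib using g h by simp
  qed
  then have "AE x in lebesgue_on \<Omega>. \<forall>i\<in>UNIV. \<forall>j\<in>UNIV. G x $ i $ j - H x $ i $ j = 0"
    by (intro AE_finite_allI) auto
  then show ?thesis by eventually_elim (auto simp: vec_eq_iff)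
qed

lemma lq_norm_cong_AE: "AE x in lebesgue_on \<Omega>. f x = g x \<Longrightarrow> lq_norm \<Omega> r f = lq_norm \<Omega> r g"
  unfolding lq_norm_def by (intro arg_cong[where f = "\<lambda>t. enn2real t powr (1 / r)"] nn_integral_cong_AE) (auto elim!: eventually_mono)

lemma lq_norm_nonneg: "0 \<le> lq_norm \<Omega> r f" by (simp add: lq_norm_def)

lemma lq_norm_zero: "lq_norm \<Omega> r (\<lambda>x. 0) = 0" by (simp add: lq_norm_def)

lemma sob_norm_nonneg: "0 \<le> sob_norm \<Omega> r u" by (simp add: sob_norm_def lq_norm_nonneg)

lemma weak_grad_wgrad: "weak_grad \<Omega> u G \<Longrightarrow> weak_grad \<Omega> u (wgrad \<Omega> u)"
  unfolding wgrad_def by (rule someI[of "weak_grad \<Omega> u"])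

lemma sob_norm_test:
  assumes \<psi>: "test_field \<Omega> \<psi>"
  shows "sob_norm \<Omega> r \<psi> \<le> lq_norm \<Omega> r \<psi> + lq_norm \<Omega> r (cgrad \<psi>)"
proof -
  have "AE x in lebesgue_on \<Omega>. wgrad \<Omega> \<psi> x = cgrad \<psi> x"
    using weak_grad_test[OF \<psi>] by (intro weak_grad_unique[OF weak_grad_wgrad]) (auto simp: aeq_def)
  then have "lq_norm \<Omega> r (wgrad \<Omega> \<psi>) = lq_norm \<Omega> r (cgrad \<psi>)" by (rule lq_norm_cong_AE)
  then show ?thesis using lq_norm_nonneg[of r \<psi>] by (simp add: sob_norm_def)
qed

lemma weak_grad_0: "weak_grad \<Omega> (\<lambda>x. 0) (\<lambda>x. 0)"
  by (simp add: weak_grad_def)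

lemma sob_norm_null:
  assumes G: "weak_grad \<Omega> u G" and u: "aeq \<Omega> u (\<lambda>x. 0)"
  shows "sob_norm \<Omega> r u = 0"
proof -
  have "AE x in lebesgue_on \<Omega>. wgrad \<Omega> u x = 0"
    using weak_grad_unique[OF weak_grad_wgrad[OF G] weak_grad_0 u] .
  then have "lq_norm \<Omega> r (wgrad \<Omega> u) = 0" using lq_norm_cong_AE[of "wgrad \<Omega> u" "\<lambda>x. 0" r] lq_norm_zero by simp
  moreover have "lq_norm \<Omega> r u = 0" using lq_norm_cong_AE[of u "\<lambda>x. 0" r] u lq_norm_zero by (simp add: aeq_def)
  ultimately show ?thesis by (simp add: sob_norm_def)
qed

section \<open>Linear combinations and null sets\<close>

lemma norm_powr_lincomb_le:
  fixes a b r :: real and x y :: "'b::real_normed_vector"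
  assumes r: "1 < r"
  shows "norm (a *\<^sub>R x + b *\<^sub>R y) powr r \<le> (2 * \<bar>a\<bar>) powr r * norm x powr r + (2 * \<bar>b\<bar>) powr r * norm y powr r"
proof -
  have "norm (a *\<^sub>R x + b *\<^sub>R y) powr r \<le> \<bar>\<bar>a\<bar> * norm x + \<bar>b\<bar> * norm y\<bar> powr r"
    using r norm_triangle_ineq[of "a *\<^sub>R x" "b *\<^sub>R y"] by (intro powr_mono2) auto
  also have "\<dots> \<le> 2 powr r * (\<bar>\<bar>a\<bar> * norm x\<bar> powr r + \<bar>\<bar>b\<bar> * norm y\<bar> powr r)" by (rule abs_powr_add_le[OF r])
  finally show ?thesis by (simp add: powr_mult abs_mult distrib_left mult.assoc)
qed

text \<open>The r-th power integrals obey a triangle inequality with crude constants. Only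
  finiteness and convergence to 0 are at stake, and both are insensitive to constants.\<close>

lemma Lq_lincomb:
  fixes f g :: "real^'n \<Rightarrow> 'b::euclidean_space"
  assumes r: "1 < r" and f: "in_Lq \<Omega> r f" and g: "in_Lq \<Omega> r g"
  shows "in_Lq \<Omega> r (\<lambda>x. a *\<^sub>R f x + b *\<^sub>R g x)"
    and "enn2real (\<integral>\<^sup>+x. ennreal (norm (a *\<^sub>R f x + b *\<^sub>R g x) powr r) \<partial>lebesgue_on \<Omega>)
       \<le> (2 * \<bar>a\<bar>) powr r * enn2real (\<integral>\<^sup>+x. ennreal (norm (f x) powr r) \<partial>lebesgue_on \<Omega>)
        + (2 * \<bar>b\<bar>) powr r * enn2real (\<integral>\<^sup>+x. ennreal (norm (g x) powr r) \<partial>lebesgue_on \<Omega>)"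
proof -
  define E where "E h = (\<integral>\<^sup>+x. ennreal (norm (h x) powr r) \<partial>lebesgue_on \<Omega>)" for h :: "real^'n \<Rightarrow> 'b"
  define A B where "A = (2 * \<bar>a\<bar>) powr r" and "B = (2 * \<bar>b\<bar>) powr r"
  have AB: "0 \<le> A" "0 \<le> B" by (simp_all add: A_def B_def)
  have [measurable]: "f \<in> borel_measurable (lebesgue_on \<Omega>)" "g \<in> borel_measurable (lebesgue_on \<Omega>)"
    and fin: "E f < \<infinity>" "E g < \<infinity>" using f g by (auto simp: in_Lq_def E_def)
  have "E (\<lambda>x. a *\<^sub>R f x + b *\<^sub>R g x) \<le> (\<integral>\<^sup>+x. ennreal A * ennreal (norm (f x) powr r) + ennreal B * ennreal (norm (g x) powr r) \<partial>lebesgue_on \<Omega>)"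
    unfolding E_def
  proof (rule nn_integral_mono)
    fix x
    have "ennreal (norm (a *\<^sub>R f x + b *\<^sub>R g x) powr r) \<le> ennreal (A * norm (f x) powr r + B * norm (g x) powr r)"
      unfolding A_def B_def by (rule ennreal_leI[OF norm_powr_lincomb_le[OF r]])
    also have "\<dots> = ennreal A * ennreal (norm (f x) powr r) + ennreal B * ennreal (norm (g x) powr r)"
      using AB by (simp add: ennreal_plus ennreal_mult)
    finally show "ennreal (norm (a *\<^sub>R f x + b *\<^sub>R g x) powr r) \<le> ennreal A * ennreal (norm (f x) powr r) + ennreal B * ennreal (norm (g x) powr r)" .
  qed
  also have "\<dots> = ennreal A * E f + ennreal B * E g"
    unfolding E_def by (simp add: nn_integral_add nn_integral_cmult)
  also have "\<dots> = ennreal (A * enn2real (E f) + B * enn2real (E g))"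
    using fin AB by (simp add: ennreal_plus ennreal_mult)
  finally have le: "E (\<lambda>x. a *\<^sub>R f x + b *\<^sub>R g x) \<le> ennreal (A * enn2real (E f) + B * enn2real (E g))" .
  then have "E (\<lambda>x. a *\<^sub>R f x + b *\<^sub>R g x) < \<infinity>" by (auto intro: order.strict_trans1)
  moreover have "(\<lambda>x. a *\<^sub>R f x + b *\<^sub>R g x) \<in> borel_measurable (lebesgue_on \<Omega>)" by measurable
  ultimately show "in_Lq \<Omega> r (\<lambda>x. a *\<^sub>R f x + b *\<^sub>R g x)" by (simp add: in_Lq_def E_def)
  show "enn2real (\<integral>\<^sup>+x. ennreal (norm (a *\<^sub>R f x + b *\<^sub>R g x) powr r) \<partial>lebesgue_on \<Omega>)
       \<le> (2 * \<bar>a\<bar>) powr r * enn2real (\<integral>\<^sup>+x. ennreal (norm (f x) powr r) \<partial>lebesgue_on \<Omega>)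
        + (2 * \<bar>b\<bar>) powr r * enn2real (\<integral>\<^sup>+x. ennreal (norm (g x) powr r) \<partial>lebesgue_on \<Omega>)"
    using enn2real_leI[OF _ le] AB by (simp add: E_def A_def B_def)
qed

lemma lq_norm_lincomb_tendsto:
  fixes f g :: "nat \<Rightarrow> real^'n \<Rightarrow> 'b::euclidean_space"
  assumes r: "1 < r" and f: "\<And>k. in_Lq \<Omega> r (f k)" and g: "\<And>k. in_Lq \<Omega> r (g k)"
    and f0: "(\<lambda>k. lq_norm \<Omega> r (f k)) \<longlonglongrightarrow> 0" and g0: "(\<lambda>k. lq_norm \<Omega> r (g k)) \<longlonglongrightarrow> 0"
  shows "(\<lambda>k. lq_norm \<Omega> r (\<lambda>x. a *\<^sub>R f k x + b *\<^sub>R g k x)) \<longlonglongrightarrow> 0"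
proof -
  define E where "E h = enn2real (\<integral>\<^sup>+x. ennreal (norm (h x) powr r) \<partial>lebesgue_on \<Omega>)" for h :: "real^'n \<Rightarrow> 'b"
  have E0: "0 \<le> E h" for h by (simp add: E_def)
  have lE: "lq_norm \<Omega> r h = E h powr (1/r)" for h by (simp add: lq_norm_def E_def)
  have tE: "(\<lambda>k. E (h k)) \<longlonglongrightarrow> 0" if "(\<lambda>k. lq_norm \<Omega> r (h k)) \<longlonglongrightarrow> 0" for h :: "nat \<Rightarrow> real^'n \<Rightarrow> 'b"
  proof -
    have "(\<lambda>k. lq_norm \<Omega> r (h k) powr r) \<longlonglongrightarrow> 0 powr r"
      using r lq_norm_nonneg by (intro tendsto_powr'[OF that tendsto_const]) (auto intro!: always_eventually)
    moreover have "lq_norm \<Omega> r (h k) powr r = E (h k)" for k unfolding lE using r E0 by (simp add: powr_powr)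
    ultimately show ?thesis by simp
  qed
  have "(\<lambda>k. E (\<lambda>x. a *\<^sub>R f k x + b *\<^sub>R g k x)) \<longlonglongrightarrow> 0"
  proof (rule tendsto_sandwich[OF _ _ tendsto_const])
    show "(\<lambda>k. (2 * \<bar>a\<bar>) powr r * E (f k) + (2 * \<bar>b\<bar>) powr r * E (g k)) \<longlonglongrightarrow> 0"
      using tendsto_add[OF tendsto_mult[OF tendsto_const tE[OF f0]] tendsto_mult[OF tendsto_const tE[OF g0]]] by simp
    show "\<forall>\<^sub>F k in sequentially. E (\<lambda>x. a *\<^sub>R f k x + b *\<^sub>R g k x) \<le> (2 * \<bar>a\<bar>) powr r * E (f k) + (2 * \<bar>b\<bar>) powr r * E (g k)"
      unfolding E_def by (intro always_eventually allI Lq_lincomb(2)[OF r f g])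
  qed (use E0 in auto)
  then have "(\<lambda>k. E (\<lambda>x. a *\<^sub>R f k x + b *\<^sub>R g k x) powr (1/r)) \<longlonglongrightarrow> 0 powr (1/r)"
    using r E0 by (intro tendsto_powr' tendsto_const) (auto intro!: always_eventually)
  then show ?thesis unfolding lE by simp
qed

lemma weak_grad_lincomb:
  assumes G: "weak_grad \<Omega> u G" and H: "weak_grad \<Omega> v H"
  shows "weak_grad \<Omega> (\<lambda>x. a *\<^sub>R u x + b *\<^sub>R v x) (\<lambda>x. a *\<^sub>R G x + b *\<^sub>R H x)"
  unfolding weak_grad_def
proof (intro conjI allI impI)
  have [measurable]: "u \<in> borel_measurable (lebesgue_on \<Omega>)" "v \<in> borel_measurable (lebesgue_on \<Omega>)"
    "G \<in> borel_measurable (lebesgue_on \<Omega>)" "H \<in> borel_measurable (lebesgue_on \<Omega>)"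
    using G H by (auto simp: weak_grad_def)
  show "(\<lambda>x. a *\<^sub>R u x + b *\<^sub>R v x) \<in> borel_measurable (lebesgue_on \<Omega>)"
    "(\<lambda>x. a *\<^sub>R G x + b *\<^sub>R H x) \<in> borel_measurable (lebesgue_on \<Omega>)" by measurable
  fix \<phi> i j assume \<phi>: "test_fun \<Omega> \<phi>"
  have g: "integrable (lebesgue_on \<Omega>) (\<lambda>x. u x $ i * pd j \<phi> x)" "integrable (lebesgue_on \<Omega>) (\<lambda>x. G x $ i $ j * \<phi> x)"
    "(\<integral>x. u x $ i * pd j \<phi> x \<partial>lebesgue_on \<Omega>) = - (\<integral>x. G x $ i $ j * \<phi> x \<partial>lebesgue_on \<Omega>)"
    using G \<phi> unfolding weak_grad_def by blast+
  have h: "integrable (lebesgue_on \<Omega>) (\<lambda>x. v x $ i * pd j \<phi> x)" "integrable (lebesgue_on \<Omega>) (\<lambda>x. H x $ i $ j * \<phi> x)"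
    "(\<integral>x. v x $ i * pd j \<phi> x \<partial>lebesgue_on \<Omega>) = - (\<integral>x. H x $ i $ j * \<phi> x \<partial>lebesgue_on \<Omega>)"
    using H \<phi> unfolding weak_grad_def by blast+
  have e1: "(\<lambda>x. (a *\<^sub>R u x + b *\<^sub>R v x) $ i * pd j \<phi> x) = (\<lambda>x. a * (u x $ i * pd j \<phi> x) + b * (v x $ i * pd j \<phi> x))"
    by (simp add: distrib_right mult.assoc)
  have e2: "(\<lambda>x. (a *\<^sub>R G x + b *\<^sub>R H x) $ i $ j * \<phi> x) = (\<lambda>x. a * (G x $ i $ j * \<phi> x) + b * (H x $ i $ j * \<phi> x))"
    by (simp add: distrib_right mult.assoc)
  show "integrable (lebesgue_on \<Omega>) (\<lambda>x. (a *\<^sub>R u x + b *\<^sub>R v x) $ i * pd j \<phi> x)" unfolding e1 using g h by simp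
  show "integrable (lebesgue_on \<Omega>) (\<lambda>x. (a *\<^sub>R G x + b *\<^sub>R H x) $ i $ j * \<phi> x)" unfolding e2 using g h by simp
  show "(\<integral>x. (a *\<^sub>R u x + b *\<^sub>R v x) $ i * pd j \<phi> x \<partial>lebesgue_on \<Omega>) = - (\<integral>x. (a *\<^sub>R G x + b *\<^sub>R H x) $ i $ j * \<phi> x \<partial>lebesgue_on \<Omega>)"
    unfolding e1 e2 using g h by simp
qed

lemma cgrad_lincomb:
  assumes "test_field \<Omega> \<psi>" "test_field \<Omega> \<xi>"
  shows "cgrad (\<lambda>x. a *\<^sub>R \<psi> x + b *\<^sub>R \<xi> x) x = a *\<^sub>R cgrad \<psi> x + b *\<^sub>R cgrad \<xi> x"
proof -
  have "pd j (\<lambda>x. a * \<psi> x $ i + b * \<xi> x $ i) x = a * pd j (\<lambda>x. \<psi> x $ i) x + b * pd j (\<lambda>x. \<xi> x $ i) x" for i j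
    using assms by (intro pd_lincomb test_fun_differentiable[OF test_field_comp])
  then show ?thesis by (simp add: cgrad_def vec_eq_iff)
qed

lemma W1q0_test:
  assumes \<psi>: "test_field \<Omega> \<psi>" and r: "1 < r"
  shows "\<psi> \<in> W1q0 \<Omega> r"
  unfolding W1q0_def
  using in_Lq_test[OF \<psi> r] weak_grad_test[OF \<psi>] \<psi>
  by (auto intro!: exI[of _ "cgrad \<psi>"] exI[of _ "\<lambda>_. \<psi>"] simp: lq_norm_zero)

lemma W1q0_lincomb:
  assumes r: "1 < r" and u: "u \<in> W1q0 \<Omega> r" and v: "v \<in> W1q0 \<Omega> r"
  shows "(\<lambda>x. a *\<^sub>R u x + b *\<^sub>R v x) \<in> W1q0 \<Omega> r"
proof -
  have ex: "\<exists>G \<phi>. in_Lq \<Omega> r u \<and> weak_grad \<Omega> u G \<and> in_Lq \<Omega> r G \<and> (\<forall>k. test_field \<Omega> (\<phi> k))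
     \<and> (\<forall>k. in_Lq \<Omega> r (\<lambda>x. \<phi> k x - u x)) \<and> (\<forall>k. in_Lq \<Omega> r (\<lambda>x. cgrad (\<phi> k) x - G x))
     \<and> (\<lambda>k. lq_norm \<Omega> r (\<lambda>x. \<phi> k x - u x)) \<longlonglongrightarrow> 0 \<and> (\<lambda>k. lq_norm \<Omega> r (\<lambda>x. cgrad (\<phi> k) x - G x)) \<longlonglongrightarrow> 0"
    if uW: "u \<in> W1q0 \<Omega> r" for u
  proof -
    obtain G \<phi> where G: "in_Lq \<Omega> r u" "weak_grad \<Omega> u G" "in_Lq \<Omega> r G" "\<And>k. test_field \<Omega> (\<phi> k)"
       and lim: "(\<lambda>k. lq_norm \<Omega> r (\<lambda>x. \<phi> k x - u x) + lq_norm \<Omega> r (\<lambda>x. cgrad (\<phi> k) x - G x)) \<longlonglongrightarrow> 0"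
      using uW unfolding W1q0_def by blast
    have 1: "in_Lq \<Omega> r (\<lambda>x. \<phi> k x - u x)" for k
      using Lq_lincomb(1)[OF r in_Lq_test(1)[OF G(4) r] G(1), of 1 k "-1"] by simp
    have 2: "in_Lq \<Omega> r (\<lambda>x. cgrad (\<phi> k) x - G x)" for k
      using Lq_lincomb(1)[OF r in_Lq_test(2)[OF G(4) r] G(3), of 1 k "-1"] by simp
    have 3: "(\<lambda>k. lq_norm \<Omega> r (\<lambda>x. \<phi> k x - u x)) \<longlonglongrightarrow> 0"
      by (rule tendsto_sandwich[OF _ _ tendsto_const lim]) (auto simp: lq_norm_nonneg)
    have 4: "(\<lambda>k. lq_norm \<Omega> r (\<lambda>x. cgrad (\<phi> k) x - G x)) \<longlonglongrightarrow> 0"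
      by (rule tendsto_sandwich[OF _ _ tendsto_const lim]) (auto simp: lq_norm_nonneg)
    show ?thesis using G 1 2 3 4 by blast
  qed
  obtain G \<phi> where G: "in_Lq \<Omega> r u" "weak_grad \<Omega> u G" "in_Lq \<Omega> r G" "\<And>k. test_field \<Omega> (\<phi> k)"
     "\<And>k. in_Lq \<Omega> r (\<lambda>x. \<phi> k x - u x)" "\<And>k. in_Lq \<Omega> r (\<lambda>x. cgrad (\<phi> k) x - G x)"
     "(\<lambda>k. lq_norm \<Omega> r (\<lambda>x. \<phi> k x - u x)) \<longlonglongrightarrow> 0" "(\<lambda>k. lq_norm \<Omega> r (\<lambda>x. cgrad (\<phi> k) x - G x)) \<longlonglongrightarrow> 0"
    using ex[OF u] by blast
  obtain H \<xi> where H: "in_Lq \<Omega> r v" "weak_grad \<Omega> v H" "in_Lq \<Omega> r H" "\<And>k. test_field \<Omega> (\<xi> k)"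
     "\<And>k. in_Lq \<Omega> r (\<lambda>x. \<xi> k x - v x)" "\<And>k. in_Lq \<Omega> r (\<lambda>x. cgrad (\<xi> k) x - H x)"
     "(\<lambda>k. lq_norm \<Omega> r (\<lambda>x. \<xi> k x - v x)) \<longlonglongrightarrow> 0" "(\<lambda>k. lq_norm \<Omega> r (\<lambda>x. cgrad (\<xi> k) x - H x)) \<longlonglongrightarrow> 0"
    using ex[OF v] by blast
  define \<zeta> where "\<zeta> k x = a *\<^sub>R \<phi> k x + b *\<^sub>R \<xi> k x" for k x
  have \<zeta>: "test_field \<Omega> (\<zeta> k)" for k unfolding \<zeta>_def[abs_def] by (rule test_field_lincomb[OF G(4) H(4)])
  have e1: "(\<lambda>x. \<zeta> k x - (a *\<^sub>R u x + b *\<^sub>R v x)) = (\<lambda>x. a *\<^sub>R (\<phi> k x - u x) + b *\<^sub>R (\<xi> k x - v x))" for k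
    by (simp add: \<zeta>_def algebra_simps)
  have e2: "(\<lambda>x. cgrad (\<zeta> k) x - (a *\<^sub>R G x + b *\<^sub>R H x)) = (\<lambda>x. a *\<^sub>R (cgrad (\<phi> k) x - G x) + b *\<^sub>R (cgrad (\<xi> k) x - H x))" for k
    unfolding \<zeta>_def[abs_def] cgrad_lincomb[OF G(4) H(4)] by (simp add: algebra_simps)
  have "(\<lambda>k. lq_norm \<Omega> r (\<lambda>x. \<zeta> k x - (a *\<^sub>R u x + b *\<^sub>R v x)) + lq_norm \<Omega> r (\<lambda>x. cgrad (\<zeta> k) x - (a *\<^sub>R G x + b *\<^sub>R H x))) \<longlonglongrightarrow> 0 + 0"
    unfolding e1 e2 by (intro tendsto_add lq_norm_lincomb_tendsto[OF r] G H)
  then show ?thesis unfolding W1q0_def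
    using Lq_lincomb(1)[OF r G(1) H(1), of a b] Lq_lincomb(1)[OF r G(3) H(3), of a b] weak_grad_lincomb[OF G(2) H(2), of a b] \<zeta>
    by auto
qed

lemma W1q0_weak_grad: "u \<in> W1q0 \<Omega> r \<Longrightarrow> \<exists>G. weak_grad \<Omega> u G" unfolding W1q0_def by blast

lemma W1q0_measurable: "u \<in> W1q0 \<Omega> r \<Longrightarrow> u \<in> borel_measurable (lebesgue_on \<Omega>)"
  unfolding W1q0_def in_Lq_def by blast

text \<open>The approximating sequence and the weak gradient of u serve v unchanged. This later
  carries the projection of a test field from one Sobolev space into the others.\<close>

lemma W1q0_aeq:
  assumes u: "u \<in> W1q0 \<Omega> r" and uv: "aeq \<Omega> u v" and v: "v \<in> borel_measurable (lebesgue_on \<Omega>)"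
  shows "v \<in> W1q0 \<Omega> r"
proof -
  obtain G \<phi> where G: "in_Lq \<Omega> r u" "weak_grad \<Omega> u G" "in_Lq \<Omega> r G" "\<forall>k. test_field \<Omega> (\<phi> k)"
    "(\<lambda>k. lq_norm \<Omega> r (\<lambda>x. \<phi> k x - u x) + lq_norm \<Omega> r (\<lambda>x. cgrad (\<phi> k) x - G x)) \<longlonglongrightarrow> 0"
    using u unfolding W1q0_def by blast
  have ae: "AE x in lebesgue_on \<Omega>. u x = v x" using uv by (simp add: aeq_def)
  have "(\<integral>\<^sup>+x. ennreal (norm (v x) powr r) \<partial>lebesgue_on \<Omega>) = (\<integral>\<^sup>+x. ennreal (norm (u x) powr r) \<partial>lebesgue_on \<Omega>)"
    using ae by (intro nn_integral_cong_AE) (auto elim!: eventually_mono)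
  then have 1: "in_Lq \<Omega> r v" using G(1) v by (simp add: in_Lq_def)
  have 2: "weak_grad \<Omega> v G"
    unfolding weak_grad_def
  proof (intro conjI allI impI)
    fix \<phi> i j assume \<phi>: "test_fun \<Omega> \<phi>"
    have g: "integrable (lebesgue_on \<Omega>) (\<lambda>x. u x $ i * pd j \<phi> x)" "integrable (lebesgue_on \<Omega>) (\<lambda>x. G x $ i $ j * \<phi> x)"
      "(\<integral>x. u x $ i * pd j \<phi> x \<partial>lebesgue_on \<Omega>) = - (\<integral>x. G x $ i $ j * \<phi> x \<partial>lebesgue_on \<Omega>)"
      using G(2) \<phi> unfolding weak_grad_def by blast+
    have m: "(\<lambda>x. v x $ i * pd j \<phi> x) \<in> borel_measurable (lebesgue_on \<Omega>)"
      by (intro borel_measurable_times borel_measurable_component v borel_measurable_lebesgue_on cc_fun_measurable[OF test_fun_cc[OF test_fun_pd[OF \<phi>]]])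
    have ae': "AE x in lebesgue_on \<Omega>. u x $ i * pd j \<phi> x = v x $ i * pd j \<phi> x" using ae by eventually_elim simp
    show "integrable (lebesgue_on \<Omega>) (\<lambda>x. v x $ i * pd j \<phi> x)"
      using integrable_cong_AE[OF borel_measurable_integrable[OF g(1)] m ae'] g(1) by simp
    show "integrable (lebesgue_on \<Omega>) (\<lambda>x. G x $ i $ j * \<phi> x)" by (rule g)
    show "(\<integral>x. v x $ i * pd j \<phi> x \<partial>lebesgue_on \<Omega>) = - (\<integral>x. G x $ i $ j * \<phi> x \<partial>lebesgue_on \<Omega>)"
      using integral_cong_AE[OF borel_measurable_integrable[OF g(1)] m ae'] g(3) by simp
  qed (use v G(2) in \<open>auto simp: weak_grad_def\<close>)
  have "lq_norm \<Omega> r (\<lambda>x. \<phi> k x - v x) = lq_norm \<Omega> r (\<lambda>x. \<phi> k x - u x)" for k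
    using ae by (intro lq_norm_cong_AE) (auto elim!: eventually_mono)
  then have "(\<lambda>k. lq_norm \<Omega> r (\<lambda>x. \<phi> k x - v x) + lq_norm \<Omega> r (\<lambda>x. cgrad (\<phi> k) x - G x)) \<longlonglongrightarrow> 0"
    using G(5) by simp
  then show ?thesis unfolding W1q0_def using 1 2 G(3,4) by blast
qed

lemma W1q0_div_test:
  assumes \<psi>: "test_field \<Omega> \<psi>" and r: "1 < r" and div: "\<forall>x. vdiv \<psi> x = 0"
  shows "\<psi> \<in> W1q0_div \<Omega> r"
proof -
  have "sob_norm \<Omega> r (\<lambda>x. \<psi> x - \<psi> x) = 0"
    using sob_norm_null[OF weak_grad_0, of r] by (simp add: aeq_def)
  then show ?thesis unfolding W1q0_div_def using W1q0_test[OF \<psi> r] \<psi> div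
    by (auto intro!: exI[of _ "\<lambda>_. \<psi>"])
qed

section \<open>Functionals and adjoint projections\<close>

lemma dualsp_lincomb:
  assumes "us \<in> dualsp \<Omega> q" "u \<in> W1q0 \<Omega> (conj_exp q)" "v \<in> W1q0 \<Omega> (conj_exp q)"
  shows "us (\<lambda>x. a *\<^sub>R u x + b *\<^sub>R v x) = a * us u + b * us v"
  using assms unfolding dualsp_def by blast

text \<open>The difference of u and v is null, so its Sobolev norm is 0 and the norm bound forces
  the value 0. Through this lemma every almost-everywhere identity for the projections becomes an
  identity of values.\<close>

lemma dualsp_aeq:
  assumes us: "us \<in> dualsp \<Omega> q" and r: "1 < conj_exp q"
    and u: "u \<in> W1q0 \<Omega> (conj_exp q)" and v: "v \<in> W1q0 \<Omega> (conj_exp q)" and uv: "aeq \<Omega> u v"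
  shows "us u = us v"
proof -
  define w where "w x = 1 *\<^sub>R u x + (- 1) *\<^sub>R v x" for x
  have w: "w \<in> W1q0 \<Omega> (conj_exp q)" unfolding w_def[abs_def] by (rule W1q0_lincomb[OF r u v])
  have "aeq \<Omega> w (\<lambda>x. 0)" using uv unfolding aeq_def by eventually_elim (simp add: w_def)
  then have "sob_norm \<Omega> (conj_exp q) w = 0" using W1q0_weak_grad[OF w] sob_norm_null by blast
  moreover obtain C where "\<forall>v\<in>W1q0 \<Omega> (conj_exp q). \<bar>us v\<bar> \<le> C * sob_norm \<Omega> (conj_exp q) v"
    using us unfolding dualsp_def by blast
  ultimately have "us w = 0" using w by force
  moreover have "us w = us u - us v" unfolding w_def[abs_def] dualsp_lincomb[OF us u v] by simp
  ultimately show ?thesis by simp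
qed

lemma nabla_regular_withD:
  assumes "nabla_regular_with \<Omega> q E"
  shows "\<And>v. v \<in> W1q0 \<Omega> (conj_exp q) \<Longrightarrow> E v \<in> W1q0 \<Omega> (conj_exp q)"
    "\<And>v w. v \<in> W1q0 \<Omega> (conj_exp q) \<Longrightarrow> w \<in> W1q0 \<Omega> (conj_exp q) \<Longrightarrow> aeq \<Omega> v w \<Longrightarrow> aeq \<Omega> (E v) (E w)"
    "\<And>v w a b. v \<in> W1q0 \<Omega> (conj_exp q) \<Longrightarrow> w \<in> W1q0 \<Omega> (conj_exp q) \<Longrightarrow>
       aeq \<Omega> (E (\<lambda>x. a *\<^sub>R v x + b *\<^sub>R w x)) (\<lambda>x. a *\<^sub>R E v x + b *\<^sub>R E w x)"
    "\<exists>C. \<forall>v\<in>W1q0 \<Omega> (conj_exp q). sob_norm \<Omega> (conj_exp q) (E v) \<le> C * sob_norm \<Omega> (conj_exp q) v"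
    "\<And>v. v \<in> W1q0 \<Omega> (conj_exp q) \<Longrightarrow> aeq \<Omega> (E (E v)) (E v)"
    "\<And>v. v \<in> W1q0 \<Omega> (conj_exp q) \<Longrightarrow> aeq \<Omega> (E v) (\<lambda>x. 0) \<longleftrightarrow> v \<in> W1q0_div \<Omega> (conj_exp q)"
    "\<And>\<psi>. test_field \<Omega> \<psi> \<Longrightarrow> aeq \<Omega> (E \<psi>) (E2 \<Omega> \<psi>)"
  using assms unfolding nabla_regular_with_def Let_def by blast+

text \<open>The projection is linear only up to null sets; \<open>dualsp_aeq\<close> turns this into
  exact linearity of the adjoint functional.\<close>

lemma Estar_dualsp:
  assumes E: "nabla_regular_with \<Omega> q E" and us: "us \<in> dualsp \<Omega> q" and r: "1 < conj_exp q"
  shows "Estar E us \<in> dualsp \<Omega> q"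
proof -
  note W = nabla_regular_withD[OF E]
  have "us (E (\<lambda>x. a *\<^sub>R u x + b *\<^sub>R v x)) = a * us (E u) + b * us (E v)"
    if u: "u \<in> W1q0 \<Omega> (conj_exp q)" and v: "v \<in> W1q0 \<Omega> (conj_exp q)" for u v a b
  proof -
    have "us (E (\<lambda>x. a *\<^sub>R u x + b *\<^sub>R v x)) = us (\<lambda>x. a *\<^sub>R E u x + b *\<^sub>R E v x)"
      by (intro dualsp_aeq[OF us r] W W1q0_lincomb[OF r] u v)
    also have "\<dots> = a * us (E u) + b * us (E v)" by (intro dualsp_lincomb[OF us] W u v)
    finally show ?thesis .
  qed
  moreover have "\<exists>C. \<forall>v\<in>W1q0 \<Omega> (conj_exp q). \<bar>us (E v)\<bar> \<le> C * sob_norm \<Omega> (conj_exp q) v"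
  proof -
    obtain C where C: "\<forall>v\<in>W1q0 \<Omega> (conj_exp q). \<bar>us v\<bar> \<le> C * sob_norm \<Omega> (conj_exp q) v"
      using us unfolding dualsp_def by blast
    obtain D where D: "\<forall>v\<in>W1q0 \<Omega> (conj_exp q). sob_norm \<Omega> (conj_exp q) (E v) \<le> D * sob_norm \<Omega> (conj_exp q) v"
      using W(4) by blast
    have "\<bar>us (E v)\<bar> \<le> (\<bar>C\<bar> * D) * sob_norm \<Omega> (conj_exp q) v" if v: "v \<in> W1q0 \<Omega> (conj_exp q)" for v
    proof -
      have "\<bar>us (E v)\<bar> \<le> C * sob_norm \<Omega> (conj_exp q) (E v)" using C W(1)[OF v] by blast
      also have "\<dots> \<le> \<bar>C\<bar> * sob_norm \<Omega> (conj_exp q) (E v)" by (intro mult_right_mono sob_norm_nonneg) simp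
      also have "\<dots> \<le> \<bar>C\<bar> * (D * sob_norm \<Omega> (conj_exp q) v)" using D v by (intro mult_left_mono) auto
      finally show ?thesis by (simp add: mult.assoc)
    qed
    then show ?thesis by blast
  qed
  ultimately show ?thesis unfolding dualsp_def Estar_def by blast
qed

text \<open>A divergence-free test field lies in the kernel of the projection. This is the vanishing
  condition from which the potential is constructed.\<close>

lemma Estar_div_free:
  assumes E: "nabla_regular_with \<Omega> q E" and us: "us \<in> dualsp \<Omega> q" and r: "1 < conj_exp q"
    and \<psi>: "test_field \<Omega> \<psi>" "\<forall>x. vdiv \<psi> x = 0"
  shows "Estar E us \<psi> = 0"
proof -
  note W = nabla_regular_withD[OF E]
  have \<psi>W: "\<psi> \<in> W1q0 \<Omega> (conj_exp q)" by (rule W1q0_test[OF \<psi>(1) r])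
  have 0: "(\<lambda>x. 0) \<in> W1q0 \<Omega> (conj_exp q)" by (rule W1q0_test[OF test_field_0 r])
  have "aeq \<Omega> (E \<psi>) (\<lambda>x. 0)" using W(6)[OF \<psi>W] W1q0_div_test[OF \<psi>(1) r \<psi>(2)] by simp
  then have "us (E \<psi>) = us (\<lambda>x. 0)" by (rule dualsp_aeq[OF us r W(1)[OF \<psi>W] 0])
  also have "\<dots> = 0" using dualsp_lincomb[OF us 0 0, of 0 0] by simp
  finally show ?thesis by (simp add: Estar_def)
qed

text \<open>Puts the norm bound into the componentwise form over the whole space that
  \<open>bounded_functional_has_pressure\<close> expects; on test fields the chosen weak gradient
  may be replaced by the classical one.\<close>

lemma dual_test_bound:
  assumes F: "F \<in> dualsp \<Omega> q" and r: "1 < conj_exp q"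
  shows "\<exists>C. \<forall>\<psi>. test_field \<Omega> \<psi> \<longrightarrow> \<bar>F \<psi>\<bar> \<le> C * (\<Sum>i\<in>UNIV. (\<integral>x. \<bar>\<psi> x $ i\<bar> powr (conj_exp q) \<partial>lborel) powr (1/conj_exp q)
        + (\<Sum>j\<in>UNIV. (\<integral>x. \<bar>pd j (\<lambda>y. \<psi> y $ i) x\<bar> powr (conj_exp q) \<partial>lborel) powr (1/conj_exp q)))"
proof -
  define r where "r = conj_exp q"
  have r1: "1 < r" using r by (simp add: r_def)
  obtain C where C: "\<forall>v\<in>W1q0 \<Omega> r. \<bar>F v\<bar> \<le> C * sob_norm \<Omega> r v"
    using F unfolding dualsp_def r_def by blast
  define c1 where "c1 = real CARD('n) * real CARD('n) powr (1/r)"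
  define c2 where "c2 = real CARD('n \<times> 'n) * real CARD('n \<times> 'n) powr (1/r)"
  have c: "0 \<le> c1" "0 \<le> c2" by (simp_all add: c1_def c2_def)
  have "\<bar>F \<psi>\<bar> \<le> (\<bar>C\<bar> * (c1 + c2)) * (\<Sum>i\<in>UNIV. (\<integral>x. \<bar>\<psi> x $ i\<bar> powr r \<partial>lborel) powr (1/r)
        + (\<Sum>j\<in>UNIV. (\<integral>x. \<bar>pd j (\<lambda>y. \<psi> y $ i) x\<bar> powr r \<partial>lborel) powr (1/r)))"
    if \<psi>: "test_field \<Omega> \<psi>" for \<psi>
  proof -
    define S1 where "S1 = (\<Sum>i\<in>UNIV. (\<integral>x. \<bar>\<psi> x $ i\<bar> powr r \<partial>lborel) powr (1/r))"
    define S2 where "S2 = (\<Sum>i\<in>UNIV. \<Sum>j\<in>UNIV. (\<integral>x. \<bar>pd j (\<lambda>y. \<psi> y $ i) x\<bar> powr r \<partial>lborel) powr (1/r))"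
    have S: "0 \<le> S1" "0 \<le> S2" by (auto simp: S1_def S2_def intro!: sum_nonneg)
    define h where "h k = pd (snd k) (\<lambda>y. \<psi> y $ fst k)" for k
    have 1: "lq_norm \<Omega> r \<psi> \<le> c1 * S1" unfolding c1_def S1_def
      by (rule lq_norm_le_components[OF r1 _ _ _ \<Omega>_sets]) (auto intro: norm_le_l1_cart test_fun_cc test_field_comp[OF \<psi>])
    have "lq_norm \<Omega> r (cgrad \<psi>) \<le> c2 * (\<Sum>k\<in>UNIV. (\<integral>x. \<bar>h k x\<bar> powr r \<partial>lborel) powr (1/r))" unfolding c2_def
    proof (rule lq_norm_le_components[OF r1 _ _ _ \<Omega>_sets])
      show "cc_fun (h k)" for k unfolding h_def by (rule test_fun_cc[OF test_fun_pd[OF test_field_comp[OF \<psi>]]])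
      show "norm (cgrad \<psi> x) \<le> (\<Sum>k\<in>UNIV. \<bar>h k x\<bar>)" for x using norm_cgrad_le[of \<psi> x] by (simp add: h_def case_prod_beta)
    qed simp
    also have "(\<Sum>k\<in>UNIV. (\<integral>x. \<bar>h k x\<bar> powr r \<partial>lborel) powr (1/r)) = S2"
      unfolding S2_def h_def by (simp add: sum.cartesian_product case_prod_beta)
    finally have 2: "lq_norm \<Omega> r (cgrad \<psi>) \<le> c2 * S2" .
    have "\<bar>F \<psi>\<bar> \<le> C * sob_norm \<Omega> r \<psi>" using C W1q0_test[OF \<psi> r1] by blast
    also have "\<dots> \<le> \<bar>C\<bar> * sob_norm \<Omega> r \<psi>" by (intro mult_right_mono sob_norm_nonneg) simp
    also have "\<dots> \<le> \<bar>C\<bar> * (c1 * S1 + c2 * S2)" using sob_norm_test[OF \<psi>, of r] 1 2 by (intro mult_left_mono) auto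
    also have "\<dots> \<le> \<bar>C\<bar> * ((c1 + c2) * (S1 + S2))"
    proof (rule mult_left_mono)
      have "0 \<le> c1 * S2" "0 \<le> c2 * S1" using c S by simp_all
      then show "c1 * S1 + c2 * S2 \<le> (c1 + c2) * (S1 + S2)" by (simp add: distrib_left distrib_right)
    qed simp
    finally show ?thesis by (simp add: S1_def S2_def sum.distrib mult.assoc)
  qed
  then show ?thesis unfolding r_def by blast
qed

section \<open>Normalised potentials\<close>

lemma local_Lq_integrable:
  fixes p :: "real^'n \<Rightarrow> real"
  assumes q: "1 < q" and p: "p \<in> borel_measurable borel" and K: "compact K"
    and fin: "(\<integral>\<^sup>+x. ennreal (\<bar>p x\<bar> powr q) * indicator K x \<partial>lborel) < \<infinity>"
  shows "integrable lborel (\<lambda>x. indicator K x * p x)"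
proof (rule integrableI_bounded)
  have Kb: "K \<in> sets borel" using K by (simp add: borel_compact)
  note [measurable] = p Kb
  show "(\<lambda>x. indicator K x * p x) \<in> borel_measurable lborel" by measurable
  have "(\<integral>\<^sup>+x. ennreal (norm (indicator K x * p x)) \<partial>lborel) \<le> (\<integral>\<^sup>+x. indicator K x + ennreal (\<bar>p x\<bar> powr q) * indicator K x \<partial>lborel)"
  proof (rule nn_integral_mono)
    fix x
    have "\<bar>p x\<bar> \<le> 1 + \<bar>p x\<bar> powr q"
    proof (cases "\<bar>p x\<bar> \<le> 1")
      case False
      then have "\<bar>p x\<bar> powr 1 \<le> \<bar>p x\<bar> powr q" using q by (intro powr_mono) auto
      then show ?thesis using False by simp
    qed (use powr_ge_zero[of "\<bar>p x\<bar>" q] in linarith)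
    then have "ennreal \<bar>p x\<bar> \<le> 1 + ennreal (\<bar>p x\<bar> powr q)"
      using ennreal_leI[of "\<bar>p x\<bar>" "1 + \<bar>p x\<bar> powr q"] by (simp add: ennreal_plus)
    then show "ennreal (norm (indicator K x * p x)) \<le> indicator K x + ennreal (\<bar>p x\<bar> powr q) * indicator K x"
      by (cases "x \<in> K") auto
  qed
  also have "\<dots> = emeasure lborel K + (\<integral>\<^sup>+x. ennreal (\<bar>p x\<bar> powr q) * indicator K x \<partial>lborel)"
    by (subst nn_integral_add) auto
  also have "\<dots> < \<infinity>" using fin emeasure_bounded_finite[OF compact_imp_bounded[OF K]] by simp
  finally show "(\<integral>\<^sup>+x. ennreal (norm (indicator K x * p x)) \<partial>lborel) < \<infinity>" .
qed

text \<open>\<open>scrP\<close> selects some normalised potential, so exhibiting one is enough. It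
  arises from \<open>bounded_functional_has_pressure\<close> by a change of sign and an additive
  constant.\<close>

lemma scrP_is_grad_of:
  assumes con: "connected \<Omega>" and q: "1 < q" and F: "F \<in> dualsp \<Omega> q"
    and div0: "\<And>\<psi>. test_field \<Omega> \<psi> \<Longrightarrow> \<forall>x. vdiv \<psi> x = 0 \<Longrightarrow> F \<psi> = 0"
    and U: "subdomain U \<Omega>"
  shows "is_grad_of \<Omega> q (scrP \<Omega> q U F) F"
proof -
  define r where "r = conj_exp q"
  have r: "1 < r" using q by (simp add: r_def conj_exp_def field_simps)
  have rq: "r / (r - 1) = q" using q by (simp add: r_def conj_exp_def field_simps)
  have ne: "\<Omega> \<noteq> {}" using U by (auto simp: subdomain_def dest: closure_subset[THEN subsetD])
  obtain C where C: "\<And>\<psi>. test_field \<Omega> \<psi> \<Longrightarrow> \<bar>F \<psi>\<bar> \<le> C * (\<Sum>i\<in>UNIV. (\<integral>x. \<bar>\<psi> x $ i\<bar> powr r \<partial>lborel) powr (1/r)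
        + (\<Sum>j\<in>UNIV. (\<integral>x. \<bar>pd j (\<lambda>y. \<psi> y $ i) x\<bar> powr r \<partial>lborel) powr (1/r)))"
    using dual_test_bound[OF F r[unfolded r_def]] unfolding r_def by blast
  have lin: "F (\<lambda>x. a *\<^sub>R \<psi> x + b *\<^sub>R \<xi> x) = a * F \<psi> + b * F \<xi>" if "test_field \<Omega> \<psi>" "test_field \<Omega> \<xi>" for \<psi> \<xi> a b
    using that r unfolding r_def by (intro dualsp_lincomb[OF F] W1q0_test)
  obtain p where p: "p \<in> borel_measurable borel"
    "\<And>K. compact K \<Longrightarrow> K \<subseteq> \<Omega> \<Longrightarrow> (\<integral>\<^sup>+x. ennreal (\<bar>p x\<bar> powr q) * indicator K x \<partial>lborel) < \<infinity>"
    "\<And>\<psi>. test_field \<Omega> \<psi> \<Longrightarrow> F \<psi> = (\<integral>x. p x * vdiv \<psi> x \<partial>lborel)"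
    using bounded_functional_has_pressure[OF r \<Omega> con ne lin div0 C] unfolding rq by blast
  have Uc: "compact (closure U)" "closure U \<subseteq> \<Omega>" "open U" "U \<noteq> {}" using U by (auto simp: subdomain_def)
  have Um: "U \<in> sets lebesgue" using Uc by (simp add: borel_open)
  have Ulm: "U \<in> lmeasurable"
    using Uc by (intro lmeasurable_open bounded_subset[OF compact_imp_bounded closure_subset])
  have Upos: "0 < measure lebesgue U"
  proof -
    obtain x e where "0 < e" "ball x e \<subseteq> U" using Uc(3,4) by (meson equals0I openE)
    then have "measure lebesgue (ball x e) \<le> measure lebesgue U"
      by (intro measure_mono_fmeasurable[OF _ _ Ulm]) auto
    moreover have "0 < measure lebesgue (ball x e)" using content_ball_pos[OF \<open>0 < e\<close>, of x] by simp
    ultimately show ?thesis by linarith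
  qed
  have loc: "integrable lborel (\<lambda>x. indicator K x * p x)" if "compact K" "K \<subseteq> \<Omega>" for K
    using local_Lq_integrable[OF q p(1) that(1) p(2)[OF that]] .
  have pU: "integrable (lebesgue_on U) p"
  proof -
    have "integrable lborel (\<lambda>x. indicator (closure U) x * p x * indicator U x)"
      using integrable_real_mult_indicator[OF _ loc[OF Uc(1,2)], of U] Uc by (simp add: borel_open)
    moreover have "(\<lambda>x. indicator (closure U) x * p x * indicator U x) = (\<lambda>x. indicator U x * p x)"
      using closure_subset[of U] by (auto simp: fun_eq_iff indicator_def)
    ultimately have "integrable lborel (\<lambda>x. indicator U x * p x)" by simp
    moreover have "(\<lambda>x. indicator U x * p x) \<in> borel_measurable lborel"
      using p(1) Uc by (intro borel_measurable_times) (auto simp: borel_open)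
    ultimately have "integrable lebesgue (\<lambda>x. indicator U x * p x)" using integrable_completion by blast
    then show ?thesis using Um integrable_restrict_space[of U lebesgue p] by simp
  qed
  \<comment> \<open>The mean of p over U. In \<open>P\<close> the sign accounts for the minus in
    \<open>is_grad_of\<close>, and the constant does not disturb the pairing because the divergence
    of a test field has integral 0.\<close>
  define c where "c = (\<integral>x. p x \<partial>lebesgue_on U) / measure lebesgue U"
  define P where "P x = c - p x" for x
  have Pm: "P \<in> borel_measurable borel" unfolding P_def[abs_def] using p(1) by measurable
  have mU: "measure (lebesgue_on U) U = measure lebesgue U" using Um by (intro measure_restrict_space) auto
  have ci: "integrable (lebesgue_on U) (\<lambda>x. c)" "(\<integral>x. c \<partial>lebesgue_on U) = c * measure lebesgue U"
  proof -
    have "finite_measure (lebesgue_on U)" using Ulm by (rule finite_measure_lebesgue_on)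
    then show "integrable (lebesgue_on U) (\<lambda>x. c)" by (rule finite_measure.integrable_const)
    show "(\<integral>x. c \<partial>lebesgue_on U) = c * measure lebesgue U" using mU by (simp add: space_restrict_space mult.commute)
  qed
  have int0: "(\<integral>x. P x \<partial>lebesgue_on U) = 0"
    unfolding P_def using pU ci Upos by (simp add: c_def)
  have vd: "F \<psi> = - (\<integral>x. P x * vdiv \<psi> x \<partial>lebesgue_on \<Omega>)" if \<psi>: "test_field \<Omega> \<psi>" for \<psi>
  proof -
    have v: "test_fun \<Omega> (vdiv \<psi>)" by (rule test_fun_vdiv[OF \<psi>])
    obtain K where K: "compact K" "K \<subseteq> \<Omega>" "\<And>x. x \<notin> K \<Longrightarrow> vdiv \<psi> x = 0" using v by (auto simp: test_fun_def)
    obtain B where B: "0 \<le> B" "\<And>x. \<bar>vdiv \<psi> x\<bar> \<le> B" using cc_fun_bounded[OF test_fun_cc[OF v]] by blast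
    note [measurable] = p(1) Pm cc_fun_measurable[OF test_fun_cc[OF v]]
    have pv: "integrable lborel (\<lambda>x. p x * vdiv \<psi> x)"
    proof (rule Bochner_Integration.integrable_bound)
      show "integrable lborel (\<lambda>x. B * (indicator K x * p x))" using loc[OF K(1,2)] by simp
      show "AE x in lborel. norm (p x * vdiv \<psi> x) \<le> norm (B * (indicator K x * p x))"
      proof (intro AE_I2)
        fix x show "norm (p x * vdiv \<psi> x) \<le> norm (B * (indicator K x * p x))"
          using B K(3)[of x] by (cases "x \<in> K") (auto simp: abs_mult mult.commute[of B] intro!: mult_left_mono)
      qed
    qed measurable
    have "(\<integral>x. P x * vdiv \<psi> x \<partial>lebesgue_on \<Omega>) = (\<integral>x. P x * vdiv \<psi> x \<partial>lborel)"
      using test_fun_outside[OF v] by (intro lebesgue_on_extend(2)[OF \<Omega>_sets]) (auto, measurable)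
    also have "\<dots> = (\<integral>x. c * vdiv \<psi> x - p x * vdiv \<psi> x \<partial>lborel)" by (simp add: P_def left_diff_distrib)
    also have "\<dots> = c * (\<integral>x. vdiv \<psi> x \<partial>lborel) - (\<integral>x. p x * vdiv \<psi> x \<partial>lborel)"
      using pv test_fun_integrable[OF v] by simp
    also have "\<dots> = - F \<psi>" using integral_vdiv[OF \<psi>] p(3)[OF \<psi>] by simp
    finally show ?thesis by simp
  qed
  have "Lq_loc \<Omega> q P"
    unfolding Lq_loc_def
  proof (intro conjI allI impI)
    show "P \<in> borel_measurable (lebesgue_on \<Omega>)" by (rule borel_measurable_lebesgue_on[OF Pm])
    fix K assume K: "compact K \<and> K \<subseteq> \<Omega>"
    have Kb: "K \<in> sets borel" using K by (simp add: borel_compact)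
    have Km: "K \<in> sets lebesgue" using Kb by simp
    note [measurable] = p(1) Kb
    have "(\<integral>\<^sup>+x. ennreal (\<bar>P x\<bar> powr q) \<partial>lebesgue_on K) = (\<integral>\<^sup>+x. ennreal (\<bar>P x\<bar> powr q) * indicator K x \<partial>lebesgue)"
      using Km by (intro nn_integral_restrict_space) simp
    also have "\<dots> = (\<integral>\<^sup>+x. ennreal (\<bar>P x\<bar> powr q) * indicator K x \<partial>lborel)" by (rule nn_integral_completion)
    also have "\<dots> \<le> (\<integral>\<^sup>+x. ennreal (2 powr q * \<bar>c\<bar> powr q) * indicator K x + ennreal (2 powr q) * (ennreal (\<bar>p x\<bar> powr q) * indicator K x) \<partial>lborel)"
    proof (rule nn_integral_mono)
      fix x
      have "\<bar>P x\<bar> powr q \<le> 2 powr q * (\<bar>c\<bar> powr q + \<bar>- p x\<bar> powr q)"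
        using abs_powr_add_le[OF q, of c "- p x"] by (simp add: P_def)
      then have "ennreal (\<bar>P x\<bar> powr q) \<le> ennreal (2 powr q * \<bar>c\<bar> powr q + 2 powr q * \<bar>p x\<bar> powr q)"
        by (intro ennreal_leI) (simp add: distrib_left)
      also have "\<dots> = ennreal (2 powr q * \<bar>c\<bar> powr q) + ennreal (2 powr q) * ennreal (\<bar>p x\<bar> powr q)"
        by (simp add: ennreal_plus ennreal_mult)
      finally show "ennreal (\<bar>P x\<bar> powr q) * indicator K x \<le> ennreal (2 powr q * \<bar>c\<bar> powr q) * indicator K x + ennreal (2 powr q) * (ennreal (\<bar>p x\<bar> powr q) * indicator K x)"
        by (cases "x \<in> K") auto
    qed
    also have "\<dots> = ennreal (2 powr q * \<bar>c\<bar> powr q) * emeasure lborel K + ennreal (2 powr q) * (\<integral>\<^sup>+x. ennreal (\<bar>p x\<bar> powr q) * indicator K x \<partial>lborel)"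
      by (subst nn_integral_add) (auto simp: nn_integral_cmult)
    also have "\<dots> < \<infinity>"
      using p(2)[of K] K emeasure_bounded_finite[OF compact_imp_bounded, of K] by (simp add: ennreal_mult_less_top)
    finally show "(\<integral>\<^sup>+x. ennreal (\<bar>P x\<bar> powr q) \<partial>lebesgue_on K) < \<infinity>" .
  qed
  then have "is_grad_of \<Omega> q P F \<and> (\<integral>x. P x \<partial>lebesgue_on U) = 0" unfolding is_grad_of_def using F vd int0 by blast
  then have "is_grad_of \<Omega> q (scrP \<Omega> q U F) F \<and> (\<integral>x. scrP \<Omega> q U F x \<partial>lebesgue_on U) = 0"
    unfolding scrP_def by (rule someI[of "\<lambda>p. is_grad_of \<Omega> q p F \<and> (\<integral>x. p x \<partial>lebesgue_on U) = 0"])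
  then show ?thesis ..
qed

text \<open>On test fields all projections agree with \<open>E2\<close> almost everywhere, so
  \<open>E k \<psi>\<close> for one fixed k stands for all of them. By idempotence \<psi> minus this
  field lies in the kernel of every projection, which makes it admissible in the orthogonality
  hypothesis.\<close>

lemma sum_Estar_eq:
  fixes q :: "nat \<Rightarrow> real" and E :: "nat \<Rightarrow> 'n vfield \<Rightarrow> 'n vfield"
  assumes r: "\<And>i. i \<in> I \<Longrightarrow> 1 < conj_exp (q i)" and E: "\<And>i. i \<in> I \<Longrightarrow> nabla_regular_with \<Omega> (q i) (E i)"
    and us: "\<And>i. i \<in> I \<Longrightarrow> us i \<in> dualsp \<Omega> (q i)"
    and ortho: "\<And>\<psi>. (\<And>i. i \<in> I \<Longrightarrow> \<psi> \<in> W1q0_div \<Omega> (conj_exp (q i))) \<Longrightarrow> (\<Sum>i\<in>I. us i \<psi>) = 0"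
    and \<psi>: "test_field \<Omega> \<psi>"
  shows "(\<Sum>i\<in>I. us i \<psi>) = (\<Sum>i\<in>I. Estar (E i) (us i) \<psi>)"
proof (cases "I = {}")
  case False
  then obtain k where k: "k \<in> I" by blast
  define \<xi> where "\<xi> x = 1 *\<^sub>R \<psi> x + (- 1) *\<^sub>R E k \<psi> x" for x
  have \<psi>W: "\<psi> \<in> W1q0 \<Omega> (conj_exp (q i))" if "i \<in> I" for i by (rule W1q0_test[OF \<psi> r[OF that]])
  have ae: "aeq \<Omega> (E i \<psi>) (E k \<psi>)" if "i \<in> I" for i
    using nabla_regular_withD(7)[OF E[OF that] \<psi>] nabla_regular_withD(7)[OF E[OF k] \<psi>]
    unfolding aeq_def by eventually_elim simp
  \<comment> \<open>The hypothesis speaks of one field in all spaces at once;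
    \<open>E k \<psi>\<close> enters the i-th space through its agreement with
    \<open>E i \<psi>\<close>.\<close>
  have EkW: "E k \<psi> \<in> W1q0 \<Omega> (conj_exp (q i))" if i: "i \<in> I" for i
    by (rule W1q0_aeq[OF nabla_regular_withD(1)[OF E[OF i] \<psi>W[OF i]] ae[OF i]
          W1q0_measurable[OF nabla_regular_withD(1)[OF E[OF k] \<psi>W[OF k]]]])
  have "\<xi> \<in> W1q0_div \<Omega> (conj_exp (q i))" if i: "i \<in> I" for i
  proof -
    note W = nabla_regular_withD[OF E[OF i]]
    have \<xi>W: "\<xi> \<in> W1q0 \<Omega> (conj_exp (q i))" unfolding \<xi>_def[abs_def] by (rule W1q0_lincomb[OF r[OF i] \<psi>W[OF i] EkW[OF i]])
    have 1: "aeq \<Omega> (E i \<xi>) (\<lambda>x. 1 *\<^sub>R E i \<psi> x + (- 1) *\<^sub>R E i (E k \<psi>) x)"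
      unfolding \<xi>_def[abs_def] by (rule W(3)[OF \<psi>W[OF i] EkW[OF i]])
    have 2: "aeq \<Omega> (E i (E i \<psi>)) (E i (E k \<psi>))" by (rule W(2)[OF W(1)[OF \<psi>W[OF i]] EkW[OF i] ae[OF i]])
    have 3: "aeq \<Omega> (E i (E i \<psi>)) (E i \<psi>)" by (rule W(5)[OF \<psi>W[OF i]])
    have "aeq \<Omega> (E i \<xi>) (\<lambda>x. 0)" using 1 2 3 unfolding aeq_def by eventually_elim simp
    then show ?thesis using W(6)[OF \<xi>W] by simp
  qed
  then have "(\<Sum>i\<in>I. us i \<xi>) = 0" by (rule ortho)
  moreover have "us i \<xi> = us i \<psi> - Estar (E i) (us i) \<psi>" if i: "i \<in> I" for i
  proof -
    have "us i (E k \<psi>) = us i (E i \<psi>)"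
      by (rule dualsp_aeq[OF us[OF i] r[OF i] nabla_regular_withD(1)[OF E[OF i] \<psi>W[OF i]] EkW[OF i] ae[OF i], symmetric])
    then show ?thesis unfolding \<xi>_def[abs_def] dualsp_lincomb[OF us[OF i] \<psi>W[OF i] EkW[OF i]] by (simp add: Estar_def)
  qed
  ultimately show ?thesis by (simp add: sum_subtractf)
qed simp

end

theorem theorem4p5:
  fixes \<Omega> :: "(real^'n::finite) set" and N :: nat and q :: "nat \<Rightarrow> real"
    and E :: "nat \<Rightarrow> ('n vfield \<Rightarrow> 'n vfield)" and us :: "nat \<Rightarrow> ('n vfield \<Rightarrow> real)"
  assumes "CARD('n) \<ge> 2"
    and "open \<Omega>" and "connected \<Omega>" and "\<Omega> \<noteq> {}"
    and "\<forall>i\<in>{1..N}. 1 < q i"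
    and "\<forall>i\<in>{1..N}. nabla_regular_with \<Omega> (q i) (E i)"
    and "\<forall>i\<in>{1..N}. us i \<in> dualsp \<Omega> (q i)"
    and "\<forall>\<psi>. (\<forall>i\<in>{1..N}. \<psi> \<in> W1q0_div \<Omega> (conj_exp (q i))) \<longrightarrow> (\<Sum>i=1..N. us i \<psi>) = 0"
  shows "\<forall>U. subdomain U \<Omega> \<longrightarrow>
           (\<forall>i\<in>{1..N}. scrP \<Omega> (q i) U (Estar (E i) (us i)) \<in> Lpot \<Omega> (q i)) \<and>
           (\<forall>\<psi>. test_field \<Omega> \<psi> \<longrightarrow>
              (\<Sum>i=1..N. us i \<psi>) =
              - (\<Sum>i=1..N. \<integral>x. scrP \<Omega> (q i) U (Estar (E i) (us i)) x * vdiv \<psi> x \<partial>lebesgue_on \<Omega>))"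
proof (intro allI impI)
  fix U assume U: "subdomain U \<Omega>"
  have r: "1 < conj_exp (q i)" if "i \<in> {1..N}" for i
  proof -
    have "1 < q i" using assms(5) that by blast
    then show ?thesis by (simp add: conj_exp_def field_simps)
  qed
  have grad: "is_grad_of \<Omega> (q i) (scrP \<Omega> (q i) U (Estar (E i) (us i))) (Estar (E i) (us i))" if i: "i \<in> {1..N}" for i
  proof (rule scrP_is_grad_of[OF assms(2,3) _ _ _ U])
    show "1 < q i" using assms(5) i by blast
    show "Estar (E i) (us i) \<in> dualsp \<Omega> (q i)"
      using assms(6,7) i by (intro Estar_dualsp[OF assms(2)] r[OF i]) auto
    show "Estar (E i) (us i) \<psi> = 0" if "test_field \<Omega> \<psi>" "\<forall>x. vdiv \<psi> x = 0" for \<psi>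
      using assms(6,7) i that by (intro Estar_div_free[OF assms(2) _ _ r[OF i]]) auto
  qed
  have "(\<Sum>i=1..N. us i \<psi>) = - (\<Sum>i=1..N. \<integral>x. scrP \<Omega> (q i) U (Estar (E i) (us i)) x * vdiv \<psi> x \<partial>lebesgue_on \<Omega>)"
    if \<psi>: "test_field \<Omega> \<psi>" for \<psi>
  proof -
    have "(\<Sum>i=1..N. us i \<psi>) = (\<Sum>i=1..N. Estar (E i) (us i) \<psi>)"
      by (rule sum_Estar_eq[OF assms(2) r]) (use assms(6-8) \<psi> in auto)
    also have "\<dots> = (\<Sum>i=1..N. - (\<integral>x. scrP \<Omega> (q i) U (Estar (E i) (us i)) x * vdiv \<psi> x \<partial>lebesgue_on \<Omega>))"
      using grad \<psi> unfolding is_grad_of_def by (intro sum.cong refl) blast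
    finally show ?thesis by (simp add: sum_negf)
  qed
  then show "(\<forall>i\<in>{1..N}. scrP \<Omega> (q i) U (Estar (E i) (us i)) \<in> Lpot \<Omega> (q i)) \<and>
           (\<forall>\<psi>. test_field \<Omega> \<psi> \<longrightarrow>
              (\<Sum>i=1..N. us i \<psi>) =
              - (\<Sum>i=1..N. \<integral>x. scrP \<Omega> (q i) U (Estar (E i) (us i)) x * vdiv \<psi> x \<partial>lebesgue_on \<Omega>))"
    using grad unfolding Lpot_def by blast
qed

end
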